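(* Let $d=2,3$, $q>d$, $1<p<\frac{2q}{2q-1}$. Let $F$ be the finite dimensional feedback operator described in the context and $\mathbb{A}_{F,q}=\mathbb{A}_q+F$. Consider the nonlinear feedback problem $$\frac{d}{dt}\begin{bmatrix}\mathbf{z}\\ h\end{bmatrix}=\mathbb{A}_{F,q}\begin{bmatrix}\mathbf{z}\\ h\end{bmatrix}-\begin{bmatrix}\mathcal{N}_q\mathbf{z}\\ \mathcal{M}_q[\mathbf{z}]h\end{bmatrix},\qquad \begin{bmatrix}\mathbf{z}(0)\\ h(0)\end{bmatrix}=\begin{bmatrix}\mathbf{z}_0\\ h_0\end{bmatrix}.$$ Let $r_1>0$ be the well-posedness constant of this problem (identified in the context by $r_1\le\frac{1}{4C^2}$), for which the following holds: if $\|\{\mathbf{z}_0,h_0\}\|_{\widetilde{\mathbf{B}}^{2-2/p}_{q,p}(\Omega)\times L^q(\Omega)}<r_1$, then the problem defines a unique (fixed point) nonlinear semigroup solution $\{\mathbf{z},h\}\in\mathbf{X}^\infty_{p,q,\sigma}\times X^\infty_{p,q}$, in the sense that $$\begin{bmatrix}\mathbf{z}\\ h\end{bmatrix}(t)=e^{\mathbb{A}_{F,q}t}\begin{bmatrix}\mathbf{z}_0\\ h_0\end{bmatrix}-\int_0^te^{\mathbb{A}_{F,q}(t-\tau)}\begin{bmatrix}\mathcal{N}_q\mathbf{z}(\tau)\\ \mathcal{M}_q[\mathbf{z}]h(\tau)\end{bmatrix}d\tau .$$ Then, for $\|\{\mathbf{z}_0,h_0\}\|_{\mathbf{V}^{q,p}(\Omega)}<r_1$,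 such solution is uniformly stable in the space $\mathbf{V}^{q,p}(\Omega)=\widetilde{\mathbf{B}}^{2-2/p}_{q,p}(\Omega)\times L^q(\Omega)$: there exist $\widetilde\gamma>0$ and $M_{\widetilde\gamma}>0$ such that said solution satisfies $$\left\|\begin{bmatrix}\mathbf{z}\\ h\end{bmatrix}(t)\right\|_{\mathbf{V}^{q,p}(\Omega)}\le M_{\widetilde\gamma}e^{-\widetilde\gamma t}\left\|\begin{bmatrix}\mathbf{z}_0\\ h_0\end{bmatrix}\right\|_{\mathbf{V}^{q,p}(\Omega)},\qquad t\ge0 .$$
   Context: **Domain and function spaces.** $\Omega\subset\mathbb{R}^d$ is a bounded connected domain with sufficiently smooth boundary $\Gamma=\partial\Omega$ and unit outward normal (also denoted $\nu$ in boundary conditions). $\omega\subset\Omega$ is an arbitrarily small open smooth subdomain of positive measure and $m$ is its characteristic function. Boldface denotes $d$-vector valued functions and spaces; $q'$ is the dual exponent of $q$. $\mathbf{L}^q_\sigma(\Omega)=\{\mathbf{g}\in\mathbf{L}^q(\Omega):\mathrm{div}\,\mathbf{g}=0,\ \mathbf{g}\cdot\nu=0\text{ on }\Gamma\}$; it is assumed that the Helmholtz decomposition $\mathbf{L}^q(\Omega)=\mathbf{L}^q_\sigma(\Omega)\oplus\mathbf{G}^q(\Omega)$ holds ($\mathbf{G}^q$ = gradient fields in $\mathbf{L}^q$), with projection $P_q:\mathbf{L}^q(\Omega)\to\mathbf{L}^q_\sigma(\Omega)$. $(\mathbf{L}^q_\sigma(\Omega))'$ is identified with $\mathbf{L}^{q'}_\sigma(\Omega)$.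 All spaces are complexified. $\mathbf{B}^{2-2/p}_{q,p}(\Omega)=(\mathbf{L}^q(\Omega),\mathbf{W}^{2,q}(\Omega))_{1-\frac1p,p}$ (real interpolation), and for $1<p<\frac{2q}{2q-1}$, $$\widetilde{\mathbf{B}}^{2-2/p}_{q,p}(\Omega)=\{\mathbf{g}\in\mathbf{B}^{2-2/p}_{q,p}(\Omega):\mathrm{div}\,\mathbf{g}=0,\ \mathbf{g}\cdot\nu|_\Gamma=0\}=(\mathbf{L}^q_\sigma(\Omega),\mathcal{D}(A_q))_{1-\frac1p,p}.$$ $\mathbf{W}^q_\sigma(\Omega)=\mathbf{L}^q_\sigma(\Omega)\times L^q(\Omega)$, $\mathbf{V}^{q,p}(\Omega)=\widetilde{\mathbf{B}}^{2-2/p}_{q,p}(\Omega)\times L^q(\Omega)$. (The paper remarks that in all its results involving $\mathbf V^{q,p}$ one could alternatively take the state space $\mathbf{V}^{q,p}_b(\Omega)=\widetilde{\mathbf{B}}^{2-2/p}_{q,p}(\Omega)\times B^{2-2/p}_{q,p}(\Omega)$, whose second factor is the real interpolation space between $L^q(\Omega)$ and $\mathcal D(\mathcal B_q)$.) $$\mathbf{X}^\infty_{p,q,\sigma}=L^p(0,\infty;\mathbf{W}^{2,q}\cap\mathbf{W}^{1,q}_0\cap\mathbf{L}^q_\sigma(\Omega))\cap W^{1,p}(0,\infty;\mathbf{L}^q_\sigma(\Omega)),$$ $$X^\infty_{p,q}=L^p(0,\infty;W^{2,q}\cap W^{1,q}_0)\cap W^{1,p}(0,\infty;L^q(\Omega)).$$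 **Equilibrium.** $\nu,\kappa>0$ are constants, $\gamma=\bar g/\bar\theta$ is a constant ($\bar g$ = gravity acceleration, $\bar\theta$ = reference temperature), $\mathbf{e}_d=(0,\dots,0,1)$. Given $\mathbf{f}\in\mathbf{L}^q(\Omega)$, $g\in L^q(\Omega)$, $(\mathbf{y}_e,\theta_e,\pi_e)\in(\mathbf{W}^{2,q}\cap\mathbf{W}^{1,q}_0)\times(W^{2,q}\cap W^{1,q}_0)\times (W^{1,q}/\mathbb{R})$ solves $-\nu\Delta\mathbf{y}_e+(\mathbf{y}_e\cdot\nabla)\mathbf{y}_e-\gamma(\theta_e-\bar\theta)\mathbf{e}_d+\nabla\pi_e=\mathbf{f}$, $-\kappa\Delta\theta_e+\mathbf{y}_e\cdot\nabla\theta_e=g$, $\mathrm{div}\,\mathbf{y}_e=0$ in $\Omega$, $\mathbf{y}_e=0,\theta_e=0$ on $\partial\Omega$. **Operators.** $A_q\mathbf{z}=-P_q\Delta\mathbf{z}$, $\mathcal{D}(A_q)=\mathbf{W}^{2,q}\cap\mathbf{W}^{1,q}_0\cap\mathbf{L}^q_\sigma$; $\mathcal{A}_q\mathbf{z}=-\nu A_q\mathbf{z}-P_q[(\mathbf{y}_e\cdot\nabla)\mathbf{z}+(\mathbf{z}\cdot\nabla)\mathbf{y}_e]$, $\mathcal{D}(\mathcal{A}_q)=\mathcal{D}(A_q)$; $\mathcal{B}_qh=\kappa\Delta h-\mathbf{y}_e\cdot\nabla h$, $\mathcal{D}(\mathcal{B}_q)=W^{2,q}\cap W^{1,q}_0$;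 $\mathcal{C}_\gamma h=-\gamma P_q(h\mathbf{e}_d)$ and $\mathcal{C}_{\theta_e}\mathbf{z}=\mathbf{z}\cdot\nabla\theta_e$, bounded operators $L^q(\Omega)\to\mathbf{L}^q_\sigma(\Omega)$ and $\mathbf{L}^q_\sigma(\Omega)\to L^q(\Omega)$; $\mathcal{N}_q(\mathbf{z})=P_q[(\mathbf{z}\cdot\nabla)\mathbf{z}]$; $\mathcal{M}_q[\mathbf{z}]h=\mathbf{z}\cdot\nabla h$; $$\mathbb{A}_q=\begin{bmatrix}\mathcal{A}_q&-\mathcal{C}_\gamma\\ -\mathcal{C}_{\theta_e}&\mathcal{B}_q\end{bmatrix},\qquad \mathcal{D}(\mathbb{A}_q)=\mathcal{D}(\mathcal{A}_q)\times\mathcal{D}(\mathcal{B}_q).$$ **Unstable subspace and feedback.** $\mathbb{A}_q$ has compact resolvent and is assumed unstable: it has finitely many (at least one) eigenvalues with $\mathrm{Re}\,\lambda\ge0$, of which $M$ are distinct, with geometric multiplicities $\ell_1,\dots,\ell_M$ and total algebraic multiplicity $N$; $K=\sup\{\ell_i\}$; $\mathrm{Re}\,\lambda_{N+1}<0$ is the largest real part of the remaining eigenvalues. $P_N$ is the spectral (Riesz) projection of $\mathbb{A}_q$ for the unstable eigenvalues, $(\mathbf{W}^q_\sigma)^u_N=P_N\mathbf{W}^q_\sigma(\Omega)$, and $((\mathbf{W}^q_\sigma)^u_N)^*$ is the range of $P_N^*$ in $\mathbf{L}^{q'}_\sigma(\Omega)\times L^{q'}(\Omega)$. $(\widehat{\mathbf{W}}^q_\sigma)^u_N$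 is obtained from $(\mathbf{W}^q_\sigma)^u_N$ by omitting the $d$-th (last fluid) coordinate; a $(d-1)$-component vector acts on the fluid equation as the $d$-vector whose $d$-th component is $0$. $(\cdot,\cdot)_\omega$ is the $L^q(\omega)$–$L^{q'}(\omega)$ duality pairing by integration over $\omega$. The vectors $\mathbf{u}_k=[\mathbf{u}^1_k,u^2_k]\in(\widehat{\mathbf{W}}^q_\sigma)^u_N$ (with $\mathbf{u}^1_k$ having $d-1$ components), $\mathbf{p}_k\in((\mathbf{W}^q_\sigma)^u_N)^*$, $k=1,\dots,K$, are fixed so that, with $$F(\mathbf{w})=\begin{bmatrix}P_q\big(m\sum_{k=1}^K(P_N\mathbf{w},\mathbf{p}_k)_\omega\mathbf{u}^1_k\big)\\ m\sum_{k=1}^K(P_N\mathbf{w},\mathbf{p}_k)_\omega u^2_k\end{bmatrix},\qquad \mathbb{A}_{F,q}=\mathbb{A}_q+F,\quad \mathcal{D}(\mathbb{A}_{F,q})=\mathcal{D}(\mathbb{A}_q),$$ on each of $X=\mathbf{W}^q_\sigma(\Omega)$ and $X=\mathbf{V}^{q,p}(\Omega)$: $\mathbb{A}_{F,q}$ generates a s.c. analytic semigroup; $\|e^{\mathbb{A}_{F,q}t}\|_{\mathcal{L}(X)}\le C_{\gamma_0}e^{-\gamma_0t}$ for any $\gamma_0>0$ with $\mathrm{Re}\,\lambda_{N+1}<-\gamma_0<0$; and $\mathbb{A}_{F,q}$ has maximal $L^p$-regularity up to $T=\infty$, i.e. $\mathbf{F}\mapsto\int_0^te^{\mathbb{A}_{F,q}(t-\tau)}\mathbf{F}(\tau)d\tau$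 is continuous from $L^p(0,\infty;X)$ into $L^p(0,\infty;\mathcal{D}(\mathbb{A}_{F,q}))\cap W^{1,p}(0,\infty;X)$ (on $X=\mathbf V^{q,p}$ with the domain of the realization there). The paper shows such vectors exist. **The constant $r_1$.** The paper's well-posedness theorem for the nonlinear feedback problem asserts the existence of a constant $r_1>0$ with the property stated in the claim, and its proof identifies it by $r_1\le\frac{1}{4C^2}$, where $C$ (without loss of generality $C>1/4$) is the constant in the estimate $$\left\|e^{\mathbb{A}_{F,q}t}\mathbf{b}_0-\int_0^te^{\mathbb{A}_{F,q}(t-\tau)}\begin{bmatrix}\mathcal{N}_q\mathbf{f}_1(\tau)\\ \mathcal{M}_q[\mathbf{f}_1]f_2(\tau)\end{bmatrix}d\tau\right\|_{\mathbf{X}^\infty_{p,q,\sigma}\times X^\infty_{p,q}}\le C\Big\{\|\mathbf{b}_0\|_{\mathbf{V}^{q,p}(\Omega)}+\|\mathbf{f}_1\|_{\mathbf{X}^\infty_{p,q,\sigma}}\big(\|\mathbf{f}_1\|_{\mathbf{X}^\infty_{p,q,\sigma}}+\|f_2\|_{X^\infty_{p,q}}\big)\Big\},$$ valid for all $\mathbf{b}_0\in\mathbf{V}^{q,p}(\Omega)$ and $\{\mathbf{f}_1,f_2\}\in\mathbf{X}^\infty_{p,q,\sigma}\times X^\infty_{p,q}$. *)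

theory Defs
  imports "HOL-Analysis.Analysis"
begin

section \<open>Complex vector spaces\<close>

text \<open>Compatible with the real structure, so that the library's simple-function integral
  (which uses real scaling) can be used for vector-valued integration.\<close>

class complex_vector = real_vector +
  fixes scaleC :: "complex \<Rightarrow> 'a \<Rightarrow> 'a" (infixr "*\<^sub>C" 75)
  assumes scaleC_add_right: "a *\<^sub>C (x + y) = a *\<^sub>C x + a *\<^sub>C y"
    and scaleC_add_left: "(a + b) *\<^sub>C x = a *\<^sub>C x + b *\<^sub>C x"
    and scaleC_scaleC: "a *\<^sub>C b *\<^sub>C x = (a * b) *\<^sub>C x"
    and scaleC_one: "1 *\<^sub>C x = x"
    and scaleR_scaleC: "r *\<^sub>R x = complex_of_real r *\<^sub>C x"

lemma vector_space_scaleC: "vector_space (scaleC :: complex \<Rightarrow> 'a \<Rightarrow> 'a::complex_vector)"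
  by unfold_locales (simp_all add: scaleC_add_right scaleC_add_left scaleC_scaleC scaleC_one)

instantiation prod :: (complex_vector, complex_vector) complex_vector
begin
definition "scaleC_prod c (x :: 'a \<times> 'b) = (c *\<^sub>C fst x, c *\<^sub>C snd x)"
instance
  by standard (simp_all add: scaleC_prod_def prod_eq_iff scaleC_add_right scaleC_add_left
      scaleC_scaleC scaleC_one scaleR_scaleC)
end

instantiation vec :: (complex_vector, finite) complex_vector
begin
definition "scaleC_vec c (x :: 'a ^ 'b) = (\<chi> i. c *\<^sub>C (x $ i))"
instance
  by standard (simp_all add: scaleC_vec_def vec_eq_iff scaleC_add_right scaleC_add_left
      scaleC_scaleC scaleC_one scaleR_scaleC)
end

definition complex_dim :: "'a::complex_vector set \<Rightarrow> nat" where
  "complex_dim = vector_space.dim scaleC"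

section \<open>Complex-valued Lebesgue measurable functions modulo null sets\<close>

text \<open>Functions on an open set \<open>\<Omega>\<close> are represented by their extension by zero.\<close>

quotient_type (overloaded) 'a lfun = "'a::euclidean_space \<Rightarrow> complex" / partial:
  "\<lambda>f g. f \<in> borel_measurable lebesgue \<and> g \<in> borel_measurable lebesgue
         \<and> (AE x in lebesgue. f x = g x)"
proof (rule part_equivpI)
  show "\<exists>f :: 'a \<Rightarrow> complex. f \<in> borel_measurable lebesgue \<and> f \<in> borel_measurable lebesgue
         \<and> (AE x in lebesgue. f x = f x)"
    by (rule exI[of _ "\<lambda>_. 0"]) simp
qed (auto simp: symp_def transp_def elim: AE_mp)

instantiation lfun :: (euclidean_space) "{complex_vector, times}"
begin

lift_definition zero_lfun :: "'a lfun" is "\<lambda>_. 0" by simp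
lift_definition plus_lfun :: "'a lfun \<Rightarrow> 'a lfun \<Rightarrow> 'a lfun" is "\<lambda>f g x. f x + g x"
  by (auto elim: AE_mp)
lift_definition minus_lfun :: "'a lfun \<Rightarrow> 'a lfun \<Rightarrow> 'a lfun" is "\<lambda>f g x. f x - g x"
  by (auto elim: AE_mp)
lift_definition uminus_lfun :: "'a lfun \<Rightarrow> 'a lfun" is "\<lambda>f x. - f x"
  by (auto elim: AE_mp)
lift_definition times_lfun :: "'a lfun \<Rightarrow> 'a lfun \<Rightarrow> 'a lfun" is "\<lambda>f g x. f x * g x"
  by (auto elim: AE_mp)
lift_definition scaleR_lfun :: "real \<Rightarrow> 'a lfun \<Rightarrow> 'a lfun" is "\<lambda>r f x. complex_of_real r * f x"
  by (auto elim: AE_mp)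
lift_definition scaleC_lfun :: "complex \<Rightarrow> 'a lfun \<Rightarrow> 'a lfun" is "\<lambda>c f x. c * f x"
  by (auto elim: AE_mp)

instance
  by standard (transfer; auto simp: algebra_simps)+

end

lift_definition cnj_lfun :: "'a::euclidean_space lfun \<Rightarrow> 'a lfun" is "\<lambda>f x. cnj (f x)"
  by (auto elim: AE_mp intro: measurable_compose[OF _ borel_measurable_continuous_onI]
      continuous_intros)

lift_definition restr :: "'a::euclidean_space set \<Rightarrow> 'a lfun \<Rightarrow> 'a lfun" is
  "\<lambda>S f x. if S \<in> sets lebesgue \<and> x \<in> S then f x else 0"
proof -
  fix S :: "'a set" and f g :: "'a \<Rightarrow> complex"
  assume "f \<in> borel_measurable lebesgue \<and> g \<in> borel_measurable lebesgue
         \<and> (AE x in lebesgue. f x = g x)"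
  then show "(\<lambda>x. if S \<in> sets lebesgue \<and> x \<in> S then f x else 0) \<in> borel_measurable lebesgue
    \<and> (\<lambda>x. if S \<in> sets lebesgue \<and> x \<in> S then g x else 0) \<in> borel_measurable lebesgue
    \<and> (AE x in lebesgue. (if S \<in> sets lebesgue \<and> x \<in> S then f x else 0)
         = (if S \<in> sets lebesgue \<and> x \<in> S then g x else 0))"
    by (cases "S \<in> sets lebesgue") (auto intro!: measurable_If_set elim: AE_mp)
qed

text \<open>Only used for measurable arguments.\<close>

definition of_fun :: "('a::euclidean_space \<Rightarrow> complex) \<Rightarrow> 'a lfun" where
  "of_fun f = abs_lfun f"

lift_definition lint :: "'a::euclidean_space lfun \<Rightarrow> complex" is "integral\<^sup>L lebesgue"
  by (blast intro: integral_cong_AE)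

lift_definition vanishes_outside :: "'a::euclidean_space set \<Rightarrow> 'a lfun \<Rightarrow> bool" is
  "\<lambda>S f. AE x in lebesgue. x \<notin> S \<longrightarrow> f x = 0"
proof -
  fix S :: "'a set" and f g :: "'a \<Rightarrow> complex"
  assume "f \<in> borel_measurable lebesgue \<and> g \<in> borel_measurable lebesgue
         \<and> (AE x in lebesgue. f x = g x)"
  then have "AE x in lebesgue. f x = g x" by simp
  then show "(AE x in lebesgue. x \<notin> S \<longrightarrow> f x = 0) = (AE x in lebesgue. x \<notin> S \<longrightarrow> g x = 0)"
    by (intro iffI; elim AE_mp) (auto elim: AE_mp)
qed

lift_definition Lq_integrable :: "real \<Rightarrow> 'a::euclidean_space lfun \<Rightarrow> bool" is
  "\<lambda>q f. integrable lebesgue (\<lambda>x. norm (f x) powr q)"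
  by (intro integrable_cong_AE) (auto elim: AE_mp)

lift_definition Lq_norm :: "real \<Rightarrow> 'a::euclidean_space lfun \<Rightarrow> real" is
  "\<lambda>q f. (integral\<^sup>L lebesgue (\<lambda>x. norm (f x) powr q)) powr (1 / q)"
  by (intro arg_cong[where f = "\<lambda>x. x powr _"] integral_cong_AE) (auto elim: AE_mp)

definition L1loc :: "'a::euclidean_space set \<Rightarrow> 'a lfun set" where
  "L1loc \<Omega> = {u. vanishes_outside \<Omega> u \<and> (\<forall>K. compact K \<and> K \<subseteq> \<Omega> \<longrightarrow> Lq_integrable 1 (restr K u))}"

section \<open>Differentiable functions and smooth domains\<close>

abbreviation partial :: "'a::euclidean_space \<Rightarrow> ('a \<Rightarrow> 'b::real_normed_vector) \<Rightarrow> 'a \<Rightarrow> 'b" where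
  "partial e f \<equiv> (\<lambda>x. frechet_derivative f (at x) e)"

primrec Ck_on :: "nat \<Rightarrow> 'a::euclidean_space set \<Rightarrow> ('a \<Rightarrow> 'b::real_normed_vector) \<Rightarrow> bool" where
  "Ck_on 0 U f \<longleftrightarrow> continuous_on U f"
| "Ck_on (Suc k) U f \<longleftrightarrow> (\<forall>x\<in>U. f differentiable (at x)) \<and> (\<forall>e\<in>Basis. Ck_on k U (partial e f))"

definition test_fun :: "'a::euclidean_space set \<Rightarrow> ('a \<Rightarrow> 'b::real_normed_vector) \<Rightarrow> bool" where
  "test_fun \<Omega> f \<longleftrightarrow> (\<forall>k. Ck_on k UNIV f)
     \<and> compact (closure {x. f x \<noteq> 0}) \<and> closure {x. f x \<noteq> 0} \<subseteq> \<Omega>"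

definition Ck_boundary :: "nat \<Rightarrow> 'a::euclidean_space set \<Rightarrow> bool" where
  "Ck_boundary k \<Omega> \<longleftrightarrow> (\<forall>x\<in>frontier \<Omega>. \<exists>U (\<rho> :: 'a \<Rightarrow> real). open U \<and> x \<in> U \<and> Ck_on k U \<rho>
     \<and> (\<forall>y\<in>U. \<exists>e\<in>Basis. partial e \<rho> y \<noteq> 0) \<and> \<Omega> \<inter> U = {y\<in>U. \<rho> y < 0})"

section \<open>Normed spaces given by carriers\<close>

record 'v nspace =
  carr :: "'v set"
  nrm :: "'v \<Rightarrow> real"

definition restrict_sp :: "'v nspace \<Rightarrow> 'v set \<Rightarrow> 'v nspace" where
  "restrict_sp X S = \<lparr>carr = carr X \<inter> S, nrm = nrm X\<rparr>"

definition prod_sp :: "'v nspace \<Rightarrow> 'w nspace \<Rightarrow> ('v \<times> 'w) nspace" where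
  "prod_sp X Y = \<lparr>carr = carr X \<times> carr Y, nrm = (\<lambda>(x, y). nrm X x + nrm Y y)\<rparr>"

definition vec_sp :: "'v nspace \<Rightarrow> ('v ^ 'd) nspace" where
  "vec_sp X = \<lparr>carr = {z. \<forall>i. z $ i \<in> carr X}, nrm = (\<lambda>z. \<Sum>i\<in>UNIV. nrm X (z $ i))\<rparr>"

definition graph_sp :: "'v nspace \<Rightarrow> 'v set \<Rightarrow> ('v \<Rightarrow> 'v) \<Rightarrow> 'v nspace" where
  "graph_sp X D A = \<lparr>carr = D, nrm = (\<lambda>x. nrm X x + nrm X (A x))\<rparr>"

definition tends_in :: "'v::minus nspace \<Rightarrow> ('i \<Rightarrow> 'v) \<Rightarrow> 'v \<Rightarrow> 'i filter \<Rightarrow> bool" where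
  "tends_in X f l F \<longleftrightarrow> l \<in> carr X \<and> ((\<lambda>i. nrm X (f i - l)) \<longlongrightarrow> 0) F"

definition bounded_op :: "'v::complex_vector nspace \<Rightarrow> ('v \<Rightarrow> 'v) \<Rightarrow> bool" where
  "bounded_op X T \<longleftrightarrow> T ` carr X \<subseteq> carr X
     \<and> (\<forall>x\<in>carr X. \<forall>y\<in>carr X. T (x + y) = T x + T y)
     \<and> (\<forall>c. \<forall>x\<in>carr X. T (c *\<^sub>C x) = c *\<^sub>C T x)
     \<and> (\<exists>B. \<forall>x\<in>carr X. nrm X (T x) \<le> B * nrm X x)"

text \<open>Peetre's K-functional and the real interpolation space \<open>(X, Y)\<^bsub>\<theta>,p\<^esub>\<close>.\<close>

definition K_fun :: "'v::plus nspace \<Rightarrow> 'v nspace \<Rightarrow> real \<Rightarrow> 'v \<Rightarrow> real" where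
  "K_fun X Y t x = Inf {nrm X a + t * nrm Y b | a b. a \<in> carr X \<and> b \<in> carr Y \<and> x = a + b}"

definition interp_sp :: "real \<Rightarrow> real \<Rightarrow> 'v::plus nspace \<Rightarrow> 'v nspace \<Rightarrow> 'v nspace" where
  "interp_sp \<theta> p X Y =
    \<lparr>carr = {x. (\<exists>a\<in>carr X. \<exists>b\<in>carr Y. x = a + b)
             \<and> set_integrable lborel {0<..} (\<lambda>t. (t powr - \<theta> * K_fun X Y t x) powr p / t)},
     nrm = (\<lambda>x. (LINT t:{0<..}|lborel. (t powr - \<theta> * K_fun X Y t x) powr p / t) powr (1 / p))\<rparr>"

section \<open>Bochner integral and time-dependent function spaces\<close>

text \<open>These follow the library's \<open>has_bochner_integral\<close>, with the type-class norm replaced by the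
  norm of the space. Off the carrier a norm has no meaning; the conditions force values in the
  carrier almost everywhere.\<close>

definition strongly_meas :: "'v::real_vector nspace \<Rightarrow> real set \<Rightarrow> (real \<Rightarrow> 'v) \<Rightarrow> bool" where
  "strongly_meas X S f \<longleftrightarrow> (\<exists>s :: nat \<Rightarrow> real \<Rightarrow> 'v.
     (\<forall>n. simple_function (lebesgue_on S) (s n) \<and> s n ` S \<subseteq> carr X)
     \<and> (AE t in lebesgue_on S. f t \<in> carr X \<and> (\<lambda>n. nrm X (f t - s n t)) \<longlonglongrightarrow> 0))"

definition has_bint :: "'v::real_vector nspace \<Rightarrow> real set \<Rightarrow> (real \<Rightarrow> 'v) \<Rightarrow> 'v \<Rightarrow> bool" where
  "has_bint X S f I \<longleftrightarrow> strongly_meas X S f \<and> (\<exists>s :: nat \<Rightarrow> real \<Rightarrow> 'v.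
     (\<forall>n. Bochner_Integration.simple_bochner_integrable (lebesgue_on S) (s n) \<and> s n ` S \<subseteq> carr X)
     \<and> (\<lambda>n. \<integral>\<^sup>+ t. ennreal (nrm X (f t - s n t)) \<partial>lebesgue_on S) \<longlonglongrightarrow> 0
     \<and> tends_in X (\<lambda>n. Bochner_Integration.simple_bochner_integral (lebesgue_on S) (s n)) I sequentially)"

definition Lp_time :: "real \<Rightarrow> 'v::real_vector nspace \<Rightarrow> (real \<Rightarrow> 'v) nspace" where
  "Lp_time p X =
    \<lparr>carr = {f. strongly_meas X {0<..} f \<and> integrable (lebesgue_on {0<..}) (\<lambda>t. nrm X (f t) powr p)},
     nrm = (\<lambda>f. (integral\<^sup>L (lebesgue_on {0<..}) (\<lambda>t. nrm X (f t) powr p)) powr (1 / p))\<rparr>"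

definition weak_time_deriv :: "'v::real_vector nspace \<Rightarrow> (real \<Rightarrow> 'v) \<Rightarrow> (real \<Rightarrow> 'v) \<Rightarrow> bool" where
  "weak_time_deriv X f g \<longleftrightarrow> (\<forall>\<phi> :: real \<Rightarrow> real. test_fun {0<..} \<phi> \<longrightarrow>
     (\<exists>I. has_bint X {0<..} (\<lambda>t. deriv \<phi> t *\<^sub>R f t) I \<and> has_bint X {0<..} (\<lambda>t. \<phi> t *\<^sub>R g t) (- I)))"

definition W1p_time :: "real \<Rightarrow> 'v::real_vector nspace \<Rightarrow> (real \<Rightarrow> 'v) nspace" where
  "W1p_time p X =
    \<lparr>carr = {f \<in> carr (Lp_time p X). \<exists>g\<in>carr (Lp_time p X). weak_time_deriv X f g},
     nrm = (\<lambda>f. nrm (Lp_time p X) f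
             + nrm (Lp_time p X) (SOME g. g \<in> carr (Lp_time p X) \<and> weak_time_deriv X f g))\<rparr>"

definition max_reg_sp :: "real \<Rightarrow> 'v::real_vector nspace \<Rightarrow> 'v nspace \<Rightarrow> (real \<Rightarrow> 'v) nspace" where
  "max_reg_sp p Y X =
    \<lparr>carr = carr (Lp_time p Y) \<inter> carr (W1p_time p X),
     nrm = (\<lambda>f. nrm (Lp_time p Y) f + nrm (W1p_time p X) f)\<rparr>"

section \<open>Semigroups and spectral theory\<close>

definition C0_semigroup :: "'v::complex_vector nspace \<Rightarrow> (real \<Rightarrow> 'v \<Rightarrow> 'v) \<Rightarrow> bool" where
  "C0_semigroup X S \<longleftrightarrow> (\<forall>t\<ge>0. bounded_op X (S t)) \<and> (\<forall>x\<in>carr X. S 0 x = x)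
     \<and> (\<forall>s\<ge>0. \<forall>t\<ge>0. \<forall>x\<in>carr X. S (s + t) x = S s (S t x))
     \<and> (\<forall>x\<in>carr X. tends_in X (\<lambda>t. S t x) x (at_right 0))"

definition generates ::
  "'v::complex_vector nspace \<Rightarrow> 'v set \<Rightarrow> ('v \<Rightarrow> 'v) \<Rightarrow> (real \<Rightarrow> 'v \<Rightarrow> 'v) \<Rightarrow> bool" where
  "generates X D A S \<longleftrightarrow> C0_semigroup X S \<and> D \<subseteq> carr X
     \<and> (\<forall>x\<in>carr X. \<forall>y. tends_in X (\<lambda>t. (1 / t) *\<^sub>R (S t x - x)) y (at_right 0)
                          \<longleftrightarrow> x \<in> D \<and> y = A x)"

definition analytic_semigroup :: "'v::complex_vector nspace \<Rightarrow> (real \<Rightarrow> 'v \<Rightarrow> 'v) \<Rightarrow> bool" where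
  "analytic_semigroup X S \<longleftrightarrow> (\<exists>\<delta>>0. \<delta> \<le> pi / 2 \<and> (\<exists>T :: complex \<Rightarrow> 'v \<Rightarrow> 'v.
     let \<Delta> = {z. z \<noteq> 0 \<and> \<bar>Arg z\<bar> < \<delta>} in
       (\<forall>t>0. \<forall>x\<in>carr X. T (complex_of_real t) x = S t x)
     \<and> (\<forall>z\<in>\<Delta>. bounded_op X (T z))
     \<and> (\<forall>z\<in>\<Delta>. \<forall>w\<in>\<Delta>. \<forall>x\<in>carr X. T (z + w) x = T z (T w x))
     \<and> (\<forall>z\<in>\<Delta>. \<forall>x\<in>carr X. \<exists>y. tends_in X (\<lambda>w. inverse (w - z) *\<^sub>C (T w x - T z x)) y (at z))
     \<and> (\<forall>x\<in>carr X. tends_in X (\<lambda>z. T z x) x (at 0 within \<Delta>))))"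

text \<open>Domain of the realization (part) of \<open>A\<close> in \<open>X\<close>.\<close>

definition part_dom :: "'v nspace \<Rightarrow> 'v set \<Rightarrow> ('v \<Rightarrow> 'v) \<Rightarrow> 'v set" where
  "part_dom X D A = {x \<in> D \<inter> carr X. A x \<in> carr X}"

definition duhamel ::
  "'v::complex_vector nspace \<Rightarrow> (real \<Rightarrow> 'v \<Rightarrow> 'v) \<Rightarrow> (real \<Rightarrow> 'v) \<Rightarrow> (real \<Rightarrow> 'v) \<Rightarrow> bool" where
  "duhamel X S G y \<longleftrightarrow> (\<forall>t\<ge>0. has_bint X {0..t} (\<lambda>\<tau>. S (t - \<tau>) (G \<tau>)) (y t))"

definition max_Lp_regularity ::
  "real \<Rightarrow> 'v::complex_vector nspace \<Rightarrow> 'v set \<Rightarrow> ('v \<Rightarrow> 'v) \<Rightarrow> (real \<Rightarrow> 'v \<Rightarrow> 'v) \<Rightarrow> bool" where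
  "max_Lp_regularity p X D A S \<longleftrightarrow> (\<exists>c. \<forall>G\<in>carr (Lp_time p X). \<exists>y. duhamel X S G y
     \<and> y \<in> carr (max_reg_sp p (graph_sp X D A) X)
     \<and> nrm (max_reg_sp p (graph_sp X D A) X) y \<le> c * nrm (Lp_time p X) G)"

definition eigenvalues :: "'v::complex_vector set \<Rightarrow> ('v \<Rightarrow> 'v) \<Rightarrow> complex set" where
  "eigenvalues D A = {\<mu>. \<exists>x\<in>D. x \<noteq> 0 \<and> A x = \<mu> *\<^sub>C x}"

definition unstable_eigs :: "'v::complex_vector set \<Rightarrow> ('v \<Rightarrow> 'v) \<Rightarrow> complex set" where
  "unstable_eigs D A = {\<mu> \<in> eigenvalues D A. Re \<mu> \<ge> 0}"

definition geom_mult :: "'v::complex_vector set \<Rightarrow> ('v \<Rightarrow> 'v) \<Rightarrow> complex \<Rightarrow> nat" where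
  "geom_mult D A \<mu> = complex_dim {x\<in>D. A x = \<mu> *\<^sub>C x}"

definition resolvent :: "'v::complex_vector set \<Rightarrow> ('v \<Rightarrow> 'v) \<Rightarrow> complex \<Rightarrow> 'v \<Rightarrow> 'v" where
  "resolvent D A \<mu> y = (THE x. x \<in> D \<and> \<mu> *\<^sub>C x - A x = y)"

text \<open>\<open>1/(2\<pi>i) \<integral> (\<lambda> - A)\<^sup>-\<^sup>1 x d\<lambda>\<close> over the union of positively oriented circles around the
  points of the finite set \<open>\<sigma>\<close>, of radius so small that each circle encloses no other point of the
  spectrum.\<close>

definition riesz_proj ::
  "'v::complex_vector nspace \<Rightarrow> 'v set \<Rightarrow> ('v \<Rightarrow> 'v) \<Rightarrow> complex set \<Rightarrow> 'v \<Rightarrow> 'v" where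
  "riesz_proj X D A \<sigma> x = (\<Sum>\<mu>\<in>\<sigma>. THE y. \<forall>\<^sub>F r in at_right 0.
     has_bint X {0..2 * pi} (\<lambda>s. ((1 / (2 * complex_of_real pi * \<i>)) * (\<i> * complex_of_real r * cis s))
                               *\<^sub>C resolvent D A (\<mu> + complex_of_real r * cis s) x) y)"

section \<open>Lebesgue and Sobolev spaces on a domain\<close>

definition conj_exp :: "real \<Rightarrow> real" where
  "conj_exp q = q / (q - 1)"

definition Lq :: "'a::euclidean_space set \<Rightarrow> real \<Rightarrow> 'a lfun nspace" where
  "Lq \<Omega> q = \<lparr>carr = {u. vanishes_outside \<Omega> u \<and> Lq_integrable q u}, nrm = Lq_norm q\<rparr>"

definition is_weak_pd :: "'a::euclidean_space set \<Rightarrow> 'a \<Rightarrow> 'a lfun \<Rightarrow> 'a lfun \<Rightarrow> bool" where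
  "is_weak_pd \<Omega> e u v \<longleftrightarrow> u \<in> L1loc \<Omega> \<and> v \<in> L1loc \<Omega> \<and> (\<forall>\<phi> :: 'a \<Rightarrow> real. test_fun \<Omega> \<phi> \<longrightarrow>
     lint (u * of_fun (\<lambda>x. complex_of_real (partial e \<phi> x)))
       = - lint (v * of_fun (\<lambda>x. complex_of_real (\<phi> x))))"

definition pd :: "'a::euclidean_space set \<Rightarrow> 'a \<Rightarrow> 'a lfun \<Rightarrow> 'a lfun" where
  "pd \<Omega> e u = (THE v. is_weak_pd \<Omega> e u v)"

primrec Wkq :: "'a::euclidean_space set \<Rightarrow> nat \<Rightarrow> real \<Rightarrow> 'a lfun nspace" where
  "Wkq \<Omega> 0 q = Lq \<Omega> q"
| "Wkq \<Omega> (Suc k) q =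
    \<lparr>carr = {u \<in> carr (Lq \<Omega> q). \<forall>e\<in>Basis. (\<exists>v. is_weak_pd \<Omega> e u v) \<and> pd \<Omega> e u \<in> carr (Wkq \<Omega> k q)},
     nrm = (\<lambda>u. Lq_norm q u + (\<Sum>e\<in>Basis. nrm (Wkq \<Omega> k q) (pd \<Omega> e u)))\<rparr>"

definition W1q0 :: "'a::euclidean_space set \<Rightarrow> real \<Rightarrow> 'a lfun set" where
  "W1q0 \<Omega> q = {u \<in> carr (Wkq \<Omega> 1 q). \<exists>\<phi> :: nat \<Rightarrow> 'a \<Rightarrow> complex. (\<forall>n. test_fun \<Omega> (\<phi> n))
     \<and> (\<lambda>n. nrm (Wkq \<Omega> 1 q) (of_fun (\<phi> n) - u)) \<longlonglongrightarrow> 0}"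

section \<open>Vector fields, solenoidal fields, Helmholtz projection\<close>

type_synonym 'd scalar = "(real ^ 'd) lfun"
type_synonym 'd field = "(real ^ 'd) lfun ^ 'd"
type_synonym 'd state = "((real ^ 'd) lfun ^ 'd) \<times> (real ^ 'd) lfun"

abbreviation pdi :: "(real ^ 'd::finite) set \<Rightarrow> 'd \<Rightarrow> 'd scalar \<Rightarrow> 'd scalar" where
  "pdi \<Omega> i \<equiv> pd \<Omega> (axis i 1)"

definition grad :: "(real ^ 'd::finite) set \<Rightarrow> 'd scalar \<Rightarrow> 'd field" where
  "grad \<Omega> h = (\<chi> i. pdi \<Omega> i h)"

definition laplacian :: "(real ^ 'd::finite) set \<Rightarrow> 'd scalar \<Rightarrow> 'd scalar" where
  "laplacian \<Omega> h = (\<Sum>i\<in>UNIV. pdi \<Omega> i (pdi \<Omega> i h))"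

definition convect :: "(real ^ 'd::finite) set \<Rightarrow> 'd field \<Rightarrow> 'd scalar \<Rightarrow> 'd scalar" where
  "convect \<Omega> y h = (\<Sum>i\<in>UNIV. y $ i * pdi \<Omega> i h)"

definition convect_vec :: "(real ^ 'd::finite) set \<Rightarrow> 'd field \<Rightarrow> 'd field \<Rightarrow> 'd field" where
  "convect_vec \<Omega> y z = (\<chi> j. convect \<Omega> y (z $ j))"

abbreviation last_coord :: "('d::{finite,linorder})" where
  "last_coord \<equiv> Max UNIV"

definition along_ed :: "('d::{finite,linorder}) scalar \<Rightarrow> 'd field" where
  "along_ed h = (\<chi> i. if i = last_coord then h else 0)"

definition omit_last :: "('d::{finite,linorder}) field \<Rightarrow> 'd field" where
  "omit_last z = (\<chi> i. if i = last_coord then 0 else z $ i)"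

abbreviation Lqv :: "(real ^ 'd::finite) set \<Rightarrow> real \<Rightarrow> 'd field nspace" where
  "Lqv \<Omega> q \<equiv> vec_sp (Lq \<Omega> q)"

definition is_weak_div :: "(real ^ 'd::finite) set \<Rightarrow> 'd field \<Rightarrow> 'd scalar \<Rightarrow> bool" where
  "is_weak_div \<Omega> g h \<longleftrightarrow> (\<forall>i. g $ i \<in> L1loc \<Omega>) \<and> h \<in> L1loc \<Omega>
     \<and> (\<forall>\<phi> :: real ^ 'd \<Rightarrow> real. test_fun \<Omega> \<phi> \<longrightarrow>
          lint (\<Sum>i\<in>UNIV. g $ i * of_fun (\<lambda>x. complex_of_real (partial (axis i 1) \<phi> x)))
            = - lint (h * of_fun (\<lambda>x. complex_of_real (\<phi> x))))"

text \<open>For \<open>g \<in> L\<^sup>q\<close> with \<open>div g \<in> L\<^sup>q\<close> the normal trace \<open>g \<cdot> n\<close> on the boundary is the functional on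
  (traces of) \<open>W\<^sup>1\<^sup>,\<^sup>q'\<close> given by Green's formula,
  \<open>\<langle>g \<cdot> n, \<phi>\<rangle> = \<integral> g \<cdot> \<nabla>\<phi> + \<integral> (div g) \<phi>\<close>.\<close>

definition normal_trace_zero :: "(real ^ 'd::finite) set \<Rightarrow> real \<Rightarrow> 'd field \<Rightarrow> bool" where
  "normal_trace_zero \<Omega> q g \<longleftrightarrow> (\<exists>h\<in>carr (Lq \<Omega> q). is_weak_div \<Omega> g h
     \<and> (\<forall>\<phi>\<in>carr (Wkq \<Omega> 1 (conj_exp q)).
          lint (\<Sum>i\<in>UNIV. g $ i * pdi \<Omega> i \<phi>) + lint (h * \<phi>) = 0))"

definition Lq_sigma :: "(real ^ 'd::finite) set \<Rightarrow> real \<Rightarrow> 'd field nspace" where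
  "Lq_sigma \<Omega> q = restrict_sp (Lqv \<Omega> q) {g. is_weak_div \<Omega> g 0 \<and> normal_trace_zero \<Omega> q g}"

definition Gq :: "(real ^ 'd::finite) set \<Rightarrow> real \<Rightarrow> 'd field set" where
  "Gq \<Omega> q = {g \<in> carr (Lqv \<Omega> q). \<exists>\<pi>. \<forall>i. is_weak_pd \<Omega> (axis i 1) \<pi> (g $ i)}"

definition helmholtz :: "(real ^ 'd::finite) set \<Rightarrow> real \<Rightarrow> bool" where
  "helmholtz \<Omega> q \<longleftrightarrow> carr (Lq_sigma \<Omega> q) \<inter> Gq \<Omega> q = {0}
     \<and> carr (Lqv \<Omega> q) = {v + g | v g. v \<in> carr (Lq_sigma \<Omega> q) \<and> g \<in> Gq \<Omega> q}"

definition Pq :: "(real ^ 'd::finite) set \<Rightarrow> real \<Rightarrow> 'd field \<Rightarrow> 'd field" where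
  "Pq \<Omega> q w = (THE v. v \<in> carr (Lq_sigma \<Omega> q) \<and> w - v \<in> Gq \<Omega> q)"

section \<open>The operators of the linearized Boussinesq system\<close>

definition W20_sp :: "(real ^ 'd::finite) set \<Rightarrow> real \<Rightarrow> 'd scalar nspace" where
  "W20_sp \<Omega> q = restrict_sp (Wkq \<Omega> 2 q) (W1q0 \<Omega> q)"

definition W20_sigma_sp :: "(real ^ 'd::finite) set \<Rightarrow> real \<Rightarrow> 'd field nspace" where
  "W20_sigma_sp \<Omega> q = restrict_sp (vec_sp (W20_sp \<Omega> q)) (carr (Lq_sigma \<Omega> q))"

definition stokes :: "(real ^ 'd::finite) set \<Rightarrow> real \<Rightarrow> 'd field \<Rightarrow> 'd field" where
  "stokes \<Omega> q z = - Pq \<Omega> q (\<chi> i. laplacian \<Omega> (z $ i))"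

definition oseen :: "(real ^ 'd::finite) set \<Rightarrow> real \<Rightarrow> real \<Rightarrow> 'd field \<Rightarrow> 'd field \<Rightarrow> 'd field" where
  "oseen \<Omega> q \<nu> ye z
     = - (\<nu> *\<^sub>R stokes \<Omega> q z) - Pq \<Omega> q (convect_vec \<Omega> ye z + convect_vec \<Omega> z ye)"

definition heat_op :: "(real ^ 'd::finite) set \<Rightarrow> real \<Rightarrow> 'd field \<Rightarrow> 'd scalar \<Rightarrow> 'd scalar" where
  "heat_op \<Omega> \<kappa> ye h = \<kappa> *\<^sub>R laplacian \<Omega> h - convect \<Omega> ye h"

definition C_gamma ::
  "(real ^ 'd::{finite,linorder}) set \<Rightarrow> real \<Rightarrow> real \<Rightarrow> 'd scalar \<Rightarrow> 'd field" where
  "C_gamma \<Omega> q \<gamma> h = - (\<gamma> *\<^sub>R Pq \<Omega> q (along_ed h))"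

definition C_theta :: "(real ^ 'd::finite) set \<Rightarrow> 'd scalar \<Rightarrow> 'd field \<Rightarrow> 'd scalar" where
  "C_theta \<Omega> \<theta>e z = convect \<Omega> z \<theta>e"

definition bouss_op ::
  "(real ^ 'd::{finite,linorder}) set \<Rightarrow> real \<Rightarrow> real \<Rightarrow> real \<Rightarrow> real \<Rightarrow> 'd field \<Rightarrow> 'd scalar
     \<Rightarrow> 'd state \<Rightarrow> 'd state" where
  "bouss_op \<Omega> q \<nu> \<kappa> \<gamma> ye \<theta>e w = (case w of (z, h) \<Rightarrow>
     (oseen \<Omega> q \<nu> ye z - C_gamma \<Omega> q \<gamma> h, - C_theta \<Omega> \<theta>e z + heat_op \<Omega> \<kappa> ye h))"

definition bouss_dom :: "(real ^ 'd::finite) set \<Rightarrow> real \<Rightarrow> 'd state set" where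
  "bouss_dom \<Omega> q = carr (W20_sigma_sp \<Omega> q) \<times> carr (W20_sp \<Omega> q)"

definition bouss_nonlin :: "(real ^ 'd::finite) set \<Rightarrow> real \<Rightarrow> 'd state \<Rightarrow> 'd state" where
  "bouss_nonlin \<Omega> q w = (case w of (z, h) \<Rightarrow> (Pq \<Omega> q (convect_vec \<Omega> z z), convect \<Omega> z h))"

definition equilibrium ::
  "(real ^ 'd::{finite,linorder}) set \<Rightarrow> real \<Rightarrow> real \<Rightarrow> real \<Rightarrow> real \<Rightarrow> real \<Rightarrow> 'd field \<Rightarrow> 'd scalar
     \<Rightarrow> 'd field \<Rightarrow> 'd scalar \<Rightarrow> 'd scalar \<Rightarrow> bool" where
  "equilibrium \<Omega> q \<nu> \<kappa> \<gamma> \<theta>bar f g ye \<theta>e \<pi>e \<longleftrightarrow>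
     f \<in> carr (Lqv \<Omega> q) \<and> g \<in> carr (Lq \<Omega> q)
     \<and> ye \<in> carr (vec_sp (W20_sp \<Omega> q)) \<and> \<theta>e \<in> carr (W20_sp \<Omega> q) \<and> \<pi>e \<in> carr (Wkq \<Omega> 1 q)
     \<and> - (\<nu> *\<^sub>R (\<chi> i. laplacian \<Omega> (ye $ i))) + convect_vec \<Omega> ye ye
         - \<gamma> *\<^sub>R along_ed (\<theta>e - of_fun (\<lambda>x. complex_of_real (\<theta>bar * indicator \<Omega> x)))
         + grad \<Omega> \<pi>e = f
     \<and> - (\<kappa> *\<^sub>R laplacian \<Omega> \<theta>e) + convect \<Omega> ye \<theta>e = g
     \<and> is_weak_div \<Omega> ye 0"

section \<open>State spaces\<close>

definition W_state :: "(real ^ 'd::finite) set \<Rightarrow> real \<Rightarrow> 'd state nspace" where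
  "W_state \<Omega> q = prod_sp (Lq_sigma \<Omega> q) (Lq \<Omega> q)"

definition Btilde :: "(real ^ 'd::finite) set \<Rightarrow> real \<Rightarrow> real \<Rightarrow> 'd field nspace" where
  "Btilde \<Omega> q p = restrict_sp (interp_sp (1 - 1 / p) p (Lqv \<Omega> q) (vec_sp (Wkq \<Omega> 2 q)))
     {g. is_weak_div \<Omega> g 0 \<and> normal_trace_zero \<Omega> q g}"

definition V_state :: "(real ^ 'd::finite) set \<Rightarrow> real \<Rightarrow> real \<Rightarrow> 'd state nspace" where
  "V_state \<Omega> q p = prod_sp (Btilde \<Omega> q p) (Lq \<Omega> q)"

text \<open>The second factor of the maximal-regularity space embeds continuously in time into the second
  factor of \<open>Vb_state\<close>, but for data whose second component is merely in \<open>L\<^sup>q\<close>, as in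
  \<open>V_state\<close>, no solution in \<open>Xinf_state\<close> can exist.\<close>

definition Vb_state ::
  "(real ^ 'd::finite) set \<Rightarrow> real \<Rightarrow> real \<Rightarrow> real \<Rightarrow> 'd field \<Rightarrow> 'd state nspace" where
  "Vb_state \<Omega> q p \<kappa> ye = prod_sp (Btilde \<Omega> q p)
     (interp_sp (1 - 1 / p) p (Lq \<Omega> q)
        (graph_sp (Lq \<Omega> q) (carr (W20_sp \<Omega> q)) (heat_op \<Omega> \<kappa> ye)))"

definition Xinf_sigma :: "(real ^ 'd::finite) set \<Rightarrow> real \<Rightarrow> real \<Rightarrow> (real \<Rightarrow> 'd field) nspace" where
  "Xinf_sigma \<Omega> q p = max_reg_sp p (W20_sigma_sp \<Omega> q) (Lq_sigma \<Omega> q)"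

definition Xinf :: "(real ^ 'd::finite) set \<Rightarrow> real \<Rightarrow> real \<Rightarrow> (real \<Rightarrow> 'd scalar) nspace" where
  "Xinf \<Omega> q p = max_reg_sp p (W20_sp \<Omega> q) (Lq \<Omega> q)"

definition Xinf_state :: "(real ^ 'd::finite) set \<Rightarrow> real \<Rightarrow> real \<Rightarrow> (real \<Rightarrow> 'd state) nspace" where
  "Xinf_state \<Omega> q p =
    \<lparr>carr = {f. fst \<circ> f \<in> carr (Xinf_sigma \<Omega> q p) \<and> snd \<circ> f \<in> carr (Xinf \<Omega> q p)},
     nrm = (\<lambda>f. nrm (Xinf_sigma \<Omega> q p) (fst \<circ> f) + nrm (Xinf \<Omega> q p) (snd \<circ> f))\<rparr>"

section \<open>The feedback\<close>

text \<open>Sesquilinear, both here and in the adjoint below. With the bilinear pairing the range of the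
  adjoint would be replaced by its complex conjugate, giving the same functionals \<open>(P w, p)\<close>.\<close>

definition pairing :: "(real ^ 'd::finite) set \<Rightarrow> 'd state \<Rightarrow> 'd state \<Rightarrow> complex" where
  "pairing E v w = (\<Sum>i\<in>UNIV. lint (restr E (fst v $ i * cnj_lfun (fst w $ i))))
     + lint (restr E (snd v * cnj_lfun (snd w)))"

definition adjoint_range ::
  "(real ^ 'd::finite) set \<Rightarrow> real \<Rightarrow> ('d state \<Rightarrow> 'd state) \<Rightarrow> 'd state set" where
  "adjoint_range \<Omega> q P = {w \<in> carr (W_state \<Omega> (conj_exp q)). \<exists>\<phi>\<in>carr (W_state \<Omega> (conj_exp q)).
     \<forall>v\<in>carr (W_state \<Omega> q). pairing \<Omega> (P v) \<phi> = pairing \<Omega> v w}"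

text \<open>A \<open>(d-1)\<close>-component field is represented by the \<open>d\<close>-component field whose last component is 0.\<close>

definition hat_range ::
  "(real ^ 'd::{finite,linorder}) set \<Rightarrow> real \<Rightarrow> ('d state \<Rightarrow> 'd state) \<Rightarrow> 'd state set" where
  "hat_range \<Omega> q P = (\<lambda>v. (omit_last (fst (P v)), snd (P v))) ` carr (W_state \<Omega> q)"

definition feedback ::
  "(real ^ 'd::finite) set \<Rightarrow> (real ^ 'd) set \<Rightarrow> real \<Rightarrow> ('d state \<Rightarrow> 'd state) \<Rightarrow> nat
     \<Rightarrow> (nat \<Rightarrow> 'd state) \<Rightarrow> (nat \<Rightarrow> 'd state) \<Rightarrow> 'd state \<Rightarrow> 'd state" where
  "feedback \<Omega> \<omega> q P K u pk w =
     (Pq \<Omega> q (\<chi> i. restr \<omega> (\<Sum>k=1..K. pairing \<omega> (P w) (pk k) *\<^sub>C (fst (u k) $ i))),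
      restr \<omega> (\<Sum>k=1..K. pairing \<omega> (P w) (pk k) *\<^sub>C snd (u k)))"

section \<open>The closed-loop problem\<close>

text \<open>\<open>y(t) = S(t) b - \<integral>\<^sub>0\<^sup>t S(t-\<tau>) [N f\<^sub>1(\<tau>), M[f\<^sub>1] f\<^sub>2(\<tau>)] d\<tau>\<close>, integral in the basic space.\<close>

definition mild_map ::
  "(real ^ 'd::finite) set \<Rightarrow> real \<Rightarrow> (real \<Rightarrow> 'd state \<Rightarrow> 'd state) \<Rightarrow> 'd state
     \<Rightarrow> (real \<Rightarrow> 'd state) \<Rightarrow> (real \<Rightarrow> 'd state) \<Rightarrow> bool" where
  "mild_map \<Omega> q S b f y \<longleftrightarrow> (\<exists>J. duhamel (W_state \<Omega> q) S (\<lambda>\<tau>. bouss_nonlin \<Omega> q (f \<tau>)) J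
     \<and> (\<forall>t\<ge>0. y t = S t b - J t))"

definition mild_solution ::
  "(real ^ 'd::finite) set \<Rightarrow> real \<Rightarrow> real \<Rightarrow> (real \<Rightarrow> 'd state \<Rightarrow> 'd state) \<Rightarrow> 'd state
     \<Rightarrow> (real \<Rightarrow> 'd state) \<Rightarrow> bool" where
  "mild_solution \<Omega> q p S b x \<longleftrightarrow> x \<in> carr (Xinf_state \<Omega> q p) \<and> mild_map \<Omega> q S b x x"

definition fixed_point_estimate ::
  "(real ^ 'd::finite) set \<Rightarrow> real \<Rightarrow> real \<Rightarrow> 'd state nspace
     \<Rightarrow> (real \<Rightarrow> 'd state \<Rightarrow> 'd state) \<Rightarrow> real \<Rightarrow> bool" where
  "fixed_point_estimate \<Omega> q p V S C \<longleftrightarrow>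
     (\<forall>b\<in>carr V. \<forall>f\<in>carr (Xinf_state \<Omega> q p). \<exists>y. mild_map \<Omega> q S b f y
        \<and> y \<in> carr (Xinf_state \<Omega> q p)
        \<and> nrm (Xinf_state \<Omega> q p) y
            \<le> C * (nrm V b + nrm (Xinf_sigma \<Omega> q p) (fst \<circ> f)
                     * (nrm (Xinf_sigma \<Omega> q p) (fst \<circ> f) + nrm (Xinf \<Omega> q p) (snd \<circ> f))))"

definition well_posed_below ::
  "(real ^ 'd::finite) set \<Rightarrow> real \<Rightarrow> real \<Rightarrow> 'd state nspace
     \<Rightarrow> (real \<Rightarrow> 'd state \<Rightarrow> 'd state) \<Rightarrow> real \<Rightarrow> bool" where
  "well_posed_below \<Omega> q p V S r \<longleftrightarrow> (\<forall>b\<in>carr V. nrm V b < r \<longrightarrow>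
     (\<exists>x. mild_solution \<Omega> q p S b x)
     \<and> (\<forall>x y. mild_solution \<Omega> q p S b x \<and> mild_solution \<Omega> q p S b y \<longrightarrow> (\<forall>t\<ge>0. x t = y t)))"

text \<open>The properties of the closed-loop linear operator on a state space \<open>X\<close>; \<open>\<mu>\<close> is the real part
  of the first stable eigenvalue of the uncontrolled operator.\<close>

definition stabilized_on ::
  "real \<Rightarrow> real \<Rightarrow> 'v::complex_vector nspace \<Rightarrow> 'v set \<Rightarrow> ('v \<Rightarrow> 'v) \<Rightarrow> (real \<Rightarrow> 'v \<Rightarrow> 'v) \<Rightarrow> bool" where
  "stabilized_on p \<mu> X D A S \<longleftrightarrow>
     generates X (part_dom X D A) A S \<and> analytic_semigroup X S
     \<and> (\<forall>\<gamma>0>0. \<mu> < - \<gamma>0 \<longrightarrow>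
          (\<exists>C. \<forall>t\<ge>0. \<forall>x\<in>carr X. nrm X (S t x) \<le> C * exp (- \<gamma>0 * t) * nrm X x))
     \<and> max_Lp_regularity p X (part_dom X D A) A S"

end

theory Submission
  imports Defs
begin

text \<open>
  A function in the maximal-regularity space has an absolutely continuous representative, and a
  maximal-regularity trace inequality (the K-functional is bounded by an integral, then Hardy's inequality)
  bounds its value at time \<open>t\<close> in \<open>V\<close> by the \<open>p\<close>-th root of an energy integral over \<open>(t, t + 1)\<close>.
  For a mild solution \<open>x\<close> with datum \<open>b\<close> let \<open>rho T\<close> be the quotient norm of the restriction of \<open>x\<close> to
  \<open>[0, T]\<close>. The fixed point estimate gives \<open>rho \<le> C (\<parallel>b\<parallel> + rho\<^sup>2)\<close>; as \<open>rho\<close> is continuous and starts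
  below \<open>C \<parallel>b\<parallel>\<close>, the smallness of \<open>b\<close> forces \<open>rho \<le> 2 C \<parallel>b\<parallel>\<close> for all \<open>T\<close>. The energies of the intervals
  \<open>(k, k + 1)\<close> therefore have a sum bounded by a multiple of \<open>\<parallel>b\<parallel>\<^sup>p\<close>, so for large \<open>N\<close> one of them is so small
  that \<open>\<parallel>x(k)\<parallel> \<le> \<parallel>b\<parallel> / 2\<close> with some \<open>k \<le> N\<close>. Restarting at \<open>k\<close> and iterating gives exponential decay.
\<close>

text \<open>The fixed point estimate concerns functions on the whole half-line, while a continuation
  argument in \<open>T\<close> needs initial segments. The infimum over all extensions of
  \<open>x\<close> beyond \<open>T\<close> links the two: a Duhamel integral up to time
  \<open>t\<close> depends on the forcing before \<open>t\<close> only, so the fixed point map sends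
  extensions to extensions. Continuation is needed because the theorem speaks of an arbitrary mild
  solution, of unknown size, and the quadratic inequality also has an upper branch. Two obstacles
  shape the rest. Membership in the maximal-regularity space is a statement modulo null sets, while
  decay is claimed at every \<open>t\<close>, so a mild solution must be shown to agree everywhere
  with its continuous representative. And the spaces are carriers inside larger types, outside the
  type classes for normed spaces. Bochner integrals are therefore reduced to real Lebesgue integrals
  by bounded functionals; a countable separating set of them, integrals over rational boxes,
  replaces the Hahn-Banach theorem.\<close>

lemmas bochner_bound = Bochner_Integration.integrable_bound
 and bochner_cong = Bochner_Integration.integral_cong
 and bochner_cong_AE = Bochner_Integration.integrable_cong_AE_imp

section \<open>Test functions and the lemma of du Bois-Reymond\<close>

lemma Ck_on_continuous: "Ck_on k UNIV f ==> continuous_on UNIV f"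
 by (cases k) (auto simp: continuous_on_eq_continuous_at differentiable_imp_continuous_within)

lemma Ck_on_Suc_imp: "Ck_on (Suc k) UNIV f ==> Ck_on k UNIV f"
proof (induction k arbitrary: f)
 case 0
 then show ?case by (auto simp: continuous_on_eq_continuous_at differentiable_imp_continuous_within)
next
 case (Suc k)
 then show ?case by (auto simp del: Ck_on.simps simp: Ck_on.simps(2)[of "Suc k"] Ck_on.simps(2)[of k])
qed

lemma Ck_on_const: "Ck_on k UNIV (%x::'a::euclidean_space. c::'b::real_normed_vector)"
 by (induction k arbitrary: c) auto

lemma Ck_on_add:
 fixes f g :: "'a::euclidean_space => 'b::real_normed_vector"
 assumes "Ck_on k UNIV f" "Ck_on k UNIV g" shows "Ck_on k UNIV (%x. f x + g x)"
 using assms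
proof (induction k arbitrary: f g)
 case 0 then show ?case by (auto intro: continuous_intros)
next
 case (Suc k)
 have "partial e (%x. f x + g x) = (%x. partial e f x + partial e g x)" for e
  using Suc.prems by (auto simp: fun_eq_iff intro!: frechet_derivative_at[THEN fun_cong, symmetric]
   has_derivative_add simp: frechet_derivative_works[symmetric])
 then show ?case using Suc by simp
qed

lemma Ck_on_mult:
 fixes f g :: "'a::euclidean_space => real"
 assumes "Ck_on k UNIV f" "Ck_on k UNIV g" shows "Ck_on k UNIV (%x. f x * g x)"
 using assms
proof (induction k arbitrary: f g)
 case 0 then show ?case by (auto intro: continuous_intros)
next
 case (Suc k)
 have "partial e (%x. f x * g x) = (%x. f x * partial e g x + partial e f x * g x)" for e
 proof
  fix x
  have "((%x. f x * g x) has_derivative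
    (%h. f x * partial h g x + partial h f x * g x)) (at x)"
   using Suc.prems
   by (auto intro!: has_derivative_mult simp: frechet_derivative_works[symmetric])
  from fun_cong[OF frechet_derivative_at[OF this], of e]
  show "partial e (%x. f x * g x) x = f x * partial e g x + partial e f x * g x" by simp
 qed
 moreover have "Ck_on k UNIV f" "Ck_on k UNIV g" using Suc.prems Ck_on_Suc_imp by blast+
 ultimately show ?case using Suc by (auto intro!: Ck_on_add)
qed

lemma Ck_on_prod:
 fixes f :: "'i => 'a::euclidean_space => real"
 assumes "finite I" "!!i. i \<in> I ==> Ck_on k UNIV (f i)" shows "Ck_on k UNIV (%x. \<Prod>i\<in>I. f i x)"
 using assms by (induction I rule: finite_induct) (auto intro: Ck_on_mult Ck_on_const)

text \<open>The class of functions \<open>P(1/t) exp(-1/t)\<close>, \<open>P\<close> a polynomial, is closed under differentiation.\<close>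

definition flat :: "real poly => real => real" where
 "flat P t = (if t > 0 then poly P (1 / t) * exp (- (1 / t)) else 0)"

lemma poly_div_exp_tendsto_0: "((%x. poly P x / exp x) \<longlongrightarrow> (0::real)) at_top"
proof -
 have "((%x. \<Sum>i\<le>degree P. coeff P i * (x ^ i / exp x)) \<longlongrightarrow> (\<Sum>i\<le>degree P. coeff P i * 0)) at_top"
  by (intro tendsto_sum tendsto_mult tendsto_const tendsto_power_div_exp_0)
 then show ?thesis by (simp add: poly_altdef sum_divide_distrib)
qed

lemma flat_tendsto_0: "((%t. poly P (1 / t) * exp (- (1 / t))) \<longlongrightarrow> 0) (at_right (0::real))"
proof -
 have "filterlim (%t::real. 1 / t) at_top (at_right 0)"
  using filterlim_inverse_at_top_right by (simp add: inverse_eq_divide)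
 from filterlim_compose[OF poly_div_exp_tendsto_0[of P] this]
 show ?thesis by (simp add: exp_minus field_simps)
qed

text \<open>With \<open>s = 1 / t\<close> one has d/dt = - s^2 d/ds, and d/ds (P(s) exp(-s)) =
  (P'(s) - P(s)) exp(-s); this is where \<open>monom 1 2 * (P - pderiv P)\<close> comes from. At 0
  both one-sided difference quotients tend to 0, so the two halves join differentiably.\<close>

lemma DERIV_flat: "(flat P has_real_derivative flat (monom 1 2 * (P - pderiv P)) t) (at t)"
proof -
 consider "t > 0" | "t < 0" | "t = 0" by linarith
 then show ?thesis
 proof cases
  case 1
  have "((%t. poly P (1 / t) * exp (- (1 / t))) has_real_derivative
    flat (monom 1 2 * (P - pderiv P)) t) (at t)"
   using 1 by (auto intro!: derivative_eq_intros DERIV_chain'[where g="poly P"]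
     simp: flat_def poly_monom power2_eq_square divide_simps algebra_simps)
  then show ?thesis
   by (rule DERIV_cong_ev[THEN iffD1, rotated 3])
    (use 1 in \<open>auto simp: flat_def eventually_nhds intro!: exI[of _ "{0<..}"]\<close>)
 next
  case 2
  have "((%t. 0) has_real_derivative flat (monom 1 2 * (P - pderiv P)) t) (at t)"
   using 2 by (auto simp: flat_def)
  then show ?thesis
   by (rule DERIV_cong_ev[THEN iffD1, rotated 3])
    (use 2 in \<open>auto simp: flat_def eventually_nhds intro!: exI[of _ "{..<0}"]\<close>)
 next
  case 3
  \<comment> \<open>The quotient by \<open>h\<close> is absorbed into the polynomial:
    \<open>flat P h / h\<close> is the value at \<open>h\<close> of \<open>flat\<close> for
    \<open>monom 1 1 * P\<close>, since the argument of the polynomial is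
    \<open>1 / h\<close>.\<close>
  have "((%h. flat P h / h) \<longlongrightarrow> 0) (at_right 0)"
   using flat_tendsto_0[of "monom 1 1 * P"]
   by (rule Lim_transform_eventually)
    (auto simp: eventually_at_filter flat_def poly_monom field_simps)
  moreover have "((%h. flat P h / h) \<longlongrightarrow> 0) (at_left 0)"
   by (rule Lim_transform_eventually[OF tendsto_const])
    (auto simp: eventually_at_filter flat_def)
  ultimately have "((%h. flat P h / h) \<longlongrightarrow> 0) (at 0)"
   by (simp add: filterlim_split_at)
  then show ?thesis using 3 by (simp add: DERIV_def flat_def)
 qed
qed

lemma Ck_on_flat_inner:
 "Ck_on k UNIV (%x::'a::euclidean_space. flat P (c * (x \<bullet> i) + d))"
proof (induction k arbitrary: P)
 case 0
 have "continuous_on UNIV (flat P)"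
  using DERIV_flat DERIV_continuous_on by (metis DERIV_subset subset_UNIV)
 then have "continuous_on UNIV (%x::'a. flat P (c * (x \<bullet> i) + d))"
  by (rule continuous_on_compose2) (auto intro!: continuous_intros)
 then show ?case by simp
next
 case (Suc k)
 let ?P = "monom 1 2 * (P - pderiv P)"
 have D: "((%x::'a. flat P (c * (x \<bullet> i) + d)) has_derivative
    (%h. flat ?P (c * (x \<bullet> i) + d) * (c * (h \<bullet> i)))) (at x)" for x
  by (rule has_derivative_compose[OF _ DERIV_flat[unfolded has_field_derivative_def], simplified])
   (auto intro!: derivative_eq_intros)
 have "partial e (%x::'a. flat P (c * (x \<bullet> i) + d)) = (%x. flat ?P (c * (x \<bullet> i) + d) * (c * (e \<bullet> i)))" for e
  using frechet_derivative_at[OF D] by (auto simp: fun_eq_iff)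
 with Suc D show ?case
  by (auto simp: differentiable_def intro!: Ck_on_mult Ck_on_const)
qed

text \<open>For positive \<open>s\<close> the value exp(-1 / ((n + 1) s)) tends to 1, so scaling by
  \<open>Suc n\<close> makes the bumps converge to the indicator of the open box without moving
  their support. The arguments are spelled out in the form \<open>c * (x \<bullet> i) + d\<close> to
  match \<open>Ck_on_flat_inner\<close>.\<close>

definition box_bump :: "'a::euclidean_space => 'a => nat => 'a => real" where
 "box_bump a b n x = (\<Prod>i\<in>Basis. flat 1 (real (Suc n) * (x \<bullet> i) + (- (real (Suc n) * (a \<bullet> i))))
    * flat 1 ((- real (Suc n)) * (x \<bullet> i) + real (Suc n) * (b \<bullet> i)))"

lemma flat_1_bounds: "0 <= flat 1 t" "flat 1 t <= 1" "flat 1 t = 0 \<longleftrightarrow> t <= 0"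
 by (auto simp: flat_def)

lemma box_bump_eq_0: "box_bump a b n x = 0 \<longleftrightarrow> x \<notin> box a b"
proof -
 have *: "r * y + - (r * z) <= 0 \<longleftrightarrow> y <= z" "(- r) * y + r * z <= 0 \<longleftrightarrow> z <= y" if "r > 0" for r y z :: real
  using that by (auto simp: field_simps)
 show ?thesis unfolding box_bump_def mem_box
  by (subst prod_zero_iff) (auto simp only: finite_Basis mult_eq_0_iff flat_1_bounds * of_nat_0_less_iff zero_less_Suc not_less)
qed

lemma box_bump_bounds: "0 <= box_bump a b n x" "box_bump a b n x <= 1"
proof -
 have "0 <= flat 1 s * flat 1 t \<and> flat 1 s * flat 1 t <= 1" for s t
  using flat_1_bounds(1,2)[of s] flat_1_bounds(1,2)[of t] mult_le_one by auto
 then show "0 <= box_bump a b n x" "box_bump a b n x <= 1"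
  unfolding box_bump_def by (auto intro!: prod_nonneg prod_le_1)
qed

lemma test_fun_box_bump:
 assumes "cbox a b \<subseteq> U" shows "test_fun U (box_bump a b n)"
proof -
 have "Ck_on k UNIV (box_bump a b n)" for k
  unfolding box_bump_def[abs_def] by (intro Ck_on_prod Ck_on_mult Ck_on_flat_inner) auto
 moreover have "{x. box_bump a b n x ~= 0} \<subseteq> cbox a b"
  using box_subset_cbox by (auto simp: box_bump_eq_0)
 then have "closure {x. box_bump a b n x ~= 0} \<subseteq> cbox a b"
  by (intro closure_minimal closed_cbox)
 ultimately show ?thesis using assms unfolding test_fun_def
  by (meson bounded_cbox bounded_subset closed_closure compact_eq_bounded_closed dual_order.trans)
qed

lemma flat_1_tendsto: "(%n. flat 1 (real (Suc n) * t)) \<longlonglongrightarrow> (if t > 0 then 1 else 0)"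
proof (cases "t > 0")
 case True
 have "(%n. (1 / t) * inverse (real (Suc n))) \<longlonglongrightarrow> (1 / t) * 0"
  by (intro tendsto_mult tendsto_const LIMSEQ_inverse_real_of_nat)
 then have "(%n. exp (- ((1 / t) * inverse (real (Suc n))))) \<longlonglongrightarrow> exp (- ((1/t) * 0))"
  by (intro tendsto_exp tendsto_minus)
 then show ?thesis using True by (simp add: flat_def field_simps del: of_nat_Suc)
next
 case False
 then have "flat 1 (real (Suc n) * t) = 0" for n
  by (auto simp: flat_1_bounds mult_nonneg_nonpos simp del: of_nat_Suc)
 then show ?thesis using False by simp
qed

lemma box_bump_tendsto: "(%n. box_bump a b n x) \<longlonglongrightarrow> indicator (box a b) x"
proof -
 have "(%n. \<Prod>i\<in>Basis. flat 1 (real (Suc n) * (x \<bullet> i - a \<bullet> i)) * flat 1 (real (Suc n) * (b \<bullet> i - x \<bullet> i)))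
   \<longlonglongrightarrow> (\<Prod>i\<in>Basis. (if x \<bullet> i - a \<bullet> i > 0 then 1 else 0) * (if b \<bullet> i - x \<bullet> i > 0 then 1 else 0))"
  by (intro tendsto_prod tendsto_mult flat_1_tendsto)
 moreover have "(\<Prod>i\<in>Basis. (if x \<bullet> i - a \<bullet> i > 0 then 1 else 0) * (if b \<bullet> i - x \<bullet> i > 0 then 1 else 0))
   = (indicator (box a b) x :: real)"
 proof (cases "x \<in> box a b")
  case True
  then show ?thesis by (auto simp: mem_box intro!: prod.neutral)
 next
  case False
  then obtain i where "i \<in> Basis" "x \<bullet> i <= a \<bullet> i \<or> b \<bullet> i <= x \<bullet> i" by (auto simp: mem_box not_less)
  then show ?thesis using False by (auto intro!: prod_zero bexI[of _ i])
 qed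
 ultimately show ?thesis
  by (simp add: box_bump_def algebra_simps del: of_nat_Suc)
qed

lemma continuous_imp_measurable_lebesgue:
 fixes f :: "'a::euclidean_space => 'b::topological_space"
 shows "continuous_on UNIV f ==> f \<in> borel_measurable lebesgue"
 by (intro measurable_completion) (simp add: borel_measurable_continuous_onI)

lemma continuous_test_fun: "test_fun U f ==> continuous_on UNIV f"
 unfolding test_fun_def using Ck_on_continuous by blast

lemma test_fun_0: "test_fun U (%x. 0)"
 by (auto simp: test_fun_def Ck_on_const)

section \<open>Rational boxes and functions with vanishing box integrals\<close>

definition rat_box :: "'a::euclidean_space set => bool" where
 "rat_box B \<longleftrightarrow> (\<exists>a b. B = box a b \<and> (\<forall>i\<in>Basis. a \<bullet> i \<in> \<rat> \<and> b \<bullet> i \<in> \<rat>))"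

lemma countable_rat_box: "countable {B. rat_box (B :: 'a::euclidean_space set)}"
proof -
 have "{B. rat_box B} \<subseteq> (%f. box (\<Sum>i\<in>Basis. fst (f i) *\<^sub>R i) (\<Sum>i\<in>Basis. snd (f i) *\<^sub>R i) :: 'a set) `
   (Basis \<rightarrow>\<^sub>E \<rat> \<times> \<rat>)"
 proof
  fix B :: "'a set" assume "B \<in> {B. rat_box B}"
  then obtain a b where B: "B = box a b" "\<forall>i\<in>Basis. a \<bullet> i \<in> \<rat> \<and> b \<bullet> i \<in> \<rat>" by (auto simp: rat_box_def)
  have "B = box (\<Sum>i\<in>Basis. fst (restrict (%i. (a \<bullet> i, b \<bullet> i)) Basis i) *\<^sub>R i)
    (\<Sum>i\<in>Basis. snd (restrict (%i. (a \<bullet> i, b \<bullet> i)) Basis i) *\<^sub>R i)"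
   by (simp add: B euclidean_representation)
  moreover have "restrict (%i. (a \<bullet> i, b \<bullet> i)) Basis \<in> Basis \<rightarrow>\<^sub>E \<rat> \<times> \<rat>" using B by auto
  ultimately show "B \<in> (%f. box (\<Sum>i\<in>Basis. fst (f i) *\<^sub>R i) (\<Sum>i\<in>Basis. snd (f i) *\<^sub>R i) :: 'a set) `
   (Basis \<rightarrow>\<^sub>E \<rat> \<times> \<rat>)" by (rule image_eqI)
 qed
 then show ?thesis
  by (rule countable_subset) (intro countable_image countable_PiE countable_SIGMA countable_rat, auto intro: countable_rat)
qed

lemma sets_borel_rat_box: "sets borel = sigma_sets UNIV {B. rat_box (B :: 'a::euclidean_space set)}"
proof -
 have "sigma_sets UNIV {S. open S} = sigma_sets UNIV {B. rat_box (B :: 'a set)}"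
 proof (rule sigma_sets_eqI)
  fix M :: "'a set" assume "M \<in> {S. open S}"
  then have "open M" by simp
  have c: "countable {f \<in> Basis \<rightarrow>\<^sub>E \<rat> \<times> \<rat>. P f}" for P :: "('a => real \<times> real) => bool"
   by (intro countable_Collect countable_PiE countable_SIGMA countable_rat finite_Basis)
  show "M \<in> sigma_sets UNIV {B. rat_box B}"
   apply (subst open_UNION_box[OF \<open>open M\<close>])
   apply (rule sigma_sets_UNION)
    apply (intro countable_image c)
   apply (auto simp: rat_box_def PiE_iff mem_Times_iff intro!: sigma_sets.Basic exI)
   done
 qed (auto simp: rat_box_def)
 then show ?thesis by (simp add: borel_def)
qed

lemma rat_box_Int: "rat_box A ==> rat_box B ==> rat_box (A \<inter> B)"
proof -
 assume "rat_box A" "rat_box B"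
 then obtain a b c d where *: "A = box a b" "B = box c d"
   "\<forall>i\<in>Basis. a \<bullet> i \<in> \<rat> \<and> b \<bullet> i \<in> \<rat>" "\<forall>i\<in>Basis. c \<bullet> i \<in> \<rat> \<and> d \<bullet> i \<in> \<rat>"
  by (auto simp: rat_box_def)
 show ?thesis unfolding rat_box_def
  by (rule exI[of _ "\<Sum>i\<in>Basis. max (a \<bullet> i) (c \<bullet> i) *\<^sub>R i"], rule exI[of _ "\<Sum>i\<in>Basis. min (b \<bullet> i) (d \<bullet> i) *\<^sub>R i"])
    (use * in \<open>auto simp: mem_box max_def min_def split: if_splits; fastforce\<close>)
qed

text \<open>The sets over which \<open>w\<close> integrates to 0 form a Dynkin system. It contains
  the rational boxes, which are closed under intersection and generate the Borel sets, and it
  contains the whole space as a limit of growing boxes. The argument runs for a Borel representative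
  \<open>w'\<close>, since \<open>w\<close> is only Lebesgue measurable. Countability of the boxes
  matters later, when they furnish a countable separating family of functionals on
  \<open>Lq\<close>.\<close>

lemma AE_0_of_rat_box_integrals:
 fixes w :: "'a::euclidean_space => real"
 assumes w: "integrable lebesgue w"
  and box: "!!B. rat_box B ==> (LINT x|lebesgue. indicator B x * w x) = 0"
 shows "AE x in lebesgue. w x = 0"
proof -
 obtain w' where w'[measurable]: "w' \<in> borel_measurable lborel" and ae: "AE x in lborel. w x = w' x"
  using completion_ex_borel_measurable_real[of w lborel] w by auto
 have [measurable]: "w \<in> borel_measurable lebesgue" using w by auto
 have ae': "AE x in lebesgue. w x = w' x" using ae by (rule AE_completion)
 have iw': "integrable lebesgue w'"
  by (rule bochner_cong_AE[OF w])
   (use ae' in \<open>auto intro: measurable_completion elim: eventually_mono\<close>)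
 then have iw: "integrable lborel w'" by (simp add: integrable_completion)
 have eq: "(LINT x:B|lborel. w' x) = 0" if "rat_box B" for B
 proof -
  have [measurable]: "B \<in> sets borel" using that by (auto simp: rat_box_def)
  have "(LINT x:B|lborel. w' x) = (LINT x|lebesgue. indicator B x * w' x)"
   unfolding set_lebesgue_integral_def by (subst integral_completion) auto
  also have "... = (LINT x|lebesgue. indicator B x * w x)"
   by (rule integral_cong_AE)
    (use ae' in \<open>auto intro!: borel_measurable_times borel_measurable_integrable[OF w] borel_measurable_integrable[OF iw'] borel_measurable_indicator sets_completionI_sets\<close>)
  finally show ?thesis using box[OF that] by simp
 qed
 have univ: "(LINT x:UNIV|lborel. w' x) = 0"
 proof -
  define B where "B n = box (- real n *\<^sub>R One) (real n *\<^sub>R One :: 'a)" for n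
  have "(%n. (LINT x|lborel. indicator (B n) x *\<^sub>R w' x)) \<longlonglongrightarrow> (LINT x|lborel. w' x)"
  proof (rule integral_dominated_convergence[where w="%x. norm (w' x)"])
   show "AE x in lborel. (%n. indicator (B n) x *\<^sub>R w' x) \<longlonglongrightarrow> w' x"
   proof (rule AE_I2)
    fix x :: 'a
    obtain N where N: "norm x < real N" using reals_Archimedean2 by blast
    have "x \<in> B n" if "n >= N" for n
    proof -
     have "\<bar>x \<bullet> i\<bar> < real n" if "i \<in> Basis" for i
      using Basis_le_norm[OF that, of x] N \<open>n >= N\<close> by linarith
     then show ?thesis by (auto simp: B_def mem_box abs_less_iff minus_less_iff)
    qed
    then have "eventually (%n. indicator (B n) x *\<^sub>R w' x = w' x) sequentially"
     unfolding eventually_sequentially by (intro exI[of _ N]) auto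
    then show "(%n. indicator (B n) x *\<^sub>R w' x) \<longlonglongrightarrow> w' x"
     by (simp add: tendsto_eventually)
   qed
  qed (use iw in \<open>auto simp: B_def split: split_indicator\<close>)
  moreover have "(LINT x|lborel. indicator (B n) x *\<^sub>R w' x) = 0" for n
  proof -
   have "rat_box (B n)" unfolding B_def rat_box_def by (intro exI conjI refl) auto
   from eq[OF this] show ?thesis by (simp add: set_lebesgue_integral_def)
  qed
  ultimately have "(LINT x|lborel. w' x) = 0" by (simp add: LIMSEQ_const_iff)
  then show ?thesis by (simp add: set_lebesgue_integral_def)
 qed
 have "(LINT x:A|lborel. w' x) = 0" if "A \<in> sigma_sets UNIV {B. rat_box B}" for A
 proof -
  have "Int_stable {B. rat_box (B :: 'a set)}" "{B. rat_box (B :: 'a set)} \<subseteq> Pow UNIV"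
   by (auto simp: Int_stable_def rat_box_Int)
  then show ?thesis using that
 proof (induction rule: sigma_sets_induct_disjoint)
  case (compl A)
  then have [measurable]: "A \<in> sets borel" by (simp add: sets_borel_rat_box)
  have "(LINT x:UNIV - A|lborel. w' x) = (LINT x:UNIV|lborel. w' x) - (LINT x:A|lborel. w' x)"
   unfolding set_lebesgue_integral_def
   by (subst Bochner_Integration.integral_diff[symmetric])
    (auto intro!: bochner_cong iw integrable_real_mult_indicator split: split_indicator simp: mult.commute[of "indicator _ _"])
  then show ?case using compl univ by simp
 next
  case (union A)
  then have *: "A i \<in> sets lborel" for i by (auto simp: sets_borel_rat_box)
  then have [measurable]: "(\<Union>i. A i) \<in> sets borel" by auto
  have "set_integrable lborel (\<Union>i. A i) w'"
   unfolding set_integrable_def by (intro integrable_mult_indicator iw) auto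
  from lebesgue_integral_countable_add[OF *  _ this] union show ?case
   by (auto simp: disjoint_family_on_def)
 qed (auto intro: eq simp: set_lebesgue_integral_def[of _ "{}"])
 qed
 then have "AE x in lborel. w' x = 0"
  by (intro sigma_finite_measure.density_zero[OF sigma_finite_lborel] iw) (auto simp: sets_borel_rat_box)
 then have "AE x in lebesgue. w' x = 0" by (rule AE_completion)
 with ae' show ?thesis by eventually_elim auto
qed

text \<open>Box bumps are test functions and converge boundedly to the indicator of the box, so
  \<open>v\<close> integrates to 0 over every box whose closure lies in \<open>U\<close>. The same
  holds for all smaller boxes, so \<open>v\<close> vanishes almost everywhere on each such box, and
  countably many rational ones cover \<open>U\<close>.\<close>

lemma du_Bois_Reymond:
 fixes v :: "'a::euclidean_space => real"
 assumes U: "open U"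
  and int: "!!K. compact K ==> K \<subseteq> U ==> integrable lebesgue (%x. indicator K x * v x)"
  and test: "!!\<phi>. test_fun U \<phi> ==> (LINT x|lebesgue. v x * \<phi> x) = 0"
 shows "AE x in lebesgue. x \<in> U --> v x = 0"
proof -
 have box: "(LINT x|lebesgue. indicator (box a b) x * v x) = 0" if "cbox a b \<subseteq> U" for a b
 proof -
  have i: "integrable lebesgue (%x. indicator (cbox a b) x * v x)" using int that by auto
  have "(%n. LINT x|lebesgue. (indicator (cbox a b) x * v x) * box_bump a b n x)
    \<longlonglongrightarrow> (LINT x|lebesgue. (indicator (cbox a b) x * v x) * indicator (box a b) x)"
  proof (rule integral_dominated_convergence[where w="%x. norm (indicator (cbox a b) x * v x)"])
   show "(%x. (indicator (cbox a b) x * v x) * box_bump a b n x) \<in> borel_measurable lebesgue" for n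
    by (intro borel_measurable_times borel_measurable_integrable[OF i] continuous_imp_measurable_lebesgue)
     (simp_all add: continuous_test_fun[OF test_fun_box_bump[OF subset_UNIV]])
   show "AE x in lebesgue. (%n. (indicator (cbox a b) x * v x) * box_bump a b n x)
     \<longlonglongrightarrow> (indicator (cbox a b) x * v x) * indicator (box a b) x"
    by (intro AE_I2 tendsto_mult tendsto_const box_bump_tendsto)
   show "AE x in lebesgue. norm (indicator (cbox a b) x * v x * box_bump a b n x) <= norm (indicator (cbox a b) x * v x)" for n
    using box_bump_bounds[of a b n] by (auto simp: abs_mult mult_left_le intro!: AE_I2)
  qed (use i in \<open>auto intro!: borel_measurable_times borel_measurable_integrable[OF i] borel_measurable_indicator sets_completionI_sets\<close>)
  moreover have "(%x. (indicator (cbox a b) x * v x) * box_bump a b n x) = (%x. v x * box_bump a b n x)" for n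
   using box_subset_cbox[of a b] by (auto simp: fun_eq_iff box_bump_eq_0 split: split_indicator)
  moreover have "(%x. (indicator (cbox a b) x * v x) * indicator (box a b) x) = (%x. indicator (box a b) x * v x)"
   using box_subset_cbox[of a b] by (auto simp: fun_eq_iff split: split_indicator)
  ultimately show ?thesis using test[OF test_fun_box_bump[OF that]] by (simp add: LIMSEQ_const_iff)
 qed
 have cb: "AE x in lebesgue. x \<in> box a b --> v x = 0" if "cbox a b \<subseteq> U" for a b
 proof -
  have i: "integrable lebesgue (%x. indicator (cbox a b) x * v x)" using int that by auto
  have "integrable lebesgue (%x. indicator (box a b) x *\<^sub>R (indicator (cbox a b) x * v x))"
   by (rule integrable_mult_indicator[OF _ i]) auto
  also have "(%x. indicator (box a b) x *\<^sub>R (indicator (cbox a b) x * v x)) = (%x. indicator (box a b) x * v x)"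
   using box_subset_cbox[of a b] by (auto simp: fun_eq_iff split: split_indicator)
  finally have "AE x in lebesgue. indicator (box a b) x * v x = 0"
  proof (rule AE_0_of_rat_box_integrals)
   fix B :: "'a set" assume "rat_box B"
   then obtain c d where B: "B = box c d" by (auto simp: rat_box_def)
   obtain e f where ef: "box c d \<inter> box a b = box e f" by (meson box_Int_box)
   \<comment> \<open>\<open>cbox e f\<close> is the closure of \<open>box e f\<close> only if the
     latter is nonempty; over an empty intersection the integral is 0 anyway.\<close>
   have "cbox e f \<subseteq> U" if ne: "box e f ~= {}"
   proof -
    have "cbox e f = closure (box e f)" using ne by (simp add: closure_box)
    also have "... \<subseteq> closure (box a b)" using ef by (metis closure_mono inf_le2)
    also have "... \<subseteq> cbox a b" by (intro closure_minimal box_subset_cbox closed_cbox)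
    finally show ?thesis using \<open>cbox a b \<subseteq> U\<close> by blast
   qed
   then have "(LINT x|lebesgue. indicator (box e f) x * v x) = 0"
    by (cases "box e f = {}") (auto intro: box)
   moreover have "indicator B x * (indicator (box a b) x * v x) = indicator (box e f) x * v x" for x
    by (simp add: B ef[symmetric] indicator_inter_arith)
   ultimately show "(LINT x|lebesgue. indicator B x * (indicator (box a b) x * v x)) = 0" by (simp only:)
  qed
  then show ?thesis by (auto split: split_indicator)
 qed
 obtain \<D> where \<D>: "countable \<D>" "!!X. X \<in> \<D> ==> \<exists>a b. X = box a b \<and> cbox a b \<subseteq> U" "U = \<Union>\<D>"
 proof -
  have cov: "\<exists>\<F>. countable \<F> \<and> (\<forall>X\<in>\<F>. \<exists>a b. X = box a b \<and> cbox a b \<subseteq> U) \<and> \<Union>\<F> = U"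
  proof -
   define \<F> where "\<F> = {X. \<exists>a b. X = box a b \<and> cbox a b \<subseteq> U \<and> (\<forall>i\<in>Basis. a \<bullet> i \<in> \<rat> \<and> b \<bullet> i \<in> \<rat>)}"
   have "\<F> \<subseteq> {B. rat_box B}" by (auto simp: \<F>_def rat_box_def)
   then have "countable \<F>" using countable_rat_box countable_subset by blast
   moreover have "\<Union>\<F> = U"
   proof
    show "\<Union>\<F> \<subseteq> U" using box_subset_cbox by (fastforce simp: \<F>_def)
    show "U \<subseteq> \<Union>\<F>"
    proof
     fix x assume "x \<in> U"
     then obtain e where e: "e > 0" "cball x e \<subseteq> U" using U open_contains_cball by blast
     obtain a b where ab: "\<forall>i\<in>Basis. a \<bullet> i \<in> \<rat> \<and> b \<bullet> i \<in> \<rat>" "x \<in> box a b" "box a b \<subseteq> ball x e"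
      using rational_boxes[OF e(1)] by metis
     have "cbox a b = closure (box a b)" using ab by (metis closure_box empty_iff)
     also have "... \<subseteq> cball x e" using ab by (meson ball_subset_cball closed_cball closure_minimal subset_trans)
     finally have "cbox a b \<subseteq> U" using e by blast
     then have "box a b \<in> \<F>" using ab(1) unfolding \<F>_def by blast
     then show "x \<in> \<Union>\<F>" using ab(2) by blast
    qed
   qed
   ultimately show ?thesis by (intro exI[of _ \<F>]) (auto simp: \<F>_def)
  qed
  then show ?thesis using that by metis
 qed
 have "AE x in lebesgue. \<forall>X\<in>\<D>. x \<in> X --> v x = 0"
 proof (subst AE_ball_countable)
  show "\<forall>X\<in>\<D>. AE x in lebesgue. x \<in> X --> v x = 0" using \<D>(2) cb by metis
 qed (rule \<D>(1))
 then show ?thesis by eventually_elim (use \<D>(3) in auto)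
qed

text \<open>Translation invariance of the integral, applied to difference quotients.\<close>

lemma integral_partial_eq_0:
 fixes F :: "'a::euclidean_space => 'b::euclidean_space"
 assumes F: "!!x. F differentiable (at x)" and cont: "continuous_on UNIV (partial e F)"
  and K: "compact K" "!!x. x \<notin> K ==> F x = 0"
 shows "(LINT x|lebesgue. partial e F x) = 0" "integrable lebesgue (partial e F)"
proof -
 have Fc: "continuous_on UNIV F"
  using F by (simp add: continuous_on_eq_continuous_at differentiable_imp_continuous_within)
 have F'0: "partial e F x = 0" if "x \<notin> K" for x
 proof -
  have op: "open (- K)" using K(1) by (simp add: compact_imp_closed open_Compl)
  have "(F has_derivative (%_. 0)) (at x)"
   by (rule has_derivative_transform_within_open[OF _ op, of "%_. 0"]) (use that K(2) in auto)
  from fun_cong[OF frechet_derivative_at[OF this], of e] show ?thesis by simp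
 qed
 \<comment> \<open>\<open>K'\<close> contains every point from which a move by \<open>t\<close>
   times \<open>e\<close>, with \<open>t\<close> between 0 and 1, leads into \<open>K\<close>. All
   difference quotients \<open>q n\<close> vanish outside it, which gives them one integrable
   majorant.\<close>
 define K' where "K' = (%(x, t). x + t *\<^sub>R (- e)) ` (K \<times> {0..1::real})"
 have K'c: "compact K'"
  unfolding K'_def
  by (intro compact_continuous_image compact_Times K) (auto intro!: continuous_intros simp: case_prod_beta)
 have KK': "K \<subseteq> K'" unfolding K'_def by (force intro!: image_eqI[of _ _ "(_, 0)"])
 have "compact (partial e F ` K)" by (intro compact_continuous_image K continuous_on_subset[OF cont]) auto
 then obtain B0 where B0: "!!x. x \<in> K ==> norm (partial e F x) <= B0" by (metis (no_types, lifting) bounded_iff compact_imp_bounded imageI)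
 define B where "B = max B0 0"
 have B: "norm (partial e F x) <= B" for x
  using B0[of x] F'0[of x] by (cases "x \<in> K") (auto simp: B_def)
 have iK': "integrable lebesgue (%x. indicator K' x * B)"
  using lmeasurable_compact[OF K'c] by (simp add: lmeasurable_iff_integrable)
 have line: "norm (F (x + h *\<^sub>R e) - F x) <= \<bar>h\<bar> * B" for x h
 proof -
  have D: "((%t. F (x + t *\<^sub>R e)) has_derivative (%s. s *\<^sub>R partial e F (x + t *\<^sub>R e))) (at t)" for t
  proof -
   have "(F has_derivative frechet_derivative F (at (x + t *\<^sub>R e))) (at (x + t *\<^sub>R e))"
    using F frechet_derivative_works by blast
   moreover have "((%t. x + t *\<^sub>R e) has_derivative (%s. s *\<^sub>R e)) (at t)" by (auto intro!: derivative_eq_intros)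
   ultimately have "((%t. F (x + t *\<^sub>R e)) has_derivative (%s. frechet_derivative F (at (x + t *\<^sub>R e)) (s *\<^sub>R e))) (at t)"
    using has_derivative_compose by blast
   then show ?thesis using linear_cmul[OF linear_frechet_derivative[OF F]] by simp
  qed
  have "norm (F (x + h *\<^sub>R e) - F (x + 0 *\<^sub>R e)) <= B * norm (h - 0)"
  proof (rule differentiable_bound[OF convex_UNIV])
   show "((%t. F (x + t *\<^sub>R e)) has_derivative (%s. s *\<^sub>R partial e F (x + t *\<^sub>R e))) (at t within UNIV)" for t using D by simp
   show "onorm (%s. s *\<^sub>R partial e F (x + t *\<^sub>R e)) <= B" for t
    by (rule onorm_le) (simp add: mult.commute[of B] mult_left_mono B)
  qed auto
  then show ?thesis by (simp add: mult.commute)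
 qed
 define q where "q n x = real (Suc n) *\<^sub>R (F (x + (1 / real (Suc n)) *\<^sub>R e) - F x)" for n x
 have Fi: "integrable lebesgue F"
 proof -
  have "integrable lebesgue (%x. indicator K x *\<^sub>R F x)"
  proof -
   have "integrable lborel (%x. indicator K x *\<^sub>R F x)"
    by (rule borel_integrable_compact[OF K(1) continuous_on_subset[OF Fc subset_UNIV]])
   then show ?thesis by (subst integrable_completion) (auto dest: borel_measurable_integrable)
  qed
  moreover have "(%x. indicator K x *\<^sub>R F x) = F" using K(2) by (auto simp: fun_eq_iff split: split_indicator)
  ultimately show ?thesis by simp
 qed
 have qi: "(LINT x|lebesgue. q n x) = 0" for n
 proof -
  have Fb: "F \<in> borel_measurable borel" using Fc by (rule borel_measurable_continuous_onI)
  have Fil: "integrable lborel F" using Fi Fb by (simp add: integrable_completion)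
  have tr: "integrable lborel (%x. F (a + x)) \<and> (LINT x|lborel. F (a + x)) = (LINT x|lborel. F x)" for a
  proof -
   have "integrable (distr lborel borel ((+) a)) F" using Fil by (simp add: lborel_distr_plus)
   then have "integrable lborel (%x. F (a + x))" by (rule integrable_distr[rotated]) simp
   moreover have "(\<integral>x. F x \<partial>distr lborel borel ((+) a)) = (LINT x|lborel. F (a + x))" by (rule integral_distr) (use Fb in auto)
   ultimately show ?thesis by (simp add: lborel_distr_plus)
  qed
  have "(LINT x|lborel. q n x) = 0"
   unfolding q_def using tr[of "(1 / real (Suc n)) *\<^sub>R e"] Fil by (simp add: add.commute)
  moreover have "q n \<in> borel_measurable borel" unfolding q_def
   by (intro borel_measurable_continuous_onI continuous_intros continuous_on_compose2[OF Fc]) auto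
  ultimately show ?thesis by (simp add: integral_completion)
 qed
 have "(%n. LINT x|lebesgue. q n x) \<longlonglongrightarrow> (LINT x|lebesgue. partial e F x)" and int: "integrable lebesgue (partial e F)"
 proof -
  have m1: "partial e F \<in> borel_measurable lebesgue" by (rule continuous_imp_measurable_lebesgue[OF cont])
  have m2: "q n \<in> borel_measurable lebesgue" for n
   unfolding q_def by (intro continuous_imp_measurable_lebesgue continuous_intros continuous_on_compose2[OF Fc]) auto
  have lim: "AE x in lebesgue. (%n. q n x) \<longlonglongrightarrow> partial e F x"
  proof (rule AE_I2)
   fix x
   have "(F has_derivative frechet_derivative F (at x)) (at x)" using F frechet_derivative_works by blast
   moreover have "((%t. x + t *\<^sub>R e) has_derivative (%s. s *\<^sub>R e)) (at (0::real))" by (auto intro!: derivative_eq_intros)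
   ultimately have "((%t. F (x + t *\<^sub>R e)) has_derivative (%s. frechet_derivative F (at x) (s *\<^sub>R e))) (at 0)"
    using has_derivative_compose[of "%t. x + t *\<^sub>R e" "%s. s *\<^sub>R e" 0 UNIV F] by simp
   then have "((%h. norm (F (x + h *\<^sub>R e) - F x - h *\<^sub>R partial e F x) / norm h) \<longlongrightarrow> 0) (at 0)"
    using linear_cmul[OF linear_frechet_derivative[OF F]] by (simp add: has_derivative_at)
   then have "(%n. norm (F (x + (1 / real (Suc n)) *\<^sub>R e) - F x - (1 / real (Suc n)) *\<^sub>R partial e F x) / norm (1 / real (Suc n))) \<longlonglongrightarrow> 0"
    by (rule filterlim_compose)
     (use LIMSEQ_inverse_real_of_nat in \<open>auto simp: filterlim_at inverse_eq_divide simp del: of_nat_Suc\<close>)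
   moreover have "norm (F (x + (1 / real (Suc n)) *\<^sub>R e) - F x - (1 / real (Suc n)) *\<^sub>R partial e F x) / norm (1 / real (Suc n))
     = norm (q n x - partial e F x)" for n
   proof -
    have "q n x - partial e F x = real (Suc n) *\<^sub>R (F (x + (1 / real (Suc n)) *\<^sub>R e) - F x - (1 / real (Suc n)) *\<^sub>R partial e F x)"
     by (simp add: q_def algebra_simps del: of_nat_Suc)
    then show ?thesis by (simp del: of_nat_Suc)
   qed
   ultimately have "(%n. norm (q n x - partial e F x)) \<longlonglongrightarrow> 0" by simp
   then show "(%n. q n x) \<longlonglongrightarrow> partial e F x" by (simp add: tendsto_norm_zero_iff LIM_zero_iff)
  qed
  have dom: "AE x in lebesgue. norm (q n x) <= indicator K' x * B" for n
  proof (rule AE_I2)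
   fix x
   let ?h = "1 / real (Suc n)"
   have "norm (q n x) <= real (Suc n) * (\<bar>?h\<bar> * B)"
    unfolding q_def norm_scaleR using line[of x ?h] by (intro mult_mono) auto
   also have "... = B" by (simp del: of_nat_Suc)
   finally have le: "norm (q n x) <= B" .
   have "q n x = 0" if "x \<notin> K'"
   proof -
    have "x \<notin> K" using that KK' by auto
    moreover have "x + ?h *\<^sub>R e \<notin> K"
    proof
     assume *: "x + ?h *\<^sub>R e \<in> K"
     have "x \<in> K'" unfolding K'_def
      by (rule image_eqI[of _ _ "(x + ?h *\<^sub>R e, ?h)"]) (use * in auto)
     with that show False ..
    qed
    ultimately show ?thesis by (simp add: q_def K(2))
   qed
   with le show "norm (q n x) <= indicator K' x * B" by (auto split: split_indicator)
  qed
  show "integrable lebesgue (partial e F)"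
   by (rule integrable_dominated_convergence[OF m1 m2 iK' lim dom])
  show "(%n. LINT x|lebesgue. q n x) \<longlonglongrightarrow> (LINT x|lebesgue. partial e F x)"
   by (rule integral_dominated_convergence[OF m1 m2 iK' lim dom])
 qed
 then show "(LINT x|lebesgue. partial e F x) = 0" by (simp add: qi LIMSEQ_const_iff)
 show "integrable lebesgue (partial e F)" by (rule int)
qed

section \<open>The Bochner integral in spaces given by carriers\<close>

text \<open>\<open>nonneg\<close> is required of every vector, also off the carrier: the functions
  considered below lie in the carrier only almost everywhere, and integrals of their norms are
  compared without first discarding a null set.\<close>

locale nsp =
 fixes X :: "'v::real_vector nspace"
 assumes zero: "0 \<in> carr X"
  and add: "x \<in> carr X ==> y \<in> carr X ==> x + y \<in> carr X"
  and scale: "x \<in> carr X ==> r *\<^sub>R x \<in> carr X"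
  and nonneg: "nrm X x >= 0"
  and triangle: "x \<in> carr X ==> y \<in> carr X ==> nrm X (x + y) <= nrm X x + nrm X y"
  and nrm_scale: "x \<in> carr X ==> nrm X (r *\<^sub>R x) = \<bar>r\<bar> * nrm X x"
  and nrm_eq_0: "x \<in> carr X ==> nrm X x = 0 ==> x = 0"
begin

lemma uminus: "x \<in> carr X ==> - x \<in> carr X"
 using scale[of x "-1"] by simp

lemma diff: "x \<in> carr X ==> y \<in> carr X ==> x - y \<in> carr X"
 using add[of x "- y"] uminus by simp

lemma nrm_0: "nrm X 0 = 0"
 using nrm_scale[OF zero, of 0] by simp

lemma nrm_minus: "x \<in> carr X ==> nrm X (- x) = nrm X x"
 using nrm_scale[of x "-1"] by simp

lemma nrm_minus_commute: "x \<in> carr X ==> y \<in> carr X ==> nrm X (x - y) = nrm X (y - x)"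
 using nrm_minus[of "x - y"] diff by simp

lemma triangle_diff: "x \<in> carr X ==> y \<in> carr X ==> nrm X (x - y) <= nrm X x + nrm X y"
 using triangle[of x "- y"] uminus nrm_minus by simp

lemma triangle3: "x \<in> carr X ==> y \<in> carr X ==> z \<in> carr X ==> nrm X (x - z) <= nrm X (x - y) + nrm X (y - z)"
 using triangle[of "x - y" "y - z"] diff by simp

lemma reverse_triangle: "x \<in> carr X ==> y \<in> carr X ==> \<bar>nrm X x - nrm X y\<bar> <= nrm X (x - y)"
 using triangle[of "x - y" y] triangle[of "y - x" x] diff nrm_minus_commute[of x y] by (auto simp: abs_le_iff)

lemma sum_in: "finite I ==> (!!i. i \<in> I ==> f i \<in> carr X) ==> sum f I \<in> carr X"
 by (induction I rule: finite_induct) (auto intro: zero add)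

lemma nrm_sum: "finite I ==> (!!i. i \<in> I ==> f i \<in> carr X) ==> nrm X (sum f I) <= (\<Sum>i\<in>I. nrm X (f i))"
proof (induction I rule: finite_induct)
 case (insert i I)
 then have "nrm X (f i + sum f I) <= nrm X (f i) + nrm X (sum f I)"
  by (intro triangle sum_in) auto
 with insert show ?case by simp
qed (simp add: nrm_0)

end

text \<open>The functionals are real valued and real linear although the spaces are complex: their
  purpose is to turn identities between vectors into identities between real Lebesgue integrals.
  Values off the carrier are unconstrained.\<close>

definition dual :: "'v::real_vector nspace => ('v => real) set" where
 "dual X = {l. (\<forall>x\<in>carr X. \<forall>y\<in>carr X. l (x + y) = l x + l y)
   \<and> (\<forall>r. \<forall>x\<in>carr X. l (r *\<^sub>R x) = r * l x)
   \<and> (\<exists>B. \<forall>x\<in>carr X. \<bar>l x\<bar> <= B * nrm X x)}"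

context nsp begin

lemma dual_add: "l \<in> dual X ==> x \<in> carr X ==> y \<in> carr X ==> l (x + y) = l x + l y"
 by (auto simp: dual_def)

lemma dual_scale: "l \<in> dual X ==> x \<in> carr X ==> l (r *\<^sub>R x) = r * l x"
 by (auto simp: dual_def)

lemma dual_0: "l \<in> dual X ==> l 0 = 0"
 using dual_scale[OF _ zero, of l 0] by simp

lemma dual_minus: "l \<in> dual X ==> x \<in> carr X ==> l (- x) = - l x"
 using dual_scale[of l x "-1"] by simp

lemma dual_diff: "l \<in> dual X ==> x \<in> carr X ==> y \<in> carr X ==> l (x - y) = l x - l y"
 using dual_add[of l x "- y"] dual_minus[of l y] uminus by simp

lemma dual_bound:
 assumes "l \<in> dual X" obtains B where "B > 0" "!!x. x \<in> carr X ==> \<bar>l x\<bar> <= B * nrm X x"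
proof -
 obtain B where B: "!!x. x \<in> carr X ==> \<bar>l x\<bar> <= B * nrm X x" using assms unfolding dual_def by blast
 show ?thesis
 proof
  show "max B 1 > 0" by simp
  fix x assume "x \<in> carr X"
  from B[OF this] show "\<bar>l x\<bar> <= max B 1 * nrm X x"
   using nonneg[of x] by (meson max.cobounded1 mult_right_mono order_trans)
 qed
qed

lemma dual_sum: "finite I ==> l \<in> dual X ==> (!!i. i \<in> I ==> f i \<in> carr X) ==> l (sum f I) = (\<Sum>i\<in>I. l (f i))"
 by (induct rule: finite_induct) (auto simp: dual_0 dual_add sum_in)

lemma tends_in_dual:
 assumes l: "l \<in> dual X" and lim: "tends_in X f y F" and f: "\<forall>\<^sub>F i in F. f i \<in> carr X"
 shows "((%i. l (f i)) \<longlongrightarrow> l y) F"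
proof -
 obtain B where B: "B > 0" "!!x. x \<in> carr X ==> \<bar>l x\<bar> <= B * nrm X x" using dual_bound[OF l] by blast
 have y: "y \<in> carr X" and "((%i. nrm X (f i - y)) \<longlongrightarrow> 0) F" using lim by (auto simp: tends_in_def)
 from tendsto_mult[OF tendsto_const this(2), of B] have "((%i. B * nrm X (f i - y)) \<longlongrightarrow> 0) F" by simp
 then have "((%i. l (f i) - l y) \<longlongrightarrow> 0) F"
 proof (rule Lim_null_comparison[rotated])
  show "\<forall>\<^sub>F i in F. norm (l (f i) - l y) <= B * nrm X (f i - y)"
   using f by eventually_elim (use B y in \<open>auto simp: dual_diff[OF l, symmetric] diff\<close>)
 qed
 then show ?thesis by (simp add: LIM_zero_iff)
qed

end

text \<open>Strong measurability provides simple approximants that converge only almost everywhere;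
  completeness of the measure is what makes the limits measurable.\<close>

lemma complete_lebesgue_on:
 assumes "S \<in> sets lebesgue" shows "complete_measure (lebesgue_on S)"
proof
 fix A B assume "B \<subseteq> A" "A \<in> null_sets (lebesgue_on S)"
 then have "A \<subseteq> S" "A \<in> null_sets lebesgue" using null_sets_restrict_space[OF assms] by auto
 then have "B \<in> sets lebesgue" "B \<subseteq> S" using \<open>B \<subseteq> A\<close> completion.complete2 by blast+
 then show "B \<in> sets (lebesgue_on S)" using assms by (simp add: sets_restrict_space_iff)
qed

lemma (in complete_measure) borel_measurable_AE_cong:
 fixes f g :: "'a => 'b::topological_space"
 assumes f: "f \<in> borel_measurable M" and ae: "AE x in M. f x = g x"
 shows "g \<in> borel_measurable M"
proof (rule measurableI)
 fix A :: "'b set" assume A: "A \<in> sets borel"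
 show "g -` A \<inter> space M \<in> sets M"
 proof (rule in_sets_AE)
  show "AE x in M. x \<in> f -` A \<inter> space M \<longleftrightarrow> x \<in> g -` A \<inter> space M" using ae by eventually_elim auto
 qed (use f A in auto)
qed auto

lemma (in complete_measure) borel_measurable_AE_LIMSEQ:
 fixes f :: "'a => real"
 assumes s: "!!n. s n \<in> borel_measurable M" and lim: "AE x in M. (%n. s n x) \<longlonglongrightarrow> f x"
 shows "f \<in> borel_measurable M"
proof (rule borel_measurable_AE_cong)
 show "(%x. lim (%n. s n x)) \<in> borel_measurable M" using s by (rule borel_measurable_lim_metric)
 show "AE x in M. lim (%n. s n x) = f x" using lim by eventually_elim (simp add: limI)
qed

lemma strongly_measE:
 fixes X :: "'v::real_vector nspace"
 assumes "strongly_meas X S f"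
 obtains s :: "nat => real => 'v" where "!!n. simple_function (lebesgue_on S) (s n)" "!!n t. t \<in> S ==> s n t \<in> carr X"
  "AE t in lebesgue_on S. f t \<in> carr X \<and> (%n. nrm X (f t - s n t)) \<longlonglongrightarrow> 0"
 using assms by (auto simp: strongly_meas_def image_subset_iff)

context nsp begin

lemma strongly_meas_nrm:
 assumes S: "S \<in> sets lebesgue" and f: "strongly_meas X S f"
 shows "(%t. nrm X (f t)) \<in> borel_measurable (lebesgue_on S)"
proof -
 interpret complete_measure "lebesgue_on S" by (rule complete_lebesgue_on[OF S])
 obtain s where s: "!!n. simple_function (lebesgue_on S) (s n)" "!!n t. t \<in> S ==> s n t \<in> carr X"
  "AE t in lebesgue_on S. f t \<in> carr X \<and> (%n. nrm X (f t - s n t)) \<longlonglongrightarrow> 0"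
  by (rule strongly_measE[OF f]) blast
 show ?thesis
 proof (rule borel_measurable_AE_LIMSEQ)
  show "(%t. nrm X (s n t)) \<in> borel_measurable (lebesgue_on S)" for n
   by (intro borel_measurable_simple_function simple_function_compose1[OF s(1)])
  show "AE t in lebesgue_on S. (%n. nrm X (s n t)) \<longlonglongrightarrow> nrm X (f t)"
   using s(3) AE_space
  proof eventually_elim
   case (elim t)
   then have ft: "f t \<in> carr X" and st: "s n t \<in> carr X" for n using s(2) by auto
   have "norm (nrm X (s n t) - nrm X (f t)) <= nrm X (f t - s n t)" for n
    using reverse_triangle[OF ft st[of n]] by (simp add: abs_minus_commute)
   then have "(%n. nrm X (s n t) - nrm X (f t)) \<longlonglongrightarrow> 0"
    by (intro Lim_null_comparison[OF always_eventually[OF allI] elim(1)[THEN conjunct2]])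
   then show ?case by (simp add: LIM_zero_iff)
  qed
 qed
qed

lemma strongly_meas_dual:
 assumes S: "S \<in> sets lebesgue" and f: "strongly_meas X S f" and l: "l \<in> dual X"
 shows "(%t. l (f t)) \<in> borel_measurable (lebesgue_on S)"
proof -
 interpret complete_measure "lebesgue_on S" by (rule complete_lebesgue_on[OF S])
 obtain s where s: "!!n. simple_function (lebesgue_on S) (s n)" "!!n t. t \<in> S ==> s n t \<in> carr X"
  "AE t in lebesgue_on S. f t \<in> carr X \<and> (%n. nrm X (f t - s n t)) \<longlonglongrightarrow> 0"
  by (rule strongly_measE[OF f]) blast
 show ?thesis
 proof (rule borel_measurable_AE_LIMSEQ)
  show "(%t. l (s n t)) \<in> borel_measurable (lebesgue_on S)" for n
   by (intro borel_measurable_simple_function simple_function_compose1[OF s(1)])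
  show "AE t in lebesgue_on S. (%n. l (s n t)) \<longlonglongrightarrow> l (f t)"
   using s(3) AE_space
  proof eventually_elim
   case (elim t)
   then have ft: "f t \<in> carr X" and st: "s n t \<in> carr X" for n using s(2) by auto
   have "nrm X (f t - s n t) = nrm X (s n t - f t)" for n by (rule nrm_minus_commute[OF ft st])
   then show ?case
    using elim(1) by (intro tends_in_dual[OF l] always_eventually allI st) (simp add: tends_in_def)
  qed
 qed
qed

lemma strongly_meas_carr: "strongly_meas X S f ==> AE t in lebesgue_on S. f t \<in> carr X"
 by (auto simp: strongly_meas_def)

definition xint :: "real set => (real => 'v) => bool" where
 "xint S f \<longleftrightarrow> strongly_meas X S f \<and> integrable (lebesgue_on S) (%t. nrm X (f t))"

lemma xint_dual:
 assumes S: "S \<in> sets lebesgue" and f: "xint S f" and l: "l \<in> dual X"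
 shows "integrable (lebesgue_on S) (%t. l (f t))"
proof -
 obtain B where B: "B > 0" "!!x. x \<in> carr X ==> \<bar>l x\<bar> <= B * nrm X x" using dual_bound[OF l] by blast
 show ?thesis
 proof (rule bochner_bound)
  show "integrable (lebesgue_on S) (%t. B * nrm X (f t))" using f by (auto simp: xint_def)
  show "AE t in lebesgue_on S. norm (l (f t)) <= norm (B * nrm X (f t))"
   using strongly_meas_carr[OF f[unfolded xint_def, THEN conjunct1]]
   by (rule eventually_mono) (use B nonneg in \<open>auto simp: abs_mult\<close>)
 qed (use f strongly_meas_dual[OF S _ l] in \<open>auto simp: xint_def\<close>)
qed

text \<open>Both sides are finite sums over the level sets of \<open>s\<close>, so linearity of
  \<open>l\<close> and the triangle inequality can be applied term by term inside the
  carrier.\<close>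

lemma simple_bint:
 assumes s: "Bochner_Integration.simple_bochner_integrable M s" "!!t. t \<in> space M ==> s t \<in> carr X"
 shows "Bochner_Integration.simple_bochner_integral M s \<in> carr X"
  and "nrm X (Bochner_Integration.simple_bochner_integral M s) <= (LINT t|M. nrm X (s t))"
  and "l \<in> dual X ==> l (Bochner_Integration.simple_bochner_integral M s) = (LINT t|M. l (s t))"
  and "integrable M (%t. nrm X (s t))"
proof -
 have sf: "simple_function M s" and fin: "finite (s ` space M)"
  using s(1) by (auto simp: simple_bochner_integrable.simps simple_functionD)
 have in1: "measure M {x \<in> space M. s x = y} *\<^sub>R y \<in> carr X" if "y \<in> s ` space M" for y
  using that s(2) scale by auto
 show "Bochner_Integration.simple_bochner_integral M s \<in> carr X"
  unfolding simple_bochner_integral_def by (intro sum_in fin in1)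
 have comp: "Bochner_Integration.simple_bochner_integrable M (%t. h (s t))"
  if "h 0 = 0" for h :: "'v => real"
  using simple_bochner_integrable_compose2[where p="%x y. h x", OF _ s(1) s(1)] that by simp
 have part: "(LINT t|M. h (s t)) = (\<Sum>y\<in>s ` space M. measure M {x\<in>space M. s x = y} *\<^sub>R h y)"
  if "h 0 = 0" for h :: "'v => real"
 proof -
  have "(LINT t|M. h (s t)) = Bochner_Integration.simple_bochner_integral M (%t. h (s t))"
   by (rule simple_bochner_integrable_eq_integral[symmetric]) (rule comp[where h=h, OF that])
  also have "... = (\<Sum>y\<in>s ` space M. measure M {x\<in>space M. s x = y} *\<^sub>R h y)"
   by (rule simple_bochner_integral_partition[OF _ sf]) (use comp[where h=h, OF that] in auto)
  finally show ?thesis .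
 qed
 have "nrm X (Bochner_Integration.simple_bochner_integral M s)
   <= (\<Sum>y\<in>s ` space M. nrm X (measure M {x \<in> space M. s x = y} *\<^sub>R y))"
  unfolding simple_bochner_integral_def by (intro nrm_sum fin in1)
 also have "... = (\<Sum>y\<in>s ` space M. measure M {x \<in> space M. s x = y} *\<^sub>R nrm X y)"
  by (intro sum.cong refl) (use s(2) in \<open>auto simp: nrm_scale\<close>)
 finally show "nrm X (Bochner_Integration.simple_bochner_integral M s) <= (LINT t|M. nrm X (s t))"
  by (simp add: part[where h="nrm X", OF nrm_0])
 show "integrable M (%t. nrm X (s t))"
  by (rule integrableI_simple_bochner_integrable[OF comp[where h="nrm X", OF nrm_0]])
 assume l: "l \<in> dual X"
 have "l (Bochner_Integration.simple_bochner_integral M s) = (\<Sum>y\<in>s ` space M. l (measure M {x \<in> space M. s x = y} *\<^sub>R y))"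
  unfolding simple_bochner_integral_def by (rule dual_sum[OF fin l in1])
 also have "... = (\<Sum>y\<in>s ` space M. measure M {x \<in> space M. s x = y} *\<^sub>R l y)"
  by (intro sum.cong refl) (use s(2) in \<open>auto simp: dual_scale[OF l]\<close>)
 finally show "l (Bochner_Integration.simple_bochner_integral M s) = (LINT t|M. l (s t))"
  by (simp add: part[where h=l, OF dual_0[OF l]])
qed

lemma strongly_meas_diff_simple:
 assumes f: "strongly_meas X S f" and s: "simple_function (lebesgue_on S) s" "!!t. t \<in> S ==> s t \<in> carr X"
 shows "strongly_meas X S (%t. f t - s t)"
proof -
 obtain r where r: "!!n. simple_function (lebesgue_on S) (r n)" "!!n t. t \<in> S ==> r n t \<in> carr X"
  "AE t in lebesgue_on S. f t \<in> carr X \<and> (%n. nrm X (f t - r n t)) \<longlonglongrightarrow> 0"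
  by (rule strongly_measE[OF f]) blast
 show ?thesis unfolding strongly_meas_def
 proof (intro exI[of _ "%n t. r n t - s t"] conjI allI)
  show "simple_function (lebesgue_on S) (%t. r n t - s t)" for n
   by (rule simple_function_compose2[OF r(1) s(1)])
  show "(%t. r n t - s t) ` S \<subseteq> carr X" for n using r s diff by auto
  show "AE t in lebesgue_on S. f t - s t \<in> carr X \<and> (%n. nrm X (f t - s t - (r n t - s t))) \<longlonglongrightarrow> 0"
   using r(3) AE_space by eventually_elim (use s diff in auto)
 qed
qed

text \<open>The approximating integrals converge to \<open>I\<close> in norm, hence under
  \<open>l\<close>; the approximating integrands converge in mean, hence the real integrals of their
  images under \<open>l\<close> converge as well. Comparing the two limits gives the scalar
  identity.\<close>

lemma has_bintD:
 assumes S: "S \<in> sets lebesgue" and hb: "has_bint X S f I"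
 shows "xint S f" "I \<in> carr X" "l \<in> dual X ==> (LINT t|lebesgue_on S. l (f t)) = l I"
proof -
 let ?M = "lebesgue_on S"
 have sm: "strongly_meas X S f" using hb by (auto simp: has_bint_def)
 obtain s where s: "!!n. Bochner_Integration.simple_bochner_integrable ?M (s n)" "!!n. s n ` S \<subseteq> carr X"
  "(%n. \<integral>\<^sup>+ t. ennreal (nrm X (f t - s n t)) \<partial>?M) \<longlonglongrightarrow> 0"
  "tends_in X (%n. Bochner_Integration.simple_bochner_integral ?M (s n)) I sequentially"
  using hb by (auto simp: has_bint_def)
 show I: "I \<in> carr X" using s(4) by (auto simp: tends_in_def)
 have sc: "t \<in> S ==> s n t \<in> carr X" for n t using s(2) by auto
 have sf: "simple_function ?M (s n)" for n using s(1)[of n] by (auto simp: simple_bochner_integrable.simps)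
 have sd: "strongly_meas X S (%t. f t - s n t)" for n using strongly_meas_diff_simple[OF sm sf sc] .
 have ms: "(%t. nrm X (f t - s n t)) \<in> borel_measurable ?M" for n
  by (rule strongly_meas_nrm[OF S sd])
 \<comment> \<open>Convergence of these integrals to 0 makes them finite from some index on; a
   single such index already bounds the norm of \<open>f\<close> by a sum of two integrable
   functions.\<close>
 have ev: "eventually (%n. (\<integral>\<^sup>+ t. ennreal (nrm X (f t - s n t)) \<partial>?M) < 1) sequentially"
  using s(3) by (rule order_tendstoD) auto
 have intd: "integrable ?M (%t. nrm X (f t - s n t))"
  if "(\<integral>\<^sup>+ t. ennreal (nrm X (f t - s n t)) \<partial>?M) < 1" for n
 proof (rule integrableI_bounded[OF ms])
  show "(\<integral>\<^sup>+ t. ennreal (norm (nrm X (f t - s n t))) \<partial>?M) < \<infinity>"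
   using that nonneg less_trans[OF that, of \<infinity>] by auto
 qed
 have ints: "integrable ?M (%t. nrm X (s n t))" for n
  by (rule simple_bint(4)[OF s(1)]) (use sc in auto)
 obtain N where N: "(\<integral>\<^sup>+ t. ennreal (nrm X (f t - s N t)) \<partial>?M) < 1" using ev by (auto simp: eventually_sequentially)
 show xf: "xint S f" unfolding xint_def
 proof (intro conjI sm)
  show "integrable ?M (%t. nrm X (f t))"
  proof (rule bochner_bound)
   show "integrable ?M (%t. nrm X (f t - s N t) + nrm X (s N t))" using intd[OF N] ints by auto
   show "AE t in ?M. norm (nrm X (f t)) <= norm (nrm X (f t - s N t) + nrm X (s N t))"
    using strongly_meas_carr[OF sm] AE_space
   proof eventually_elim
    case (elim t)
    then show ?case using triangle[of "f t - s N t" "s N t"] sc[of t N] diff[of "f t" "s N t"] nonneg by (auto simp: abs_of_nonneg)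
   qed
  qed (rule strongly_meas_nrm[OF S sm])
 qed
 assume l: "l \<in> dual X"
 obtain B where B: "B > 0" "!!x. x \<in> carr X ==> \<bar>l x\<bar> <= B * nrm X x" using dual_bound[OF l] by blast
 have "(%n. LINT t|?M. l (s n t)) \<longlonglongrightarrow> l I"
  using tends_in_dual[OF l s(4)] simple_bint(1,3)[OF s(1), OF _ ] sc l by (simp add: simple_bint(1,3)[OF s(1)])
 moreover have "(%n. LINT t|?M. l (s n t)) \<longlonglongrightarrow> (LINT t|?M. l (f t))"
 proof -
  have 0: "(%n. B * (enn2real (\<integral>\<^sup>+ t. ennreal (nrm X (f t - s n t)) \<partial>?M))) \<longlonglongrightarrow> B * 0"
   by (intro tendsto_mult tendsto_const tendsto_enn2real) (use s(3) in auto)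
  have "(%n. (LINT t|?M. l (s n t)) - (LINT t|?M. l (f t))) \<longlonglongrightarrow> 0"
  proof (rule Lim_null_comparison[OF _ 0[simplified]])
   show "eventually (%n. norm ((LINT t|?M. l (s n t)) - (LINT t|?M. l (f t)))
    <= B * (enn2real (\<integral>\<^sup>+ t. ennreal (nrm X (f t - s n t)) \<partial>?M))) sequentially"
    using ev
   proof eventually_elim
    case (elim n)
    have il: "integrable ?M (%t. l (s n t))"
     by (rule xint_dual[OF S _ l, unfolded xint_def]) 
      (use ints sf sc in \<open>auto simp: strongly_meas_def nrm_0 intro!: exI[of _ "%_. s n"]\<close>)
    have "norm ((LINT t|?M. l (s n t)) - (LINT t|?M. l (f t))) = norm (LINT t|?M. l (s n t) - l (f t))"
     by (simp add: il xint_dual[OF S xf l])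
    also have "... <= (LINT t|?M. norm (l (s n t) - l (f t)))" by (rule integral_norm_bound)
    also have "... <= (LINT t|?M. B * nrm X (f t - s n t))"
    proof (rule integral_mono_AE)
     show "AE t in ?M. norm (l (s n t) - l (f t)) <= B * nrm X (f t - s n t)"
      using strongly_meas_carr[OF sm] AE_space
     proof eventually_elim
      case (elim t)
      then show ?case using B(2)[of "f t - s n t"] sc[of t n] diff by (auto simp: dual_diff[OF l])
     qed
    qed (use intd[OF elim] il xint_dual[OF S xf l] in auto)
    also have "... = B * enn2real (\<integral>\<^sup>+ t. ennreal (nrm X (f t - s n t)) \<partial>?M)"
     using nonneg ms by (subst Bochner_Integration.integral_mult_right_zero, subst integral_eq_nn_integral) auto
    finally show ?case .
   qed
  qed
  then show ?thesis by (simp add: LIM_zero_iff)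
 qed
 ultimately show "(LINT t|?M. l (f t)) = l I" by (metis LIMSEQ_unique)
qed

end

text \<open>A countable separating subset of the dual stands in for the Hahn-Banach theorem.
  Countability is what allows the exceptional null sets of the individual functionals to be
  united.\<close>

locale bsp = nsp +
 assumes complete: "(!!n::nat. s n \<in> carr X) ==> (!!e. e > 0 ==> \<exists>N. \<forall>m\<ge>N. \<forall>n\<ge>N. nrm X (s m - s n) < e)
   ==> \<exists>l. tends_in X s l sequentially"
  and separating: "\<exists>L. countable L \<and> L \<subseteq> dual X \<and> (\<forall>x\<in>carr X. (\<forall>l\<in>L. l x = 0) --> x = 0)"
begin

lemma dual_eqI: "x \<in> carr X ==> y \<in> carr X ==> (!!l. l \<in> dual X ==> l x = l y) ==> x = y"
proof -
 assume xy: "x \<in> carr X" "y \<in> carr X" and eq: "!!l. l \<in> dual X ==> l x = l y"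
 then have "l (x - y) = 0" if "l \<in> dual X" for l using that by (simp add: dual_diff)
 then show "x = y" using separating diff[OF xy] by (metis eq_iff_diff_eq_0 subsetD)
qed

lemma has_bint_ex:
 assumes S: "S \<in> sets lebesgue" and f: "xint S f"
 shows "\<exists>I. has_bint X S f I \<and> nrm X I <= (LINT t|lebesgue_on S. nrm X (f t))"
proof -
 let ?M = "lebesgue_on S"
 have sm: "strongly_meas X S f" and intf: "integrable ?M (%t. nrm X (f t))" using f by (auto simp: xint_def)
 obtain s where s: "!!n. simple_function ?M (s n)" "!!n t. t \<in> S ==> s n t \<in> carr X"
  "AE t in ?M. f t \<in> carr X \<and> (%n. nrm X (f t - s n t)) \<longlonglongrightarrow> 0"
  by (rule strongly_measE[OF sm]) blast
 \<comment> \<open>Truncation: replacing \<open>s n\<close> by 0 wherever its norm exceeds twice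
   that of \<open>f\<close> yields the majorant \<open>3 * nrm X (f t)\<close>. Pointwise
   convergence survives, because \<open>s n t\<close> eventually satisfies the bound wherever
   \<open>f t\<close> is nonzero, and where \<open>f t = 0\<close> the truncated value has norm
   0.\<close>
 define r where "r n t = (if nrm X (s n t) <= 2 * nrm X (f t) then s n t else 0)" for n t
 have rsf: "simple_function ?M (r n)" for n
  unfolding r_def[abs_def]
 proof (rule simple_function_If)
  show "{x \<in> space ?M. nrm X (s n x) <= 2 * nrm X (f x)} \<in> sets ?M"
   using strongly_meas_nrm[OF S sm] borel_measurable_simple_function[OF simple_function_compose1[OF s(1)], of "nrm X" n]
   by (intro borel_measurable_le) auto
 qed (use s in auto)
 have rc: "t \<in> S ==> r n t \<in> carr X" for n t using s(2) zero by (auto simp: r_def)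
 have rle: "nrm X (r n t) <= 2 * nrm X (f t)" for n t using nonneg[of "f t"] by (auto simp: r_def nrm_0)
 have nr: "(%t. nrm X (r n t)) \<in> borel_measurable ?M" for n
  by (intro borel_measurable_simple_function simple_function_compose1[OF rsf])
 have rint: "integrable ?M (%t. nrm X (r n t))" for n
  by (rule bochner_bound[of _ "%t. 2 * nrm X (f t)"])
   (use intf nr rle nonneg in \<open>auto simp: abs_of_nonneg\<close>)
 have rs: "Bochner_Integration.simple_bochner_integrable ?M (r n)" for n
 proof -
  have "Bochner_Integration.simple_bochner_integrable ?M (%t. nrm X (r n t))"
   by (rule simple_bochner_integrableI_bounded[OF simple_function_compose1[OF rsf]])
    (use integrableD(2)[OF rint[of n]] nonneg in \<open>simp add: less_top abs_of_nonneg\<close>)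
  then have "emeasure ?M {y \<in> space ?M. nrm X (r n y) ~= 0} ~= \<infinity>" by (simp add: simple_bochner_integrable.simps)
  moreover have "{y \<in> space ?M. nrm X (r n y) ~= 0} = {y \<in> space ?M. r n y ~= 0}"
   using rc nrm_eq_0 nrm_0 by fastforce
  ultimately show ?thesis using rsf by (simp add: simple_bochner_integrable.simps)
 qed
 have ms: "(%t. nrm X (f t - r n t)) \<in> borel_measurable ?M" for n
  by (rule strongly_meas_nrm[OF S strongly_meas_diff_simple[OF sm rsf rc]])
 have bound: "AE t in ?M. nrm X (f t - r n t) <= 3 * nrm X (f t)" for n
  using s(3) AE_space
 proof eventually_elim
  case (elim t)
  then show ?case using triangle_diff[of "f t" "r n t"] rle[of n t] rc[of t n] by auto
 qed
 have dint: "integrable ?M (%t. nrm X (f t - r n t))" for n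
  by (rule bochner_bound[of _ "%t. 3 * nrm X (f t)"])
   (use intf ms bound[of n] nonneg in \<open>auto simp: abs_of_nonneg\<close>)
 have lim0: "(%n. LINT t|?M. nrm X (f t - r n t)) \<longlonglongrightarrow> (LINT t|?M. 0)"
 proof (rule integral_dominated_convergence[where w="%t. 3 * nrm X (f t)"])
  show "AE t in ?M. (%n. nrm X (f t - r n t)) \<longlonglongrightarrow> 0"
   using s(3) AE_space
  proof eventually_elim
   case (elim t)
   then have ft: "f t \<in> carr X" and t: "t \<in> S" and l: "(%n. nrm X (f t - s n t)) \<longlonglongrightarrow> 0" by auto
   show ?case
   proof (cases "nrm X (f t) = 0")
    case True
    then have "f t = 0" using ft nrm_eq_0 by blast
    moreover have "nrm X (- r n t) = 0" for n
     using rle[of n t] True nonneg[of "r n t"] nrm_minus[OF rc[OF t, of n]] by simp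
    ultimately show ?thesis by simp
   next
    case False
    then have "nrm X (f t) > 0" using nonneg[of "f t"] by linarith
    then have "eventually (%n. nrm X (f t - s n t) < nrm X (f t)) sequentially"
     by (rule order_tendstoD(2)[OF l])
    then have "eventually (%n. nrm X (f t - s n t) = nrm X (f t - r n t)) sequentially"
    proof eventually_elim
     case (elim n)
     then show ?case using reverse_triangle[OF ft s(2)[OF t, of n]] by (auto simp: r_def)
    qed
    then show ?thesis using l by (rule Lim_transform_eventually[rotated])
   qed
  qed
 qed (use intf ms bound nonneg in \<open>auto simp: abs_of_nonneg\<close>)
 then have lim: "(%n. LINT t|?M. nrm X (f t - r n t)) \<longlonglongrightarrow> 0" by simp
 let ?I = "%n. Bochner_Integration.simple_bochner_integral ?M (r n)"
 have Ic: "?I n \<in> carr X" for n by (rule simple_bint(1)[OF rs]) (use rc in auto)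
 have "\<exists>l. tends_in X ?I l sequentially"
 proof (rule complete)
  fix e :: real assume "e > 0"
  then have "eventually (%n. (LINT t|?M. nrm X (f t - r n t)) < e / 2) sequentially"
   by (intro order_tendstoD(2)[OF lim]) auto
  then obtain N where N: "!!n. n >= N ==> (LINT t|?M. nrm X (f t - r n t)) < e / 2"
   by (auto simp: eventually_sequentially)
  have "nrm X (?I m - ?I n) < e" if "m >= N" "n >= N" for m n
  proof -
   have "?I m - ?I n = Bochner_Integration.simple_bochner_integral ?M (%t. r m t - r n t)"
    by (rule simple_bochner_integral_diff[OF rs rs, symmetric])
   also have "nrm X ... <= (LINT t|?M. nrm X (r m t - r n t))"
    by (rule simple_bint(2)) (use rc diff simple_bochner_integrable_compose2[OF _ rs rs, of "(-)"] in auto)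
   also have "... <= (LINT t|?M. nrm X (f t - r m t) + nrm X (f t - r n t))"
   proof (rule integral_mono_AE)
    show "integrable ?M (%t. nrm X (r m t - r n t))"
     by (rule simple_bint(4)) (use rc diff simple_bochner_integrable_compose2[OF _ rs rs, of "(-)"] in auto)
    show "AE t in ?M. nrm X (r m t - r n t) <= nrm X (f t - r m t) + nrm X (f t - r n t)"
     using s(3) AE_space
    proof eventually_elim
     case (elim t)
     then show ?case using triangle3[of "r m t" "f t" "r n t"] rc[of t] nrm_minus_commute[of "r m t" "f t"] by simp
    qed
   qed (use dint in auto)
   also have "... < e" using N[OF that(1)] N[OF that(2)] dint by simp
   finally show ?thesis .
  qed
  then show "\<exists>N. \<forall>m\<ge>N. \<forall>n\<ge>N. nrm X (?I m - ?I n) < e" by blast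
 qed (rule Ic)
 then obtain I where I: "tends_in X ?I I sequentially" by blast
 then have Icr: "I \<in> carr X" and Il: "(%n. nrm X (?I n - I)) \<longlonglongrightarrow> 0" by (auto simp: tends_in_def)
 have "has_bint X S f I" unfolding has_bint_def
 proof (intro conjI sm exI[of _ r] allI I)
  show "(%n. \<integral>\<^sup>+ t. ennreal (nrm X (f t - r n t)) \<partial>?M) \<longlonglongrightarrow> 0"
   using lim nonneg dint by (subst nn_integral_eq_integral) (auto simp: ennreal_0[symmetric] simp del: ennreal_0)
 qed (use rs rc in auto)
 moreover have "nrm X I <= (LINT t|?M. nrm X (f t))"
 proof (rule LIMSEQ_le_const)
  show "(%n. nrm X (?I n - I) + ((LINT t|?M. nrm X (f t)) + (LINT t|?M. nrm X (f t - r n t)))) \<longlonglongrightarrow> (LINT t|?M. nrm X (f t))"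
   using tendsto_add[OF Il tendsto_add[OF tendsto_const lim]] by simp
  have "nrm X I <= nrm X (?I n - I) + ((LINT t|?M. nrm X (f t)) + (LINT t|?M. nrm X (f t - r n t)))" for n
  proof -
   have "nrm X I <= nrm X (?I n - I) + nrm X (?I n)"
    using triangle_diff[of "?I n" "?I n - I"] Ic diff Icr by simp
   also have "nrm X (?I n) <= (LINT t|?M. nrm X (r n t))" by (rule simple_bint(2)[OF rs]) (use rc in auto)
   also have "... <= (LINT t|?M. nrm X (f t) + nrm X (f t - r n t))"
   proof (rule integral_mono_AE)
    show "AE t in ?M. nrm X (r n t) <= nrm X (f t) + nrm X (f t - r n t)"
     using s(3) AE_space
    proof eventually_elim
     case (elim t)
     then show ?case using triangle_diff[of "f t" "f t - r n t"] rc diff by auto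
    qed
   qed (use dint rint intf in auto)
   finally show ?thesis using dint intf by simp
  qed
  then show "\<exists>N. \<forall>n\<ge>N. nrm X I <= nrm X (?I n - I) + ((LINT t|?M. nrm X (f t)) + (LINT t|?M. nrm X (f t - r n t)))" by blast
 qed
 ultimately show ?thesis by blast
qed

text \<open>From here on Bochner integrals are handled weakly: substitution, splitting of the domain
  and changes on null sets are carried out for the real functions \<open>l (f t)\<close> and
  transferred back by this equivalence.\<close>

lemma has_bint_iff:
 assumes S: "S \<in> sets lebesgue"
 shows "has_bint X S f I \<longleftrightarrow> xint S f \<and> I \<in> carr X \<and> (\<forall>l\<in>dual X. (LINT t|lebesgue_on S. l (f t)) = l I)"
proof
 assume "has_bint X S f I" then show "xint S f \<and> I \<in> carr X \<and> (\<forall>l\<in>dual X. (LINT t|lebesgue_on S. l (f t)) = l I)"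
  using has_bintD[OF S] by blast
next
 assume *: "xint S f \<and> I \<in> carr X \<and> (\<forall>l\<in>dual X. (LINT t|lebesgue_on S. l (f t)) = l I)"
 then obtain J where J: "has_bint X S f J" using has_bint_ex[OF S] by blast
 have "I = J" by (rule dual_eqI) (use * has_bintD[OF S J] in auto)
 with J show "has_bint X S f I" by simp
qed

lemma has_bint_unique:
 "S \<in> sets lebesgue ==> has_bint X S f I ==> has_bint X S f J ==> I = J"
 by (rule dual_eqI) (auto simp: has_bint_iff)

lemma has_bint_nrm_le:
 "S \<in> sets lebesgue ==> has_bint X S f I ==> nrm X I <= (LINT t|lebesgue_on S. nrm X (f t))"
 using has_bint_ex has_bint_unique has_bintD(1) by metis

end

text \<open>Extension by zero moves every integral to the full line, where affine substitutions are
  available; integrals over different subsets then differ only in the integrand.\<close>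

definition zext :: "real set => (real => 'v::zero) => real => 'v" where
 "zext S f t = (if t \<in> S then f t else 0)"

lemma integrable_zext:
 assumes "S \<in> sets lebesgue" and "h 0 = (0::real)"
 shows "integrable (lebesgue_on S) (%t. h (f t)) \<longleftrightarrow> integrable lebesgue (%t. h (zext S f t))"
  and "(LINT t|lebesgue_on S. h (f t)) = (LINT t|lebesgue. h (zext S f t))"
proof -
 have "indicator S t *\<^sub>R h (f t) = h (zext S f t)" for t using assms by (auto simp: zext_def)
 then show "integrable (lebesgue_on S) (%t. h (f t)) \<longleftrightarrow> integrable lebesgue (%t. h (zext S f t))"
  "(LINT t|lebesgue_on S. h (f t)) = (LINT t|lebesgue. h (zext S f t))"
  using assms by (simp_all add: integrable_restrict_space integral_restrict_space)
qed

lemma simple_function_finite_measurable: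
 "simple_function M f \<longleftrightarrow> finite (f ` space M) \<and> f \<in> M \<rightarrow>\<^sub>M count_space UNIV"
 by (auto simp: simple_functionD measurable_simple_function) (auto simp: simple_function_def)

lemma AE_lebesgue_affine:
 fixes c :: real
 assumes ae: "AE x in lebesgue. P x" and c: "c ~= 0" shows "AE t in lebesgue. P (a + c * t)"
proof -
 have "AE x in density (distr lebesgue lebesgue (%x. a + c * x)) (%_. ennreal \<bar>c\<bar>). P x"
  using ae by (subst lebesgue_real_affine[OF c, of a, symmetric])
 then have "AE x in distr lebesgue lebesgue (%x. a + c * x). P x"
  using c by (subst (asm) AE_density) auto
 then show ?thesis
  by (rule AE_distrD[rotated]) (use lebesgue_affine_measurable[of "%_::real. c" a] c in \<open>simp add: mult.commute\<close>)
qed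

lemma affine_measurable_lebesgue: "(%t::real. a + c * t) \<in> lebesgue \<rightarrow>\<^sub>M lebesgue" if "c ~= 0"
 using lebesgue_affine_measurable[of "%_::real. c" a] that by (simp add: mult.commute)

text \<open>Made for the spaces of higher regularity such as \<open>W20_sp\<close>: they enter
  through measurability and through integrals of their norm, and for this the three properties
  suffice.\<close>

locale zsp =
 fixes X :: "'v::real_vector nspace"
 assumes zero: "0 \<in> carr X" and nonneg: "nrm X x >= 0" and nrm_0: "nrm X 0 = 0"

sublocale nsp \<subseteq> zsp
 by unfold_locales (rule zero nonneg nrm_0)+

context zsp begin

lemma strongly_meas_zext:
 assumes S: "S \<in> sets lebesgue"
 shows "strongly_meas X S f \<longleftrightarrow> strongly_meas X UNIV (zext S f)"
proof
 assume "strongly_meas X S f"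
 then obtain s where s: "!!n. simple_function (lebesgue_on S) (s n)" "!!n t. t \<in> S ==> s n t \<in> carr X"
  "AE t in lebesgue_on S. f t \<in> carr X \<and> (%n. nrm X (f t - s n t)) \<longlonglongrightarrow> 0"
  by (rule strongly_measE) blast
 have "simple_function lebesgue (zext S (s n))" for n
 proof -
  have "finite (zext S (s n) ` UNIV)"
  proof (rule finite_subset)
   show "zext S (s n) ` UNIV \<subseteq> insert 0 (s n ` S)" by (auto simp: zext_def)
   show "finite (insert 0 (s n ` S))" using s(1)[of n] by (auto simp: simple_function_finite_measurable)
  qed
  moreover have "(%t. if t \<in> S then s n t else 0) \<in> lebesgue \<rightarrow>\<^sub>M count_space UNIV"
   using s(1)[of n] S by (subst measurable_restrict_space_iff[symmetric]) (auto simp: simple_function_finite_measurable)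
  ultimately show ?thesis by (simp add: simple_function_finite_measurable zext_def[abs_def])
 qed
 moreover have "AE t in lebesgue. zext S f t \<in> carr X \<and> (%n. nrm X (zext S f t - zext S (s n) t)) \<longlonglongrightarrow> 0"
  using s(3) S by (subst (asm) AE_restrict_space_iff) (auto simp: zext_def nrm_0 zero elim!: eventually_mono)
 ultimately show "strongly_meas X UNIV (zext S f)"
  unfolding strongly_meas_def lebesgue_on_UNIV_eq
  by (intro exI[of _ "%n. zext S (s n)"]) (use s(2) zero in \<open>auto simp: zext_def\<close>)
next
 assume "strongly_meas X UNIV (zext S f)"
 then obtain s where s: "!!n. simple_function lebesgue (s n)" "!!n t. s n t \<in> carr X"
  "AE t in lebesgue. zext S f t \<in> carr X \<and> (%n. nrm X (zext S f t - s n t)) \<longlonglongrightarrow> 0"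
  by (rule strongly_measE[where S=UNIV, unfolded lebesgue_on_UNIV_eq]) auto
 show "strongly_meas X S f" unfolding strongly_meas_def
 proof (intro exI[of _ s] conjI allI)
  show "simple_function (lebesgue_on S) (s n)" for n
   using s(1)[of n] by (auto simp: simple_function_finite_measurable intro: finite_subset[OF image_mono] measurable_restrict_space1)
  show "AE t in lebesgue_on S. f t \<in> carr X \<and> (%n. nrm X (f t - s n t)) \<longlonglongrightarrow> 0"
  proof (subst AE_restrict_space_iff)
   show "AE t in lebesgue. t \<in> S --> f t \<in> carr X \<and> (%n. nrm X (f t - s n t)) \<longlonglongrightarrow> 0"
    using s(3) by (rule eventually_mono) (auto simp: zext_def)
  qed (use S in auto)
 qed (use s in auto)
qed

lemma strongly_meas_AE_cong:
 assumes "strongly_meas X S f" "AE t in lebesgue_on S. f t = g t" shows "strongly_meas X S g"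
proof -
 obtain s where s: "!!n. simple_function (lebesgue_on S) (s n)" "!!n t. t \<in> S ==> s n t \<in> carr X"
  "AE t in lebesgue_on S. f t \<in> carr X \<and> (%n. nrm X (f t - s n t)) \<longlonglongrightarrow> 0"
  by (rule strongly_measE[OF assms(1)]) blast
 have "AE t in lebesgue_on S. g t \<in> carr X \<and> (%n. nrm X (g t - s n t)) \<longlonglongrightarrow> 0"
  using s(3) assms(2) by eventually_elim auto
 then show ?thesis unfolding strongly_meas_def using s by (intro exI[of _ s]) auto
qed

lemma strongly_meas_If:
 assumes A: "A \<in> sets lebesgue" and f: "strongly_meas X UNIV f" and g: "strongly_meas X UNIV g"
 shows "strongly_meas X UNIV (%t. if t \<in> A then f t else g t)"
proof -
 obtain s where s: "!!n. simple_function lebesgue (s n)" "!!n t. s n t \<in> carr X"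
  "AE t in lebesgue. f t \<in> carr X \<and> (%n. nrm X (f t - s n t)) \<longlonglongrightarrow> 0"
  by (rule strongly_measE[OF f, unfolded lebesgue_on_UNIV_eq]) auto
 obtain r where r: "!!n. simple_function lebesgue (r n)" "!!n t. r n t \<in> carr X"
  "AE t in lebesgue. g t \<in> carr X \<and> (%n. nrm X (g t - r n t)) \<longlonglongrightarrow> 0"
  by (rule strongly_measE[OF g, unfolded lebesgue_on_UNIV_eq]) auto
 show ?thesis unfolding strongly_meas_def lebesgue_on_UNIV_eq
 proof (intro exI[of _ "%n t. if t \<in> A then s n t else r n t"] conjI allI)
  show "simple_function lebesgue (%t. if t \<in> A then s n t else r n t)" for n
   by (rule simple_function_If_set) (use A s r in auto)
  show "AE t in lebesgue. (if t \<in> A then f t else g t) \<in> carr X \<and>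
    (%n. nrm X ((if t \<in> A then f t else g t) - (if t \<in> A then s n t else r n t))) \<longlonglongrightarrow> 0"
   using s(3) r(3) by eventually_elim auto
 qed (use s r in auto)
qed

lemma strongly_meas_0: "strongly_meas X UNIV (%t. 0)"
 unfolding strongly_meas_def by (intro exI[of _ "%n t. 0"]) (auto simp: zero nrm_0)

lemma strongly_meas_affine:
 assumes f: "strongly_meas X UNIV f" and c: "c ~= 0"
 shows "strongly_meas X UNIV (%t. f (a + c * t))"
proof -
 obtain s where s: "!!n. simple_function lebesgue (s n)" "!!n t. s n t \<in> carr X"
  "AE t in lebesgue. f t \<in> carr X \<and> (%n. nrm X (f t - s n t)) \<longlonglongrightarrow> 0"
  by (rule strongly_measE[OF f, unfolded lebesgue_on_UNIV_eq]) auto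
 show ?thesis unfolding strongly_meas_def lebesgue_on_UNIV_eq
 proof (intro exI[of _ "%n t. s n (a + c * t)"] conjI allI)
  show "simple_function lebesgue (%t. s n (a + c * t))" for n
   using s(1)[of n] measurable_compose[OF affine_measurable_lebesgue[OF c], of "s n" "count_space UNIV" a]
   by (auto simp: simple_function_finite_measurable intro: finite_subset[of _ "range (s n)"])
  show "AE t in lebesgue. f (a + c * t) \<in> carr X \<and> (%n. nrm X (f (a + c * t) - s n (a + c * t))) \<longlonglongrightarrow> 0"
   using AE_lebesgue_affine[OF s(3) c] .
 qed (use s in auto)
qed

end

context nsp begin

lemma strongly_meas_scaleR:
 assumes f: "strongly_meas X S f" and \<phi>: "\<phi> \<in> borel_measurable (lebesgue_on S)"
 shows "strongly_meas X S (%t. \<phi> t *\<^sub>R f t)"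
proof -
 obtain s where s: "!!n. simple_function (lebesgue_on S) (s n)" "!!n t. t \<in> S ==> s n t \<in> carr X"
  "AE t in lebesgue_on S. f t \<in> carr X \<and> (%n. nrm X (f t - s n t)) \<longlonglongrightarrow> 0"
  by (rule strongly_measE[OF f]) blast
 obtain r where r: "!!n. simple_function (lebesgue_on S) (r n)" 
  "!!t. t \<in> S ==> (%n. r n t) \<longlonglongrightarrow> \<phi> t"
  using borel_measurable_implies_sequence_metric[OF \<phi>, of 0] by auto
 show ?thesis unfolding strongly_meas_def
 proof (intro exI[of _ "%n t. r n t *\<^sub>R s n t"] conjI allI)
  show "simple_function (lebesgue_on S) (%t. r n t *\<^sub>R s n t)" for n
   by (rule simple_function_compose2[OF r(1) s(1)])
  show "AE t in lebesgue_on S. \<phi> t *\<^sub>R f t \<in> carr X \<and> (%n. nrm X (\<phi> t *\<^sub>R f t - r n t *\<^sub>R s n t)) \<longlonglongrightarrow> 0"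
   using s(3) AE_space
  proof eventually_elim
   case (elim t)
   then have t: "t \<in> S" and ft: "f t \<in> carr X" and l: "(%n. nrm X (f t - s n t)) \<longlonglongrightarrow> 0" by auto
   have "(%n. \<bar>\<phi> t - r n t\<bar> * nrm X (f t) + \<bar>r n t\<bar> * nrm X (f t - s n t)) \<longlonglongrightarrow> \<bar>\<phi> t - \<phi> t\<bar> * nrm X (f t) + \<bar>\<phi> t\<bar> * 0"
    by (intro tendsto_intros r l t)
   then have lim: "(%n. \<bar>\<phi> t - r n t\<bar> * nrm X (f t) + \<bar>r n t\<bar> * nrm X (f t - s n t)) \<longlonglongrightarrow> 0" by simp
   have "norm (nrm X (\<phi> t *\<^sub>R f t - r n t *\<^sub>R s n t)) <= \<bar>\<phi> t - r n t\<bar> * nrm X (f t) + \<bar>r n t\<bar> * nrm X (f t - s n t)" for n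
   proof -
    have "\<phi> t *\<^sub>R f t - r n t *\<^sub>R s n t = (\<phi> t - r n t) *\<^sub>R f t + r n t *\<^sub>R (f t - s n t)" by (simp add: algebra_simps)
    then show ?thesis
     using triangle[of "(\<phi> t - r n t) *\<^sub>R f t" "r n t *\<^sub>R (f t - s n t)"] scale ft s(2)[OF t, of n] diff nonneg
     by (simp add: nrm_scale)
   qed
   from Lim_null_comparison[OF always_eventually[OF allI[OF this]] lim] show ?case using scale ft by simp
  qed
 qed (use s scale in auto)
qed

lemma xint_zext: "S \<in> sets lebesgue ==> xint S f \<longleftrightarrow> xint UNIV (zext S f)"
 unfolding xint_def lebesgue_on_UNIV_eq
 using strongly_meas_zext integrable_zext(1)[where h="nrm X", OF _ nrm_0] by blast

lemma xint_AE_cong: 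
 assumes S: "S \<in> sets lebesgue" and f: "xint S f" and ae: "AE t in lebesgue_on S. f t = g t" shows "xint S g"
proof -
 have sg: "strongly_meas X S g" using strongly_meas_AE_cong f ae by (auto simp: xint_def)
 have "integrable (lebesgue_on S) (%t. nrm X (f t))" using f by (simp add: xint_def)
 then have "integrable (lebesgue_on S) (%t. nrm X (g t))"
  by (rule bochner_cong_AE)
   (use strongly_meas_nrm[OF S sg] ae in \<open>auto elim: eventually_mono\<close>)
 with sg show ?thesis by (simp add: xint_def)
qed

lemma xint_subset:
 assumes S: "S \<in> sets lebesgue" and T: "T \<in> sets lebesgue" "T \<subseteq> S" and f: "xint S f" shows "xint T f"
proof -
 have f': "strongly_meas X UNIV (zext S f)" "integrable lebesgue (%t. nrm X (zext S f t))"
  using f unfolding xint_zext[OF S] unfolding xint_def lebesgue_on_UNIV_eq by auto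
 have eq: "zext T f = (%t. if t \<in> T then zext S f t else 0)" using T by (auto simp: zext_def fun_eq_iff)
 have "strongly_meas X UNIV (zext T f)" unfolding eq by (rule strongly_meas_If[OF T(1) f'(1) strongly_meas_0])
 moreover have "integrable lebesgue (%t. nrm X (zext T f t))"
 proof (rule bochner_bound[OF f'(2)])
  show "(%t. nrm X (zext T f t)) \<in> borel_measurable lebesgue"
   using strongly_meas_nrm[OF _ calculation] by (simp add: lebesgue_on_UNIV_eq)
 qed (use nonneg in \<open>auto simp: eq nrm_0\<close>)
 ultimately show ?thesis unfolding xint_zext[OF T(1)] unfolding xint_def lebesgue_on_UNIV_eq by auto
qed

lemma xint_affine:
 assumes "xint UNIV f" "c ~= 0" shows "xint UNIV (%t. f (a + c * t))"
 using assms lebesgue_integrable_real_affine[of "%t. nrm X (f t)" c a]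
 by (auto simp: xint_def lebesgue_on_UNIV_eq intro: strongly_meas_affine)

end

context bsp begin

lemma has_bint_zext: "S \<in> sets lebesgue ==> has_bint X S f I \<longleftrightarrow> has_bint X UNIV (zext S f) I"
proof -
 assume S: "S \<in> sets lebesgue"
 have "(LINT t|lebesgue_on S. l (f t)) = (LINT t|lebesgue_on UNIV. l (zext S f t))" if "l \<in> dual X" for l
  unfolding lebesgue_on_UNIV_eq by (rule integrable_zext(2)[where h=l, OF S dual_0[OF that]])
 moreover have "UNIV \<in> sets lebesgue" by simp
 ultimately show ?thesis unfolding has_bint_iff[OF S] has_bint_iff[OF \<open>UNIV \<in> sets lebesgue\<close>] xint_zext[OF S] by simp
qed

lemma has_bint_AE_cong:
 assumes S: "S \<in> sets lebesgue" and f: "has_bint X S f I" and ae: "AE t in lebesgue_on S. f t = g t"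
 shows "has_bint X S g I"
proof -
 have xf: "xint S f" using f has_bintD(1)[OF S] by blast
 have xg: "xint S g" by (rule xint_AE_cong[OF S xf ae])
 have "(LINT t|lebesgue_on S. l (g t)) = (LINT t|lebesgue_on S. l (f t))" if "l \<in> dual X" for l
  by (rule integral_cong_AE)
   (use xint_dual[OF S xf that] xint_dual[OF S xg that] ae in \<open>auto elim: eventually_mono\<close>)
 then show ?thesis using f xg by (simp add: has_bint_iff[OF S])
qed

lemma has_bint_0: "S \<in> null_sets lebesgue ==> has_bint X S f I ==> I = 0"
proof -
 assume S: "S \<in> null_sets lebesgue" and f: "has_bint X S f I"
 then have Sm: "S \<in> sets lebesgue" by auto
 have "nrm X I <= (LINT t|lebesgue_on S. nrm X (f t))" by (rule has_bint_nrm_le[OF Sm f])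
 also have "... = (LINT t|lebesgue. indicator S t *\<^sub>R nrm X (f t))" using Sm by (simp add: integral_restrict_space)
 also have "... = 0"
  by (rule integral_eq_zero_AE) (use AE_not_in[OF S] in \<open>auto elim: eventually_mono\<close>)
 finally show "I = 0" using nonneg[of I] nrm_eq_0 has_bintD(2)[OF Sm f] by simp
qed

end

section \<open>Lebesgue spaces\<close>

text \<open>Convexity of \<open>x powr q\<close> at the weights \<open>A / (A + B)\<close> and
  \<open>B / (A + B)\<close>. If \<open>A\<close> and \<open>B\<close> are the norms of the two
  functions, the integral of the right-hand side is exactly \<open>(A + B) powr q\<close>, which
  gives Minkowski's inequality.\<close>

lemma powr_sum_convex:
 fixes a b A B q :: real
 assumes q: "q >= 1" and ab: "a >= 0" "b >= 0" and AB: "A > 0" "B > 0"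
 shows "(a + b) powr q <= (A + B) powr q * (A / (A + B) * (a powr q / A powr q) + B / (A + B) * (b powr q / B powr q))"
proof -
 define u v where "u = A / (A + B)" and "v = B / (A + B)"
 have uv: "u > 0" "v > 0" "u + v = 1" using AB by (auto simp: u_def v_def add_divide_distrib[symmetric])
 have small: "(w * s) powr q <= w * s powr q" if "0 < w" "w <= 1" "s >= 0" for w s
 proof -
  have "(w * s) powr q = w powr q * s powr q" using that by (simp add: powr_mult)
  also have "w powr q <= w powr 1" using that q by (intro powr_mono') auto
  finally show ?thesis using that by (simp add: mult_right_mono)
 qed
 have conv: "(u * s + v * t) powr q <= u * s powr q + v * t powr q" if "s >= 0" "t >= 0" for s t
 proof (cases "s = 0 \<or> t = 0")
  case True
  then show ?thesis using small[of u s] small[of v t] uv that q by auto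
 next
  case False
  then show ?thesis using powr_convex[OF q] that uv unfolding convex_on_def by (auto simp: less_eq_real_def)
 qed
 have "(a + b) powr q = ((A + B) * (u * (a / A) + v * (b / B))) powr q"
 proof -
  have "(A + B) * (u * (a / A) + v * (b / B)) = a + b"
   using AB by (simp add: u_def v_def distrib_left)
  then show ?thesis by simp
 qed
 also have "... = (A + B) powr q * (u * (a / A) + v * (b / B)) powr q"
  by (simp add: powr_mult)
 also have "... <= (A + B) powr q * (u * (a / A) powr q + v * (b / B) powr q)"
  using conv[of "a / A" "b / B"] AB ab by (intro mult_left_mono) auto
 finally show ?thesis using AB ab by (simp add: u_def v_def powr_divide)
qed

lemma powr_sum_le: 
 fixes a b q :: real
 assumes "q >= 1" "a >= 0" "b >= 0" shows "(a + b) powr q <= 2 powr q * (a powr q + b powr q)"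
proof -
 have "(a + b) powr q <= 2 powr q * (1 / 2 * a powr q + 1 / 2 * b powr q)"
  using powr_sum_convex[OF assms, of 1 1] by simp
 also have "... <= 2 powr q * (a powr q + b powr q)"
 proof (rule mult_left_mono)
  show "1 / 2 * a powr q + 1 / 2 * b powr q <= a powr q + b powr q"
   using powr_ge_zero[of a q] powr_ge_zero[of b q] by linarith
 qed simp
 finally show ?thesis .
qed

lemma integrable_powr_add:
 fixes f g :: "'a => 'b::{real_normed_vector, second_countable_topology}"
 assumes q: "q >= 1" and f: "f \<in> borel_measurable M" and g: "g \<in> borel_measurable M"
  and fi: "integrable M (%x. norm (f x) powr q)" and gi: "integrable M (%x. norm (g x) powr q)"
 shows "integrable M (%x. norm (f x + g x) powr q)"
proof (rule bochner_bound)
 show "integrable M (%x. 2 powr q * (norm (f x) powr q + norm (g x) powr q))" using fi gi by auto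
 show "AE x in M. norm (norm (f x + g x) powr q) <= norm (2 powr q * (norm (f x) powr q + norm (g x) powr q))"
 proof (rule AE_I2)
  fix x
  have "norm (f x + g x) powr q <= (norm (f x) + norm (g x)) powr q"
   using q by (intro powr_mono2 norm_triangle_ineq) auto
  also have "... <= 2 powr q * (norm (f x) powr q + norm (g x) powr q)" using q by (intro powr_sum_le) auto
  finally show "norm (norm (f x + g x) powr q) <= norm (2 powr q * (norm (f x) powr q + norm (g x) powr q))" by simp
 qed
qed (use f g in measurable)

lemma integral_powr_eq_0:
 fixes f :: "'a => 'b::real_normed_vector"
 assumes "integrable M (%x. norm (f x) powr q)" "(LINT x|M. norm (f x) powr q) powr (1 / q) = 0"
 shows "AE x in M. f x = 0"
proof -
 have "(LINT x|M. norm (f x) powr q) = 0" using assms(2) by simp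
 then have "AE x in M. norm (f x) powr q = 0"
  using assms(1) by (subst (asm) integral_nonneg_eq_0_iff_AE) auto
 then show ?thesis by (rule eventually_mono) auto
qed

lemma Minkowski:
 fixes f g :: "'a => 'b::{real_normed_vector, second_countable_topology}"
 assumes q: "q >= 1" and f: "f \<in> borel_measurable M" and g: "g \<in> borel_measurable M"
  and fi: "integrable M (%x. norm (f x) powr q)" and gi: "integrable M (%x. norm (g x) powr q)"
 shows "(LINT x|M. norm (f x + g x) powr q) powr (1 / q)
  <= (LINT x|M. norm (f x) powr q) powr (1 / q) + (LINT x|M. norm (g x) powr q) powr (1 / q)"
proof -
 define A B where "A = (LINT x|M. norm (f x) powr q) powr (1 / q)" and "B = (LINT x|M. norm (g x) powr q) powr (1 / q)"
 have s: "integrable M (%x. norm (f x + g x) powr q)" by (rule integrable_powr_add[OF q f g fi gi])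
 have AB: "A >= 0" "B >= 0" by (auto simp: A_def B_def)
 have Aq: "A powr q = (LINT x|M. norm (f x) powr q)" "B powr q = (LINT x|M. norm (g x) powr q)"
  using q by (auto simp: A_def B_def powr_powr)
 consider "A = 0" | "B = 0" | "A > 0" "B > 0" using AB by linarith
 then show ?thesis
 proof cases
  case 1
  have "AE x in M. f x = 0" using integral_powr_eq_0[OF fi] 1 by (simp add: A_def)
  then have "(LINT x|M. norm (f x + g x) powr q) = (LINT x|M. norm (g x) powr q)"
   by (intro integral_cong_AE) (use s gi in \<open>auto elim: eventually_mono\<close>)
  then show ?thesis by simp
 next
  case 2
  have "AE x in M. g x = 0" using integral_powr_eq_0[OF gi] 2 by (simp add: B_def)
  then have "(LINT x|M. norm (f x + g x) powr q) = (LINT x|M. norm (f x) powr q)"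
   by (intro integral_cong_AE) (use s fi in \<open>auto elim: eventually_mono\<close>)
  then show ?thesis by simp
 next
  case 3
  have "(LINT x|M. norm (f x + g x) powr q) <= (LINT x|M. (A + B) powr q * (A / (A + B) * (norm (f x) powr q / A powr q) + B / (A + B) * (norm (g x) powr q / B powr q)))"
  proof (rule integral_mono[OF s])
   fix x
   have "norm (f x + g x) powr q <= (norm (f x) + norm (g x)) powr q"
    using q by (intro powr_mono2 norm_triangle_ineq) auto
   also have "... <= (A + B) powr q * (A / (A + B) * (norm (f x) powr q / A powr q) + B / (A + B) * (norm (g x) powr q / B powr q))"
    by (rule powr_sum_convex[OF q _ _ 3]) auto
   finally show "norm (f x + g x) powr q <= ..." .
  qed (use fi gi in auto)
  also have "... = (A + B) powr q * (A / (A + B) * (A powr q / A powr q) + B / (A + B) * (B powr q / B powr q))"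
   using fi gi by (simp add: Aq)
  also have "... = (A + B) powr q" using 3 by (simp add: add_divide_distrib[symmetric])
  finally have "(LINT x|M. norm (f x + g x) powr q) powr (1 / q) <= ((A + B) powr q) powr (1 / q)"
   using q by (intro powr_mono2) (auto intro!: integral_nonneg_AE)
  then show ?thesis using 3 q by (simp add: powr_powr A_def[symmetric] B_def[symmetric])
 qed
qed

text \<open>Young's inequality for the functions divided by their norms \<open>A\<close> and
  \<open>B\<close>; a vanishing norm makes the product zero almost everywhere and is treated
  apart.\<close>

lemma Hoelder:
 fixes f g :: "'a => 'b::{real_normed_field, second_countable_topology, banach}"
 assumes q: "q > 1" and r: "1 / q + 1 / r = 1" and f: "f \<in> borel_measurable M" and g: "g \<in> borel_measurable M"
  and fi: "integrable M (%x. norm (f x) powr q)" and gi: "integrable M (%x. norm (g x) powr r)"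
 shows "integrable M (%x. f x * g x)" (is ?I)
  and "(LINT x|M. norm (f x * g x)) <= (LINT x|M. norm (f x) powr q) powr (1 / q) * (LINT x|M. norm (g x) powr r) powr (1 / r)" (is ?B)
proof -
 have r1: "r > 1"
 proof -
  have "1 / q < 1" "1 / q > 0" using q by auto
  then have "1 / r > 0" "1 / r < 1" using r by linarith+
  moreover from this(1) have "r > 0" by (simp add: zero_less_divide_iff)
  ultimately show ?thesis by (simp add: field_simps)
 qed
 show I: ?I
 proof (rule bochner_bound)
  show "integrable M (%x. norm (f x) powr q / q + norm (g x) powr r / r)" using fi gi by auto
  show "AE x in M. norm (f x * g x) <= norm (norm (f x) powr q / q + norm (g x) powr r / r)"
  proof (rule AE_I2)
   fix x
   have "norm (f x) * norm (g x) <= norm (f x) powr q / q + norm (g x) powr r / r"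
    by (intro Youngs_inequality q r1 r) auto
   then show "norm (f x * g x) <= norm (norm (f x) powr q / q + norm (g x) powr r / r)"
    unfolding norm_mult real_norm_def by linarith
  qed
 qed (use f g in measurable)
 define A B where "A = (LINT x|M. norm (f x) powr q) powr (1 / q)" and "B = (LINT x|M. norm (g x) powr r) powr (1 / r)"
 have AB: "A >= 0" "B >= 0" by (auto simp: A_def B_def)
 have Aq: "A powr q = (LINT x|M. norm (f x) powr q)" "B powr r = (LINT x|M. norm (g x) powr r)"
  using q r1 by (auto simp: A_def B_def powr_powr)
 consider "A = 0" | "B = 0" | "A > 0" "B > 0" using AB by linarith
 then show ?B
 proof cases
  case 1
  have "AE x in M. f x = 0" using integral_powr_eq_0[OF fi] 1 by (simp add: A_def)
  then have "(LINT x|M. norm (f x * g x)) = (LINT x|M. 0)"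
   by (intro integral_cong_AE) (use I in \<open>auto elim: eventually_mono\<close>)
  then show ?thesis by simp
 next
  case 2
  have "AE x in M. g x = 0" using integral_powr_eq_0[OF gi] 2 by (simp add: B_def)
  then have "(LINT x|M. norm (f x * g x)) = (LINT x|M. 0)"
   by (intro integral_cong_AE) (use I in \<open>auto elim: eventually_mono\<close>)
  then show ?thesis by simp
 next
  case 3
  have "(LINT x|M. norm (f x * g x)) <= (LINT x|M. A * B * (norm (f x) powr q / A powr q / q + norm (g x) powr r / B powr r / r))"
  proof (rule integral_mono)
   fix x
   have "(norm (f x) / A) * (norm (g x) / B) <= (norm (f x) / A) powr q / q + (norm (g x) / B) powr r / r"
    using 3 by (intro Youngs_inequality q r1 r) auto
   then have "A * B * ((norm (f x) / A) * (norm (g x) / B)) <= A * B * ((norm (f x) / A) powr q / q + (norm (g x) / B) powr r / r)"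
    using 3 by (intro mult_left_mono) auto
   then show "norm (f x * g x) <= A * B * (norm (f x) powr q / A powr q / q + norm (g x) powr r / B powr r / r)"
    using 3 by (simp add: norm_mult powr_divide)
  qed (use I fi gi in auto)
  also have "... = A * B * (A powr q / A powr q / q + B powr r / B powr r / r)"
   using fi gi by (simp add: Aq)
  also have "... = A * B" using 3 r by simp
  finally show ?thesis by (simp add: A_def B_def)
 qed
qed

text \<open>The Riesz-Fischer argument in series form: by Minkowski's inequality and monotone
  convergence the sum of the pointwise norms has an integrable \<open>q\<close>-th power. Hence the
  series converges absolutely almost everywhere, and that sum dominates all remainders.\<close>

lemma Lq_series:
 fixes f :: "nat => 'a => 'b::{banach, second_countable_topology}"
 assumes q: "q >= 1" and f: "!!k. f k \<in> borel_measurable M" and fi: "!!k. integrable M (%x. norm (f k x) powr q)"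
  and sm: "summable (%k. (LINT x|M. norm (f k x) powr q) powr (1 / q))"
 defines "F \<equiv> %x. \<Sum>k. f k x"
 shows "F \<in> borel_measurable M" and "integrable M (%x. norm (F x - (\<Sum>k<K. f k x)) powr q)"
  and "(%K. LINT x|M. norm (F x - (\<Sum>k<K. f k x)) powr q) \<longlonglongrightarrow> 0"
proof -
 show Fm[measurable]: "F \<in> borel_measurable M" unfolding F_def using f by measurable
 note [measurable] = f
 define a where "a k = (LINT x|M. norm (f k x) powr q) powr (1 / q)" for k
 define S where "S K x = (\<Sum>k<K. norm (f k x))" for K x
 have [measurable]: "S K \<in> borel_measurable M" for K unfolding S_def by measurable
 have S0: "S K x >= 0" for K x by (auto simp: S_def sum_nonneg)
 have SB: "integrable M (%x. S K x powr q) \<and> (LINT x|M. S K x powr q) powr (1 / q) <= (\<Sum>k<K. a k)" for K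
 proof (induction K)
  case 0 then show ?case by (simp add: S_def)
 next
  case (Suc K)
  have i: "integrable M (%x. norm (S K x) powr q)" "integrable M (%x. norm (norm (f K x)) powr q)"
   using Suc fi S0 by (auto simp: abs_of_nonneg)
  have "integrable M (%x. norm (S K x + norm (f K x)) powr q)"
   by (rule integrable_powr_add[OF q _ _ i]) auto
  moreover have "(LINT x|M. norm (S K x + norm (f K x)) powr q) powr (1 / q) <= (\<Sum>k<K. a k) + a K"
   using Minkowski[OF q _ _ i] Suc S0 by (simp add: abs_of_nonneg a_def)
  moreover have "norm (S K x + norm (f K x)) = S (Suc K) x" for x using S0[of K x] by (simp add: S_def)
  ultimately show ?case by simp
 qed
 define B where "B = (\<Sum>k. a k)"
 have a0: "a k >= 0" for k by (simp add: a_def)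
 have sa: "summable a" using sm by (simp add: a_def[abs_def])
 have nnS: "(\<integral>\<^sup>+x. ennreal (S K x powr q) \<partial>M) <= ennreal (B powr q)" for K
 proof -
  have "(LINT x|M. S K x powr q) powr (1 / q) <= B"
   using SB[of K] sum_le_suminf[OF sa, of "{..<K}"] a0 by (auto simp: B_def)
  then have "((LINT x|M. S K x powr q) powr (1 / q)) powr q <= B powr q" using q by (intro powr_mono2) auto
  then have "(LINT x|M. S K x powr q) <= B powr q" using q by (simp add: powr_powr)
  then show ?thesis using SB[of K] by (subst nn_integral_eq_integral) (auto intro: ennreal_leI)
 qed
 have inc: "S K x <= S L x" if "K <= L" for K L x
  unfolding S_def using that by (intro sum_mono2) auto
 have incq: "incseq (%K x. ennreal (S K x powr q))"
  using inc q S0 by (auto simp: incseq_def le_fun_def intro!: ennreal_leI powr_mono2)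
 have sup: "(\<integral>\<^sup>+x. (SUP K. ennreal (S K x powr q)) \<partial>M) <= ennreal (B powr q)"
  by (subst nn_integral_monotone_convergence_SUP[OF incq]) (auto intro: SUP_least nnS)
 have "AE x in M. (SUP K. ennreal (S K x powr q)) ~= \<infinity>"
  by (rule nn_integral_noteq_infinite) (use sup in \<open>auto simp: top_unique\<close>)
 then have summ: "AE x in M. summable (%k. norm (f k x))"
 proof eventually_elim
  case (elim x)
  then obtain c where c: "c >= 0" "(SUP K. ennreal (S K x powr q)) = ennreal c" by (cases "SUP K. ennreal (S K x powr q)") auto
  have "S K x <= c powr (1 / q)" for K
  proof -
   have "ennreal (S K x powr q) <= ennreal c" unfolding c(2)[symmetric] by (rule SUP_upper) simp
   then have "(S K x powr q) powr (1 / q) <= c powr (1 / q)" using q c by (intro powr_mono2) auto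
   then show ?thesis using q S0 by (simp add: powr_powr)
  qed
  then show ?case by (intro summableI_nonneg_bounded[of _ "c powr (1 / q)"]) (auto simp: S_def)
 qed
 define G where "G x = (\<Sum>k. norm (f k x))" for x
 have [measurable]: "G \<in> borel_measurable M" unfolding G_def by measurable
 have Gi: "integrable M (%x. G x powr q)"
 proof (rule integrableI_bounded)
  have "AE x in M. ennreal (norm (G x powr q)) <= (SUP K. ennreal (S K x powr q))"
   using summ
  proof eventually_elim
   case (elim x)
   have "(%K. S K x powr q) \<longlonglongrightarrow> G x powr q"
    using summable_LIMSEQ[OF elim] q S0 unfolding S_def G_def by (intro tendsto_powr' tendsto_const) (auto intro!: sum_nonneg always_eventually)
   then have "(%K. ennreal (S K x powr q)) \<longlonglongrightarrow> ennreal (G x powr q)" by (rule tendsto_ennrealI)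
   moreover have "ennreal (S K x powr q) <= (SUP K. ennreal (S K x powr q))" for K
    by (rule SUP_upper) simp
   ultimately have "ennreal (G x powr q) <= (SUP K. ennreal (S K x powr q))"
    using LIMSEQ_le_const2 by blast
   then show ?case by simp
  qed
  then have "(\<integral>\<^sup>+x. ennreal (norm (G x powr q)) \<partial>M) <= (\<integral>\<^sup>+x. (SUP K. ennreal (S K x powr q)) \<partial>M)"
   by (rule nn_integral_mono_AE)
  also have "... < \<infinity>" using le_less_trans[OF sup ennreal_less_top] by simp
  finally show "(\<integral>\<^sup>+x. ennreal (norm (G x powr q)) \<partial>M) < \<infinity>" .
 qed simp
 have dom: "AE x in M. norm (norm (F x - (\<Sum>k<K. f k x)) powr q) <= G x powr q" for K
  using summ
 proof eventually_elim
  case (elim x)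
  have "F x - (\<Sum>k<K. f k x) = (\<Sum>k. f (k + K) x)"
   unfolding F_def using suminf_minus_initial_segment[OF summable_norm_cancel[OF elim], of K] by simp
  also have "norm ... <= (\<Sum>k. norm (f (k + K) x))"
   by (rule summable_norm) (use elim in \<open>simp add: summable_iff_shift[of "%k. norm (f k x)"]\<close>)
  also have "... = G x - S K x" unfolding G_def S_def by (rule suminf_minus_initial_segment[OF elim])
  also have "... <= G x" using S0 by simp
  finally show ?case using q by (simp add: powr_mono2)
 qed
 show "integrable M (%x. norm (F x - (\<Sum>k<K. f k x)) powr q)"
  by (rule bochner_bound[OF Gi]) (use dom[of K] in auto)
 have "(%K. LINT x|M. norm (F x - (\<Sum>k<K. f k x)) powr q) \<longlonglongrightarrow> (LINT x|M. 0)"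
 proof (rule integral_dominated_convergence[where w="%x. G x powr q"])
  show "AE x in M. (%K. norm (F x - (\<Sum>k<K. f k x)) powr q) \<longlonglongrightarrow> 0"
   using summ
  proof eventually_elim
   case (elim x)
   have "(%K. norm (F x - (\<Sum>k<K. f k x))) \<longlonglongrightarrow> norm (F x - F x)"
    unfolding F_def by (intro tendsto_intros summable_LIMSEQ summable_norm_cancel[OF elim])
   then show ?case using q by (intro tendsto_zero_powrI[of _ _ "%_. q" q]) auto
  qed
 qed (use Gi dom in auto)
 then show "(%K. LINT x|M. norm (F x - (\<Sum>k<K. f k x)) powr q) \<longlonglongrightarrow> 0" by simp
qed

section \<open>Products, finite powers and closed subspaces\<close>

lemma dualI:
 assumes "!!x y. x \<in> carr X ==> y \<in> carr X ==> l (x + y) = l x + l y"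
  and "!!r x. x \<in> carr X ==> l (r *\<^sub>R x) = r * l x"
  and "!!x. x \<in> carr X ==> \<bar>l x\<bar> <= B * nrm X x"
 shows "l \<in> dual X"
 using assms unfolding dual_def by blast

lemma nsp_prod:
 assumes "nsp X" "nsp Y" shows "nsp (prod_sp X Y)"
proof -
 interpret X: nsp X by fact
 interpret Y: nsp Y by fact
 show ?thesis
 proof
  fix x y :: "'a \<times> 'b"
  assume "x \<in> carr (prod_sp X Y)" "y \<in> carr (prod_sp X Y)"
  then show "nrm (prod_sp X Y) (x + y) <= nrm (prod_sp X Y) x + nrm (prod_sp X Y) y"
   using X.triangle[of "fst x" "fst y"] Y.triangle[of "snd x" "snd y"]
   by (auto simp: prod_sp_def split: prod.splits)
 next
  fix x :: "'a \<times> 'b" assume "x \<in> carr (prod_sp X Y)" "nrm (prod_sp X Y) x = 0"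
  then show "x = 0" using X.nonneg[of "fst x"] Y.nonneg[of "snd x"] X.nrm_eq_0[of "fst x"] Y.nrm_eq_0[of "snd x"]
   by (auto simp: prod_sp_def prod_eq_iff split: prod.splits)
 qed (auto simp: prod_sp_def zero_prod_def X.zero Y.zero X.add Y.add X.scale Y.scale X.nonneg Y.nonneg X.nrm_scale Y.nrm_scale
   algebra_simps split: prod.splits)
qed

lemma bsp_prod:
 assumes "bsp X" "bsp Y" shows "bsp (prod_sp X Y)"
proof -
 interpret X: bsp X by fact
 interpret Y: bsp Y by fact
 interpret P: nsp "prod_sp X Y" by (rule nsp_prod) unfold_locales
 have n: "nrm (prod_sp X Y) z = nrm X (fst z) + nrm Y (snd z)" for z by (simp add: prod_sp_def split: prod.splits)
 have c: "z \<in> carr (prod_sp X Y) \<longleftrightarrow> fst z \<in> carr X \<and> snd z \<in> carr Y" for z by (cases z) (simp add: prod_sp_def)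
 show ?thesis
 proof
  fix s :: "nat => 'a \<times> 'b"
  assume s: "!!n. s n \<in> carr (prod_sp X Y)"
   and C: "!!e. e > 0 ==> \<exists>N. \<forall>m\<ge>N. \<forall>n\<ge>N. nrm (prod_sp X Y) (s m - s n) < e"
  have "\<exists>l. tends_in X (%n. fst (s n)) l sequentially"
  proof (rule X.complete)
   fix e :: real assume "e > 0"
   from C[OF this] obtain N where N: "!!m n. m >= N ==> n >= N ==> nrm (prod_sp X Y) (s m - s n) < e" by blast
   have "nrm X (fst (s m) - fst (s n)) < e" if "m >= N" "n >= N" for m n
    using N[OF that] Y.nonneg[of "snd (s m) - snd (s n)"] by (simp add: n)
   then show "\<exists>N. \<forall>m\<ge>N. \<forall>n\<ge>N. nrm X (fst (s m) - fst (s n)) < e" by blast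
  qed (use s c in blast)
  then obtain l1 where l1: "tends_in X (%n. fst (s n)) l1 sequentially" by blast
  have "\<exists>l. tends_in Y (%n. snd (s n)) l sequentially"
  proof (rule Y.complete)
   fix e :: real assume "e > 0"
   from C[OF this] obtain N where N: "!!m n. m >= N ==> n >= N ==> nrm (prod_sp X Y) (s m - s n) < e" by blast
   have "nrm Y (snd (s m) - snd (s n)) < e" if "m >= N" "n >= N" for m n
    using N[OF that] X.nonneg[of "fst (s m) - fst (s n)"] by (simp add: n)
   then show "\<exists>N. \<forall>m\<ge>N. \<forall>n\<ge>N. nrm Y (snd (s m) - snd (s n)) < e" by blast
  qed (use s c in blast)
  then obtain l2 where l2: "tends_in Y (%n. snd (s n)) l2 sequentially" by blast
  have "tends_in (prod_sp X Y) s (l1, l2) sequentially"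
   using l1 l2 tendsto_add[of "%n. nrm X (fst (s n) - l1)" 0 sequentially "%n. nrm Y (snd (s n) - l2)" 0]
   by (simp add: tends_in_def n c)
  then show "\<exists>l. tends_in (prod_sp X Y) s l sequentially" by blast
 next
  obtain L1 where L1: "countable L1" "L1 \<subseteq> dual X" "!!x. x \<in> carr X ==> (!!l. l \<in> L1 ==> l x = 0) ==> x = 0"
   using X.separating by metis
  obtain L2 where L2: "countable L2" "L2 \<subseteq> dual Y" "!!x. x \<in> carr Y ==> (!!l. l \<in> L2 ==> l x = 0) ==> x = 0"
   using Y.separating by metis
  have d1: "(%z. l (fst z)) \<in> dual (prod_sp X Y)" if l: "l \<in> dual X" for l
  proof -
   obtain B where B: "B > 0" "!!x. x \<in> carr X ==> \<bar>l x\<bar> <= B * nrm X x" using X.dual_bound[OF l] by blast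
   have "\<bar>l (fst z)\<bar> <= B * nrm (prod_sp X Y) z" if "z \<in> carr (prod_sp X Y)" for z
   proof -
    have "\<bar>l (fst z)\<bar> <= B * nrm X (fst z)" using B that c by blast
    also have "... <= B * nrm (prod_sp X Y) z" using B Y.nonneg[of "snd z"] by (simp add: n)
    finally show ?thesis .
   qed
   then show ?thesis by (rule dualI[rotated 2]) (use l in \<open>simp_all add: c X.dual_add X.dual_scale\<close>)
  qed
  have d2: "(%z. l (snd z)) \<in> dual (prod_sp X Y)" if l: "l \<in> dual Y" for l
  proof -
   obtain B where B: "B > 0" "!!x. x \<in> carr Y ==> \<bar>l x\<bar> <= B * nrm Y x" using Y.dual_bound[OF l] by blast
   have "\<bar>l (snd z)\<bar> <= B * nrm (prod_sp X Y) z" if "z \<in> carr (prod_sp X Y)" for z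
   proof -
    have "\<bar>l (snd z)\<bar> <= B * nrm Y (snd z)" using B that c by blast
    also have "... <= B * nrm (prod_sp X Y) z" using B X.nonneg[of "fst z"] by (simp add: n)
    finally show ?thesis .
   qed
   then show ?thesis by (rule dualI[rotated 2]) (use l in \<open>simp_all add: c Y.dual_add Y.dual_scale\<close>)
  qed
  show "\<exists>L. countable L \<and> L \<subseteq> dual (prod_sp X Y) \<and> (\<forall>x\<in>carr (prod_sp X Y). (\<forall>l\<in>L. l x = 0) --> x = 0)"
  proof (intro exI[of _ "(%l z. l (fst z)) ` L1 \<union> (%l z. l (snd z)) ` L2"] conjI)
   show "(%l z. l (fst z)) ` L1 \<union> (%l z. l (snd z)) ` L2 \<subseteq> dual (prod_sp X Y)" using d1 d2 L1(2) L2(2) by blast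
   show "\<forall>x\<in>carr (prod_sp X Y). (\<forall>l\<in>(%l z. l (fst z)) ` L1 \<union> (%l z. l (snd z)) ` L2. l x = 0) --> x = 0"
   proof (intro ballI impI)
    fix x assume x: "x \<in> carr (prod_sp X Y)" and z: "\<forall>l\<in>(%l z. l (fst z)) ` L1 \<union> (%l z. l (snd z)) ` L2. l x = 0"
    have "fst x = 0" by (rule L1(3)) (use x z c in auto)
    moreover have "snd x = 0" by (rule L2(3)) (use x z c in auto)
    ultimately show "x = 0" by (simp add: prod_eq_iff)
   qed
  qed (use L1(1) L2(1) in auto)
 qed
qed

lemma vec_sp_carr: "z \<in> carr (vec_sp X) \<longleftrightarrow> (\<forall>i. z $ i \<in> carr X)"
 by (simp add: vec_sp_def)

lemma vec_sp_nrm: "nrm (vec_sp X) z = (\<Sum>i\<in>UNIV. nrm X (z $ i))"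
 by (simp add: vec_sp_def)

lemma nsp_vec:
 assumes "nsp X" shows "nsp (vec_sp X :: ('v::real_vector ^ 'd::finite) nspace)"
proof -
 interpret X: nsp X by fact
 show ?thesis
 proof
  fix x y :: "'v ^ 'd"
  assume "x \<in> carr (vec_sp X)" "y \<in> carr (vec_sp X)"
  then show "nrm (vec_sp X) (x + y) <= nrm (vec_sp X) x + nrm (vec_sp X) y"
   by (auto simp: vec_sp_carr vec_sp_nrm sum.distrib[symmetric] intro!: sum_mono X.triangle)
 next
  fix x :: "'v ^ 'd" assume x: "x \<in> carr (vec_sp X)" "nrm (vec_sp X) x = 0"
  then have "nrm X (x $ i) = 0" for i
   by (simp add: vec_sp_nrm sum_nonneg_eq_0_iff X.nonneg)
  then show "x = 0" using x(1) X.nrm_eq_0 by (auto simp: vec_sp_carr vec_eq_iff)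
 qed (auto simp: vec_sp_carr vec_sp_nrm X.zero X.add X.scale X.nrm_scale sum_distrib_left intro!: sum_nonneg X.nonneg)
qed

lemma bsp_vec:
 assumes "bsp X" shows "bsp (vec_sp X :: ('v::real_vector ^ 'd::finite) nspace)"
proof -
 interpret X: bsp X by fact
 interpret P: nsp "vec_sp X :: ('v ^ 'd) nspace" by (rule nsp_vec) unfold_locales
 have le: "nrm X (z $ i) <= nrm (vec_sp X) z" for z :: "'v ^ 'd" and i
  unfolding vec_sp_nrm by (rule member_le_sum) (auto simp: X.nonneg)
 show ?thesis
 proof
  fix s :: "nat => 'v ^ 'd"
  assume s: "!!n. s n \<in> carr (vec_sp X)"
   and C: "!!e. e > 0 ==> \<exists>N. \<forall>m\<ge>N. \<forall>n\<ge>N. nrm (vec_sp X) (s m - s n) < e"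
  have "\<exists>l. tends_in X (%n. s n $ i) l sequentially" for i
  proof (rule X.complete)
   fix e :: real assume "e > 0"
   from C[OF this] obtain N where N: "!!m n. m >= N ==> n >= N ==> nrm (vec_sp X) (s m - s n) < e" by blast
   have "nrm X (s m $ i - s n $ i) < e" if "m >= N" "n >= N" for m n
    using N[OF that] le[of "s m - s n" i] by simp
   then show "\<exists>N. \<forall>m\<ge>N. \<forall>n\<ge>N. nrm X (s m $ i - s n $ i) < e" by blast
  qed (use s vec_sp_carr in blast)
  then obtain l where l: "!!i. tends_in X (%n. s n $ i) (l i) sequentially" by metis
  have "(%n. \<Sum>i\<in>UNIV. nrm X (s n $ i - l i)) \<longlonglongrightarrow> (\<Sum>i\<in>(UNIV::'d set). 0)"
   by (intro tendsto_sum) (use l in \<open>simp add: tends_in_def\<close>)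
  then have "tends_in (vec_sp X) s (vec_lambda l) sequentially"
   using l by (simp add: tends_in_def vec_sp_carr vec_sp_nrm)
  then show "\<exists>l. tends_in (vec_sp X) s l sequentially" by blast
 next
  obtain L where L: "countable L" "L \<subseteq> dual X" "!!x. x \<in> carr X ==> (!!l. l \<in> L ==> l x = 0) ==> x = 0"
   using X.separating by metis
  have d: "(%z. l (z $ i)) \<in> dual (vec_sp X)" if l: "l \<in> dual X" for l and i :: 'd
  proof -
   obtain B where B: "B > 0" "!!x. x \<in> carr X ==> \<bar>l x\<bar> <= B * nrm X x" using X.dual_bound[OF l] by blast
   have "\<bar>l (z $ i)\<bar> <= B * nrm (vec_sp X) z" if "z \<in> carr (vec_sp X)" for z :: "'v ^ 'd"
   proof -
    have "\<bar>l (z $ i)\<bar> <= B * nrm X (z $ i)" using B that vec_sp_carr by blast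
    also have "... <= B * nrm (vec_sp X) z" using B le by simp
    finally show ?thesis .
   qed
   then show ?thesis by (rule dualI[rotated 2]) (use l in \<open>simp_all add: vec_sp_carr X.dual_add X.dual_scale\<close>)
  qed
  show "\<exists>L. countable L \<and> L \<subseteq> dual (vec_sp X :: ('v ^ 'd) nspace) \<and> (\<forall>x\<in>carr (vec_sp X). (\<forall>l\<in>L. l x = 0) --> x = 0)"
  proof (intro exI[of _ "\<Union>i. (%l z. l (z $ i)) ` L"] conjI)
   show "(\<Union>i. (%l z. l (z $ i)) ` L) \<subseteq> dual (vec_sp X :: ('v ^ 'd) nspace)"
   proof
    fix k assume "k \<in> (\<Union>i::'d. (%l z. l (z $ i)) ` L)"
    then obtain i l where "k = (%z. l (z $ i))" "l \<in> L" by auto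
    then show "k \<in> dual (vec_sp X)" using d[of l i] L(2) by auto
   qed
   show "\<forall>x\<in>carr (vec_sp X). (\<forall>l\<in>(\<Union>i. (%l z. l (z $ i)) ` L). l x = 0) --> x = (0 :: 'v ^ 'd)"
   proof (intro ballI impI)
    fix x :: "'v ^ 'd"
    assume x: "x \<in> carr (vec_sp X)" and z: "\<forall>l\<in>(\<Union>i. (%l z. l (z $ i)) ` L). l x = 0"
    have "x $ i = 0" for i by (rule L(3)) (use x z in \<open>auto simp: vec_sp_carr\<close>)
    then show "x = 0" by (simp add: vec_eq_iff)
   qed
  qed (use L(1) in auto)
 qed
qed

lemma nsp_restrict:
 assumes "nsp X" "0 \<in> S" "!!x y. x \<in> carr X ==> y \<in> carr X ==> x \<in> S ==> y \<in> S ==> x + y \<in> S"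
  "!!r x. x \<in> carr X ==> x \<in> S ==> r *\<^sub>R x \<in> S"
 shows "nsp (restrict_sp X S)"
proof -
 interpret X: nsp X by fact
 show ?thesis
  by unfold_locales (use assms in \<open>auto simp: restrict_sp_def X.zero X.add X.scale X.nonneg X.triangle X.nrm_scale X.nrm_eq_0\<close>)
qed

lemma bsp_restrict:
 assumes "bsp X" "0 \<in> S" "!!x y. x \<in> carr X ==> y \<in> carr X ==> x \<in> S ==> y \<in> S ==> x + y \<in> S"
  "!!r x. x \<in> carr X ==> x \<in> S ==> r *\<^sub>R x \<in> S"
  and closed: "!!s l. (!!n::nat. s n \<in> carr X \<inter> S) ==> tends_in X s l sequentially ==> l \<in> S"
 shows "bsp (restrict_sp X S)"
proof -
 interpret X: bsp X by fact
 interpret P: nsp "restrict_sp X S" by (rule nsp_restrict) (use assms X.nsp_axioms in auto)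
 show ?thesis
 proof
  fix s :: "nat => 'a"
  assume s: "!!n. s n \<in> carr (restrict_sp X S)"
   and C: "!!e. e > 0 ==> \<exists>N. \<forall>m\<ge>N. \<forall>n\<ge>N. nrm (restrict_sp X S) (s m - s n) < e"
  obtain l where l: "tends_in X s l sequentially"
   using X.complete[of s] s C by (auto simp: restrict_sp_def)
  have "l \<in> S" by (rule closed[OF _ l]) (use s in \<open>auto simp: restrict_sp_def\<close>)
  with l show "\<exists>l. tends_in (restrict_sp X S) s l sequentially" by (auto simp: tends_in_def restrict_sp_def)
 next
  have "dual X \<subseteq> dual (restrict_sp X S)" unfolding dual_def restrict_sp_def by fastforce
  then show "\<exists>L. countable L \<and> L \<subseteq> dual (restrict_sp X S) \<and> (\<forall>x\<in>carr (restrict_sp X S). (\<forall>l\<in>L. l x = 0) --> x = 0)"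
   using X.separating by (fastforce simp: restrict_sp_def)
 qed
qed

section \<open>Representatives of classes of measurable functions\<close>

lemma rep_lfun_measurable[measurable]: "rep_lfun u \<in> borel_measurable lebesgue"
 using Quotient_rel_rep[OF Quotient_lfun, of u u] by simp

lemma abs_rep_lfun: "abs_lfun (rep_lfun u) = u"
 using Quotient_abs_rep[OF Quotient_lfun] .

lemma rep_abs_lfun:
 assumes "f \<in> borel_measurable lebesgue" shows "AE x in lebesgue. rep_lfun (abs_lfun f) x = f x"
 using Quotient_rep_abs[OF Quotient_lfun, of f] assms by auto

lemma lfun_eq_iff: "u = v \<longleftrightarrow> (AE x in lebesgue. rep_lfun u x = rep_lfun v x)"
 using Quotient_rel_rep[OF Quotient_lfun, of u v] by simp

lemma rep_of_fun: "f \<in> borel_measurable lebesgue ==> AE x in lebesgue. rep_lfun (of_fun f) x = f x"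
 unfolding of_fun_def by (rule rep_abs_lfun)

lemma rep_plus: "AE x in lebesgue. rep_lfun (u + v) x = rep_lfun u x + rep_lfun v x"
proof -
 have "u + v = abs_lfun (%x. rep_lfun u x + rep_lfun v x)"
  using plus_lfun.abs_eq[of "rep_lfun u" "rep_lfun v"] by (simp add: abs_rep_lfun)
 then show ?thesis using rep_abs_lfun[of "%x. rep_lfun u x + rep_lfun v x"] by simp
qed

lemma rep_minus: "AE x in lebesgue. rep_lfun (u - v) x = rep_lfun u x - rep_lfun v x"
proof -
 have "u - v = abs_lfun (%x. rep_lfun u x - rep_lfun v x)"
  using minus_lfun.abs_eq[of "rep_lfun u" "rep_lfun v"] by (simp add: abs_rep_lfun)
 then show ?thesis using rep_abs_lfun[of "%x. rep_lfun u x - rep_lfun v x"] by simp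
qed

lemma rep_times: "AE x in lebesgue. rep_lfun (u * v) x = rep_lfun u x * rep_lfun v x"
proof -
 have "u * v = abs_lfun (%x. rep_lfun u x * rep_lfun v x)"
  using times_lfun.abs_eq[of "rep_lfun u" "rep_lfun v"] by (simp add: abs_rep_lfun)
 then show ?thesis using rep_abs_lfun[of "%x. rep_lfun u x * rep_lfun v x"] by simp
qed

lemma rep_scaleR: "AE x in lebesgue. rep_lfun (r *\<^sub>R u) x = complex_of_real r * rep_lfun u x"
proof -
 have "r *\<^sub>R u = abs_lfun (%x. complex_of_real r * rep_lfun u x)"
  using scaleR_lfun.abs_eq[of "rep_lfun u" r] by (simp add: abs_rep_lfun)
 then show ?thesis using rep_abs_lfun[of "%x. complex_of_real r * rep_lfun u x"] by simp
qed

lemma rep_zero: "AE x in lebesgue. rep_lfun 0 x = 0"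
 unfolding zero_lfun.abs_eq by (rule rep_abs_lfun) simp

lemma rep_restr:
 assumes "S \<in> sets lebesgue" shows "AE x in lebesgue. rep_lfun (restr S u) x = (if x \<in> S then rep_lfun u x else 0)"
proof -
 have "restr S u = abs_lfun (%x. if S \<in> sets lebesgue \<and> x \<in> S then rep_lfun u x else 0)"
  using restr.abs_eq[of "rep_lfun u" S] by (simp add: abs_rep_lfun)
 moreover have "(%x. if S \<in> sets lebesgue \<and> x \<in> S then rep_lfun u x else 0) \<in> borel_measurable lebesgue"
  using assms by (auto intro!: measurable_If_set)
 ultimately show ?thesis using rep_abs_lfun assms by fastforce
qed

lemma rep_sum: "finite I ==> AE x in lebesgue. rep_lfun (\<Sum>i\<in>I. u i) x = (\<Sum>i\<in>I. rep_lfun (u i) x)"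
proof (induction I rule: finite_induct)
 case empty then show ?case using rep_zero by simp
next
 case (insert i I)
 with rep_plus[of "u i" "sum u I"] show ?case by (auto elim: AE_mp)
qed

lemma Lq_carr_iff:
 "u \<in> carr (Lq U q) \<longleftrightarrow> (AE x in lebesgue. x \<notin> U --> rep_lfun u x = 0) \<and> integrable lebesgue (%x. norm (rep_lfun u x) powr q)"
 by (simp add: Lq_def vanishes_outside.rep_eq Lq_integrable.rep_eq)

lemma Lq_nrm: "nrm (Lq U q) = Lq_norm q"
 by (simp add: Lq_def)

lemma Lq_norm_cong:
 assumes "AE x in lebesgue. norm (rep_lfun u x) = norm (f x)" "f \<in> borel_measurable lebesgue"
 shows "Lq_norm q u = (LINT x|lebesgue. norm (f x) powr q) powr (1 / q)"
 unfolding Lq_norm.rep_eq using assms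
 by (intro arg_cong[where f="%x. x powr (1/q)"] integral_cong_AE) (auto elim: eventually_mono)

lemma Lq_integrable_cong:
 assumes "AE x in lebesgue. norm (rep_lfun u x) = norm (f x)" "f \<in> borel_measurable lebesgue"
 shows "Lq_integrable q u \<longleftrightarrow> integrable lebesgue (%x. norm (f x) powr q)"
 unfolding Lq_integrable.rep_eq using assms by (intro integrable_cong_AE) (auto elim: eventually_mono)

lemma Lq_norm_nonneg: "Lq_norm q u >= 0"
 by (simp add: Lq_norm.rep_eq)

lemma nsp_Lq:
 assumes q: "q >= 1" shows "nsp (Lq U q)"
proof
 show "0 \<in> carr (Lq U q)"
  using rep_zero q unfolding Lq_carr_iff 
  by (auto elim: eventually_mono intro!: bochner_cong_AE[OF integrable_zero])
 fix u v :: "'a lfun" and r :: real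
 show "nrm (Lq U q) u >= 0" by (simp add: Lq_nrm Lq_norm_nonneg)
 assume u: "u \<in> carr (Lq U q)"
 then have u': "AE x in lebesgue. x \<notin> U --> rep_lfun u x = 0" "integrable lebesgue (%x. norm (rep_lfun u x) powr q)"
  by (auto simp: Lq_carr_iff)
 have ns: "AE x in lebesgue. norm (rep_lfun (r *\<^sub>R u) x) = norm (complex_of_real r * rep_lfun u x)"
  using rep_scaleR[of r u] by (rule eventually_mono) simp
 show "r *\<^sub>R u \<in> carr (Lq U q)" unfolding Lq_carr_iff
 proof
  show "AE x in lebesgue. x \<notin> U --> rep_lfun (r *\<^sub>R u) x = 0" using u'(1) rep_scaleR[of r u] by eventually_elim auto
  show "integrable lebesgue (%x. norm (rep_lfun (r *\<^sub>R u) x) powr q)"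
   using Lq_integrable_cong[OF ns] u'(2) by (simp add: Lq_integrable.rep_eq norm_mult powr_mult)
 qed
 show "nrm (Lq U q) (r *\<^sub>R u) = \<bar>r\<bar> * nrm (Lq U q) u"
  using Lq_norm_cong[OF ns] q by (simp add: Lq_nrm Lq_norm.rep_eq norm_mult powr_mult powr_powr)
 show "u = 0" if "nrm (Lq U q) u = 0"
 proof -
  have "AE x in lebesgue. rep_lfun u x = 0"
   using integral_powr_eq_0[OF u'(2)] that by (simp add: Lq_nrm Lq_norm.rep_eq)
  then show ?thesis unfolding lfun_eq_iff using rep_zero by eventually_elim simp
 qed
 assume v: "v \<in> carr (Lq U q)"
 then have v': "AE x in lebesgue. x \<notin> U --> rep_lfun v x = 0" "integrable lebesgue (%x. norm (rep_lfun v x) powr q)"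
  by (auto simp: Lq_carr_iff)
 have np: "AE x in lebesgue. norm (rep_lfun (u + v) x) = norm (rep_lfun u x + rep_lfun v x)"
  using rep_plus[of u v] by (rule eventually_mono) simp
 show "u + v \<in> carr (Lq U q)" unfolding Lq_carr_iff
 proof
  show "AE x in lebesgue. x \<notin> U --> rep_lfun (u + v) x = 0" using u'(1) v'(1) rep_plus[of u v] by eventually_elim auto
  show "integrable lebesgue (%x. norm (rep_lfun (u + v) x) powr q)"
   using Lq_integrable_cong[OF np] integrable_powr_add[OF q _ _ u'(2) v'(2)] by (simp add: Lq_integrable.rep_eq)
 qed
 show "nrm (Lq U q) (u + v) <= nrm (Lq U q) u + nrm (Lq U q) v"
  using Lq_norm_cong[OF np, of q] Minkowski[OF q _ _ u'(2) v'(2)] by (simp add: Lq_nrm Lq_norm.rep_eq)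
qed

lemma Lq_Hoelder:
 assumes q: "q > 1" and r: "1 / q + 1 / r = 1" and u: "Lq_integrable q u" and w: "Lq_integrable r w"
 shows "integrable lebesgue (%x. rep_lfun u x * rep_lfun w x)"
  and "(LINT x|lebesgue. norm (rep_lfun u x * rep_lfun w x)) <= Lq_norm q u * Lq_norm r w"
 using Hoelder[OF q r _ _ u[unfolded Lq_integrable.rep_eq] w[unfolded Lq_integrable.rep_eq]]
 by (auto simp: Lq_norm.rep_eq)

lemma conj_exp_eq: "q > 1 ==> 1 / q + 1 / conj_exp q = 1"
 by (simp add: conj_exp_def field_simps)

text \<open>Hoelder's inequality against the indicator of a box containing \<open>U\<close>; this is
  where boundedness of the domain enters.\<close>

lemma Lq_L1:
 fixes U :: "'a::euclidean_space set"
 assumes q: "q > 1" and U: "bounded U"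
 shows "\<exists>c\<ge>0. \<forall>u\<in>carr (Lq U q). integrable lebesgue (rep_lfun u) \<and> (LINT x|lebesgue. norm (rep_lfun u x)) <= c * Lq_norm q u"
proof -
 obtain a where a: "U \<subseteq> cbox (-a) a" using bounded_subset_cbox_symmetric[OF U] by blast
 define g :: "'a => complex" where "g = indicator (cbox (-a) a)"
 define r where "r = conj_exp q"
 have r: "1 / q + 1 / r = 1" using conj_exp_eq[OF q] by (simp add: r_def)
 have [measurable]: "g \<in> borel_measurable lebesgue" unfolding g_def by (auto intro!: borel_measurable_indicator)
 have gi: "integrable lebesgue (%x. norm (g x) powr r)"
 proof -
  have "(%x. norm (g x) powr r) = indicator (cbox (-a) a)" by (auto simp: g_def fun_eq_iff split: split_indicator)
  then show ?thesis using lmeasurable_cbox[of "-a" a] by (simp add: lmeasurable_iff_integrable)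
 qed
 show ?thesis
 proof (intro exI[of _ "(LINT x|lebesgue. norm (g x) powr r) powr (1 / r)"] conjI ballI)
  fix u assume "u \<in> carr (Lq U q)"
  then have u: "AE x in lebesgue. x \<notin> U --> rep_lfun u x = 0" "integrable lebesgue (%x. norm (rep_lfun u x) powr q)"
   by (auto simp: Lq_carr_iff)
  note H = Hoelder[OF q r _ _ u(2) gi]
  have ae: "AE x in lebesgue. rep_lfun u x * g x = rep_lfun u x"
   using u(1) by eventually_elim (use a in \<open>auto simp: g_def split: split_indicator\<close>)
  show "integrable lebesgue (rep_lfun u)"
   by (rule bochner_cong_AE[OF H(1)]) (use ae in \<open>auto elim: eventually_mono\<close>)
  have "(LINT x|lebesgue. norm (rep_lfun u x)) = (LINT x|lebesgue. norm (rep_lfun u x * g x))"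
   by (rule integral_cong_AE) (use ae in \<open>auto elim: eventually_mono\<close>)
  then show "(LINT x|lebesgue. norm (rep_lfun u x)) <= (LINT x|lebesgue. norm (g x) powr r) powr (1 / r) * Lq_norm q u"
   using H(2) by (simp add: Lq_norm.rep_eq mult.commute)
 qed simp
qed

lemma Lq_complete:
 assumes q: "q >= 1" and s: "!!n. s n \<in> carr (Lq U q)"
  and C: "!!e. e > 0 ==> \<exists>N. \<forall>m\<ge>N. \<forall>n\<ge>N. nrm (Lq U q) (s m - s n) < e"
 shows "\<exists>l. tends_in (Lq U q) s l sequentially"
proof -
 interpret nsp "Lq U q" by (rule nsp_Lq[OF q])
 have "\<exists>N. \<forall>m\<ge>N. \<forall>n\<ge>N. Lq_norm q (s m - s n) < (1/2)^k" for k :: nat using C[of "(1/2)^k"] by (simp add: Lq_nrm)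
 then obtain N where N: "!!k m n. m >= N k ==> n >= N k ==> Lq_norm q (s m - s n) < (1/2)^k" by metis
 \<comment> \<open>Taking the maximum over all earlier indices makes \<open>r\<close> monotone while
   keeping \<open>r k >= N k\<close>, so consecutive differences have norm at most
   \<open>(1/2)^k\<close> and the telescoping series falls under \<open>Lq_series\<close>.\<close>
 define r where "r k = Max (N ` {..k})" for k
 have rN: "r k >= N k" for k unfolding r_def by (rule Max_ge) auto
 have rm: "r k <= r l" if "k <= l" for k l unfolding r_def using that by (intro Max_mono) auto
 define f where "f k = rep_lfun (s (r (Suc k)) - s (r k))" for k
 have dc: "s (r (Suc k)) - s (r k) \<in> carr (Lq U q)" for k by (intro diff s)
 have sm: "summable (%k. (LINT x|lebesgue. norm (f k x) powr q) powr (1 / q))"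
 proof (rule summable_comparison_test')
  show "summable (%k. (1/2)^k :: real)" by (simp add: summable_geometric)
  fix k :: nat
  have "r (Suc k) >= N k" using rm[of k "Suc k"] rN[of k] by simp
  from N[OF this rN] show "norm ((LINT x|lebesgue. norm (f k x) powr q) powr (1 / q)) <= (1/2)^k"
   by (simp add: f_def Lq_norm.rep_eq)
 qed
 have fi: "integrable lebesgue (%x. norm (f k x) powr q)" for k using dc[of k] by (simp add: f_def Lq_carr_iff)
 have fm: "f k \<in> borel_measurable lebesgue" for k by (simp add: f_def)
 define F where "F = (%x. \<Sum>k. f k x)"
 have L: "F \<in> borel_measurable lebesgue" "!!K. integrable lebesgue (%x. norm (F x - (\<Sum>k<K. f k x)) powr q)"
  "(%K. LINT x|lebesgue. norm (F x - (\<Sum>k<K. f k x)) powr q) \<longlonglongrightarrow> 0"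
  unfolding F_def by (rule Lq_series[where f=f, OF q fm fi sm])+
 define l where "l = of_fun F + s (r 0)"
 have tel: "AE x in lebesgue. rep_lfun (l - s (r K)) x = F x - (\<Sum>k<K. f k x)" for K
 proof -
  have "l - s (r K) = of_fun F - (\<Sum>k<K. s (r (Suc k)) - s (r k))"
   using sum_lessThan_telescope[of "%k. s (r k)" K] by (simp add: l_def algebra_simps)
  then show ?thesis
   using rep_minus[of "of_fun F" "\<Sum>k<K. s (r (Suc k)) - s (r k)"] rep_of_fun[OF L(1)]
    rep_sum[of "{..<K}" "%k. s (r (Suc k)) - s (r k)"]
   by (auto simp: f_def elim: AE_mp)
 qed
 have Lqi: "Lq_integrable q (l - s (r K))" for K
  by (subst Lq_integrable_cong[where f="%x. F x - (\<Sum>k<K. f k x)"])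
   (use tel[of K] L fm in \<open>auto elim: eventually_mono\<close>)
 have van: "AE x in lebesgue. x \<notin> U --> rep_lfun (of_fun F) x = 0"
 proof -
  have "AE x in lebesgue. \<forall>k. x \<notin> U --> f k x = 0"
   using dc by (subst AE_all_countable) (auto simp: f_def Lq_carr_iff)
  with rep_of_fun[OF L(1)] show ?thesis by eventually_elim (auto simp: F_def)
 qed
 have "of_fun F = l - s (r 0)" by (simp add: l_def)
 then have "of_fun F \<in> carr (Lq U q)" using Lqi[of 0] van by (simp add: Lq_def vanishes_outside.rep_eq)
 then have lc: "l \<in> carr (Lq U q)" unfolding l_def by (intro add s)
 have "(%K. (LINT x|lebesgue. norm (F x - (\<Sum>k<K. f k x)) powr q) powr (1 / q)) \<longlonglongrightarrow> 0"
  using L(3) q by (intro tendsto_zero_powrI[of _ _ "%_. 1 / q" "1 / q"]) (auto intro!: always_eventually)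
 moreover have "(LINT x|lebesgue. norm (F x - (\<Sum>k<K. f k x)) powr q) powr (1 / q) = Lq_norm q (l - s (r K))" for K
  by (rule Lq_norm_cong[symmetric]) (use tel[of K] L(1) fm in \<open>auto elim: eventually_mono\<close>)
 ultimately have lim: "(%K. Lq_norm q (l - s (r K))) \<longlonglongrightarrow> 0" by simp
 have "(%n. Lq_norm q (s n - l)) \<longlonglongrightarrow> 0"
 proof (rule LIMSEQ_I)
  fix e :: real assume e: "e > 0"
  obtain K where K: "(1/2::real)^K < e / 2" using real_arch_pow_inv[of "e/2" "1/2"] e by auto
  have "eventually (%k. Lq_norm q (l - s (r k)) < e / 2 \<and> k >= K) sequentially"
   using order_tendstoD(2)[OF lim, of "e/2"] e by (intro eventually_conj eventually_ge_at_top) auto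
  then obtain k where k: "Lq_norm q (l - s (r k)) < e / 2" "k >= K" by (auto simp: eventually_sequentially)
  have "norm (Lq_norm q (s n - l) - 0) < e" if "n >= N K" for n
  proof -
   have "r k >= N K" using rm[OF k(2)] rN[of K] by simp
   then have "Lq_norm q (s n - s (r k)) < (1/2)^K" using N that by blast
   moreover have "Lq_norm q (s n - l) <= Lq_norm q (s n - s (r k)) + Lq_norm q (s (r k) - l)"
    using triangle3[of "s n" "s (r k)" l] s lc by (simp add: Lq_nrm)
   moreover have "Lq_norm q (s (r k) - l) = Lq_norm q (l - s (r k))" using nrm_minus_commute[OF s lc] by (simp add: Lq_nrm)
   ultimately show ?thesis using k K Lq_norm_nonneg[of q "s n - l"] by simp
  qed
  then show "\<exists>no. \<forall>n\<ge>no. norm (Lq_norm q (s n - l) - 0) < e" by blast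
 qed
 then show ?thesis using lc by (auto simp: tends_in_def Lq_nrm)
qed

text \<open>The separating functionals are the real and imaginary parts of integrals over rational
  boxes. They are bounded because functions in \<open>Lq\<close> on a bounded set are integrable
  with control by the norm, and they separate points by
  \<open>AE_0_of_rat_box_integrals\<close>.\<close>

lemma bsp_Lq:
 fixes U :: "'a::euclidean_space set"
 assumes q: "q > 1" and U: "bounded U" shows "bsp (Lq U q)"
proof -
 interpret nsp "Lq U q" using q by (intro nsp_Lq) simp
 obtain c where c: "c >= 0" "!!u. u \<in> carr (Lq U q) ==> integrable lebesgue (rep_lfun u)"
  "!!u. u \<in> carr (Lq U q) ==> (LINT x|lebesgue. norm (rep_lfun u x)) <= c * Lq_norm q u"
  using Lq_L1[OF q U] by metis
 define fl :: "(complex => real) => 'a set => 'a lfun => real"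
  where "fl p B u = (LINT x|lebesgue. indicator B x * p (rep_lfun u x))" for p B u
 have dual: "fl p B \<in> dual (Lq U q)" if B: "B \<in> sets borel" and p: "bounded_linear p" and p1: "!!z. \<bar>p z\<bar> <= norm z" for p B
 proof -
  interpret p: bounded_linear p by (rule p)
  have Bl: "B \<in> sets lebesgue" using B by auto
  have i: "integrable lebesgue (%x. indicator B x * p (rep_lfun u x))" if "u \<in> carr (Lq U q)" for u
   using integrable_mult_indicator[OF Bl integrable_bounded_linear[OF p c(2)[OF that]]] by simp
  have [measurable]: "(%x. p (rep_lfun u x)) \<in> borel_measurable lebesgue" for u
   by (rule measurable_compose[OF rep_lfun_measurable borel_measurable_continuous_onI])
    (rule p.continuous_on[OF continuous_on_id])
  have [measurable]: "indicat_real B \<in> borel_measurable lebesgue" using Bl by simp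
  show ?thesis unfolding dual_def
  proof (intro CollectI conjI ballI allI exI[of _ c])
   fix u v assume uv: "u \<in> carr (Lq U q)" "v \<in> carr (Lq U q)"
   have "fl p B (u + v) = (LINT x|lebesgue. indicator B x * p (rep_lfun u x) + indicator B x * p (rep_lfun v x))"
    unfolding fl_def by (rule integral_cong_AE)
     (use rep_plus[of u v] in \<open>auto simp: p.add algebra_simps elim!: eventually_mono\<close>)
   then show "fl p B (u + v) = fl p B u + fl p B v" using i uv by (simp add: fl_def)
  next
   fix r u assume u: "u \<in> carr (Lq U q)"
   have "fl p B (r *\<^sub>R u) = (LINT x|lebesgue. r * (indicator B x * p (rep_lfun u x)))"
    unfolding fl_def
   proof (rule integral_cong_AE)
    show "AE x in lebesgue. indicator B x * p (rep_lfun (r *\<^sub>R u) x) = r * (indicator B x * p (rep_lfun u x))"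
     using rep_scaleR[of r u] by eventually_elim (simp add: p.scaleR scaleR_conv_of_real[symmetric])
   qed auto
   then show "fl p B (r *\<^sub>R u) = r * fl p B u" by (simp add: fl_def)
  next
   fix u assume u: "u \<in> carr (Lq U q)"
   have "\<bar>fl p B u\<bar> <= (LINT x|lebesgue. norm (indicator B x * p (rep_lfun u x)))"
    unfolding fl_def using integral_norm_bound[of lebesgue "%x. indicator B x * p (rep_lfun u x)"] by simp
   also have "... <= (LINT x|lebesgue. norm (rep_lfun u x))"
    using i[OF u] c(2)[OF u] p1 by (intro integral_mono) (auto split: split_indicator)
   also have "... <= c * nrm (Lq U q) u" using c(3)[OF u] by (simp add: Lq_nrm)
   finally show "\<bar>fl p B u\<bar> <= c * nrm (Lq U q) u" .
  qed
 qed
 show ?thesis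
 proof
  show "\<exists>L. countable L \<and> L \<subseteq> dual (Lq U q) \<and> (\<forall>x\<in>carr (Lq U q). (\<forall>l\<in>L. l x = 0) --> x = 0)"
  proof (intro exI[of _ "(fl Re ` {B. rat_box B}) \<union> (fl Im ` {B. rat_box B})"] conjI)
   show "countable (fl Re ` {B. rat_box B} \<union> fl Im ` {B. rat_box B})" using countable_rat_box by auto
   show "fl Re ` {B. rat_box B} \<union> fl Im ` {B. rat_box B} \<subseteq> dual (Lq U q)"
    by (auto simp: rat_box_def intro!: dual bounded_linear_Re bounded_linear_Im abs_Re_le_cmod abs_Im_le_cmod)
   show "\<forall>x\<in>carr (Lq U q). (\<forall>l\<in>fl Re ` {B. rat_box B} \<union> fl Im ` {B. rat_box B}. l x = 0) --> x = 0"
   proof (intro ballI impI)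
    fix u assume u: "u \<in> carr (Lq U q)" and z: "\<forall>l\<in>fl Re ` {B. rat_box B} \<union> fl Im ` {B. rat_box B}. l u = 0"
    have z': "fl Re B u = 0" "fl Im B u = 0" if "rat_box B" for B using z that by blast+
    have "AE x in lebesgue. Re (rep_lfun u x) = 0"
     by (rule AE_0_of_rat_box_integrals) (use z' c(2)[OF u] in \<open>auto simp: fl_def\<close>)
    moreover have "AE x in lebesgue. Im (rep_lfun u x) = 0"
     by (rule AE_0_of_rat_box_integrals) (use z' c(2)[OF u] in \<open>auto simp: fl_def\<close>)
    ultimately show "u = 0" unfolding lfun_eq_iff using rep_zero
     by eventually_elim (simp add: complex_eq_iff)
   qed
  qed
 qed (use q in \<open>auto intro: Lq_complete\<close>)
qed

section \<open>Hardy's inequality\<close>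

lemma nn_integral_powr_0:
 fixes \<alpha> s :: real
 assumes "\<alpha> > -1" "s > 0"
 shows "(\<integral>\<^sup>+x. ennreal (indicator {0<..<s} x * x powr \<alpha>) \<partial>lborel) = ennreal (s powr (\<alpha> + 1) / (\<alpha> + 1))"
proof -
 have "((%x. x powr \<alpha>) has_integral (s powr (\<alpha> + 1) / (\<alpha> + 1))) {0..s}"
  using assms by (intro has_integral_powr_from_0) auto
 then have "((%x. x powr \<alpha>) has_integral (s powr (\<alpha> + 1) / (\<alpha> + 1))) {0<..<s}"
  by (simp add: has_integral_Icc_iff_Ioo)
 then have "(\<integral>\<^sup>+x. indicator {0<..<s} x * (x powr \<alpha>) \<partial>lborel) = ennreal (s powr (\<alpha> + 1) / (\<alpha> + 1))"
  by (intro nn_integral_has_integral_lebesgue) auto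
 then show ?thesis by (simp add: ennreal_mult' ennreal_indicator)
qed

lemma nn_integral_powr_inf:
 fixes \<alpha> s :: real
 assumes "\<alpha> < -1" "s > 0"
 shows "(\<integral>\<^sup>+x. ennreal (indicator {s<..} x * x powr \<alpha>) \<partial>lborel) = ennreal (- (s powr (\<alpha> + 1) / (\<alpha> + 1)))"
proof -
 have "((%x. x powr \<alpha>) has_integral (- (s powr (\<alpha> + 1)) / (\<alpha> + 1))) {s..}"
  using assms by (intro has_integral_powr_to_inf) auto
 then have "((%x. x powr \<alpha>) has_integral (- (s powr (\<alpha> + 1)) / (\<alpha> + 1))) {s<..}"
 proof (subst has_integral_spike_set_eq[of "{s<..}" "{s..}"])
  show "negligible {x \<in> {s..} - {s<..}. x powr \<alpha> ~= 0}" by (rule negligible_subset[of "{s}"]) auto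
  show "negligible {x \<in> {s<..} - {s..}. x powr \<alpha> ~= 0}" by (rule negligible_subset[of "{s}"]) auto
 qed
 then have "(\<integral>\<^sup>+x. indicator {s<..} x * (x powr \<alpha>) \<partial>lborel) = ennreal (- (s powr (\<alpha> + 1)) / (\<alpha> + 1))"
  by (intro nn_integral_has_integral_lebesgue) auto
 then show ?thesis by (simp add: ennreal_mult' ennreal_indicator)
qed

text \<open>Hoelder's inequality on (0, s) for \<open>\<phi> t * t powr a\<close> and
  \<open>t powr (- a)\<close> bounds the mean of \<open>\<phi>\<close> pointwise; interchanging the
  integrations leaves the tail integral of a power, whose value cancels the remaining weight. The
  constant \<open>\<beta> powr (- p)\<close> is the classical (p / (p - 1))^p.\<close>

lemma Hardy_borel:
 fixes \<phi> :: "real => real"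
 assumes p: "p > 1" and \<phi>[measurable]: "\<phi> \<in> borel_measurable borel" and \<phi>0: "!!t. \<phi> t >= 0"
  and int: "integrable lborel (%t. indicator {0<..} t * \<phi> t powr p)"
 defines "\<beta> \<equiv> (p - 1) / p"
 shows "!!s. s > 0 ==> integrable lborel (%t. indicator {0<..<s} t * \<phi> t)"
  and "(\<integral>\<^sup>+s. ennreal (indicator {0<..} s * ((LINT t|lborel. indicator {0<..<s} t * \<phi> t) / s) powr p) \<partial>lborel)
   <= ennreal (\<beta> powr (- p) * (LINT t|lborel. indicator {0<..} t * \<phi> t powr p))"
proof -
 define p' where "p' = p / (p - 1)"
 \<comment> \<open>With this exponent the second factor raised to the power \<open>p'\<close> is
   \<open>t powr (- (1 / p))\<close>, which is integrable at 0. The first factor keeps the weight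
   \<open>t powr \<beta>\<close>, which the integral of \<open>s powr (- 1 - \<beta>)\<close> over
   \<open>s > t\<close> compensates exactly.\<close>
 define a where "a = 1 / (p * p')"
 have p': "1 / p + 1 / p' = 1" "p' > 1" using p by (auto simp: p'_def field_simps)
 have \<beta>: "\<beta> > 0" "\<beta> < 1" "a * p = \<beta>" "a * p' = 1 / p" using p p'(2) by (auto simp: \<beta>_def a_def p'_def field_simps)
 have \<beta>1: "- (1 / p) + 1 = \<beta>" using p by (simp add: \<beta>_def field_simps)
 have gi: "integrable lborel (%t. norm (indicator {0<..<s} t * t powr (- a)) powr p')"
  and gI: "(LINT t|lborel. norm (indicator {0<..<s} t * t powr (- a)) powr p') = s powr \<beta> / \<beta>" if s: "s > 0" for s
 proof -
  have eq: "norm (indicator {0<..<s} t * t powr (- a)) powr p' = indicator {0<..<s} t * t powr (- (1 / p))" for t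
   using \<beta>(4) by (auto simp: powr_powr split: split_indicator)
  have nn: "(\<integral>\<^sup>+t. ennreal (indicator {0<..<s} t * t powr (- (1 / p))) \<partial>lborel) = ennreal (s powr \<beta> / \<beta>)"
   using nn_integral_powr_0[of "- (1 / p)" s] s p \<beta>1 by simp
  show "integrable lborel (%t. norm (indicator {0<..<s} t * t powr (- a)) powr p')"
   unfolding eq by (rule integrableI_nn_integral_finite[OF _ _ nn]) (use \<beta> in auto)
  show "(LINT t|lborel. norm (indicator {0<..<s} t * t powr (- a)) powr p') = s powr \<beta> / \<beta>"
   unfolding eq by (rule integral_eq_nn_integral[THEN trans]) (use nn \<beta> in auto)
 qed
 have fi: "integrable lborel (%t. norm (indicator {0<..<s} t * (\<phi> t * t powr a)) powr p)" if s: "s > 0" for s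
 proof (rule bochner_bound)
  show "integrable lborel (%t. s powr \<beta> * (indicator {0<..} t * \<phi> t powr p))" using int by auto
  show "AE t in lborel. norm (norm (indicator {0<..<s} t * (\<phi> t * t powr a)) powr p) <= norm (s powr \<beta> * (indicator {0<..} t * \<phi> t powr p))"
  proof (rule AE_I2)
   fix t
   show "norm (norm (indicator {0<..<s} t * (\<phi> t * t powr a)) powr p) <= norm (s powr \<beta> * (indicator {0<..} t * \<phi> t powr p))"
   proof (cases "0 < t \<and> t < s")
    case True
    then have "(\<phi> t * t powr a) powr p = t powr \<beta> * \<phi> t powr p"
     using \<phi>0[of t] \<beta>(3) by (simp add: powr_mult powr_powr)
    also have "... <= s powr \<beta> * \<phi> t powr p" using True \<beta> by (intro mult_right_mono powr_mono2) auto
    finally show ?thesis using True \<phi>0[of t] by (simp add: abs_mult)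
   qed (auto split: split_indicator)
  qed
 qed simp
 have prod: "(indicator {0<..<s} t * (\<phi> t * t powr a)) * (indicator {0<..<s} t * t powr (- a)) = indicator {0<..<s} t * \<phi> t" for s t
  by (auto simp: powr_minus field_simps split: split_indicator)
 show I: "integrable lborel (%t. indicator {0<..<s} t * \<phi> t)" if s: "s > 0" for s
  using Hoelder(1)[OF p p'(1) _ _ fi[OF s] gi[OF s]] by (simp add: prod)
 define \<psi> where "\<psi> t = \<phi> t powr p * t powr \<beta>" for t
 have [measurable]: "\<psi> \<in> borel_measurable borel" unfolding \<psi>_def by measurable
 have pw: "((LINT t|lborel. indicator {0<..<s} t * \<phi> t) / s) powr p
   <= \<beta> powr (1 - p) * s powr (- 1 - \<beta>) * (LINT t|lborel. indicator {0<..<s} t * \<psi> t)"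
  and psi: "integrable lborel (%t. indicator {0<..<s} t * \<psi> t)" if s: "s > 0" for s
 proof -
  let ?F = "LINT t|lborel. indicator {0<..<s} t * \<phi> t"
  have eqf: "norm (indicator {0<..<s} t * (\<phi> t * t powr a)) powr p = indicator {0<..<s} t * \<psi> t" for t
   using \<phi>0[of t] \<beta>(3) by (auto simp: \<psi>_def powr_mult powr_powr abs_mult split: split_indicator)
  show "integrable lborel (%t. indicator {0<..<s} t * \<psi> t)" using fi[OF s] unfolding eqf .
  define P where "P = (LINT t|lborel. indicator {0<..<s} t * \<psi> t)"
  have P0: "P >= 0" unfolding P_def by (intro integral_nonneg_AE AE_I2) (auto simp: \<psi>_def)
  have F0: "?F >= 0" using \<phi>0 by (intro integral_nonneg_AE AE_I2) auto
  have "(LINT t|lborel. norm (indicator {0<..<s} t * \<phi> t)) <= P powr (1 / p) * (s powr \<beta> / \<beta>) powr (1 / p')"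
   using Hoelder(2)[OF p p'(1) _ _ fi[OF s] gi[OF s]] unfolding prod gI[OF s] eqf P_def by simp
  moreover have "(LINT t|lborel. norm (indicator {0<..<s} t * \<phi> t)) = ?F"
   using \<phi>0 by (intro bochner_cong) (auto simp: abs_mult)
  ultimately have "?F powr p <= (P powr (1 / p) * (s powr \<beta> / \<beta>) powr (1 / p')) powr p"
   using F0 p by (intro powr_mono2) auto
  also have "... = P * (s powr \<beta> / \<beta>) powr (p - 1)"
   using p P0 by (simp add: powr_mult powr_powr p'_def)
  also have "(s powr \<beta> / \<beta>) powr (p - 1) = \<beta> powr (1 - p) * s powr (\<beta> * (p - 1))"
  proof -
   have "(s powr \<beta> / \<beta>) powr (p - 1) = (s powr \<beta>) powr (p - 1) / \<beta> powr (p - 1)"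
    using \<beta> by (simp add: powr_divide)
   moreover have "\<beta> powr (1 - p) = inverse (\<beta> powr (p - 1))" using powr_minus[of \<beta> "p - 1"] by simp
   ultimately show ?thesis by (simp add: powr_powr field_simps)
  qed
  finally have 1: "?F powr p <= P * (\<beta> powr (1 - p) * s powr (\<beta> * (p - 1)))" .
  have "(?F / s) powr p = ?F powr p * s powr (- p)" using F0 s by (simp add: powr_divide powr_minus_divide)
  also have "... <= P * (\<beta> powr (1 - p) * s powr (\<beta> * (p - 1))) * s powr (- p)" using 1 by (intro mult_right_mono) auto
  also have "... = \<beta> powr (1 - p) * (s powr (\<beta> * (p - 1)) * s powr (- p)) * P" by (simp add: ac_simps)
  also have "s powr (\<beta> * (p - 1)) * s powr (- p) = s powr (- 1 - \<beta>)"
  proof -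
   have "\<beta> * (p - 1) + - p = - 1 - \<beta>" using p by (simp add: \<beta>_def field_simps)
   then show ?thesis by (simp add: powr_add[symmetric])
  qed
  finally show "(?F / s) powr p <= \<beta> powr (1 - p) * s powr (- 1 - \<beta>) * P" .
 qed
 have "(\<integral>\<^sup>+s. ennreal (indicator {0<..} s * ((LINT t|lborel. indicator {0<..<s} t * \<phi> t) / s) powr p) \<partial>lborel)
   <= (\<integral>\<^sup>+s. (\<integral>\<^sup>+t. ennreal (\<beta> powr (1 - p)) * ennreal (indicator {0<..} s * s powr (- 1 - \<beta>) * (indicator {0<..<s} t * \<psi> t)) \<partial>lborel) \<partial>lborel)"
 proof (rule nn_integral_mono)
  fix s :: real
  show "ennreal (indicator {0<..} s * ((LINT t|lborel. indicator {0<..<s} t * \<phi> t) / s) powr p)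
    <= (\<integral>\<^sup>+t. ennreal (\<beta> powr (1 - p)) * ennreal (indicator {0<..} s * s powr (- 1 - \<beta>) * (indicator {0<..<s} t * \<psi> t)) \<partial>lborel)"
  proof (cases "s > 0")
   case True
   have "(\<integral>\<^sup>+t. ennreal (\<beta> powr (1 - p)) * ennreal (indicator {0<..} s * s powr (- 1 - \<beta>) * (indicator {0<..<s} t * \<psi> t)) \<partial>lborel)
    = ennreal (\<beta> powr (1 - p)) * (ennreal (s powr (- 1 - \<beta>)) * (\<integral>\<^sup>+t. ennreal (indicator {0<..<s} t * \<psi> t) \<partial>lborel))"
    using True by (simp add: nn_integral_cmult ennreal_mult \<psi>_def)
   also have "(\<integral>\<^sup>+t. ennreal (indicator {0<..<s} t * \<psi> t) \<partial>lborel) = ennreal (LINT t|lborel. indicator {0<..<s} t * \<psi> t)"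
    by (rule nn_integral_eq_integral[OF psi[OF True]]) (auto simp: \<psi>_def)
   moreover have "0 <= (LINT t|lborel. indicator {0<..<s} t * \<psi> t)"
    by (intro integral_nonneg_AE AE_I2) (auto simp: \<psi>_def)
   ultimately show ?thesis using pw[OF True] True by (simp add: ennreal_mult[symmetric] mult.assoc)
  qed simp
 qed
 also have "... = (\<integral>\<^sup>+t. (\<integral>\<^sup>+s. ennreal (\<beta> powr (1 - p)) * ennreal (indicator {0<..} s * s powr (- 1 - \<beta>) * (indicator {0<..<s} t * \<psi> t)) \<partial>lborel) \<partial>lborel)"
 proof (rule lborel_pair.Fubini')
  \<comment> \<open>The indicator of an interval with moving end point becomes that of a fixed
    planar set, for which joint measurability can be seen.\<close>
  have [measurable]: "{(x, y). (0::real) < x \<and> x < (y::real)} \<in> sets (lborel \<Otimes>\<^sub>M lborel)"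
  proof -
   have "{(x, y). (0::real) < x \<and> x < (y::real)} = {z \<in> space (borel \<Otimes>\<^sub>M borel). 0 < fst z \<and> fst z < snd z}"
    by (auto simp: space_pair_measure)
   also have "... \<in> sets (borel \<Otimes>\<^sub>M borel)" by measurable
   finally show ?thesis by (simp cong: sets_pair_measure_cong)
  qed
  have "(%(t, s). ennreal (\<beta> powr (1 - p)) * ennreal (indicator {0<..} s * s powr (- 1 - \<beta>) * (indicator {0<..<s} t * \<psi> t)))
   = (%z. ennreal (\<beta> powr (1 - p)) * ennreal (indicator {0<..} (snd z) * snd z powr (- 1 - \<beta>) * (indicator {(x, y). (0::real) < x \<and> x < (y::real)} z * \<psi> (fst z))))"
   by (auto simp: fun_eq_iff split: split_indicator)
  also have "... \<in> borel_measurable (lborel \<Otimes>\<^sub>M lborel)" by measurable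
  finally show "(%(t, s). ennreal (\<beta> powr (1 - p)) * ennreal (indicator {0<..} s * s powr (- 1 - \<beta>) * (indicator {0<..<s} t * \<psi> t)))
    \<in> borel_measurable (lborel \<Otimes>\<^sub>M lborel)" .
 qed
 also have "... = (\<integral>\<^sup>+t. ennreal (\<beta> powr (- p) * (indicator {0<..} t * \<phi> t powr p)) \<partial>lborel)"
 proof (rule nn_integral_cong)
  fix t :: real
  show "(\<integral>\<^sup>+s. ennreal (\<beta> powr (1 - p)) * ennreal (indicator {0<..} s * s powr (- 1 - \<beta>) * (indicator {0<..<s} t * \<psi> t)) \<partial>lborel)
    = ennreal (\<beta> powr (- p) * (indicator {0<..} t * \<phi> t powr p))"
  proof (cases "t > 0")
   case True
   have "(\<integral>\<^sup>+s. ennreal (\<beta> powr (1 - p)) * ennreal (indicator {0<..} s * s powr (- 1 - \<beta>) * (indicator {0<..<s} t * \<psi> t)) \<partial>lborel)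
    = (\<integral>\<^sup>+s. ennreal (\<beta> powr (1 - p) * \<psi> t) * ennreal (indicator {t<..} s * s powr (- 1 - \<beta>)) \<partial>lborel)"
    using True by (intro nn_integral_cong) (auto simp: ennreal_mult[symmetric] \<psi>_def ac_simps split: split_indicator)
   also have "... = ennreal (\<beta> powr (1 - p) * \<psi> t) * ennreal (t powr (- \<beta>) / \<beta>)"
    using nn_integral_powr_inf[of "- 1 - \<beta>" t] True \<beta> by (simp add: nn_integral_cmult)
   also have "... = ennreal (\<beta> powr (1 - p) * \<psi> t * (t powr (- \<beta>) / \<beta>))"
    using \<beta> by (simp add: ennreal_mult[symmetric] \<psi>_def)
   also have "\<beta> powr (1 - p) * \<psi> t * (t powr (- \<beta>) / \<beta>) = \<beta> powr (- p) * \<phi> t powr p"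
   proof -
    have "\<beta> powr (1 - p) / \<beta> = \<beta> powr (- p)" using \<beta>(1) by (simp add: powr_diff powr_minus field_simps)
    moreover have "t powr \<beta> * t powr (- \<beta>) = 1" using True by (simp add: powr_minus)
    moreover have "\<beta> powr (1 - p) * \<psi> t * (t powr (- \<beta>) / \<beta>) = (\<beta> powr (1 - p) / \<beta>) * (t powr \<beta> * t powr (- \<beta>)) * \<phi> t powr p"
     by (simp add: \<psi>_def)
    ultimately show ?thesis by simp
   qed
   finally show ?thesis using True by simp
  next
   case False
   then have "indicator {0<..<s} t = (0::real)" for s :: real by auto
   then show ?thesis using False by simp
  qed
 qed
 also have "... = ennreal (LINT t|lborel. \<beta> powr (- p) * (indicator {0<..} t * \<phi> t powr p))"
  by (rule nn_integral_eq_integral) (use int in auto)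
 finally show "(\<integral>\<^sup>+s. ennreal (indicator {0<..} s * ((LINT t|lborel. indicator {0<..<s} t * \<phi> t) / s) powr p) \<partial>lborel)
   <= ennreal (\<beta> powr (- p) * (LINT t|lborel. indicator {0<..} t * \<phi> t powr p))" by simp
qed

text \<open>Stated for a function \<open>K\<close> below the primitive of \<open>\<phi>\<close>
  rather than for the primitive itself, since \<open>K\<close> is going to be a K-functional. The
  bound \<open>Kle\<close> may presuppose integrability of \<open>\<phi>\<close> near 0, which the
  Borel version supplies.\<close>

lemma Hardy:
 fixes \<phi> K :: "real => real"
 assumes p: "p > 1" and \<phi>: "\<phi> \<in> borel_measurable lebesgue" and \<phi>0: "!!t. \<phi> t >= 0"
  and int: "integrable lebesgue (%t. indicator {0<..} t * \<phi> t powr p)"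
  and K[measurable]: "K \<in> borel_measurable borel" and K0: "!!s. s > 0 ==> 0 <= K s"
  and Kle: "!!s. s > 0 ==> integrable lebesgue (%t. indicator {0<..<s} t * \<phi> t) ==> K s <= (LINT t|lebesgue. indicator {0<..<s} t * \<phi> t)"
 shows "integrable lborel (%s. indicator {0<..} s * (K s / s) powr p)"
  and "(LINT s|lborel. indicator {0<..} s * (K s / s) powr p)
   <= ((p - 1) / p) powr (- p) * (LINT t|lebesgue. indicator {0<..} t * \<phi> t powr p)"
proof -
 obtain \<phi>1 where \<phi>1[measurable]: "\<phi>1 \<in> borel_measurable lborel" and ae1: "AE t in lborel. \<phi> t = \<phi>1 t"
  using completion_ex_borel_measurable_real[OF \<phi>] by auto
 define \<phi>' where "\<phi>' t = max 0 (\<phi>1 t)" for t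
 have [measurable]: "\<phi>' \<in> borel_measurable borel" using \<phi>1 unfolding \<phi>'_def by measurable
 have ae: "AE t in lebesgue. \<phi> t = \<phi>' t"
 proof (rule AE_completion)
  show "AE t in lborel. \<phi> t = \<phi>' t"
   using ae1
  proof eventually_elim
   case (elim t)
   then show ?case using \<phi>0[of t] by (simp add: \<phi>'_def)
  qed
 qed
 have m': "\<phi>' \<in> borel_measurable lebesgue" by (rule measurable_completion) simp
 have intl: "integrable lebesgue (%t. indicator {0<..} t * \<phi>' t powr p)"
  by (rule bochner_cong_AE[OF int])
   (use ae measurable_completion[of "%t. indicator {0<..} t * \<phi>' t powr p" lborel borel] in \<open>auto elim: eventually_mono\<close>)
 then have int': "integrable lborel (%t. indicator {0<..} t * \<phi>' t powr p)" by (simp add: integrable_completion)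
 have Ieq: "(LINT t|lborel. indicator {0<..} t * \<phi>' t powr p) = (LINT t|lebesgue. indicator {0<..} t * \<phi> t powr p)"
 proof -
  have "(LINT t|lborel. indicator {0<..} t * \<phi>' t powr p) = (LINT t|lebesgue. indicator {0<..} t * \<phi>' t powr p)"
   by (subst integral_completion) auto
  also have "... = (LINT t|lebesgue. indicator {0<..} t * \<phi> t powr p)"
   by (rule integral_cong_AE) (use ae borel_measurable_integrable[OF int] borel_measurable_integrable[OF intl] in \<open>auto elim: eventually_mono\<close>)
  finally show ?thesis .
 qed
 have "!!t. \<phi>' t >= 0" by (simp add: \<phi>'_def)
 note H = Hardy_borel[OF p _ this int', simplified]
 have K': "K s <= (LINT t|lborel. indicator {0<..<s} t * \<phi>' t)" if s: "s > 0" for s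
 proof -
  have i: "integrable lebesgue (%t. indicator {0<..<s} t * \<phi>' t)" using H(1)[OF s] by (simp add: integrable_completion)
  have ae2: "AE t in lebesgue. indicator {0<..<s} t * \<phi>' t = indicator {0<..<s} t * \<phi> t" using ae by eventually_elim simp
  have m2: "(%t. indicator {0<..<s} t * \<phi> t) \<in> borel_measurable lebesgue" by (intro borel_measurable_times \<phi> borel_measurable_indicator) auto
  have i2: "integrable lebesgue (%t. indicator {0<..<s} t * \<phi> t)"
   by (rule bochner_cong_AE[OF i m2]) (use ae2 in \<open>auto elim: eventually_mono\<close>)
  have "K s <= (LINT t|lebesgue. indicator {0<..<s} t * \<phi> t)" by (rule Kle[OF s i2])
  also have "... = (LINT t|lebesgue. indicator {0<..<s} t * \<phi>' t)"
   by (rule integral_cong_AE) (use ae2 m2 borel_measurable_integrable[OF i] in \<open>auto elim: eventually_mono\<close>)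
  also have "... = (LINT t|lborel. indicator {0<..<s} t * \<phi>' t)" by (subst integral_completion) auto
  finally show ?thesis .
 qed
 define c where "c = ((p - 1) / p) powr (- p) * (LINT t|lebesgue. indicator {0<..} t * \<phi> t powr p)"
 have c0: "c >= 0" unfolding c_def by (intro mult_nonneg_nonneg integral_nonneg_AE AE_I2) auto
 have "(\<integral>\<^sup>+s. ennreal (indicator {0<..} s * (K s / s) powr p) \<partial>lborel)
  <= (\<integral>\<^sup>+s. ennreal (indicator {0<..} s * ((LINT t|lborel. indicator {0<..<s} t * \<phi>' t) / s) powr p) \<partial>lborel)"
  by (intro nn_integral_mono ennreal_leI)
   (use K' K0 p in \<open>auto intro!: powr_mono2 divide_right_mono split: split_indicator\<close>)
 also have "... <= ennreal c" using H(2) by (simp add: c_def Ieq)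
 finally have nn: "(\<integral>\<^sup>+s. ennreal (indicator {0<..} s * (K s / s) powr p) \<partial>lborel) <= ennreal c" .
 show I: "integrable lborel (%s. indicator {0<..} s * (K s / s) powr p)"
  by (rule integrableI_bounded) (use le_less_trans[OF nn ennreal_less_top] in auto)
 show "(LINT s|lborel. indicator {0<..} s * (K s / s) powr p) <= ((p - 1) / p) powr (- p) * (LINT t|lebesgue. indicator {0<..} t * \<phi> t powr p)"
  using nn c0 by (subst (asm) nn_integral_eq_integral[OF I]) (auto simp: c_def)
qed

section \<open>Weak derivatives on the half-line\<close>

lemma test_fun_real_DERIV:
 fixes \<phi> :: "real => real"
 assumes "test_fun U \<phi>"
 shows "(\<phi> has_real_derivative deriv \<phi> x) (at x)" and "continuous_on UNIV (deriv \<phi>)"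
  and "deriv \<phi> = partial 1 \<phi>" and "!!k. Ck_on k UNIV (deriv \<phi>)"
proof -
 have C: "Ck_on (Suc k) UNIV \<phi>" for k using assms unfolding test_fun_def by blast
 from C[of 0] have d: "\<phi> differentiable (at x)" for x by simp
 then show D: "(\<phi> has_real_derivative deriv \<phi> x) (at x)" for x
  using DERIV_deriv_iff_real_differentiable by blast
 have "partial 1 \<phi> x = deriv \<phi> x" for x
  using fun_cong[OF frechet_derivative_at[OF D[of x, unfolded has_field_derivative_def]], of 1] by simp
 then show eq: "deriv \<phi> = partial 1 \<phi>" by auto
 show ck: "Ck_on k UNIV (deriv \<phi>)" for k using C[of k] unfolding eq by simp
 show "continuous_on UNIV (deriv \<phi>)" using ck[of 0] by simp
qed

lemma test_fun_real_support:
 fixes \<phi> :: "real => real"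
 assumes "test_fun {0<..} \<phi>"
 obtains a b where "0 < a" "a < b" "!!t. t \<notin> {a..b} ==> \<phi> t = 0" "!!t. t \<notin> {a..b} ==> deriv \<phi> t = 0"
proof -
 let ?S = "closure {x. \<phi> x ~= 0}"
 have c: "compact ?S" "?S \<subseteq> {0<..}" using assms by (auto simp: test_fun_def)
 obtain a b where ab: "0 < a" "a < b" "?S \<subseteq> {a..b}"
 proof (cases "?S = {}")
  case True then show ?thesis using that[of 1 2] by auto
 next
  case False
  obtain m where m: "m \<in> ?S" "!!t. t \<in> ?S ==> m <= t" using compact_attains_inf[OF c(1) False] by blast
  obtain n where n: "n \<in> ?S" "!!t. t \<in> ?S ==> t <= n" using compact_attains_sup[OF c(1) False] by blast
  show ?thesis using that[of m "n + 1"] m n c(2) by (force simp: subset_eq)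
 qed
 have z: "\<phi> t = 0" if "t \<notin> {a..b}" for t using that ab(3) closure_subset[of "{x. \<phi> x ~= 0}"] by auto
 moreover have "deriv \<phi> t = 0" if t: "t \<notin> {a..b}" for t
 proof -
  have "(\<phi> has_real_derivative 0) (at t)"
   by (rule has_field_derivative_transform_within_open[of "%_. 0" _ _ "- {a..b}"]) (use t z in auto)
  then show ?thesis by (rule DERIV_imp_deriv)
 qed
 ultimately show ?thesis using that ab by blast
qed

lemma test_fun_real_support':
 fixes \<phi> :: "real => real"
 assumes "test_fun {0<..} \<phi>"
 obtains a b where "0 < a" "a < b" "!!t. t \<notin> {a..b} ==> \<phi> t = 0"
proof (rule test_fun_real_support[OF assms])
 fix a b assume "0 < a" "a < b" "!!t. t \<notin> {a..b} ==> \<phi> t = 0"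
 then show thesis by (rule that)
qed

lemma test_fun_integrable_mult:
 fixes \<phi> v :: "'a::euclidean_space => real"
 assumes "continuous_on UNIV \<phi>" "compact K" "!!t. t \<notin> K ==> \<phi> t = 0"
  and "integrable lebesgue (%t. indicator K t * v t)"
 shows "integrable lebesgue (%t. v t * \<phi> t)" 
proof -
 have "bounded (\<phi> ` K)" by (intro compact_imp_bounded compact_continuous_image assms continuous_on_subset[OF assms(1)]) auto
 then obtain B where B: "!!t. t \<in> K ==> \<bar>\<phi> t\<bar> <= B" by (metis (no_types, lifting) bounded_iff imageI real_norm_def)
 have eq: "v t * \<phi> t = (indicator K t * v t) * \<phi> t" for t using assms(3)[of t] by (auto split: split_indicator)
 show ?thesis
 proof (rule bochner_bound)
  show "integrable lebesgue (%t. max B 0 * (indicator K t * v t))" using assms(4) by auto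
  show "(%t. v t * \<phi> t) \<in> borel_measurable lebesgue"
   unfolding eq by (intro borel_measurable_times borel_measurable_integrable[OF assms(4)] continuous_imp_measurable_lebesgue assms)
  show "AE t in lebesgue. norm (v t * \<phi> t) <= norm (max B 0 * (indicator K t * v t))"
  proof (rule AE_I2)
   fix t
   show "norm (v t * \<phi> t) <= norm (max B 0 * (indicator K t * v t))"
   proof (cases "t \<in> K")
    case True
    then have "\<bar>\<phi> t\<bar> <= max B 0" using B by force
    then have "\<bar>v t\<bar> * \<bar>\<phi> t\<bar> <= \<bar>v t\<bar> * max B 0" by (intro mult_left_mono) auto
    then show ?thesis using True by (simp add: abs_mult mult.commute)
   qed (use assms(3) in auto)
  qed
 qed
qed

text \<open>Fubini's theorem on the triangle \<open>0 <= s <= t\<close>: integrating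
  \<open>deriv \<phi> t * v s\<close> first in \<open>s\<close> produces the increment of
  \<open>u\<close>, first in \<open>t\<close> it produces \<open>- \<phi> s\<close>.\<close>

lemma integral_AC_by_parts:
 fixes u v \<phi> :: "real => real"
 assumes v: "!!R. integrable lebesgue (%t. indicator {0..R} t * v t)"
  and u: "!!t. t >= 0 ==> u t = u 0 + (LINT s|lebesgue. indicator {0..t} s * v s)"
  and \<phi>: "test_fun {0<..} \<phi>"
 shows "(LINT t|lebesgue. deriv \<phi> t * u t) = - (LINT t|lebesgue. \<phi> t * v t)"
  and "integrable lebesgue (%t. deriv \<phi> t * u t)" and "integrable lebesgue (%t. \<phi> t * v t)"
proof -
 obtain a b where ab: "0 < a" "a < b" and z: "!!t. t \<notin> {a..b} ==> \<phi> t = 0" and z': "!!t. t \<notin> {a..b} ==> deriv \<phi> t = 0"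
  by (rule test_fun_real_support[OF \<phi>]) blast
 note D = test_fun_real_DERIV(1)[OF \<phi>]
 note cD = test_fun_real_DERIV(2)[OF \<phi>]
 have c\<phi>: "continuous_on UNIV \<phi>" by (rule continuous_test_fun[OF \<phi>])
 \<comment> \<open>Product measurability in the double integral requires a Borel version of
   \<open>v\<close>; beyond \<open>b\<close>, where \<open>\<phi>\<close> vanishes, it may be cut
   off.\<close>
 obtain w where w[measurable]: "w \<in> borel_measurable lborel" and aew: "AE t in lborel. indicator {0..b} t * v t = w t"
  using completion_ex_borel_measurable_real[of "%t. indicator {0..b} t * v t" lborel] v[of b] by auto
 have aew': "AE t in lebesgue. indicator {0..b} t * v t = w t" by (rule AE_completion[OF aew])
 have wl: "w \<in> borel_measurable lebesgue" by (rule measurable_completion[OF w])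
 have iwl: "integrable lebesgue w"
  by (rule bochner_cong_AE[OF v[of b] wl]) (use aew' in \<open>auto elim: eventually_mono\<close>)
 then have iw: "integrable lborel w" using w by (simp add: integrable_completion)
 have U: "(LINT s|lebesgue. indicator {0..t} s * v s) = (LINT s|lborel. indicator {0..t} s * w s)" if "t <= b" for t
 proof -
  have "(LINT s|lebesgue. indicator {0..t} s * v s) = (LINT s|lebesgue. indicator {0..t} s * w s)"
  proof (rule integral_cong_AE)
   show "AE s in lebesgue. indicator {0..t} s * v s = indicator {0..t} s * w s"
    using aew' by eventually_elim (use that in \<open>auto split: split_indicator split_indicator_asm\<close>)
  qed (use borel_measurable_integrable[OF v[of t]] wl in \<open>auto intro!: borel_measurable_times borel_measurable_indicator\<close>)
  then show ?thesis by (subst (asm) integral_completion) auto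
 qed
 have cont: "(LINT t|lborel. indicator {s..b} t * deriv \<phi> t) = - \<phi> s" if "s >= 0" for s
 proof (cases "s <= b")
  case True
  have "(LINT t|lborel. deriv \<phi> t * indicator {s..b} t) = \<phi> b - \<phi> s"
   by (rule integral_FTC_Icc_real[OF True]) (use D cD in \<open>auto intro: continuous_on_interior simp: continuous_on_eq_continuous_at\<close>)
  moreover have "\<phi> b = 0"
  proof -
   have "(\<phi> \<longlongrightarrow> \<phi> b) (at_right b)" using c\<phi> by (auto simp: continuous_on_def intro: tendsto_within_subset)
   moreover have "(\<phi> \<longlongrightarrow> 0) (at_right b)"
    by (rule tendsto_eventually) (use z in \<open>auto simp: eventually_at_filter\<close>)
   ultimately show ?thesis using tendsto_unique trivial_limit_at_right_real by blast
  qed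
  ultimately show ?thesis by (simp add: mult.commute)
 next
  case False then show ?thesis using z[of s] by simp
 qed
 have bd: "\<exists>B. \<forall>t. \<bar>deriv \<phi> t\<bar> <= B"
 proof -
  have "bounded (deriv \<phi> ` {a..b})" by (intro compact_imp_bounded compact_continuous_image continuous_on_subset[OF cD]) auto
  then obtain B where "!!t. t \<in> {a..b} ==> \<bar>deriv \<phi> t\<bar> <= B" by (metis (no_types, lifting) bounded_iff imageI real_norm_def)
  then have "\<bar>deriv \<phi> t\<bar> <= max B 0" for t using z'[of t] by (cases "t \<in> {a..b}") force+
  then show ?thesis by blast
 qed
 then obtain B where B: "!!t. \<bar>deriv \<phi> t\<bar> <= B" by blast
 have dm[measurable]: "deriv \<phi> \<in> borel_measurable borel" by (rule borel_measurable_continuous_onI[OF cD])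
 define f where "f t s = (indicator {0..b} t * deriv \<phi> t) * (indicator {0..t} s * w s)" for t s
 have Hi: "integrable (lborel \<Otimes>\<^sub>M lborel) (%(t, s). f t s)"
 proof (rule bochner_bound)
  have i0: "integrable lborel (%t. indicator {0..b} t * B :: real)" by (intro integrable_mult_left integrable_real_indicator) (auto simp: emeasure_lborel_Icc_eq)
  show "integrable (lborel \<Otimes>\<^sub>M lborel) (%(t, s). (indicator {0..b} t * B) * w s)"
  proof (rule lborel_pair.Fubini_integrable)
   have "(%x. LINT y|lborel. norm (case (x, y) of (t, s) => indicator {0..b} t * B * w s))
    = (%x. norm (indicator {0..b} x * B) * (LINT y|lborel. norm (w y)))"
    using iw by (auto simp: abs_mult fun_eq_iff)
   moreover have "integrable lborel (%x. norm (indicator {0..b} x * B) * (LINT y|lborel. norm (w y)))"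
    by (intro integrable_mult_left integrable_norm i0)
   ultimately show "integrable lborel (%x. LINT y|lborel. norm (case (x, y) of (t, s) => indicator {0..b} t * B * w s))" by (simp only:)
  qed (use iw in auto)
  have [measurable]: "{(t, s). (0::real) <= s \<and> s <= (t::real)} \<in> sets (borel \<Otimes>\<^sub>M borel)"
  proof -
   have "{(t, s). (0::real) <= s \<and> s <= (t::real)} = {z \<in> space (borel \<Otimes>\<^sub>M borel). 0 <= snd z \<and> snd z <= fst z}"
    by (auto simp: space_pair_measure)
   also have "... \<in> sets (borel \<Otimes>\<^sub>M borel)" by measurable
   finally show ?thesis .
  qed
  have "(%(t, s). f t s) = (%z. (indicator {0..b} (fst z) * deriv \<phi> (fst z)) * (indicator {(t, s). (0::real) <= s \<and> s <= (t::real)} z * w (snd z)))"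
   by (auto simp: f_def fun_eq_iff split: split_indicator)
  also have "... \<in> borel_measurable (lborel \<Otimes>\<^sub>M lborel)" by measurable
  finally show "(%(t, s). f t s) \<in> borel_measurable (lborel \<Otimes>\<^sub>M lborel)" .
  have "\<bar>deriv \<phi> t\<bar> * \<bar>w s\<bar> <= \<bar>B\<bar> * \<bar>w s\<bar>" for t s
   by (intro mult_right_mono order_trans[OF B abs_ge_self]) auto
  then show "AE x in lborel \<Otimes>\<^sub>M lborel. norm (case x of (t, s) => f t s) <= norm (case x of (t, s) => (indicator {0..b} t * B) * w s)"
   by (auto simp: f_def abs_mult split: split_indicator)
 qed
 have ft: "(LINT s|lborel. f t s) = deriv \<phi> t * u t - indicator {0..b} t * deriv \<phi> t * u 0" for t
 proof (cases "t \<in> {0..b}")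
  case True
  have "(LINT s|lborel. f t s) = (indicator {0..b} t * deriv \<phi> t) * (LINT s|lborel. indicator {0..t} s * w s)"
   unfolding f_def by (rule integral_mult_right_zero)
  then show ?thesis using True u[of t] U[of t] by (simp add: right_diff_distrib[symmetric])
 next
  case False then show ?thesis using z'[of t] ab by (simp add: f_def)
 qed
 have fs: "(LINT t|lborel. f t s) = - (\<phi> s * w s)" for s
 proof (cases "s >= 0")
  case True
  have "(LINT t|lborel. f t s) = (LINT t|lborel. (indicator {s..b} t * deriv \<phi> t) * w s)"
   using True by (intro bochner_cong) (auto simp: f_def split: split_indicator)
  then show ?thesis using cont[OF True] by simp
 next
  case False then show ?thesis using z[of s] ab by (simp add: f_def)
 qed
 have i0: "integrable lborel (%t. indicator {0..b} t * deriv \<phi> t * u 0)"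
 proof -
  have "integrable lborel (%t. indicator {0..b} t *\<^sub>R deriv \<phi> t)"
   by (rule borel_integrable_compact) (use continuous_on_subset[OF cD] in auto)
  then show ?thesis by (intro integrable_mult_left) simp
 qed
 have int_diff: "integrable lborel (%t. deriv \<phi> t * u t - indicator {0..b} t * deriv \<phi> t * u 0)"
  using lborel_pair.integrable_fst[OF Hi] by (simp add: ft)
 then have iu: "integrable lborel (%t. deriv \<phi> t * u t)"
  using Bochner_Integration.integrable_add[OF int_diff i0] by simp
 then show "integrable lebesgue (%t. deriv \<phi> t * u t)"
  by (subst integrable_completion) (auto dest: borel_measurable_integrable)
 show iv: "integrable lebesgue (%t. \<phi> t * v t)"
  using test_fun_integrable_mult[of \<phi> "{0..b}" v] c\<phi> z ab v[of b] by (simp add: mult.commute)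
 have "(LINT t|lebesgue. deriv \<phi> t * u t) = (LINT t|lborel. deriv \<phi> t * u t)"
  by (subst integral_completion) (use iu in \<open>auto dest: borel_measurable_integrable\<close>)
 also have "... = (LINT t|lborel. (LINT s|lborel. f t s)) + (LINT t|lborel. indicator {0..b} t * deriv \<phi> t * u 0)"
  by (subst Bochner_Integration.integral_add[symmetric]) (use int_diff i0 in \<open>auto simp: ft\<close>)
 also have "(LINT t|lborel. indicator {0..b} t * deriv \<phi> t * u 0) = 0" using cont[of 0] z[of 0] ab by simp
 also have "(LINT t|lborel. (LINT s|lborel. f t s)) = (LINT s|lborel. (LINT t|lborel. f t s))"
  by (rule lborel_pair.Fubini_integral[OF Hi, symmetric])
 also have "... = - (LINT s|lborel. \<phi> s * w s)" by (simp add: fs)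
 also have "(LINT s|lborel. \<phi> s * w s) = (LINT s|lebesgue. \<phi> s * w s)"
  using borel_measurable_continuous_onI[OF c\<phi>] by (subst integral_completion) auto
 also have "... = (LINT s|lebesgue. \<phi> s * v s)"
 proof (rule integral_cong_AE)
  show "AE s in lebesgue. \<phi> s * w s = \<phi> s * v s"
   using aew'
  proof eventually_elim
   case (elim s)
   then show ?case using z[of s] ab by (cases "s \<in> {0..b}") auto
  qed
 qed (use borel_measurable_integrable[OF iv] wl continuous_imp_measurable_lebesgue[OF c\<phi>] in auto)
 finally show "(LINT t|lebesgue. deriv \<phi> t * u t) = - (LINT t|lebesgue. \<phi> t * v t)" by simp
qed

lemma test_fun_add_scale:
 fixes f g :: "'a::euclidean_space => real"
 assumes f: "test_fun U f" and g: "test_fun U g" shows "test_fun U (%x. f x + c * g x)"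
proof -
 have sub: "closure {x. f x + c * g x ~= 0} \<subseteq> closure {x. f x ~= 0} \<union> closure {x. g x ~= 0}"
  unfolding closure_Un[symmetric] by (rule closure_mono) auto
 moreover have "compact (closure {x. f x ~= 0} \<union> closure {x. g x ~= 0})" using f g by (auto simp: test_fun_def)
 ultimately have "compact (closure {x. f x + c * g x ~= 0})"
  using sub closed_closure compact_Int_closed[of "closure {x. f x ~= 0} \<union> closure {x. g x ~= 0}" "closure {x. f x + c * g x ~= 0}"]
  by (simp add: Int_absorb1)
 moreover have "Ck_on k UNIV (%x. f x + c * g x)" for k
 proof -
  have "Ck_on k UNIV f" "Ck_on k UNIV g" using f g unfolding test_fun_def by blast+
  then show ?thesis by (rule Ck_on_add[OF _ Ck_on_mult[OF Ck_on_const]])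
 qed
 moreover have "closure {x. f x + c * g x ~= 0} \<subseteq> U"
  using sub f g unfolding test_fun_def by (meson Un_subset_iff order_trans Un_mono sup.idem le_sup_iff)
 ultimately show ?thesis unfolding test_fun_def by simp
qed

text \<open>The vanishing mean makes the primitive return to 0 on the right of the support, so that
  it is again a test function.\<close>

lemma test_fun_antiderivative:
 fixes \<eta> :: "real => real"
 assumes \<eta>: "test_fun {0<..} \<eta>" and 0: "(LINT t|lborel. \<eta> t) = 0"
 shows "\<exists>\<psi>. test_fun {0<..} \<psi> \<and> deriv \<psi> = \<eta>"
proof -
 obtain a b where ab: "0 < a" "a < b" and z: "!!t. t \<notin> {a..b} ==> \<eta> t = 0"
  by (rule test_fun_real_support'[OF \<eta>]) blast
 have c: "continuous_on UNIV \<eta>" by (rule continuous_test_fun[OF \<eta>])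
 obtain F where F: "!!x. (F has_vector_derivative \<eta> x) (at x)"
  using einterval_antiderivative[of "-\<infinity>" "\<infinity>" \<eta>] c by (auto simp: continuous_on_eq_continuous_at)
 define \<psi> where "\<psi> x = F x - F a" for x
 have D: "(\<psi> has_real_derivative \<eta> x) (at x)" for x
  unfolding \<psi>_def using F[of x] by (auto intro!: derivative_eq_intros simp: has_real_derivative_iff_has_vector_derivative)
 have FTC: "(LINT t|lborel. \<eta> t * indicator {x..y} t) = \<psi> y - \<psi> x" if "x <= y" for x y
  by (rule integral_FTC_Icc_real[OF that]) (use D c in \<open>auto simp: continuous_on_eq_continuous_at\<close>)
 have za: "\<eta> a = 0"
 proof -
  have "(\<eta> \<longlongrightarrow> \<eta> a) (at_left a)" using c by (auto simp: continuous_on_def intro: tendsto_within_subset)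
  moreover have "(\<eta> \<longlongrightarrow> 0) (at_left a)"
   by (rule tendsto_eventually) (use z in \<open>auto simp: eventually_at_filter\<close>)
  ultimately show ?thesis using tendsto_unique trivial_limit_at_left_real by blast
 qed
 have out: "\<psi> t = 0" if t: "t \<notin> {a..b}" for t
 proof (cases "t < a")
  case True
  have "(LINT s|lborel. \<eta> s * indicator {t..a} s) = (LINT s|(lborel :: real measure). 0)"
   using z za by (intro bochner_cong) (auto simp: less_eq_real_def split: split_indicator)
  then show ?thesis using FTC[of t a] True by (simp add: \<psi>_def)
 next
  case False
  then have tb: "t > b" using t by auto
  have "(LINT s|lborel. \<eta> s * indicator {a..t} s) = (LINT s|lborel. \<eta> s)"
   using z tb by (intro bochner_cong) (auto split: split_indicator)
  then show ?thesis using FTC[of a t] tb ab 0 by (simp add: \<psi>_def)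
 qed
 have p1: "partial 1 \<psi> = \<eta>"
 proof
  fix x show "partial 1 \<psi> x = \<eta> x"
   using fun_cong[OF frechet_derivative_at[OF D[of x, unfolded has_field_derivative_def]], of 1] by simp
 qed
 have dif: "\<psi> differentiable (at x)" for x using D real_differentiable_def by blast
 have "Ck_on k UNIV \<psi>" for k
 proof (cases k)
  case 0
  then show ?thesis using dif by (simp add: continuous_on_eq_continuous_at differentiable_imp_continuous_within)
 next
  case (Suc n)
  then show ?thesis using dif \<eta> by (auto simp: p1 test_fun_def)
 qed
 moreover have "{x. \<psi> x ~= 0} \<subseteq> {a..b}" using out by blast
 then have "closure {x. \<psi> x ~= 0} \<subseteq> {a..b}" by (intro closure_minimal) auto
 ultimately have "test_fun {0<..} \<psi>" unfolding test_fun_def using ab(1)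
  by (auto intro: bounded_subset[of "{a..b}"] simp: compact_eq_bounded_closed)
 moreover have "deriv \<psi> = \<eta>" using D by (auto simp: fun_eq_iff intro: DERIV_imp_deriv)
 ultimately show ?thesis by blast
qed

lemma continuous_on_indefinite_integral:
 fixes v :: "real => real"
 assumes v: "!!R. integrable lebesgue (%t. indicator {0..R} t * v t)"
 shows "continuous_on {0..b} (%t. LINT s|lebesgue. indicator {0..t} s * v s)"
proof -
 have si: "set_integrable lebesgue {0..t} v" for t using v[of t] by (simp add: set_integrable_def)
 then have "v absolutely_integrable_on {0..b}" .
 then have "v integrable_on {0..b}" by (rule absolutely_integrable_on_def[THEN iffD1, THEN conjunct1])
 then have "continuous_on {0..b} (%t. integral {0..t} v)" by (rule indefinite_integral_continuous_1)
 moreover have "integral {0..t} v = (LINT s|lebesgue. indicator {0..t} s * v s)" for t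
  using set_lebesgue_integral_eq_integral(2)[OF si[of t]] by (simp add: set_lebesgue_integral_def)
 ultimately show ?thesis by simp
qed

text \<open>Subtracting the primitive \<open>F\<close> of \<open>v\<close> leaves a function
  \<open>w\<close> with zero weak derivative. Every test function becomes the derivative of a test
  function after subtraction of a multiple of one fixed bump \<open>\<beta>\<close>, chosen to
  remove the mean; so \<open>w\<close> minus a constant is orthogonal to all test functions.\<close>

lemma weak_derivative_imp_AC:
 fixes u v :: "real => real"
 assumes u: "!!K. compact K ==> K \<subseteq> {0<..} ==> integrable lebesgue (%t. indicator K t * u t)"
  and v: "!!R. integrable lebesgue (%t. indicator {0..R} t * v t)"
  and weak: "!!\<phi>. test_fun {0<..} \<phi> ==> (LINT t|lebesgue. deriv \<phi> t * u t) = - (LINT t|lebesgue. \<phi> t * v t)"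
 shows "\<exists>c. AE t in lebesgue. t \<in> {0<..} --> u t = c + (LINT s|lebesgue. indicator {0..t} s * v s)"
proof -
 define F where "F t = (LINT s|lebesgue. indicator {0..t} s * v s)" for t
 have F0: "F 0 = 0"
 proof -
  show ?thesis unfolding F_def
  proof (rule integral_eq_zero_AE)
   show "AE s in lebesgue. indicator {0..0} s * v s = 0"
    using AE_not_in[of "{0::real}" lebesgue] by (auto elim: eventually_mono)
  qed
 qed
 note P = integral_AC_by_parts[of v F, OF v, unfolded F0 add_0, OF F_def]
 define w where "w t = u t - F t" for t
 have test_int: "integrable lebesgue (%t. \<phi> t * u t)" if \<phi>: "test_fun {0<..} \<phi>" for \<phi>
 proof -
  obtain a b where ab: "0 < a" "a < b" and z: "!!t. t \<notin> {a..b} ==> \<phi> t = 0"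
   by (rule test_fun_real_support'[OF \<phi>]) blast
  have "{a..b} \<subseteq> {0<..}" using ab by auto
  then show ?thesis
   using test_fun_integrable_mult[OF continuous_test_fun[OF \<phi>], of "{a..b}" u] z u[of "{a..b}"] by (simp add: mult.commute)
 qed
 have wK: "integrable lebesgue (%t. indicator K t * w t)" if K: "compact K" "K \<subseteq> {0<..}" for K
 proof -
  obtain b where b: "K \<subseteq> {0..b}"
   using compact_imp_bounded[OF K(1)] K(2) by (fastforce simp: bounded_iff subset_eq)
  have "integrable lborel (%t. indicator K t *\<^sub>R F t)"
   unfolding F_def by (rule borel_integrable_compact[OF K(1) continuous_on_subset[OF continuous_on_indefinite_integral[OF v] b]])
  then have "integrable lebesgue (%t. indicator K t *\<^sub>R F t)"
   by (subst integrable_completion) (auto dest: borel_measurable_integrable)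
  then show ?thesis using u[OF K] by (simp add: w_def right_diff_distrib)
 qed
 have antider: "\<exists>\<psi>. test_fun {0<..} \<psi> \<and> deriv \<psi> = \<eta>" if "test_fun {0<..} \<eta>" "(LINT t|lborel. \<eta> t) = 0" for \<eta> :: "real => real"
  by (rule test_fun_antiderivative[OF that])
 define \<beta> where "\<beta> = box_bump 1 (2::real) 0"
 have \<beta>: "test_fun {0<..} \<beta>" unfolding \<beta>_def by (rule test_fun_box_bump) auto
 have ti: "integrable lborel \<phi>" if \<phi>: "test_fun {0<..} \<phi>" for \<phi> :: "real => real"
 proof -
  obtain a b where ab: "0 < a" "a < b" and z: "!!t. t \<notin> {a..b} ==> \<phi> t = 0"
   by (rule test_fun_real_support'[OF \<phi>]) blast
  have "integrable lborel (%t. indicator {a..b} t *\<^sub>R \<phi> t)"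
   by (rule borel_integrable_compact) (use continuous_on_subset[OF continuous_test_fun[OF \<phi>]] in auto)
  moreover have "(%t. indicator {a..b} t *\<^sub>R \<phi> t) = \<phi>" using z by (auto simp: fun_eq_iff split: split_indicator)
  ultimately show ?thesis by simp
 qed
 define m where "m = (LINT t|lborel. \<beta> t)"
 have m: "m ~= 0"
 proof
  assume "m = 0"
  then have "AE t in lborel. \<beta> t = 0"
   using integral_nonneg_eq_0_iff_AE[OF ti[OF \<beta>], OF AE_I2] box_bump_bounds(1) unfolding m_def \<beta>_def by blast
  then have "AE t in lborel. t \<notin> {1<..<2::real}" by (simp add: \<beta>_def box_bump_eq_0)
  then have "{1<..<2::real} \<in> null_sets lborel" by (subst AE_iff_null_sets) auto
  then show False by (simp add: null_sets_def)
 qed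
 \<comment> \<open>The constant is forced by testing with \<open>\<beta>\<close>: it is the mean of
   \<open>w\<close> with weight \<open>\<beta>\<close>.\<close>
 define c where "c = (LINT t|lebesgue. \<beta> t * w t) / m"
 have wi: "integrable lebesgue (%t. \<phi> t * w t)" if \<phi>: "test_fun {0<..} \<phi>" for \<phi>
 proof -
  obtain a b where ab: "0 < a" "a < b" and z: "!!t. t \<notin> {a..b} ==> \<phi> t = 0"
   by (rule test_fun_real_support'[OF \<phi>]) blast
  have "{a..b} \<subseteq> {0<..}" using ab by auto
  then show ?thesis
   using test_fun_integrable_mult[OF continuous_test_fun[OF \<phi>], of "{a..b}" w] z wK[of "{a..b}"] by (simp add: mult.commute)
 qed
 have "AE t in lebesgue. t \<in> {0<..} --> w t - c = 0"
 proof (rule du_Bois_Reymond)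
  show "integrable lebesgue (%t. indicator K t * (w t - c))" if "compact K" "K \<subseteq> {0<..}" for K
  proof -
   have "integrable lebesgue (%t. indicator K t * c)"
    using lmeasurable_compact[OF that(1)] by (simp add: lmeasurable_iff_integrable)
   then show ?thesis using wK[OF that] by (simp add: right_diff_distrib)
  qed
  fix \<phi> :: "real => real" assume \<phi>: "test_fun {0<..} \<phi>"
  define M where "M = (LINT t|lborel. \<phi> t)"
  define \<eta> where "\<eta> t = \<phi> t + (- (M / m)) * \<beta> t" for t
  have "test_fun {0<..} \<eta>" unfolding \<eta>_def by (rule test_fun_add_scale[OF \<phi> \<beta>])
  moreover have "(LINT t|lborel. \<eta> t) = 0" using ti[OF \<phi>] ti[OF \<beta>] m by (simp add: \<eta>_def M_def m_def)
  ultimately obtain \<psi> where \<psi>: "test_fun {0<..} \<psi>" "deriv \<psi> = \<eta>" using antider by blast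
  have "(LINT t|lebesgue. \<eta> t * w t) = (LINT t|lebesgue. \<eta> t * u t) - (LINT t|lebesgue. \<eta> t * F t)"
   using P(2)[OF \<psi>(1)] test_int[OF \<open>test_fun {0<..} \<eta>\<close>]
   by (subst Bochner_Integration.integral_diff[symmetric]) (auto simp: w_def algebra_simps \<psi>(2))
  also have "... = 0" using weak[OF \<psi>(1)] P(1)[OF \<psi>(1)] by (simp add: \<psi>(2))
  finally have "(LINT t|lebesgue. \<eta> t * w t) = 0" .
  moreover have "(LINT t|lebesgue. \<eta> t * w t) = (LINT t|lebesgue. \<phi> t * w t) - M * c"
  proof -
   have "(LINT t|lebesgue. \<eta> t * w t) = (LINT t|lebesgue. \<phi> t * w t + (- (M / m)) * (\<beta> t * w t))"
    by (rule bochner_cong) (auto simp: \<eta>_def algebra_simps)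
   then show ?thesis using wi[OF \<phi>] wi[OF \<beta>] by (simp add: c_def)
  qed
  moreover have "(LINT t|lebesgue. (w t - c) * \<phi> t) = (LINT t|lebesgue. \<phi> t * w t) - M * c"
  proof -
   have il: "integrable lebesgue \<phi>" using ti[OF \<phi>] by (subst integrable_completion) (auto dest: borel_measurable_integrable)
   have "M = (LINT t|lebesgue. \<phi> t)" unfolding M_def
    using ti[OF \<phi>] by (subst integral_completion) (auto dest: borel_measurable_integrable)
   moreover have "(LINT t|lebesgue. (w t - c) * \<phi> t) = (LINT t|lebesgue. \<phi> t * w t - \<phi> t * c)"
    by (rule bochner_cong) (auto simp: algebra_simps)
   ultimately show ?thesis using wi[OF \<phi>] il by simp
  qed
  ultimately show "(LINT t|lebesgue. (w t - c) * \<phi> t) = 0" by simp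
 qed auto
 then show ?thesis unfolding w_def F_def by (intro exI[of _ c]) (auto elim!: eventually_mono simp: algebra_simps)
qed

section \<open>Morrey's inequality\<close>

lemma has_derivative_partial_sum:
 fixes F :: "'a::euclidean_space => 'b::real_normed_vector"
 assumes "F differentiable (at x)"
 shows "(F has_derivative (%h. \<Sum>e\<in>Basis. (h \<bullet> e) *\<^sub>R partial e F x)) (at x)"
proof -
 interpret linear "frechet_derivative F (at x)" by (rule linear_frechet_derivative[OF assms])
 have "frechet_derivative F (at x) h = (\<Sum>e\<in>Basis. (h \<bullet> e) *\<^sub>R partial e F x)" for h
 proof -
  have "frechet_derivative F (at x) h = frechet_derivative F (at x) (\<Sum>e\<in>Basis. (h \<bullet> e) *\<^sub>R e)"
   by (simp only: euclidean_representation)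
  also have "... = (\<Sum>e\<in>Basis. frechet_derivative F (at x) ((h \<bullet> e) *\<^sub>R e))" by (rule sum)
  finally show ?thesis by (simp only: scale)
 qed
 then have eq: "frechet_derivative F (at x) = (%h. \<Sum>e\<in>Basis. (h \<bullet> e) *\<^sub>R partial e F x)" by (rule ext)
 have "(F has_derivative frechet_derivative F (at x)) (at x)"
  by (rule frechet_derivative_works[THEN iffD1, OF assms])
 then show ?thesis by (rule subst[OF eq, where P="%f'. (F has_derivative f') (at x)"])
qed

text \<open>The average of \<open>F\<close> over the cube of half-side \<open>s\<close> around \<open>x\<close> has \<open>s\<close>-derivative
 \<open>O(s powr (- d / q))\<close> by Hoelder's inequality, which is integrable at 0 for \<open>q > d\<close>.\<close>

lemma Morrey:
 fixes q :: real
 assumes q: "q > real DIM('a)"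
 shows "\<exists>C. \<forall>F :: 'a::euclidean_space => complex.
  (\<forall>x. F differentiable (at x)) --> (\<forall>e\<in>Basis. continuous_on UNIV (partial e F)) -->
  integrable lborel (%x. norm (F x) powr q) --> (\<forall>e\<in>Basis. integrable lborel (%x. norm (partial e F x) powr q)) -->
  (\<forall>x. norm (F x) <= C * ((LINT x|lborel. norm (F x) powr q) powr (1 / q)
    + (\<Sum>e\<in>Basis. (LINT x|lborel. norm (partial e F x) powr q) powr (1 / q))))"
proof -
 let ?d = "real DIM('a)"
 define Q where "Q = cbox (- One) (One :: 'a)"
 define r where "r = q / (q - 1)"
 define V where "V = (2::real) ^ DIM('a)"
 define \<alpha> where "\<alpha> = 1 - ?d / q"
 have q1: "q > 1" using q DIM_positive[where 'a='a] by linarith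
 have r: "1 / q + 1 / r = 1" using q1 by (simp add: r_def field_simps)
 have r0: "r > 0" using q1 by (simp add: r_def)
 have \<alpha>: "\<alpha> > 0" using q q1 by (simp add: \<alpha>_def)
 have V0: "V > 0" by (simp add: V_def)
 have Vm: "measure lborel Q = V" 
  unfolding Q_def V_def by (subst content_cbox_cases) (simp add: inner_diff_left)
 have Vl: "measure lborel Q = V" using Vm .
 have [measurable]: "Q \<in> sets borel" by (simp add: Q_def)
 have Qc: "compact Q" by (simp add: Q_def)
 have iQ: "integrable lborel (indicator Q :: 'a => real)" 
  by (intro integrable_real_indicator) (auto simp: Q_def emeasure_lborel_cbox_finite)
 have yQ: "\<bar>y \<bullet> e\<bar> <= 1" if "y \<in> Q" "e \<in> Basis" for y e
  using that by (auto simp: Q_def mem_box abs_le_iff)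
 have scaled: "integrable lborel (%y. indicator Q y * norm (G (x + s *\<^sub>R y)))"
  "(LINT y|lborel. indicator Q y * norm (G (x + s *\<^sub>R y))) <= V powr (1 / r) * s powr (\<alpha> - 1) * (LINT x|lborel. norm (G x) powr q) powr (1 / q)"
  if G: "continuous_on UNIV G" "integrable lborel (%x. norm (G x) powr q)" and s: "s > 0" for G :: "'a => complex" and x s
 proof -
  have GM: "G \<in> borel_measurable borel" using G(1) by (rule borel_measurable_continuous_onI)
  note [measurable] = GM
  have aff: "lborel = density (distr lborel borel (%y. x + s *\<^sub>R y)) (%_. \<bar>s\<bar> ^ DIM('a))"
   using lborel_affine[of s x] s by simp
  have N: "integrable lborel (%y. norm (G (x + s *\<^sub>R y)) powr q) \<and>
    (LINT y|lborel. norm (G (x + s *\<^sub>R y)) powr q) = s powr (- ?d) * (LINT x|lborel. norm (G x) powr q)"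
  proof -
   let ?g = "%x. norm (G x) powr q"
   have "integrable (density (distr lborel borel (%y. x + s *\<^sub>R y)) (%_. \<bar>s\<bar> ^ DIM('a))) ?g"
    using G(2) aff by simp
   then have "integrable (distr lborel borel (%y. x + s *\<^sub>R y)) (%x. (\<bar>s\<bar> ^ DIM('a)) *\<^sub>R ?g x)"
    by (subst (asm) integrable_density) auto
   then have "integrable (distr lborel borel (%y. x + s *\<^sub>R y)) ?g" using s by simp
   then have i: "integrable lborel (%y. ?g (x + s *\<^sub>R y))" by (subst (asm) integrable_distr_eq) auto
   have "(LINT x|lborel. ?g x) = (\<integral>x. ?g x \<partial>density (distr lborel borel (%y. x + s *\<^sub>R y)) (%_. \<bar>s\<bar> ^ DIM('a)))"
    using aff by simp
   also have "... = (\<integral>x. (\<bar>s\<bar> ^ DIM('a)) *\<^sub>R ?g x \<partial>distr lborel borel (%y. x + s *\<^sub>R y))"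
    by (subst integral_density) auto
   also have "... = s ^ DIM('a) * (LINT y|lborel. ?g (x + s *\<^sub>R y))"
    using s by (subst integral_distr) auto
   finally show ?thesis using i s by (simp add: powr_minus powr_realpow field_simps)
  qed
  have gi: "integrable lborel (%y. norm (indicator Q y :: complex) powr r)"
  proof -
   have "(%y. norm (indicator Q y :: complex) powr r) = indicator Q" by (auto simp: fun_eq_iff split: split_indicator)
   then show ?thesis using iQ by simp
  qed
  have gI: "(LINT y|lborel. norm (indicator Q y :: complex) powr r) = V"
  proof -
   have "(%y. norm (indicator Q y :: complex) powr r) = indicator Q" by (auto simp: fun_eq_iff split: split_indicator)
   then show ?thesis using Vm by simp
  qed
  have m1: "(%y. G (x + s *\<^sub>R y)) \<in> borel_measurable lborel" by simp
  have m2: "(indicator Q :: 'a => complex) \<in> borel_measurable lborel" by simp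
  note H = Hoelder[OF q1 r m1 m2 N[THEN conjunct1] gi]
  have eq: "norm (G (x + s *\<^sub>R y) * indicator Q y) = indicator Q y * norm (G (x + s *\<^sub>R y))" for y
   by (auto split: split_indicator)
  show "integrable lborel (%y. indicator Q y * norm (G (x + s *\<^sub>R y)))"
   using integrable_norm[OF H(1)] unfolding eq .
  have "(LINT y|lborel. indicator Q y * norm (G (x + s *\<^sub>R y)))
   <= (s powr (- ?d) * (LINT x|lborel. norm (G x) powr q)) powr (1 / q) * V powr (1 / r)"
   using H(2) unfolding eq gI N[THEN conjunct2] .
  also have "(s powr (- ?d) * (LINT x|lborel. norm (G x) powr q)) powr (1 / q)
    = s powr (\<alpha> - 1) * (LINT x|lborel. norm (G x) powr q) powr (1 / q)"
   by (simp add: powr_mult powr_powr \<alpha>_def)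
  finally show "(LINT y|lborel. indicator Q y * norm (G (x + s *\<^sub>R y)))
   <= V powr (1 / r) * s powr (\<alpha> - 1) * (LINT x|lborel. norm (G x) powr q) powr (1 / q)" by (simp add: ac_simps)
 qed
 define C where "C = V powr (1 / r) * (1 + 1 / \<alpha>) / V"
 show ?thesis
 proof (intro exI[of _ C] allI impI)
  fix F :: "'a => complex" and x
  assume F: "\<forall>x. F differentiable (at x)" and cF: "\<forall>e\<in>Basis. continuous_on UNIV (partial e F)"
   and iF: "integrable lborel (%x. norm (F x) powr q)" and iP: "\<forall>e\<in>Basis. integrable lborel (%x. norm (partial e F x) powr q)"
  define P where "P = (\<Sum>e\<in>Basis. (LINT x|lborel. norm (partial e F x) powr q) powr (1 / q))"
  define N where "N = (LINT x|lborel. norm (F x) powr q) powr (1 / q)"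
  have P0: "P >= 0" by (auto simp: P_def intro: sum_nonneg)
  have N0: "N >= 0" by (simp add: N_def)
  have Fc: "continuous_on UNIV F"
   using F by (simp add: continuous_on_eq_continuous_at differentiable_imp_continuous_within)
  define D where "D s y = (\<Sum>e\<in>Basis. (y \<bullet> e) *\<^sub>R partial e F (x + s *\<^sub>R y))" for s y
  have dline: "((%s. F (x + s *\<^sub>R y)) has_vector_derivative D s y) (at s)" for s y
  proof -
   have "((%s. x + s *\<^sub>R y) has_derivative (%h. h *\<^sub>R y)) (at s)" by (auto intro!: derivative_eq_intros)
   from has_derivative_compose[OF this has_derivative_partial_sum[OF F[rule_format]]]
   show ?thesis unfolding has_vector_derivative_def D_def by (simp add: scaleR_sum_right)
  qed
  have cD: "continuous_on UNIV (%(s, y). D s y)"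
   unfolding D_def case_prod_beta
   by (intro continuous_intros continuous_on_compose2[OF cF[rule_format]]) auto
  define A where "A s = integral Q (%y. F (x + s *\<^sub>R y))" for s
  have derA: "(A has_vector_derivative integral Q (D s)) (at s within {0..1})" if "s \<in> {0..1}" for s
   unfolding A_def Q_def
  proof (rule leibniz_rule_vector_derivative)
   show "((%s. F (x + s *\<^sub>R y)) has_vector_derivative D s y) (at s within {0..1})" for s y
    using dline has_vector_derivative_at_within by blast
   show "(%y. F (x + s *\<^sub>R y)) integrable_on cbox (- One) One" for s
    by (intro integrable_continuous continuous_on_compose2[OF Fc] continuous_intros) auto
   show "continuous_on ({0..1} \<times> cbox (- One) One) (%(s, y). D s y)"
    by (rule continuous_on_subset[OF cD]) auto
  qed (use that in auto)
  have bD: "norm (integral Q (D s)) <= V powr (1 / r) * P * s powr (\<alpha> - 1)" if s: "s > 0" for s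
  proof -
   have cDs: "continuous_on UNIV (D s)"
    unfolding D_def by (intro continuous_intros continuous_on_compose2[OF cF[rule_format]]) auto
   have iD: "integrable lborel (%y. indicator Q y *\<^sub>R D s y)"
    by (rule borel_integrable_compact[OF Qc continuous_on_subset[OF cDs]]) auto
   have "integral Q (D s) = (LINT y|lborel. indicator Q y *\<^sub>R D s y)"
    using set_borel_integral_eq_integral(2)[of Q "D s"] iD by (simp add: set_integrable_def set_lebesgue_integral_def)
   also have "norm ... <= (LINT y|lborel. norm (indicator Q y *\<^sub>R D s y))" by (rule integral_norm_bound)
   also have "... <= (LINT y|lborel. (\<Sum>e\<in>Basis. indicator Q y * norm (partial e F (x + s *\<^sub>R y))))"
   proof (rule integral_mono)
    show "integrable lborel (%y. \<Sum>e\<in>Basis. indicator Q y * norm (partial e F (x + s *\<^sub>R y)))"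
     by (intro Bochner_Integration.integrable_sum scaled(1)[OF _ _ s]) (use cF iP in auto)
    show "norm (indicator Q y *\<^sub>R D s y) <= (\<Sum>e\<in>Basis. indicator Q y * norm (partial e F (x + s *\<^sub>R y)))" for y
    proof (cases "y \<in> Q")
     case True
     have "norm (D s y) <= (\<Sum>e\<in>Basis. norm ((y \<bullet> e) *\<^sub>R partial e F (x + s *\<^sub>R y)))" unfolding D_def by (rule norm_sum)
     also have "... <= (\<Sum>e\<in>Basis. norm (partial e F (x + s *\<^sub>R y)))"
      using yQ[OF True] by (intro sum_mono) (auto intro!: mult_left_le_one_le)
     finally show ?thesis using True by simp
    qed simp
   qed (rule integrable_norm[OF iD])
   also have "... = (\<Sum>e\<in>Basis. (LINT y|lborel. indicator Q y * norm (partial e F (x + s *\<^sub>R y))))"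
    by (rule Bochner_Integration.integral_sum) (use scaled(1)[OF _ _ s] cF iP in auto)
   also have "... <= (\<Sum>e\<in>Basis. V powr (1 / r) * s powr (\<alpha> - 1) * (LINT x|lborel. norm (partial e F x) powr q) powr (1 / q))"
    by (intro sum_mono scaled(2)[OF _ _ s]) (use cF iP in auto)
   also have "... = V powr (1 / r) * P * s powr (\<alpha> - 1)"
    by (simp add: P_def sum_distrib_left ac_simps)
   finally show ?thesis .
  qed
  \<comment> \<open>The comparison function \<open>s powr \<alpha> / \<alpha>\<close> has the
    derivative \<open>s powr (\<alpha> - 1)\<close>, which may blow up at 0; the mean value
    inequality asks for derivatives in the open interval and for continuity at the ends.\<close>
  have "norm (A 1 - A 0) <= V powr (1 / r) * P * (1 powr \<alpha> / \<alpha>) - V powr (1 / r) * P * (0 powr \<alpha> / \<alpha>)"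
  proof (rule differentiable_bound_general[of 0 1])
   show "continuous_on {0..1} A"
    unfolding continuous_on_eq_continuous_within
    using derA has_vector_derivative_continuous by blast
   show "continuous_on {0..1} (%s. V powr (1 / r) * P * (s powr \<alpha> / \<alpha>))"
    using \<alpha> by (intro continuous_intros continuous_on_powr') auto
   show "(A has_vector_derivative integral Q (D s)) (at s)" if "0 < s" "s < 1" for s
   proof -
    have "(A has_vector_derivative integral Q (D s)) (at s within {0..1})" using derA[of s] that by simp
    then show ?thesis by (simp only: at_within_Icc_at[OF that])
   qed
   show "((%s. V powr (1 / r) * P * (s powr \<alpha> / \<alpha>)) has_vector_derivative V powr (1 / r) * P * s powr (\<alpha> - 1)) (at s)" if "0 < s" "s < 1" for s
    unfolding has_real_derivative_iff_has_vector_derivative[symmetric]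
    using that \<alpha> by (auto intro!: derivative_eq_intros)
  qed (use bD in auto)
  then have d1: "norm (A 1 - A 0) <= V powr (1 / r) * P / \<alpha>" by simp
  have A0: "A 0 = V *\<^sub>R F x"
   unfolding A_def using Vm by (simp add: Q_def)
  have "A 1 = (LINT y|lborel. indicator Q y *\<^sub>R F (x + 1 *\<^sub>R y))"
  proof -
   have "integrable lborel (%y. indicator Q y *\<^sub>R F (x + 1 *\<^sub>R y))"
    by (intro borel_integrable_compact[OF Qc] continuous_on_compose2[OF Fc] continuous_intros) auto
   then show ?thesis unfolding A_def
    using set_borel_integral_eq_integral(2)[of Q "%y. F (x + 1 *\<^sub>R y)"] by (simp add: set_integrable_def set_lebesgue_integral_def)
  qed
  also have "norm ... <= (LINT y|lborel. norm (indicator Q y *\<^sub>R F (x + 1 *\<^sub>R y)))" by (rule integral_norm_bound)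
  also have "... <= V powr (1 / r) * N" using scaled(2)[OF Fc iF, of 1 x] by (simp add: N_def)
  finally have A1: "norm (A 1) <= V powr (1 / r) * N" .
  have "V * norm (F x) = norm (A 0)" using V0 by (simp add: A0)
  also have "... <= norm (A 1) + norm (A 1 - A 0)" by (metis norm_minus_commute norm_triangle_sub add.commute norm_triangle_sub)
  also have "... <= V powr (1 / r) * N + V powr (1 / r) * P / \<alpha>" using A1 d1 by simp
  also have "... <= V powr (1 / r) * (1 + 1 / \<alpha>) * (N + P)"
  proof -
   have "N + P / \<alpha> <= (1 + 1 / \<alpha>) * (N + P)" using N0 P0 \<alpha> by (simp add: field_simps)
   from mult_left_mono[OF this, of "V powr (1 / r)"] show ?thesis by (simp add: algebra_simps)
  qed
  finally show "norm (F x) <= C * ((LINT x|lborel. norm (F x) powr q) powr (1 / q)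
    + (\<Sum>e\<in>Basis. (LINT x|lborel. norm (partial e F x) powr q) powr (1 / q)))"
   using V0 unfolding C_def N_def P_def by (simp add: field_simps)
 qed
qed

section \<open>Sobolev spaces and solenoidal fields\<close>

lemma rep_restr_indicator:
 assumes "S \<in> sets lebesgue" shows "AE x in lebesgue. rep_lfun (restr S u) x = indicator S x * rep_lfun u x"
 using rep_restr[OF assms, of u] by eventually_elim (simp split: split_indicator)

lemma L1loc_iff:
 "u \<in> L1loc U \<longleftrightarrow> (AE x in lebesgue. x \<notin> U --> rep_lfun u x = 0)
   \<and> (\<forall>K. compact K \<and> K \<subseteq> U --> integrable lebesgue (%x. indicator K x * rep_lfun u x))"
proof -
 have "Lq_integrable 1 (restr K u) \<longleftrightarrow> integrable lebesgue (%x. indicator K x * rep_lfun u x)" if "compact K" for K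
 proof -
  have K: "K \<in> sets lebesgue" using that by (simp add: lmeasurable_compact fmeasurableD)
  have m: "(%x. indicator K x * rep_lfun u x) \<in> borel_measurable lebesgue"
   using K by (intro borel_measurable_times borel_measurable_indicator) auto
  have "Lq_integrable 1 (restr K u) \<longleftrightarrow> integrable lebesgue (%x. norm (indicator K x * rep_lfun u x) powr 1)"
   by (rule Lq_integrable_cong) (use rep_restr_indicator[OF K, of u] m in \<open>auto elim: eventually_mono\<close>)
  also have "... \<longleftrightarrow> integrable lebesgue (%x. indicator K x * rep_lfun u x)"
   using m by (simp add: integrable_norm_iff)
  finally show ?thesis .
 qed
 then show ?thesis by (auto simp: L1loc_def vanishes_outside.rep_eq)
qed

lemma Lq_subset_L1loc:
 assumes q: "q > 1" and u: "u \<in> carr (Lq U q)" shows "u \<in> L1loc U"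
 unfolding L1loc_iff
proof (intro conjI allI impI)
 show "AE x in lebesgue. x \<notin> U --> rep_lfun u x = 0" using u by (simp add: Lq_carr_iff)
 fix K assume K: "compact K \<and> K \<subseteq> U"
 then have Ks: "K \<in> sets lebesgue" by (simp add: lmeasurable_compact fmeasurableD)
 have "integrable lebesgue (%x. norm (rep_lfun (restr K u) x) powr q)"
 proof (rule bochner_bound)
  show "integrable lebesgue (%x. norm (rep_lfun u x) powr q)" using u by (simp add: Lq_carr_iff)
  show "AE x in lebesgue. norm (norm (rep_lfun (restr K u) x) powr q) <= norm (norm (rep_lfun u x) powr q)"
   using rep_restr[OF Ks, of u] by eventually_elim (use q in auto)
 qed simp
 moreover have "AE x in lebesgue. x \<notin> K --> rep_lfun (restr K u) x = 0"
  using rep_restr[OF Ks, of u] by eventually_elim auto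
 ultimately have "restr K u \<in> carr (Lq K q)" by (simp add: Lq_carr_iff)
 then have i: "integrable lebesgue (rep_lfun (restr K u))"
  using Lq_L1[OF q compact_imp_bounded] K by blast
 show "integrable lebesgue (%x. indicator K x * rep_lfun u x)"
  by (rule bochner_cong_AE[OF i])
   (use Ks rep_restr_indicator[OF Ks, of u] in \<open>auto intro!: borel_measurable_times borel_measurable_indicator elim: eventually_mono\<close>)
qed

text \<open>One class for test functions and their partial derivatives, so that integrability and
  linearity of the pairing \<open>tst\<close> have to be proved only once.\<close>

definition cfun :: "'a::euclidean_space set => ('a => real) => bool" where
 "cfun U \<phi> \<longleftrightarrow> continuous_on UNIV \<phi> \<and> (\<exists>K. compact K \<and> K \<subseteq> U \<and> (\<forall>x. x \<notin> K --> \<phi> x = 0))"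

lemma partial_support:
 fixes \<phi> :: "'a::euclidean_space => 'b::real_normed_vector"
 assumes K: "closed K" "!!x. x \<notin> K ==> \<phi> x = 0" and x: "x \<notin> K"
 shows "partial e \<phi> x = 0"
proof -
 have "(\<phi> has_derivative (%_. 0)) (at x)"
  by (rule has_derivative_transform_within_open[of "%_. 0" _ _ _ "- K"]) (use K x in auto)
 from fun_cong[OF frechet_derivative_at[OF this], of e] show ?thesis by simp
qed

lemma test_fun_support:
 assumes "test_fun U \<phi>" obtains K where "compact K" "K \<subseteq> U" "!!x. x \<notin> K ==> \<phi> x = 0"
proof
 show "compact (closure {x. \<phi> x ~= 0})" "closure {x. \<phi> x ~= 0} \<subseteq> U" using assms by (auto simp: test_fun_def)
 show "\<phi> x = 0" if "x \<notin> closure {x. \<phi> x ~= 0}" for x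
  using that closure_subset[of "{x. \<phi> x ~= 0}"] by auto
qed

lemma cfun_test:
 assumes "test_fun U \<phi>" shows "cfun U \<phi>" and "e \<in> Basis ==> cfun U (partial e \<phi>)"
proof -
 obtain K where K: "compact K" "K \<subseteq> U" "!!x. x \<notin> K ==> \<phi> x = 0" by (rule test_fun_support[OF assms]) blast
 show "cfun U \<phi>" unfolding cfun_def using K continuous_test_fun[OF assms] by blast
 assume e: "e \<in> Basis"
 have "Ck_on (Suc 0) UNIV \<phi>" using assms unfolding test_fun_def by blast
 then have "continuous_on UNIV (partial e \<phi>)" using e by simp
 moreover have "partial e \<phi> x = 0" if "x \<notin> K" for x
  by (rule partial_support[of K]) (use K that in \<open>auto simp: compact_imp_closed\<close>)
 ultimately show "cfun U (partial e \<phi>)" unfolding cfun_def using K by blast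
qed

definition tst :: "'a::euclidean_space lfun => ('a => real) => complex" where
 "tst u \<phi> = (LINT x|lebesgue. rep_lfun u x * complex_of_real (\<phi> x))"

lemma cfun_integrable:
 assumes u: "u \<in> L1loc U" and \<phi>: "cfun U \<phi>"
 shows "integrable lebesgue (%x. rep_lfun u x * complex_of_real (\<phi> x))"
proof -
 obtain K where K: "compact K" "K \<subseteq> U" "!!x. x \<notin> K ==> \<phi> x = 0" and c: "continuous_on UNIV \<phi>"
  using \<phi> by (auto simp: cfun_def)
 have "bounded (\<phi> ` K)" by (intro compact_imp_bounded compact_continuous_image K continuous_on_subset[OF c]) auto
 then obtain B where B: "!!t. t \<in> K ==> \<bar>\<phi> t\<bar> <= B" by (metis (no_types, lifting) bounded_iff imageI real_norm_def)
 have iu: "integrable lebesgue (%x. indicator K x * rep_lfun u x)" using u K by (auto simp: L1loc_iff)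
 show ?thesis
 proof (rule bochner_bound)
  show "integrable lebesgue (%x. complex_of_real (max B 0) * (indicator K x * rep_lfun u x))" using iu by auto
  show "(%x. rep_lfun u x * complex_of_real (\<phi> x)) \<in> borel_measurable lebesgue"
   by (intro borel_measurable_times rep_lfun_measurable continuous_imp_measurable_lebesgue continuous_intros c)
  show "AE x in lebesgue. norm (rep_lfun u x * complex_of_real (\<phi> x)) <= norm (complex_of_real (max B 0) * (indicator K x * rep_lfun u x))"
  proof (rule AE_I2)
   fix x
   show "norm (rep_lfun u x * complex_of_real (\<phi> x)) <= norm (complex_of_real (max B 0) * (indicator K x * rep_lfun u x))"
   proof (cases "x \<in> K")
    case True
    then have "norm (rep_lfun u x) * \<bar>\<phi> x\<bar> <= norm (rep_lfun u x) * max B 0"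
     using B[OF True] by (intro mult_left_mono) auto
    then show ?thesis using True by (simp add: norm_mult mult.commute)
   qed (use K in auto)
  qed
 qed
qed

lemma lint_of_fun:
 fixes u :: "'a::euclidean_space lfun"
 assumes "continuous_on UNIV \<phi>"
 shows "lint (u * of_fun (%x. complex_of_real (\<phi> x))) = tst u \<phi>"
proof -
 have m: "(%x. complex_of_real (\<phi> x)) \<in> borel_measurable lebesgue"
  by (intro continuous_imp_measurable_lebesgue continuous_intros assms)
 show ?thesis unfolding lint.rep_eq tst_def
 proof (rule integral_cong_AE)
  show "AE x in lebesgue. rep_lfun (u * of_fun (%x. complex_of_real (\<phi> x))) x = rep_lfun u x * complex_of_real (\<phi> x)"
   using rep_times[of u "of_fun (%x. complex_of_real (\<phi> x))"] rep_of_fun[OF m] by eventually_elim simp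
 qed (use m in auto)
qed

lemma lint_sum_of_fun:
 fixes u :: "'i => 'a::euclidean_space lfun"
 assumes "finite I" "!!i. i \<in> I ==> u i \<in> L1loc U" "!!i. i \<in> I ==> cfun U (\<phi> i)"
 shows "lint (\<Sum>i\<in>I. u i * of_fun (%x. complex_of_real (\<phi> i x))) = (\<Sum>i\<in>I. tst (u i) (\<phi> i))"
proof -
 have m: "(%x. complex_of_real (\<phi> i x)) \<in> borel_measurable lebesgue" if "i \<in> I" for i
  by (intro continuous_imp_measurable_lebesgue continuous_intros) (use assms(3)[OF that] in \<open>auto simp: cfun_def\<close>)
 have "lint (\<Sum>i\<in>I. u i * of_fun (%x. complex_of_real (\<phi> i x))) = (LINT x|lebesgue. (\<Sum>i\<in>I. rep_lfun (u i) x * complex_of_real (\<phi> i x)))"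
  unfolding lint.rep_eq
 proof (rule integral_cong_AE)
  have "AE x in lebesgue. \<forall>i\<in>I. rep_lfun (u i * of_fun (%x. complex_of_real (\<phi> i x))) x = rep_lfun (u i) x * complex_of_real (\<phi> i x)"
  proof (rule AE_finite_allI[OF assms(1)])
   fix i assume i: "i \<in> I"
   show "AE x in lebesgue. rep_lfun (u i * of_fun (%x. complex_of_real (\<phi> i x))) x = rep_lfun (u i) x * complex_of_real (\<phi> i x)"
    using rep_times[of "u i" "of_fun (%x. complex_of_real (\<phi> i x))"] rep_of_fun[OF m[OF i]] by eventually_elim simp
  qed
  then show "AE x in lebesgue. rep_lfun (\<Sum>i\<in>I. u i * of_fun (%x. complex_of_real (\<phi> i x))) x = (\<Sum>i\<in>I. rep_lfun (u i) x * complex_of_real (\<phi> i x))"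
   using rep_sum[OF assms(1), of "%i. u i * of_fun (%x. complex_of_real (\<phi> i x))"] by eventually_elim simp
 qed (use m in \<open>auto intro!: borel_measurable_sum borel_measurable_times\<close>)
 also have "... = (\<Sum>i\<in>I. tst (u i) (\<phi> i))"
  unfolding tst_def by (rule Bochner_Integration.integral_sum) (rule cfun_integrable[OF assms(2,3)])
 finally show ?thesis .
qed

text \<open>The du Bois-Reymond lemma for real and imaginary parts. It yields uniqueness of weak
  partial derivatives, which makes the description in \<open>pd\<close> meaningful, and uniqueness
  of the weak divergence.\<close>

lemma L1loc_eq_0:
 fixes v :: "'a::euclidean_space lfun"
 assumes U: "open U" and v: "v \<in> L1loc U" and t: "!!\<phi>. test_fun U \<phi> ==> tst v \<phi> = 0"
 shows "v = 0"
proof -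
 have part: "AE x in lebesgue. x \<in> U --> p (rep_lfun v x) = 0"
  if p: "bounded_linear p" and pr: "!!r z. p (z * complex_of_real r) = p z * r" for p :: "complex => real"
 proof (rule du_Bois_Reymond[OF U])
  interpret p: bounded_linear p by (rule p)
  show "integrable lebesgue (%x. indicator K x * p (rep_lfun v x))" if "compact K" "K \<subseteq> U" for K
  proof -
   have "integrable lebesgue (%x. p (indicator K x * rep_lfun v x))"
    by (rule integrable_bounded_linear[OF p]) (use v that in \<open>auto simp: L1loc_iff\<close>)
   moreover have "p (indicator K x * rep_lfun v x) = indicator K x * p (rep_lfun v x)" for x
    by (auto split: split_indicator simp: p.zero)
   ultimately show ?thesis by simp
  qed
  fix \<phi> :: "'a => real" assume \<phi>: "test_fun U \<phi>"
  have i: "integrable lebesgue (%x. rep_lfun v x * complex_of_real (\<phi> x))" by (rule cfun_integrable[OF v cfun_test(1)[OF \<phi>]])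
  have "(LINT x|lebesgue. p (rep_lfun v x) * \<phi> x) = (LINT x|lebesgue. p (rep_lfun v x * complex_of_real (\<phi> x)))"
   by (simp add: pr)
  also have "... = p (tst v \<phi>)" unfolding tst_def by (rule integral_bounded_linear[OF p i])
  finally show "(LINT x|lebesgue. p (rep_lfun v x) * \<phi> x) = 0" by (simp add: t[OF \<phi>] p.zero)
 qed
 have "AE x in lebesgue. x \<in> U --> Re (rep_lfun v x) = 0" by (rule part) (auto intro: bounded_linear_Re)
 moreover have "AE x in lebesgue. x \<in> U --> Im (rep_lfun v x) = 0" by (rule part) (auto intro: bounded_linear_Im)
 moreover have "AE x in lebesgue. x \<notin> U --> rep_lfun v x = 0" using v by (simp add: L1loc_iff)
 ultimately show ?thesis unfolding lfun_eq_iff using rep_zero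
  by eventually_elim (auto simp: complex_eq_iff)
qed

lemma L1loc_0: "0 \<in> L1loc U"
 unfolding L1loc_iff
proof (intro conjI allI impI)
 show "AE x in lebesgue. x \<notin> U --> rep_lfun 0 x = 0" using rep_zero by eventually_elim auto
 fix K assume "compact K \<and> K \<subseteq> U"
 then have "K \<in> sets lebesgue" by (simp add: lmeasurable_compact fmeasurableD)
 then show "integrable lebesgue (%x. indicator K x * rep_lfun 0 x)"
  by (intro bochner_cong_AE[OF integrable_zero])
   (use rep_zero in \<open>auto intro!: borel_measurable_times borel_measurable_indicator elim: eventually_mono\<close>)
qed

lemma L1loc_add_scale:
 assumes u: "u \<in> L1loc U" and v: "v \<in> L1loc U" shows "u + r *\<^sub>R v \<in> L1loc U"
proof -
 have ae: "AE x in lebesgue. rep_lfun (u + r *\<^sub>R v) x = rep_lfun u x + complex_of_real r * rep_lfun v x"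
  using rep_plus[of u "r *\<^sub>R v"] rep_scaleR[of r v] by eventually_elim simp
 show ?thesis unfolding L1loc_iff
 proof (intro conjI allI impI)
  have "AE x in lebesgue. x \<notin> U --> rep_lfun u x = 0" "AE x in lebesgue. x \<notin> U --> rep_lfun v x = 0"
   using u v by (auto simp: L1loc_iff)
  then show "AE x in lebesgue. x \<notin> U --> rep_lfun (u + r *\<^sub>R v) x = 0" using ae by eventually_elim auto
  fix K assume K: "compact K \<and> K \<subseteq> U"
  then have Ks: "K \<in> sets lebesgue" by (simp add: lmeasurable_compact fmeasurableD)
  have i: "integrable lebesgue (%x. indicator K x * rep_lfun u x + complex_of_real r * (indicator K x * rep_lfun v x))"
   using u v K by (auto simp: L1loc_iff)
  show "integrable lebesgue (%x. indicator K x * rep_lfun (u + r *\<^sub>R v) x)"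
   by (rule bochner_cong_AE[OF i])
    (use ae Ks in \<open>auto intro!: borel_measurable_times borel_measurable_indicator simp: algebra_simps elim: eventually_mono\<close>)
 qed
qed

lemma tst_add_scale:
 assumes u: "u \<in> L1loc U" and v: "v \<in> L1loc U" and \<phi>: "cfun U \<phi>"
 shows "tst (u + r *\<^sub>R v) \<phi> = tst u \<phi> + r *\<^sub>R tst v \<phi>"
proof -
 have ae: "AE x in lebesgue. rep_lfun (u + r *\<^sub>R v) x = rep_lfun u x + complex_of_real r * rep_lfun v x"
  using rep_plus[of u "r *\<^sub>R v"] rep_scaleR[of r v] by eventually_elim simp
 note i = cfun_integrable[OF u \<phi>] cfun_integrable[OF v \<phi>] cfun_integrable[OF L1loc_add_scale[OF u v, of r] \<phi>]
 have "tst (u + r *\<^sub>R v) \<phi> = (LINT x|lebesgue. rep_lfun u x * complex_of_real (\<phi> x) + complex_of_real r * (rep_lfun v x * complex_of_real (\<phi> x)))"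
  unfolding tst_def
  by (rule integral_cong_AE) (use ae i in \<open>auto simp: algebra_simps elim: eventually_mono dest: borel_measurable_integrable\<close>)
 also have "... = tst u \<phi> + complex_of_real r * tst v \<phi>" using i by (simp add: tst_def)
 finally show ?thesis by (simp add: scaleR_conv_of_real)
qed

lemma tst_zero: "tst 0 \<phi> = 0"
 unfolding tst_def by (rule integral_eq_zero_AE) (use rep_zero in \<open>auto elim: eventually_mono\<close>)

section \<open>Weak partial derivatives\<close>

lemma is_weak_pd_iff:
 assumes e: "e \<in> Basis"
 shows "is_weak_pd U e u v \<longleftrightarrow> u \<in> L1loc U \<and> v \<in> L1loc U \<and> (\<forall>\<phi>. test_fun U \<phi> --> tst u (partial e \<phi>) = - tst v \<phi>)"
proof -
 have "continuous_on UNIV (partial e \<phi>)" "continuous_on UNIV \<phi>" if "test_fun U \<phi>" for \<phi> :: "'a => real"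
  using cfun_test[OF that] e by (auto simp: cfun_def)
 then show ?thesis unfolding is_weak_pd_def by (auto simp: lint_of_fun)
qed

lemma is_weak_pd_unique:
 assumes U: "open U" and e: "e \<in> Basis" and 1: "is_weak_pd U e u v" and 2: "is_weak_pd U e u w"
 shows "v = w"
proof -
 have vw: "v \<in> L1loc U" "w \<in> L1loc U" using 1 2 by (auto simp: is_weak_pd_def)
 have "v + (-1) *\<^sub>R w = 0"
 proof (rule L1loc_eq_0[OF U L1loc_add_scale[OF vw]])
  fix \<phi> :: "'a => real" assume "test_fun U \<phi>"
  then show "tst (v + (-1) *\<^sub>R w) \<phi> = 0"
   using tst_add_scale[OF vw cfun_test(1), of \<phi> "-1"] 1 2 by (auto simp: is_weak_pd_iff[OF e])
 qed
 then show ?thesis by simp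
qed

lemma pd_eq:
 assumes "open U" "e \<in> Basis" "is_weak_pd U e u v" shows "pd U e u = v"
 unfolding pd_def using assms is_weak_pd_unique by blast

lemma is_weak_pd_add_scale:
 assumes e: "e \<in> Basis" and 1: "is_weak_pd U e u v" and 2: "is_weak_pd U e u' v'"
 shows "is_weak_pd U e (u + r *\<^sub>R u') (v + r *\<^sub>R v')"
proof -
 have L: "u \<in> L1loc U" "v \<in> L1loc U" "u' \<in> L1loc U" "v' \<in> L1loc U" using 1 2 by (auto simp: is_weak_pd_def)
 show ?thesis unfolding is_weak_pd_iff[OF e]
 proof (intro conjI L1loc_add_scale L allI impI)
  fix \<phi> :: "'a => real" assume \<phi>: "test_fun U \<phi>"
  show "tst (u + r *\<^sub>R u') (partial e \<phi>) = - tst (v + r *\<^sub>R v') \<phi>"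
   using 1 2 \<phi> by (simp add: tst_add_scale[OF L(1,3) cfun_test(2)[OF \<phi> e]] tst_add_scale[OF L(2,4) cfun_test(1)[OF \<phi>]] is_weak_pd_iff[OF e])
 qed
qed

lemma is_weak_pd_zero: "e \<in> Basis ==> is_weak_pd U e 0 0"
 by (simp add: is_weak_pd_iff L1loc_0 tst_zero)

lemma pd_zero: "open U ==> e \<in> Basis ==> pd U e 0 = 0"
 by (rule pd_eq) (auto intro: is_weak_pd_zero)

lemma Lq_norm_zero: "q > 0 ==> Lq_norm q 0 = 0"
 using Lq_norm_cong[of 0 "%_. 0" q] rep_zero by (auto elim: eventually_mono)

lemma Wkq_zero:
 assumes q: "q >= 1" and U: "open U"
 shows "0 \<in> carr (Wkq U k q) \<and> nrm (Wkq U k q) 0 = 0"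
proof (induction k)
 case 0 then show ?case using nsp.zero[OF nsp_Lq[OF q]] nsp.nrm_0[OF nsp_Lq[OF q]] by auto
next
 case (Suc k)
 then show ?case using nsp.zero[OF nsp_Lq[OF q]] is_weak_pd_zero q
  by (auto simp: pd_zero[OF U] Lq_norm_zero)
qed

lemma Wkq_nonneg: "nrm (Wkq U k q) u >= 0"
 by (induction k arbitrary: u) (auto simp: Lq_nrm Lq_norm_nonneg intro!: add_nonneg_nonneg sum_nonneg)

lemma W1q0_zero:
 assumes q: "q >= 1" and U: "open U" shows "0 \<in> W1q0 U q"
proof -
 have "of_fun (%_. 0) = (0 :: 'a lfun)"
  unfolding lfun_eq_iff using rep_of_fun[of "%_::'a. 0"] rep_zero by (auto elim: AE_mp)
 moreover have "0 \<in> carr (Wkq U 1 q)" "nrm (Wkq U 1 q) 0 = 0" using Wkq_zero[OF q U, of 1] by auto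
 ultimately show ?thesis unfolding W1q0_def
  by (auto intro!: exI[of _ "%_ _. 0"] test_fun_0)
qed

text \<open>Integration by parts without boundary terms: the product with a second test function has
  compact support, and by \<open>integral_partial_eq_0\<close> its partial derivative has integral
  0.\<close>

lemma is_weak_pd_test:
 fixes \<phi> :: "'a::euclidean_space => complex"
 assumes \<phi>: "test_fun U \<phi>" and e: "e \<in> Basis"
 shows "is_weak_pd U e (of_fun \<phi>) (of_fun (partial e \<phi>))"
  and "continuous_on UNIV (partial e \<phi>)"
  and "\<exists>K. compact K \<and> K \<subseteq> U \<and> (\<forall>x. x \<notin> K --> \<phi> x = 0 \<and> partial e \<phi> x = 0)"
  and "!!x. \<phi> differentiable (at x)"
proof -
 obtain K where K: "compact K" "K \<subseteq> U" "!!x. x \<notin> K ==> \<phi> x = 0" by (rule test_fun_support[OF \<phi>]) blast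
 have C1: "Ck_on (Suc 0) UNIV \<phi>" using \<phi> unfolding test_fun_def by blast
 then show d: "\<phi> differentiable (at x)" for x by simp
 from C1 e show c': "continuous_on UNIV (partial e \<phi>)" by simp
 have c: "continuous_on UNIV \<phi>" by (rule continuous_test_fun[OF \<phi>])
 have K': "partial e \<phi> x = 0" if "x \<notin> K" for x
  by (rule partial_support[of K]) (use K that in \<open>auto simp: compact_imp_closed\<close>)
 with K show "\<exists>K. compact K \<and> K \<subseteq> U \<and> (\<forall>x. x \<notin> K --> \<phi> x = 0 \<and> partial e \<phi> x = 0)" by blast
 have L: "of_fun f \<in> L1loc U" if f: "continuous_on UNIV f" "!!x. x \<notin> K ==> f x = 0" for f :: "'a => complex"
 proof -
  have m: "f \<in> borel_measurable lebesgue" by (rule continuous_imp_measurable_lebesgue[OF f(1)])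
  show ?thesis unfolding L1loc_iff
  proof (intro conjI allI impI)
   show "AE x in lebesgue. x \<notin> U --> rep_lfun (of_fun f) x = 0" using rep_of_fun[OF m] by eventually_elim (use f K in auto)
   fix J assume J: "compact J \<and> J \<subseteq> U"
   have "integrable lborel (%x. indicator J x *\<^sub>R f x)"
    by (rule borel_integrable_compact) (use J continuous_on_subset[OF f(1)] in auto)
   then have i: "integrable lebesgue (%x. indicator J x *\<^sub>R f x)" by (subst integrable_completion) (auto dest: borel_measurable_integrable)
   have "J \<in> sets lebesgue" using J by (simp add: lmeasurable_compact fmeasurableD)
   then show "integrable lebesgue (%x. indicator J x * rep_lfun (of_fun f) x)"
    by (intro bochner_cong_AE[OF i])
     (use rep_of_fun[OF m] in \<open>auto intro!: borel_measurable_times borel_measurable_indicator elim!: eventually_mono split: split_indicator\<close>)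
  qed
 qed
 have L1: "of_fun \<phi> \<in> L1loc U" using L[OF c] K by blast
 have L2: "of_fun (partial e \<phi>) \<in> L1loc U" using L[OF c'] K' by blast
 show "is_weak_pd U e (of_fun \<phi>) (of_fun (partial e \<phi>))"
  unfolding is_weak_pd_iff[OF e]
 proof (intro conjI L1 L2 allI impI)
  fix \<psi> :: "'a => real" assume \<psi>: "test_fun U \<psi>"
  have C1': "Ck_on (Suc 0) UNIV \<psi>" using \<psi> unfolding test_fun_def by blast
  have prod: "partial e (%x. \<phi> x * complex_of_real (\<psi> x)) x = \<phi> x * complex_of_real (partial e \<psi> x) + partial e \<phi> x * complex_of_real (\<psi> x)" for x
  proof -
   have "(\<psi> has_derivative frechet_derivative \<psi> (at x)) (at x)" using C1' frechet_derivative_works by auto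
   then have "((%x. complex_of_real (\<psi> x)) has_derivative (%h. complex_of_real (frechet_derivative \<psi> (at x) h))) (at x)"
    by (rule has_derivative_of_real)
   moreover have "(\<phi> has_derivative frechet_derivative \<phi> (at x)) (at x)" using d frechet_derivative_works by auto
   ultimately have "((%x. \<phi> x * complex_of_real (\<psi> x)) has_derivative
     (%h. \<phi> x * complex_of_real (frechet_derivative \<psi> (at x) h) + frechet_derivative \<phi> (at x) h * complex_of_real (\<psi> x))) (at x)"
    by (intro has_derivative_mult)
   from fun_cong[OF frechet_derivative_at[OF this], of e] show ?thesis by simp
  qed
  have dif: "(%x. \<phi> x * complex_of_real (\<psi> x)) differentiable (at x)" for x
  proof -
   have "(\<psi> has_derivative frechet_derivative \<psi> (at x)) (at x)" using C1' frechet_derivative_works by auto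
   from has_derivative_of_real[OF this] have "(%x. complex_of_real (\<psi> x)) differentiable (at x)" by (auto simp: differentiable_def)
   then show ?thesis using d by (intro differentiable_mult) auto
  qed
  have c\<psi>: "continuous_on UNIV \<psi>" "continuous_on UNIV (partial e \<psi>)" using cfun_test[OF \<psi>] e by (auto simp: cfun_def)
  have "(LINT x|lebesgue. partial e (%x. \<phi> x * complex_of_real (\<psi> x)) x) = 0"
   by (rule integral_partial_eq_0(1)[OF dif _ K(1)])
    (use K c c' c\<psi> in \<open>auto simp: prod intro!: continuous_intros\<close>)
  moreover have i: "integrable lebesgue (%x. rep_lfun (of_fun \<phi>) x * complex_of_real (partial e \<psi> x))"
   "integrable lebesgue (%x. rep_lfun (of_fun (partial e \<phi>)) x * complex_of_real (\<psi> x))"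
   using cfun_integrable[OF L1 cfun_test(2)[OF \<psi> e]] cfun_integrable[OF L2 cfun_test(1)[OF \<psi>]] by auto
  moreover have "(LINT x|lebesgue. partial e (%x. \<phi> x * complex_of_real (\<psi> x)) x)
    = (LINT x|lebesgue. rep_lfun (of_fun \<phi>) x * complex_of_real (partial e \<psi> x) + rep_lfun (of_fun (partial e \<phi>)) x * complex_of_real (\<psi> x))"
  proof (rule integral_cong_AE)
   show "AE x in lebesgue. partial e (%x. \<phi> x * complex_of_real (\<psi> x)) x = rep_lfun (of_fun \<phi>) x * complex_of_real (partial e \<psi> x) + rep_lfun (of_fun (partial e \<phi>)) x * complex_of_real (\<psi> x)"
    using rep_of_fun[OF continuous_imp_measurable_lebesgue[OF c]] rep_of_fun[OF continuous_imp_measurable_lebesgue[OF c']]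
    by eventually_elim (simp add: prod)
   show "partial e (%x. \<phi> x * complex_of_real (\<psi> x)) \<in> borel_measurable lebesgue"
    unfolding prod by (intro continuous_imp_measurable_lebesgue continuous_intros c c' c\<psi>)
  qed (use i in \<open>auto dest: borel_measurable_integrable\<close>)
  ultimately have "tst (of_fun \<phi>) (partial e \<psi>) + tst (of_fun (partial e \<phi>)) \<psi> = 0" by (simp add: tst_def)
  then show "tst (of_fun \<phi>) (partial e \<psi>) = - tst (of_fun (partial e \<phi>)) \<psi>" by (simp add: eq_neg_iff_add_eq_0)
 qed
qed

section \<open>Boundedness of Sobolev functions with zero boundary values\<close>

lemma Lq_of_fun:
 fixes f :: "'a::euclidean_space => complex"
 assumes q: "q > 0" and f: "continuous_on UNIV f" and K: "compact K" "K \<subseteq> U" "!!x. x \<notin> K ==> f x = 0"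
 shows "of_fun f \<in> carr (Lq U q)" and "integrable lborel (%x. norm (f x) powr q)"
  and "Lq_norm q (of_fun f) = (LINT x|lborel. norm (f x) powr q) powr (1 / q)"
proof -
 have m: "f \<in> borel_measurable lebesgue" by (rule continuous_imp_measurable_lebesgue[OF f])
 have mb: "f \<in> borel_measurable borel" by (rule borel_measurable_continuous_onI[OF f])
 have "continuous_on UNIV (%x. norm (f x) powr q)" using q by (intro continuous_on_powr' continuous_intros f) auto
 then have "integrable lborel (%x. indicator K x *\<^sub>R (norm (f x) powr q))"
  by (intro borel_integrable_compact K) (auto intro: continuous_on_subset)
 moreover have "(%x. indicator K x *\<^sub>R (norm (f x) powr q)) = (%x. norm (f x) powr q)"
  using K(3) by (auto simp: fun_eq_iff split: split_indicator)
 ultimately show i: "integrable lborel (%x. norm (f x) powr q)" by simp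
 then have il: "integrable lebesgue (%x. norm (f x) powr q)" by (subst integrable_completion) (auto dest: borel_measurable_integrable)
 have ae: "AE x in lebesgue. norm (rep_lfun (of_fun f) x) = norm (f x)" using rep_of_fun[OF m] by eventually_elim simp
 have z: "f x = 0" if "x \<notin> U" for x using that K by blast
 show "of_fun f \<in> carr (Lq U q)"
  using z Lq_integrable_cong[OF ae m, of q] il rep_of_fun[OF m]
  by (auto simp: Lq_def vanishes_outside.rep_eq elim!: eventually_mono)
 show "Lq_norm q (of_fun f) = (LINT x|lborel. norm (f x) powr q) powr (1 / q)"
  unfolding Lq_norm_cong[OF ae m, of q] using mb by (subst integral_completion) auto
qed

text \<open>Morrey's inequality bounds the approximating test functions by one constant
  \<open>M\<close>. The excess \<open>h\<close> of the modulus of \<open>u\<close> over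
  \<open>M\<close> is then dominated by the distance of \<open>u\<close> from the approximants, so
  its \<open>q\<close>-norm is 0. This avoids extracting a pointwise convergent subsequence.\<close>

lemma W1q0_bounded:
 fixes U :: "'a::euclidean_space set"
 assumes U: "open U" and q: "q > real DIM('a)" and u: "u \<in> W1q0 U q"
 shows "\<exists>M\<ge>0. AE x in lebesgue. norm (rep_lfun u x) <= M"
proof -
 have q1: "q > 1" using q DIM_positive[where 'a='a] by linarith
 interpret L: nsp "Lq U q" using q1 by (intro nsp_Lq) simp
 obtain \<phi> :: "nat => 'a => complex" where \<phi>: "!!n. test_fun U (\<phi> n)"
  and lim: "(%n. nrm (Wkq U 1 q) (of_fun (\<phi> n) - u)) \<longlonglongrightarrow> 0" using u by (auto simp: W1q0_def)
 have uW: "u \<in> carr (Wkq U 1 q)" using u by (simp add: W1q0_def)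
 then have uL: "u \<in> carr (Lq U q)" by simp
 have pdL: "pd U e u \<in> carr (Lq U q)" if "e \<in> Basis" for e using uW that by simp
 have pdu: "is_weak_pd U e u (pd U e u)" if e: "e \<in> Basis" for e
 proof -
  obtain v where "is_weak_pd U e u v" using uW e by auto
  then show ?thesis using pd_eq[OF U e] by simp
 qed
 note T = is_weak_pd_test[OF \<phi>]
 have pdn: "pd U e (of_fun (\<phi> n) - u) = of_fun (partial e (\<phi> n)) - pd U e u" if e: "e \<in> Basis" for e n
  using pd_eq[OF U e is_weak_pd_add_scale[OF e T(1)[OF e, of n] pdu[OF e], of "-1"]] by simp
 have fL: "of_fun (\<phi> n) \<in> carr (Lq U q)" "integrable lborel (%x. norm (\<phi> n x) powr q)"
  "Lq_norm q (of_fun (\<phi> n)) = (LINT x|lborel. norm (\<phi> n x) powr q) powr (1 / q)" for n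
 proof -
  obtain K where K: "compact K" "K \<subseteq> U" "!!x. x \<notin> K ==> \<phi> n x = 0" by (rule test_fun_support[OF \<phi>]) blast
  show "of_fun (\<phi> n) \<in> carr (Lq U q)" "integrable lborel (%x. norm (\<phi> n x) powr q)"
   "Lq_norm q (of_fun (\<phi> n)) = (LINT x|lborel. norm (\<phi> n x) powr q) powr (1 / q)"
   using Lq_of_fun[OF _ continuous_test_fun[OF \<phi>] K] q1 by auto
 qed
 have dL: "of_fun (partial e (\<phi> n)) \<in> carr (Lq U q)" "integrable lborel (%x. norm (partial e (\<phi> n) x) powr q)"
  "Lq_norm q (of_fun (partial e (\<phi> n))) = (LINT x|lborel. norm (partial e (\<phi> n) x) powr q) powr (1 / q)" if e: "e \<in> Basis" for e n
 proof -
  obtain K where K: "compact K" "K \<subseteq> U" "!!x. x \<notin> K ==> partial e (\<phi> n) x = 0" using T(3)[OF e, of n] by blast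
  show "of_fun (partial e (\<phi> n)) \<in> carr (Lq U q)" "integrable lborel (%x. norm (partial e (\<phi> n) x) powr q)"
   "Lq_norm q (of_fun (partial e (\<phi> n))) = (LINT x|lborel. norm (partial e (\<phi> n) x) powr q) powr (1 / q)"
   using Lq_of_fun[OF _ T(2)[OF e, of n] K] q1 by auto
 qed
 define a where "a n = nrm (Wkq U 1 q) (of_fun (\<phi> n) - u)" for n
 have a_eq: "a n = Lq_norm q (of_fun (\<phi> n) - u) + (\<Sum>e\<in>Basis. Lq_norm q (of_fun (partial e (\<phi> n)) - pd U e u))" for n
  unfolding a_def by (simp add: pdn Lq_nrm)
 have a1: "Lq_norm q (of_fun (\<phi> n) - u) <= a n" for n unfolding a_eq by (simp add: sum_nonneg Lq_norm_nonneg)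
 have a2: "Lq_norm q (of_fun (partial e (\<phi> n)) - pd U e u) <= a n" if "e \<in> Basis" for e n
 proof -
  have "Lq_norm q (of_fun (partial e (\<phi> n)) - pd U e u) <= (\<Sum>e\<in>Basis. Lq_norm q (of_fun (partial e (\<phi> n)) - pd U e u))"
   by (rule member_le_sum[OF that]) (auto simp: Lq_norm_nonneg)
  then show ?thesis unfolding a_eq using Lq_norm_nonneg[of q "of_fun (\<phi> n) - u"] by linarith
 qed
 have b1: "Lq_norm q (of_fun (\<phi> n)) <= a n + Lq_norm q u" for n
  using L.triangle[of "of_fun (\<phi> n) - u" u] L.diff fL(1) uL a1[of n] by (simp add: Lq_nrm)
 have b2: "Lq_norm q (of_fun (partial e (\<phi> n))) <= a n + Lq_norm q (pd U e u)" if "e \<in> Basis" for e n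
  using L.triangle[of "of_fun (partial e (\<phi> n)) - pd U e u" "pd U e u"] L.diff dL(1)[OF that] pdL[OF that] a2[OF that, of n] by (simp add: Lq_nrm)
 obtain C where C: "!!F :: 'a => complex. (\<forall>x. F differentiable (at x)) ==> (\<forall>e\<in>Basis. continuous_on UNIV (partial e F)) ==>
  integrable lborel (%x. norm (F x) powr q) ==> (\<forall>e\<in>Basis. integrable lborel (%x. norm (partial e F x) powr q)) ==>
  (\<forall>x. norm (F x) <= C * ((LINT x|lborel. norm (F x) powr q) powr (1 / q)
    + (\<Sum>e\<in>Basis. (LINT x|lborel. norm (partial e F x) powr q) powr (1 / q))))"
  using Morrey[OF q] by metis
 have dif: "\<phi> n differentiable (at x)" for n x using T(4) nonempty_Basis by fastforce
 \<comment> \<open>The summands 1 absorb the distance \<open>a n\<close>, which is at most 1 for the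
   indices in question.\<close>
 define M where "M = \<bar>C\<bar> * ((1 + Lq_norm q u) + (\<Sum>e\<in>Basis. 1 + Lq_norm q (pd U e u)))"
 have M0: "M >= 0" unfolding M_def by (intro mult_nonneg_nonneg add_nonneg_nonneg sum_nonneg Lq_norm_nonneg) auto
 have bnd: "norm (\<phi> n x) <= M" if n: "a n <= 1" for n x
 proof -
  let ?S = "Lq_norm q (of_fun (\<phi> n)) + (\<Sum>e\<in>Basis. Lq_norm q (of_fun (partial e (\<phi> n))))"
  have S0: "?S >= 0" by (intro add_nonneg_nonneg sum_nonneg Lq_norm_nonneg)
  have "norm (\<phi> n x) <= C * ?S"
   using C[of "\<phi> n"] dif T(2) fL(2) dL(2) by (simp add: fL(3) dL(3))
  also have "... <= \<bar>C\<bar> * ?S" using S0 by (intro mult_right_mono) auto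
  also have "... <= M" unfolding M_def
   by (intro mult_left_mono add_mono sum_mono order_trans[OF b1] order_trans[OF b2]) (use n in auto)
  finally show ?thesis .
 qed
 have lim': "a \<longlonglongrightarrow> 0" using lim by (simp add: a_def[abs_def])
 have ev: "eventually (%n. a n <= 1) sequentially"
  using order_tendstoD(2)[OF lim', of 1] by (auto elim: eventually_mono)
 define h where "h x = max 0 (norm (rep_lfun u x) - M)" for x
 have [measurable]: "h \<in> borel_measurable lebesgue" unfolding h_def by measurable
 have hint: "integrable lebesgue (%x. norm (h x) powr q) \<and> (LINT x|lebesgue. norm (h x) powr q) <= a n powr q" if n: "a n <= 1" for n
 proof -
  have m: "\<phi> n \<in> borel_measurable lebesgue" by (rule continuous_imp_measurable_lebesgue[OF continuous_test_fun[OF \<phi>]])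
  have ae: "AE x in lebesgue. norm (h x) powr q <= norm (rep_lfun (of_fun (\<phi> n) - u) x) powr q"
   using rep_minus[of "of_fun (\<phi> n)" u] rep_of_fun[OF m]
  proof eventually_elim
   case (elim x)
   have "norm (rep_lfun u x) <= norm (\<phi> n x) + norm (\<phi> n x - rep_lfun u x)" using norm_triangle_sub[of "rep_lfun u x" "\<phi> n x"] by (simp add: norm_minus_commute)
   then have "norm (h x) <= norm (rep_lfun (of_fun (\<phi> n) - u) x)" using bnd[OF n, of x] elim by (auto simp: h_def)
   then show ?case using q1 by (intro powr_mono2) auto
  qed
  have iu: "integrable lebesgue (%x. norm (rep_lfun (of_fun (\<phi> n) - u) x) powr q)"
   using L.diff[OF fL(1) uL, of n] by (simp add: Lq_carr_iff)
  have ih: "integrable lebesgue (%x. norm (h x) powr q)"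
   by (rule bochner_bound[OF iu]) (use ae in auto)
  have "(LINT x|lebesgue. norm (h x) powr q) <= (LINT x|lebesgue. norm (rep_lfun (of_fun (\<phi> n) - u) x) powr q)"
   by (rule integral_mono_AE[OF ih iu ae])
  also have "... = Lq_norm q (of_fun (\<phi> n) - u) powr q" using q1 by (simp add: Lq_norm.rep_eq powr_powr)
  also have "... <= a n powr q" using a1[of n] q1 Lq_norm_nonneg by (intro powr_mono2) auto
  finally show ?thesis using ih by blast
 qed
 obtain n where "a n <= 1" using ev by (auto simp: eventually_sequentially)
 then have ih: "integrable lebesgue (%x. norm (h x) powr q)" using hint by blast
 have "(%n. a n powr q) \<longlonglongrightarrow> 0"
 proof (rule tendsto_zero_powrI[of _ _ "%_. q" q])
  show "\<forall>\<^sub>F n in sequentially. 0 <= a n" unfolding a_def by (intro always_eventually allI Wkq_nonneg)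
 qed (use lim' q1 in auto)
 then have "(LINT x|lebesgue. norm (h x) powr q) <= 0"
  by (rule tendsto_lowerbound) (use ev hint in \<open>auto elim: eventually_mono\<close>)
 then have "(LINT x|lebesgue. norm (h x) powr q) = 0" by (intro antisym integral_nonneg_AE) auto
 then have "AE x in lebesgue. h x = 0" by (intro integral_powr_eq_0[OF ih]) simp
 then have "AE x in lebesgue. norm (rep_lfun u x) <= M" by eventually_elim (auto simp: h_def max_def split: if_splits)
 with M0 show ?thesis by blast
qed

lemma Lq_mult_bounded:
 assumes q: "q >= 1" and M: "M >= 0" and a: "AE x in lebesgue. norm (rep_lfun a x) <= M" and w: "w \<in> carr (Lq U q)"
 shows "a * w \<in> carr (Lq U q)" and "Lq_norm q (a * w) <= M * Lq_norm q w"
proof -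
 have w': "AE x in lebesgue. x \<notin> U --> rep_lfun w x = 0" "integrable lebesgue (%x. norm (rep_lfun w x) powr q)"
  using w by (auto simp: Lq_carr_iff)
 have ae: "AE x in lebesgue. norm (rep_lfun (a * w) x) powr q <= M powr q * norm (rep_lfun w x) powr q"
  using a rep_times[of a w]
 proof eventually_elim
  case (elim x)
  then have "norm (rep_lfun (a * w) x) <= M * norm (rep_lfun w x)" by (simp add: norm_mult mult_right_mono)
  then have "norm (rep_lfun (a * w) x) powr q <= (M * norm (rep_lfun w x)) powr q" using q by (intro powr_mono2) auto
  then show ?case by (simp add: powr_mult)
 qed
 have i1: "integrable lebesgue (%x. M powr q * norm (rep_lfun w x) powr q)" using w'(2) by auto
 have i2: "integrable lebesgue (%x. norm (rep_lfun (a * w) x) powr q)"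
  by (rule bochner_bound[OF i1]) (use ae in auto)
 moreover have "AE x in lebesgue. x \<notin> U --> rep_lfun (a * w) x = 0"
  using w'(1) rep_times[of a w] by eventually_elim auto
 ultimately show "a * w \<in> carr (Lq U q)" by (simp add: Lq_carr_iff)
 have "(LINT x|lebesgue. norm (rep_lfun (a * w) x) powr q) <= (LINT x|lebesgue. M powr q * norm (rep_lfun w x) powr q)"
  by (rule integral_mono_AE[OF i2 i1 ae])
 then have "Lq_norm q (a * w) <= (M powr q * (LINT x|lebesgue. norm (rep_lfun w x) powr q)) powr (1 / q)"
  unfolding Lq_norm.rep_eq using q by (intro powr_mono2) (auto intro!: integral_nonneg_AE)
 also have "... = M * Lq_norm q w" using q M by (simp add: powr_mult powr_powr Lq_norm.rep_eq)
 finally show "Lq_norm q (a * w) <= M * Lq_norm q w" .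
qed

lemma sum_Basis_axis: "(\<Sum>e\<in>(Basis :: (real ^ 'd::finite) set). f e) = (\<Sum>i\<in>UNIV. f (axis i 1))"
proof -
 have B: "(Basis :: (real ^ 'd) set) = (%i. axis i 1) ` UNIV" by (auto simp: Basis_vec_def)
 have i: "inj (%i :: 'd. axis i (1::real))" by (auto simp: inj_def axis_eq_axis)
 show ?thesis unfolding B sum.reindex[OF i] by simp
qed

lemma axis_in_Basis_real: "(axis i 1 :: real ^ 'd::finite) \<in> Basis"
 by (auto simp: Basis_vec_def)

lemma convect_bound:
 fixes U :: "(real ^ 'd::finite) set"
 assumes q: "q >= 1" and M: "M >= 0" and y: "!!i. AE x in lebesgue. norm (rep_lfun (y $ i) x) <= M"
  and h: "!!i. pdi U i h \<in> carr (Lq U q)"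
 shows "convect U y h \<in> carr (Lq U q)" and "Lq_norm q (convect U y h) <= M * (\<Sum>i\<in>UNIV. Lq_norm q (pdi U i h))"
proof -
 interpret nsp "Lq U q" by (rule nsp_Lq[OF q])
 have c: "y $ i * pdi U i h \<in> carr (Lq U q)" for i by (rule Lq_mult_bounded(1)[OF q M y h])
 then show "convect U y h \<in> carr (Lq U q)" unfolding convect_def by (intro sum_in) auto
 have "Lq_norm q (convect U y h) <= (\<Sum>i\<in>UNIV. Lq_norm q (y $ i * pdi U i h))"
  using nrm_sum[of UNIV "%i. y $ i * pdi U i h"] c by (simp add: convect_def Lq_nrm)
 also have "... <= (\<Sum>i\<in>UNIV. M * Lq_norm q (pdi U i h))" by (intro sum_mono Lq_mult_bounded(2)[OF q M y h])
 finally show "Lq_norm q (convect U y h) <= M * (\<Sum>i\<in>UNIV. Lq_norm q (pdi U i h))" by (simp add: sum_distrib_left)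
qed

lemma W20_facts:
 fixes U :: "(real ^ 'd::finite) set"
 assumes "h \<in> carr (W20_sp U q)"
 shows "h \<in> carr (Lq U q)" "h \<in> W1q0 U q" "pdi U i h \<in> carr (Lq U q)" "pdi U j (pdi U i h) \<in> carr (Lq U q)"
  and "Lq_norm q h + (\<Sum>i\<in>UNIV. Lq_norm q (pdi U i h)) + (\<Sum>i\<in>UNIV. Lq_norm q (pdi U i (pdi U i h))) <= nrm (W20_sp U q) h"
proof -
 have h: "h \<in> carr (Wkq U 2 q)" "h \<in> W1q0 U q" using assms by (auto simp: W20_sp_def restrict_sp_def)
 then show "h \<in> carr (Lq U q)" "h \<in> W1q0 U q" by (auto simp: numeral_2_eq_2)
 show "pdi U i h \<in> carr (Lq U q)" "pdi U j (pdi U i h) \<in> carr (Lq U q)"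
  using h(1) axis_in_Basis_real by (auto simp: numeral_2_eq_2)
 have "nrm (W20_sp U q) h = Lq_norm q h + (\<Sum>i\<in>UNIV. Lq_norm q (pdi U i h) + (\<Sum>j\<in>UNIV. Lq_norm q (pdi U j (pdi U i h))))"
  by (simp add: W20_sp_def restrict_sp_def numeral_2_eq_2 sum_Basis_axis Lq_nrm)
 also have "... = Lq_norm q h + (\<Sum>i\<in>UNIV. Lq_norm q (pdi U i h)) + (\<Sum>i\<in>UNIV. (\<Sum>j\<in>UNIV. Lq_norm q (pdi U j (pdi U i h))))"
  by (simp add: sum.distrib)
 also have "... >= Lq_norm q h + (\<Sum>i\<in>UNIV. Lq_norm q (pdi U i h)) + (\<Sum>i\<in>UNIV. Lq_norm q (pdi U i (pdi U i h)))"
 proof -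
  have "Lq_norm q (pdi U i (pdi U i h)) <= (\<Sum>j\<in>UNIV. Lq_norm q (pdi U j (pdi U i h)))" for i
   by (rule member_le_sum[where f="%j. Lq_norm q (pdi U j (pdi U i h))"]) (auto simp: Lq_norm_nonneg)
  then show ?thesis by (intro add_left_mono sum_mono)
 qed
 finally show "Lq_norm q h + (\<Sum>i\<in>UNIV. Lq_norm q (pdi U i h)) + (\<Sum>i\<in>UNIV. Lq_norm q (pdi U i (pdi U i h))) <= nrm (W20_sp U q) h" .
qed

lemma W20_field_bounded:
 fixes U :: "(real ^ 'd::finite) set"
 assumes U: "open U" and q: "q > real CARD('d)" and z: "!!i. z $ i \<in> carr (W20_sp U q)"
 shows "\<exists>M\<ge>0. \<forall>i. AE x in lebesgue. norm (rep_lfun (z $ i) x) <= M"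
proof -
 have "\<exists>M\<ge>0. AE x in lebesgue. norm (rep_lfun (z $ i) x) <= M" for i
  by (rule W1q0_bounded[OF U]) (use q z W20_facts(2) in auto)
 then obtain M where M: "!!i. M i >= 0" "!!i. AE x in lebesgue. norm (rep_lfun (z $ i) x) <= M i" by metis
 have le: "M i <= sum M UNIV" for i by (rule member_le_sum) (use M in auto)
 have "AE x in lebesgue. norm (rep_lfun (z $ i) x) <= sum M UNIV" for i
  using M(2)[of i] by (rule eventually_mono) (use le[of i] in linarith)
 then show ?thesis using M(1) by (intro exI[of _ "sum M UNIV"]) (auto intro: sum_nonneg)
qed

text \<open>It compares the graph norm of \<open>heat_op\<close> with the norm of
  \<open>W20_sp\<close>, so that a trace can be measured in the interpolation space of
  \<open>Vb_state\<close>. The convection term is under control because \<open>q\<close> exceeds the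
  dimension and \<open>ye\<close> is therefore bounded.\<close>

lemma heat_op_bounded:
 fixes U :: "(real ^ 'd::finite) set"
 assumes U: "open U" and q: "q > real CARD('d)" and ye: "ye \<in> carr (vec_sp (W20_sp U q))"
 shows "\<exists>c\<ge>0. \<forall>h\<in>carr (W20_sp U q). heat_op U \<kappa> ye h \<in> carr (Lq U q) \<and> Lq_norm q (heat_op U \<kappa> ye h) <= c * nrm (W20_sp U q) h"
proof -
 have "real CARD('d) >= 1" using zero_less_card_finite[where 'a='d] by linarith
 then have q1: "q >= 1" using q by linarith
 interpret nsp "Lq U q" by (rule nsp_Lq[OF q1])
 obtain M where M: "M >= 0" "!!i. AE x in lebesgue. norm (rep_lfun (ye $ i) x) <= M"
  using W20_field_bounded[OF U q, of ye] ye by (auto simp: vec_sp_def)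
 show ?thesis
 proof (intro exI[of _ "\<bar>\<kappa>\<bar> + M"] conjI ballI)
  fix h assume h: "h \<in> carr (W20_sp U q)"
  note F = W20_facts[OF h]
  note c = convect_bound[OF q1 M F(3)]
  have l: "laplacian U h \<in> carr (Lq U q)" unfolding laplacian_def by (intro sum_in F(4)) auto
  have ln: "Lq_norm q (laplacian U h) <= (\<Sum>i\<in>UNIV. Lq_norm q (pdi U i (pdi U i h)))"
   using nrm_sum[of UNIV "%i. pdi U i (pdi U i h)"] F(4) by (simp add: laplacian_def Lq_nrm)
  show "heat_op U \<kappa> ye h \<in> carr (Lq U q)" unfolding heat_op_def by (intro diff scale l c)
  have "Lq_norm q (heat_op U \<kappa> ye h) <= \<bar>\<kappa>\<bar> * Lq_norm q (laplacian U h) + Lq_norm q (convect U ye h)"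
   using triangle_diff[OF scale[OF l, of \<kappa>] c(1)] nrm_scale[OF l, of \<kappa>] by (simp add: heat_op_def Lq_nrm)
  also have "... <= \<bar>\<kappa>\<bar> * (\<Sum>i\<in>UNIV. Lq_norm q (pdi U i (pdi U i h))) + M * (\<Sum>i\<in>UNIV. Lq_norm q (pdi U i h))"
   using ln c(2) by (intro add_mono mult_left_mono) auto
  also have "... <= \<bar>\<kappa>\<bar> * nrm (W20_sp U q) h + M * nrm (W20_sp U q) h"
  proof (intro add_mono mult_left_mono)
   have "0 <= (\<Sum>i\<in>UNIV. Lq_norm q (pdi U i h))" "0 <= (\<Sum>i\<in>UNIV. Lq_norm q (pdi U i (pdi U i h)))"
    by (intro sum_nonneg Lq_norm_nonneg)+
   then show "(\<Sum>i\<in>UNIV. Lq_norm q (pdi U i (pdi U i h))) <= nrm (W20_sp U q) h"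
    "(\<Sum>i\<in>UNIV. Lq_norm q (pdi U i h)) <= nrm (W20_sp U q) h"
    using F(5) Lq_norm_nonneg[of q h] by linarith+
  qed (use M in auto)
  finally show "Lq_norm q (heat_op U \<kappa> ye h) <= (\<bar>\<kappa>\<bar> + M) * nrm (W20_sp U q) h" by (simp add: distrib_right)
 qed (use M in auto)
qed

section \<open>Weak divergence and solenoidal fields\<close>

lemma is_weak_div_iff:
 fixes U :: "(real ^ 'd::finite) set"
 shows "is_weak_div U g h \<longleftrightarrow> (\<forall>i. g $ i \<in> L1loc U) \<and> h \<in> L1loc U
   \<and> (\<forall>\<phi>. test_fun U \<phi> --> (\<Sum>i\<in>UNIV. tst (g $ i) (partial (axis i 1) \<phi>)) = - tst h \<phi>)"
proof -
 have "lint (\<Sum>i\<in>UNIV. g $ i * of_fun (%x. complex_of_real (partial (axis i 1) \<phi> x))) = (\<Sum>i\<in>UNIV. tst (g $ i) (partial (axis i 1) \<phi>))"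
  if "\<forall>i. g $ i \<in> L1loc U" "test_fun U \<phi>" for \<phi>
  by (rule lint_sum_of_fun[where U=U]) (use that cfun_test(2)[OF _ axis_in_Basis_real] in auto)
 moreover have "lint (h * of_fun (%x. complex_of_real (\<phi> x))) = tst h \<phi>" if "test_fun U \<phi>" for \<phi>
  by (rule lint_of_fun[OF continuous_test_fun[OF that]])
 ultimately show ?thesis unfolding is_weak_div_def by auto
qed

lemma is_weak_div_unique:
 fixes U :: "(real ^ 'd::finite) set"
 assumes U: "open U" and 1: "is_weak_div U g h" and 2: "is_weak_div U g k" shows "h = k"
proof -
 have hk: "h \<in> L1loc U" "k \<in> L1loc U" using 1 2 by (auto simp: is_weak_div_def)
 have "h + (-1) *\<^sub>R k = 0"
 proof (rule L1loc_eq_0[OF U L1loc_add_scale[OF hk]])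
  fix \<phi> :: "real ^ 'd => real" assume \<phi>: "test_fun U \<phi>"
  have "(\<Sum>i\<in>UNIV. tst (g $ i) (partial (axis i 1) \<phi>)) = - tst h \<phi>"
   using 1 \<phi> unfolding is_weak_div_iff by blast
  moreover have "(\<Sum>i\<in>UNIV. tst (g $ i) (partial (axis i 1) \<phi>)) = - tst k \<phi>"
   using 2 \<phi> unfolding is_weak_div_iff by blast
  ultimately show "tst (h + (-1) *\<^sub>R k) \<phi> = 0"
   using tst_add_scale[OF hk cfun_test(1)[OF \<phi>], of "-1"] by simp
 qed
 then show ?thesis by simp
qed

lemma lint_times:
 "lint (u * w) = (LINT x|lebesgue. rep_lfun u x * rep_lfun w x)"
 unfolding lint.rep_eq by (rule integral_cong_AE) (use rep_times[of u w] in \<open>auto elim: eventually_mono\<close>)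

lemma lint_sum_times:
 assumes "finite I" "!!i. i \<in> I ==> integrable lebesgue (%x. rep_lfun (u i) x * rep_lfun (w i) x)"
 shows "lint (\<Sum>i\<in>I. u i * w i) = (\<Sum>i\<in>I. lint (u i * w i))"
proof -
 have "lint (\<Sum>i\<in>I. u i * w i) = (LINT x|lebesgue. (\<Sum>i\<in>I. rep_lfun (u i) x * rep_lfun (w i) x))"
  unfolding lint.rep_eq
 proof (rule integral_cong_AE)
  have "AE x in lebesgue. \<forall>i\<in>I. rep_lfun (u i * w i) x = rep_lfun (u i) x * rep_lfun (w i) x"
   by (rule AE_finite_allI[OF assms(1)]) (rule rep_times)
  then show "AE x in lebesgue. rep_lfun (\<Sum>i\<in>I. u i * w i) x = (\<Sum>i\<in>I. rep_lfun (u i) x * rep_lfun (w i) x)"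
   using rep_sum[OF assms(1), of "%i. u i * w i"] by eventually_elim simp
 qed auto
 also have "... = (\<Sum>i\<in>I. lint (u i * w i))"
  unfolding lint_times by (rule Bochner_Integration.integral_sum[OF assms(2)])
 finally show ?thesis .
qed

lemma lint_times_linear:
 assumes q: "q > 1" and u: "u \<in> carr (Lq U q)" and v: "v \<in> carr (Lq U q)" and w: "Lq_integrable (conj_exp q) w"
 shows "lint ((u + r *\<^sub>R v) * w) = lint (u * w) + r *\<^sub>R lint (v * w)"
  and "norm (lint (u * w)) <= Lq_norm q u * Lq_norm (conj_exp q) w"
  and "integrable lebesgue (%x. rep_lfun u x * rep_lfun w x)"
proof -
 have Lu: "Lq_integrable q u" "Lq_integrable q v" using u v by (auto simp: Lq_def)
 note Hu = Lq_Hoelder[OF q conj_exp_eq[OF q] Lu(1) w] and Hv = Lq_Hoelder[OF q conj_exp_eq[OF q] Lu(2) w]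
 show "integrable lebesgue (%x. rep_lfun u x * rep_lfun w x)" by (rule Hu(1))
 have "norm (lint (u * w)) <= (LINT x|lebesgue. norm (rep_lfun u x * rep_lfun w x))"
  unfolding lint_times by (rule integral_norm_bound)
 with Hu(2) show "norm (lint (u * w)) <= Lq_norm q u * Lq_norm (conj_exp q) w" by linarith
 have ae: "AE x in lebesgue. rep_lfun (u + r *\<^sub>R v) x = rep_lfun u x + complex_of_real r * rep_lfun v x"
  using rep_plus[of u "r *\<^sub>R v"] rep_scaleR[of r v] by eventually_elim simp
 have "lint ((u + r *\<^sub>R v) * w) = (LINT x|lebesgue. rep_lfun u x * rep_lfun w x + complex_of_real r * (rep_lfun v x * rep_lfun w x))"
  unfolding lint_times by (rule integral_cong_AE) (use ae in \<open>auto simp: algebra_simps elim: eventually_mono\<close>)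
 also have "... = lint (u * w) + complex_of_real r * lint (v * w)" using Hu(1) Hv(1) by (simp add: lint_times)
 finally show "lint ((u + r *\<^sub>R v) * w) = lint (u * w) + r *\<^sub>R lint (v * w)" by (simp add: scaleR_conv_of_real)
qed

lemma card_ge_1: "real CARD('d::finite) >= 1"
 using zero_less_card_finite[where 'a='d] by linarith

context
 fixes U :: "(real ^ 'd::finite) set" and q :: real
 assumes U: "open U" "bounded U" and q: "q > 1"
begin

interpretation L: bsp "Lq U q" by (rule bsp_Lq[OF q U(2)])
interpretation V: bsp "Lqv U q" by (rule bsp_vec) unfold_locales

text \<open>Divergence and normal trace become two families of linear conditions on the components;
  the function \<open>h\<close> in \<open>normal_trace_zero\<close> is forced to be 0 by uniqueness
  of the weak divergence. In this form linearity and closedness can be checked condition by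
  condition.\<close>

lemma Lq_sigma_iff:
 "g \<in> carr (Lqv U q) ==> is_weak_div U g 0 \<and> normal_trace_zero U q g \<longleftrightarrow>
   (\<forall>\<phi>. test_fun U \<phi> --> (\<Sum>i\<in>UNIV. tst (g $ i) (partial (axis i 1) \<phi>)) = 0)
  \<and> (\<forall>\<phi>\<in>carr (Wkq U 1 (conj_exp q)). (\<Sum>i\<in>UNIV. lint (g $ i * pdi U i \<phi>)) = 0)"
proof -
 assume g: "g \<in> carr (Lqv U q)"
 then have gi: "g $ i \<in> carr (Lq U q)" for i by (simp add: vec_sp_carr)
 have div: "is_weak_div U g 0 \<longleftrightarrow> (\<forall>\<phi>. test_fun U \<phi> --> (\<Sum>i\<in>UNIV. tst (g $ i) (partial (axis i 1) \<phi>)) = 0)"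
  unfolding is_weak_div_iff by (simp add: L1loc_0 Lq_subset_L1loc[OF q gi] tst_zero)
 have sum: "lint (\<Sum>i\<in>UNIV. g $ i * pdi U i \<phi>) = (\<Sum>i\<in>UNIV. lint (g $ i * pdi U i \<phi>))"
  if \<phi>: "\<phi> \<in> carr (Wkq U 1 (conj_exp q))" for \<phi>
 proof (rule lint_sum_times)
  fix i :: 'd
  have "pdi U i \<phi> \<in> carr (Lq U (conj_exp q))" using \<phi> axis_in_Basis_real by auto
  then have "Lq_integrable (conj_exp q) (pdi U i \<phi>)" by (simp add: Lq_def)
  then show "integrable lebesgue (%x. rep_lfun (g $ i) x * rep_lfun (pdi U i \<phi>) x)"
   using lint_times_linear(3)[OF q gi gi] by blast
 qed simp
 have l0: "lint (0 * \<phi>) = 0" for \<phi> :: "'d scalar"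
  unfolding lint_times by (rule integral_eq_zero_AE) (use rep_zero in \<open>auto elim: eventually_mono\<close>)
 have "normal_trace_zero U q g \<longleftrightarrow> (\<forall>\<phi>\<in>carr (Wkq U 1 (conj_exp q)). (\<Sum>i\<in>UNIV. lint (g $ i * pdi U i \<phi>)) = 0)"
  if d: "is_weak_div U g 0"
 proof -
  have h0: "h = 0" if "is_weak_div U g h" for h using is_weak_div_unique[OF U(1) that d] .
  show ?thesis
  proof
   assume "normal_trace_zero U q g"
   then obtain h where h: "is_weak_div U g h"
    "!!\<phi>. \<phi> \<in> carr (Wkq U 1 (conj_exp q)) ==> lint (\<Sum>i\<in>UNIV. g $ i * pdi U i \<phi>) + lint (h * \<phi>) = 0"
    unfolding normal_trace_zero_def by blast
   show "\<forall>\<phi>\<in>carr (Wkq U 1 (conj_exp q)). (\<Sum>i\<in>UNIV. lint (g $ i * pdi U i \<phi>)) = 0"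
   proof
    fix \<phi> assume \<phi>: "\<phi> \<in> carr (Wkq U 1 (conj_exp q))"
    from h(2)[OF \<phi>] show "(\<Sum>i\<in>UNIV. lint (g $ i * pdi U i \<phi>)) = 0"
     unfolding sum[OF \<phi>] h0[OF h(1)] l0 by simp
   qed
  next
   assume *: "\<forall>\<phi>\<in>carr (Wkq U 1 (conj_exp q)). (\<Sum>i\<in>UNIV. lint (g $ i * pdi U i \<phi>)) = 0"
   show "normal_trace_zero U q g" unfolding normal_trace_zero_def
   proof (intro bexI[of _ 0] conjI d L.zero ballI)
    fix \<phi> assume \<phi>: "\<phi> \<in> carr (Wkq U 1 (conj_exp q))"
    then show "lint (\<Sum>i\<in>UNIV. g $ i * pdi U i \<phi>) + lint (0 * \<phi>) = 0"
     unfolding sum[OF \<phi>] l0 using * by simp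
   qed
  qed
 qed
 with div show ?thesis by blast
qed

lemma pd_conj_integrable:
 assumes "\<phi> \<in> carr (Wkq U 1 (conj_exp q))" shows "Lq_integrable (conj_exp q) (pdi U i \<phi>)"
proof -
 have "pdi U i \<phi> \<in> carr (Lq U (conj_exp q))" using assms axis_in_Basis_real by auto
 then show ?thesis by (simp add: Lq_def)
qed

text \<open>Both families of conditions in \<open>Lq_sigma_iff\<close> are of this kind; the
  Lipschitz bound comes from boundedness of the test function in one case and from Hoelder's
  inequality in the other.\<close>

lemma sum_limit_zero:
 fixes T :: "'d => 'd scalar => complex"
 assumes T: "!!i u v. u \<in> carr (Lq U q) ==> v \<in> carr (Lq U q) ==> norm (T i u - T i v) <= B i * Lq_norm q (u - v)"
  and s: "!!n. s n \<in> carr (Lqv U q)" and l: "tends_in (Lqv U q) s l sequentially"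
  and z: "!!n. (\<Sum>i\<in>UNIV. T i (s n $ i)) = 0"
 shows "(\<Sum>i\<in>UNIV. T i (l $ i)) = 0"
proof -
 have lc: "l \<in> carr (Lqv U q)" and lim: "(%n. \<Sum>i\<in>UNIV. Lq_norm q (s n $ i - l $ i)) \<longlonglongrightarrow> 0"
  using l by (auto simp: tends_in_def vec_sp_nrm Lq_nrm)
 have "(%n. T i (s n $ i)) \<longlonglongrightarrow> T i (l $ i)" for i
 proof -
  have le: "Lq_norm q (s n $ i - l $ i) <= (\<Sum>i\<in>UNIV. Lq_norm q (s n $ i - l $ i))" for n
   by (rule member_le_sum) (auto simp: Lq_norm_nonneg)
  have "norm (T i (s n $ i) - T i (l $ i)) <= \<bar>B i\<bar> * (\<Sum>i\<in>UNIV. Lq_norm q (s n $ i - l $ i))" for n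
  proof -
   have "norm (T i (s n $ i) - T i (l $ i)) <= B i * Lq_norm q (s n $ i - l $ i)"
    using T s lc by (simp add: vec_sp_carr)
   also have "... <= \<bar>B i\<bar> * Lq_norm q (s n $ i - l $ i)" by (intro mult_right_mono Lq_norm_nonneg) auto
   also have "... <= \<bar>B i\<bar> * (\<Sum>i\<in>UNIV. Lq_norm q (s n $ i - l $ i))" by (intro mult_left_mono le) auto
   finally show ?thesis .
  qed
  note le' = this
  have lim': "(%n. \<bar>B i\<bar> * (\<Sum>i\<in>UNIV. Lq_norm q (s n $ i - l $ i))) \<longlonglongrightarrow> 0"
   using tendsto_mult[OF tendsto_const lim, of "\<bar>B i\<bar>"] by simp
  have "(%n. T i (s n $ i) - T i (l $ i)) \<longlonglongrightarrow> 0"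
   by (rule Lim_null_comparison[OF always_eventually[OF allI[OF le']] lim'])
  then show ?thesis by (simp add: LIM_zero_iff)
 qed
 then have "(%n. \<Sum>i\<in>UNIV. T i (s n $ i)) \<longlonglongrightarrow> (\<Sum>i\<in>UNIV. T i (l $ i))" by (intro tendsto_sum)
 then show ?thesis by (simp add: z LIMSEQ_const_iff)
qed

lemma tst_Lq_Lipschitz:
 assumes \<phi>: "cfun U \<phi>"
 shows "\<exists>B. \<forall>u\<in>carr (Lq U q). \<forall>v\<in>carr (Lq U q). norm (tst u \<phi> - tst v \<phi>) <= B * Lq_norm q (u - v)"
proof -
 obtain c where c: "c >= 0" "!!u. u \<in> carr (Lq U q) ==> integrable lebesgue (rep_lfun u)"
  "!!u. u \<in> carr (Lq U q) ==> (LINT x|lebesgue. norm (rep_lfun u x)) <= c * Lq_norm q u"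
  using Lq_L1[OF q U(2)] by metis
 obtain K where K: "compact K" "!!x. x \<notin> K ==> \<phi> x = 0" and cont: "continuous_on UNIV \<phi>"
  using \<phi> by (auto simp: cfun_def)
 have "bounded (\<phi> ` K)" by (intro compact_imp_bounded compact_continuous_image K continuous_on_subset[OF cont]) auto
 then obtain B0 where B0: "!!t. t \<in> K ==> \<bar>\<phi> t\<bar> <= B0" by (metis (no_types, lifting) bounded_iff imageI real_norm_def)
 define B where "B = max B0 0"
 have B: "\<bar>\<phi> t\<bar> <= B" for t using B0[of t] K(2)[of t] by (cases "t \<in> K") (auto simp: B_def)
 show ?thesis
 proof (intro exI[of _ "B * c"] ballI)
  fix u v assume u: "u \<in> carr (Lq U q)" and v: "v \<in> carr (Lq U q)"
  have d: "u + (-1) *\<^sub>R v \<in> carr (Lq U q)" using L.diff[OF u v] by simp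
  have "tst u \<phi> - tst v \<phi> = tst (u + (-1) *\<^sub>R v) \<phi>"
   using tst_add_scale[OF Lq_subset_L1loc[OF q u] Lq_subset_L1loc[OF q v] \<phi>, of "-1"] by simp
  also have "norm ... <= (LINT x|lebesgue. norm (rep_lfun (u + (-1) *\<^sub>R v) x * complex_of_real (\<phi> x)))"
   unfolding tst_def by (rule integral_norm_bound)
  also have "... <= (LINT x|lebesgue. B * norm (rep_lfun (u + (-1) *\<^sub>R v) x))"
  proof (rule integral_mono)
   show "integrable lebesgue (%x. norm (rep_lfun (u + (-1) *\<^sub>R v) x * complex_of_real (\<phi> x)))"
    by (intro integrable_norm cfun_integrable[OF Lq_subset_L1loc[OF q d] \<phi>])
   show "norm (rep_lfun (u + (-1) *\<^sub>R v) x * complex_of_real (\<phi> x)) <= B * norm (rep_lfun (u + (-1) *\<^sub>R v) x)" for x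
    using mult_right_mono[OF B[of x], of "norm (rep_lfun (u + (-1) *\<^sub>R v) x)"] by (simp add: norm_mult mult.commute)
  qed (use c(2)[OF d] in auto)
  also have "... = B * (LINT x|lebesgue. norm (rep_lfun (u + (-1) *\<^sub>R v) x))" by simp
  also have "... <= B * (c * Lq_norm q (u + (-1) *\<^sub>R v))"
   by (intro mult_left_mono c(3) d) (auto simp: B_def)
  finally show "norm (tst u \<phi> - tst v \<phi>) <= B * c * Lq_norm q (u - v)" by (simp add: mult.assoc)
 qed
qed

lemma bsp_Lq_sigma: "bsp (Lq_sigma U q)"
 unfolding Lq_sigma_def
proof (rule bsp_restrict)
 show "bsp (Lqv U q)" by unfold_locales
 have tz: "lint (0 * w) = 0" for w :: "'d scalar"
  unfolding lint_times by (rule integral_eq_zero_AE) (use rep_zero in \<open>auto elim: eventually_mono\<close>)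
 show "0 \<in> {g. is_weak_div U g 0 \<and> normal_trace_zero U q g}"
  using Lq_sigma_iff[OF V.zero] by (simp add: tst_zero tz)
 have comb: "x + r *\<^sub>R y \<in> {g. is_weak_div U g 0 \<and> normal_trace_zero U q g}"
  if x: "x \<in> carr (Lqv U q)" "x \<in> {g. is_weak_div U g 0 \<and> normal_trace_zero U q g}"
   and y: "y \<in> carr (Lqv U q)" "y \<in> {g. is_weak_div U g 0 \<and> normal_trace_zero U q g}" for x y r
 proof -
  have xi: "x $ i \<in> carr (Lq U q)" "y $ i \<in> carr (Lq U q)" for i using x y by (auto simp: vec_sp_carr)
  have "x + r *\<^sub>R y \<in> carr (Lqv U q)" by (intro V.add V.scale x y)
  moreover have "(\<Sum>i\<in>UNIV. tst ((x + r *\<^sub>R y) $ i) (partial (axis i 1) \<phi>)) = 0" if \<phi>: "test_fun U \<phi>" for \<phi>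
  proof -
   have "(\<Sum>i\<in>UNIV. tst ((x + r *\<^sub>R y) $ i) (partial (axis i 1) \<phi>))
    = (\<Sum>i\<in>UNIV. tst (x $ i) (partial (axis i 1) \<phi>)) + r *\<^sub>R (\<Sum>i\<in>UNIV. tst (y $ i) (partial (axis i 1) \<phi>))"
    by (simp add: tst_add_scale[OF Lq_subset_L1loc[OF q xi(1)] Lq_subset_L1loc[OF q xi(2)] cfun_test(2)[OF \<phi> axis_in_Basis_real]]
      sum.distrib scaleR_sum_right)
   then show ?thesis using x y \<phi> Lq_sigma_iff by simp
  qed
  moreover have "(\<Sum>i\<in>UNIV. lint ((x + r *\<^sub>R y) $ i * pdi U i \<phi>)) = 0" if \<phi>: "\<phi> \<in> carr (Wkq U 1 (conj_exp q))" for \<phi>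
  proof -
   have "(\<Sum>i\<in>UNIV. lint ((x + r *\<^sub>R y) $ i * pdi U i \<phi>))
    = (\<Sum>i\<in>UNIV. lint (x $ i * pdi U i \<phi>)) + r *\<^sub>R (\<Sum>i\<in>UNIV. lint (y $ i * pdi U i \<phi>))"
    by (simp add: lint_times_linear(1)[OF q xi pd_conj_integrable[OF \<phi>]] sum.distrib scaleR_sum_right)
   moreover have "(\<Sum>i\<in>UNIV. lint (x $ i * pdi U i \<phi>)) = 0" using x \<phi> Lq_sigma_iff by blast
   moreover have "(\<Sum>i\<in>UNIV. lint (y $ i * pdi U i \<phi>)) = 0" using y \<phi> Lq_sigma_iff by blast
   ultimately show ?thesis by simp
  qed
  ultimately show ?thesis using Lq_sigma_iff by blast
 qed
 show "x + y \<in> {g. is_weak_div U g 0 \<and> normal_trace_zero U q g}"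
  if "x \<in> carr (Lqv U q)" "y \<in> carr (Lqv U q)" "x \<in> {g. is_weak_div U g 0 \<and> normal_trace_zero U q g}"
   "y \<in> {g. is_weak_div U g 0 \<and> normal_trace_zero U q g}" for x y
  using comb[OF that(1,3) that(2,4), of 1] by (simp only: scaleR_one)
 show "r *\<^sub>R x \<in> {g. is_weak_div U g 0 \<and> normal_trace_zero U q g}"
  if "x \<in> carr (Lqv U q)" "x \<in> {g. is_weak_div U g 0 \<and> normal_trace_zero U q g}" for r x
  using comb[OF V.zero \<open>0 \<in> _\<close> that, of r] by (simp only: add_0)
 show "l \<in> {g. is_weak_div U g 0 \<and> normal_trace_zero U q g}"
  if s: "!!n::nat. s n \<in> carr (Lqv U q) \<inter> {g. is_weak_div U g 0 \<and> normal_trace_zero U q g}"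
   and l: "tends_in (Lqv U q) s l sequentially" for s l
 proof -
  have sc: "s n \<in> carr (Lqv U q)" for n using s by blast
  have lc: "l \<in> carr (Lqv U q)" using l by (simp add: tends_in_def)
  have "(\<Sum>i\<in>UNIV. tst (l $ i) (partial (axis i 1) \<phi>)) = 0" if \<phi>: "test_fun U \<phi>" for \<phi>
  proof -
   have "\<exists>B. \<forall>u\<in>carr (Lq U q). \<forall>v\<in>carr (Lq U q). norm (tst u (partial (axis i 1) \<phi>) - tst v (partial (axis i 1) \<phi>)) <= B * Lq_norm q (u - v)" for i
    by (rule tst_Lq_Lipschitz[OF cfun_test(2)[OF \<phi> axis_in_Basis_real]])
   then obtain B where "!!i u v. u \<in> carr (Lq U q) ==> v \<in> carr (Lq U q) ==>
    norm (tst u (partial (axis i 1) \<phi>) - tst v (partial (axis i 1) \<phi>)) <= B i * Lq_norm q (u - v)" by metis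
   then show ?thesis
    by (rule sum_limit_zero[OF _ sc l]) (use s Lq_sigma_iff[OF sc] \<phi> in auto)
  qed
  moreover have "(\<Sum>i\<in>UNIV. lint (l $ i * pdi U i \<phi>)) = 0" if \<phi>: "\<phi> \<in> carr (Wkq U 1 (conj_exp q))" for \<phi>
  proof (rule sum_limit_zero[OF _ sc l])
   fix i u v assume u: "u \<in> carr (Lq U q)" and v: "v \<in> carr (Lq U q)"
   have "u + (-1) *\<^sub>R v \<in> carr (Lq U q)" using L.diff[OF u v] by simp
   from lint_times_linear(2)[OF q this v pd_conj_integrable[OF \<phi>], of i] lint_times_linear(1)[OF q u v pd_conj_integrable[OF \<phi>], of "-1" i]
   show "norm (lint (u * pdi U i \<phi>) - lint (v * pdi U i \<phi>)) <= Lq_norm (conj_exp q) (pdi U i \<phi>) * Lq_norm q (u - v)"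
    by (simp add: mult.commute)
  next
   fix n show "(\<Sum>i\<in>UNIV. lint (s n $ i * pdi U i \<phi>)) = 0" using s[of n] Lq_sigma_iff[OF sc[of n]] \<phi> by blast
  qed
  ultimately show ?thesis using Lq_sigma_iff[OF lc] by blast
 qed
qed

text \<open>\<open>Pq\<close> is a definite description. The decomposition in
  \<open>helmholtz\<close> gives existence, and the trivial intersection of solenoidal and gradient
  fields gives uniqueness.\<close>

lemma Pq_in_Lq_sigma:
 assumes H: "helmholtz U q" and w: "w \<in> carr (Lqv U q)"
 shows "Pq U q w \<in> carr (Lq_sigma U q)"
proof -
 interpret S: bsp "Lq_sigma U q" by (rule bsp_Lq_sigma)
 obtain v g where vg: "w = v + g" "v \<in> carr (Lq_sigma U q)" "g \<in> Gq U q" using H w by (auto simp: helmholtz_def)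
 have "\<exists>!v. v \<in> carr (Lq_sigma U q) \<and> w - v \<in> Gq U q"
 proof (rule ex1I[of _ v])
  show "v \<in> carr (Lq_sigma U q) \<and> w - v \<in> Gq U q" using vg by simp
  fix v' assume v': "v' \<in> carr (Lq_sigma U q) \<and> w - v' \<in> Gq U q"
  have "v' - v \<in> Gq U q"
  proof -
   obtain \<pi> where \<pi>: "!!i. is_weak_pd U (axis i 1) \<pi> (g $ i)" and gL: "g \<in> carr (Lqv U q)" using vg by (auto simp: Gq_def)
   obtain \<pi>' where \<pi>': "!!i. is_weak_pd U (axis i 1) \<pi>' ((w - v') $ i)" and gL': "w - v' \<in> carr (Lqv U q)" using v' by (auto simp: Gq_def)
   have eq: "v' - v = g + (-1) *\<^sub>R (w - v')" by (simp add: vg)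
   have "is_weak_pd U (axis i 1) (\<pi> + (-1) *\<^sub>R \<pi>') ((v' - v) $ i)" for i
    using is_weak_pd_add_scale[OF axis_in_Basis_real \<pi>[of i] \<pi>'[of i], of "-1"] unfolding eq by simp
   moreover have "v' - v \<in> carr (Lqv U q)" unfolding eq by (intro V.add V.scale gL gL')
   ultimately show ?thesis by (auto simp: Gq_def)
  qed
  moreover have "v' - v \<in> carr (Lq_sigma U q)" using v' vg S.diff by blast
  ultimately have "v' - v \<in> carr (Lq_sigma U q) \<inter> Gq U q" by blast
  then have "v' - v = 0" using H unfolding helmholtz_def by blast
  then show "v' = v" by simp
 qed
 from theI'[OF this] show ?thesis unfolding Pq_def by blast
qed

text \<open>Since \<open>q\<close> exceeds the dimension, \<open>z\<close> is essentially bounded,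
  so multiplication by its components keeps the gradients of \<open>z\<close> and \<open>h\<close>
  in \<open>Lq\<close>.\<close>

lemma bouss_nonlin_in_W:
 assumes qd: "q > real CARD('d)" and H: "helmholtz U q"
  and z: "z \<in> carr (W20_sigma_sp U q)" and h: "h \<in> carr (W20_sp U q)"
 shows "bouss_nonlin U q (z, h) \<in> carr (W_state U q)"
proof -
 have zi: "z $ i \<in> carr (W20_sp U q)" for i using z by (auto simp: W20_sigma_sp_def restrict_sp_def vec_sp_carr)
 obtain M where M: "M >= 0" "!!i. AE x in lebesgue. norm (rep_lfun (z $ i) x) <= M"
  using W20_field_bounded[OF U(1) qd zi] by auto
 have "convect U z h \<in> carr (Lq U q)" by (rule convect_bound(1)[OF _ M W20_facts(3)[OF h]]) (use q in simp)
 moreover have "convect U z (z $ j) \<in> carr (Lq U q)" for j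
  by (rule convect_bound(1)[OF _ M W20_facts(3)[OF zi]]) (use q in simp)
 then have "convect_vec U z z \<in> carr (Lqv U q)" by (simp add: convect_vec_def vec_sp_carr)
 ultimately show ?thesis using Pq_in_Lq_sigma[OF H] by (simp add: bouss_nonlin_def W_state_def prod_sp_def)
qed

lemma bsp_W_state: "bsp (W_state U q)"
 unfolding W_state_def by (rule bsp_prod[OF bsp_Lq_sigma L.bsp_axioms])

end

section \<open>Absolutely continuous paths\<close>

lemma finite_null_lebesgue: "finite A ==> A \<in> null_sets (lebesgue :: real measure)"
 by (intro null_sets_completionI finite_imp_null_set_lborel)

lemma null_lebesgue_singleton: "{a} \<in> null_sets (lebesgue :: real measure)"
 by (rule finite_null_lebesgue) simp

lemma lebesgue_AE_cong:
 fixes f g :: "'a::euclidean_space => real"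
 assumes f: "integrable lebesgue f" and ae: "AE x in lebesgue. f x = g x"
 shows "integrable lebesgue g" and "(LINT x|lebesgue. g x) = (LINT x|lebesgue. f x)"
proof -
 have g: "g \<in> borel_measurable lebesgue"
  by (rule completion.borel_measurable_AE_cong[OF borel_measurable_integrable[OF f] ae])
 show "integrable lebesgue g"
  by (rule bochner_cong_AE[OF f g]) (use ae in \<open>auto elim: eventually_mono\<close>)
 show "(LINT x|lebesgue. g x) = (LINT x|lebesgue. f x)"
  by (rule integral_cong_AE) (use f g ae in \<open>auto elim: eventually_mono\<close>)
qed

context zsp begin

lemma Lp_iff: "f \<in> carr (Lp_time p X) \<longleftrightarrow> strongly_meas X UNIV (zext {0<..} f)
  \<and> integrable lebesgue (%t. nrm X (zext {0<..} f t) powr p)"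
 using strongly_meas_zext[of "{0<..}" f] integrable_zext(1)[of "{0<..}" "%x. nrm X x powr p" f]
 by (simp add: Lp_time_def nrm_0)

lemma Lp_nrm: "nrm (Lp_time p X) f = (LINT t|lebesgue. nrm X (zext {0<..} f t) powr p) powr (1 / p)"
 using integrable_zext(2)[of "{0<..}" "%x. nrm X x powr p" f] by (simp add: Lp_time_def nrm_0)

lemma Lp_nrm_nonneg: "nrm (Lp_time p X) f >= 0"
 by (simp add: Lp_nrm)

lemma strongly_meas_UNIV_AE_cong:
 assumes "strongly_meas X UNIV f" "AE t in lebesgue. f t = g t" shows "strongly_meas X UNIV g"
 by (rule strongly_meas_AE_cong[of UNIV f g, unfolded lebesgue_on_UNIV_eq, OF assms])

lemma Lp_nrm_measurable:
 assumes "f \<in> carr (Lp_time p X)" "p > 0" shows "(%t. nrm X (zext {0<..} f t)) \<in> borel_measurable lebesgue"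
proof -
 have i: "integrable lebesgue (%t. nrm X (zext {0<..} f t) powr p)" using assms by (simp add: Lp_iff)
 have "(%t. (nrm X (zext {0<..} f t) powr p) powr (1 / p)) \<in> borel_measurable lebesgue"
  by (rule powr_real_measurable[OF borel_measurable_integrable[OF i] borel_measurable_const])
 then show ?thesis using assms(2) nonneg by (simp add: powr_powr)
qed

lemma Lp_AE_cong:
 assumes f: "f \<in> carr (Lp_time p X)" and ae: "AE t in lebesgue. t > 0 --> f t = g t"
 shows "g \<in> carr (Lp_time p X)" and "nrm (Lp_time p X) g = nrm (Lp_time p X) f"
proof -
 have z: "AE t in lebesgue. zext {0<..} f t = zext {0<..} g t" using ae by eventually_elim (simp add: zext_def)
 then have z2: "AE t in lebesgue. nrm X (zext {0<..} f t) powr p = nrm X (zext {0<..} g t) powr p" by eventually_elim simp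
 note i = f[unfolded Lp_iff, THEN conjunct2]
 show "g \<in> carr (Lp_time p X)" "nrm (Lp_time p X) g = nrm (Lp_time p X) f"
  using f strongly_meas_UNIV_AE_cong[OF _ z] lebesgue_AE_cong[OF i z2] by (auto simp: Lp_iff Lp_nrm)
qed

end

text \<open>Subadditivity of the \<open>p\<close>-th root; it turns additive growth of a
  \<open>p\<close>-th power under loop insertion into additive growth of the norm.\<close>

lemma powr_sum_ge:
 fixes x y p :: real
 assumes p: "p >= 1" and x: "x >= 0" and y: "y >= 0"
 shows "(x + y) powr (1 / p) <= x powr (1 / p) + y powr (1 / p)"
proof (cases "x + y = 0")
 case False
 then have s: "x + y > 0" using x y by linarith
 have le: "w <= w powr (1 / p)" if "0 <= w" "w <= 1" for w :: real
 proof (cases "w = 0")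
  case False
  then have "w powr 1 <= w powr (1 / p)" using that p by (intro powr_mono') auto
  then show ?thesis using that by simp
 qed (use p in simp)
 have "1 = x / (x + y) + y / (x + y)" using s by (simp add: add_divide_distrib[symmetric])
 also have "... <= (x / (x + y)) powr (1 / p) + (y / (x + y)) powr (1 / p)"
  using x y s by (intro add_mono le) auto
 also have "... = (x powr (1 / p) + y powr (1 / p)) / (x + y) powr (1 / p)"
  using x y s by (simp add: powr_divide add_divide_distrib)
 finally show ?thesis using s by (simp add: field_simps)
qed (use x y in auto)

text \<open>The path \<open>v\<close> with the loop \<open>u|\<^bsub>[T,T']\<^esub>\<close> (forth and back) inserted at time \<open>T\<close>; on derivatives,
 the way back is traversed with \<open>w = - u\<close>.\<close>

definition insert_loop :: "real => real => (real => 'v) => (real => 'v) => (real => 'v) => real => 'v" where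
 "insert_loop T T' v u w t = (if t <= T then v t else if t <= T' then u t
   else if t <= 2 * T' - T then w (2 * T' + (-1) * t) else v (2 * (T - T') + 1 * t))"

text \<open>The factor 2 counts the two passages through the loop; the part of \<open>a\<close>
  after \<open>T\<close> is merely translated. \<open>c\<close> is compared with \<open>b\<close>
  only almost everywhere, because on the way back it stands for the norm of a reversed
  derivative.\<close>

lemma insert_loop_integral:
 fixes a b c :: "real => real"
 assumes T: "T <= T'" and a: "integrable lebesgue a" and b: "integrable lebesgue (%t. indicator {T<..T'} t * b t)"
  and bc: "AE t in lebesgue. indicator {T<..T'} t * c t = indicator {T<..T'} t * b t"
 shows "integrable lebesgue (insert_loop T T' a b c)"
  and "(LINT t|lebesgue. insert_loop T T' a b c t) = (LINT t|lebesgue. a t) + 2 * (LINT t|lebesgue. indicator {T<..T'} t * b t)"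
proof -
 define b' c' where "b' t = indicator {T<..T'} t * b t" and "c' t = indicator {T..<T'} t * c t" for t
 have ic: "integrable lebesgue c'" and Ic: "(LINT t|lebesgue. c' t) = (LINT t|lebesgue. b' t)"
 proof -
  have nn: "AE t in lebesgue. t \<notin> {T, T'}" by (rule AE_not_in[OF finite_null_lebesgue]) simp
  have ae: "AE t in lebesgue. b' t = c' t"
   using bc nn
   by eventually_elim (auto simp: b'_def c'_def split: split_indicator split_indicator_asm)
  have ib: "integrable lebesgue b'" unfolding b'_def by (rule b)
  show "integrable lebesgue c'" "(LINT t|lebesgue. c' t) = (LINT t|lebesgue. b' t)"
   by (rule lebesgue_AE_cong[OF ib ae])+
 qed
 have ib: "integrable lebesgue b'" using b by (simp add: b'_def[abs_def])
 have ia1: "integrable lebesgue (%t. indicator {..T} t * a t)" and ia2: "integrable lebesgue (%t. indicator {T<..} t * a t)"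
  using integrable_mult_indicator[OF _ a, of "{..T}"] integrable_mult_indicator[OF _ a, of "{T<..}"] by auto
 have r: "integrable lebesgue (%t. c' (2 * T' + (-1) * t))" "(LINT t|lebesgue. c' (2 * T' + (-1) * t)) = (LINT t|lebesgue. c' t)"
  using lebesgue_integrable_real_affine[OF ic, of "-1" "2 * T'"] lebesgue_integral_real_affine[of "-1" c' "2 * T'"] by auto
 have s: "integrable lebesgue (%t. indicator {T<..} (2 * (T - T') + 1 * t) * a (2 * (T - T') + 1 * t))"
  "(LINT t|lebesgue. indicator {T<..} (2 * (T - T') + 1 * t) * a (2 * (T - T') + 1 * t)) = (LINT t|lebesgue. indicator {T<..} t * a t)"
  using lebesgue_integrable_real_affine[OF ia2, of 1 "2 * (T - T')"] lebesgue_integral_real_affine[of 1 "%t. indicator {T<..} t * a t" "2 * (T - T')"] by auto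
 have eq: "insert_loop T T' a b c = (%t. indicator {..T} t * a t + b' t + c' (2 * T' + (-1) * t)
   + indicator {T<..} (2 * (T - T') + 1 * t) * a (2 * (T - T') + 1 * t))"
  using T by (auto simp: fun_eq_iff insert_loop_def b'_def c'_def split: split_indicator)
 show "integrable lebesgue (insert_loop T T' a b c)" unfolding eq using ia1 ib r s by auto
 have "(LINT t|lebesgue. insert_loop T T' a b c t) = (LINT t|lebesgue. indicator {..T} t * a t) + (LINT t|lebesgue. b' t) + (LINT t|lebesgue. b' t) + (LINT t|lebesgue. indicator {T<..} t * a t)"
  unfolding eq using ia1 ib r s Ic by simp
 also have "(LINT t|lebesgue. indicator {..T} t * a t) + (LINT t|lebesgue. indicator {T<..} t * a t) = (LINT t|lebesgue. a t)"
  by (subst Bochner_Integration.integral_add[symmetric, OF ia1 ia2], rule bochner_cong) (auto split: split_indicator)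
 then have "(LINT t|lebesgue. indicator {..T} t * a t) + (LINT t|lebesgue. b' t) + (LINT t|lebesgue. b' t) + (LINT t|lebesgue. indicator {T<..} t * a t)
   = (LINT t|lebesgue. a t) + 2 * (LINT t|lebesgue. b' t)" by simp
 finally show "(LINT t|lebesgue. insert_loop T T' a b c t) = (LINT t|lebesgue. a t) + 2 * (LINT t|lebesgue. indicator {T<..T'} t * b t)"
  by (simp add: b'_def)
qed

context zsp begin

lemma Lp_insert_loop:
 assumes p: "p >= 1" and T: "0 <= T" "T <= T'" and v: "v \<in> carr (Lp_time p X)" and u: "u \<in> carr (Lp_time p X)"
  and w: "w \<in> carr (Lp_time p X)" and wu: "AE t in lebesgue. t > 0 --> nrm X (w t) = nrm X (u t)"
 shows "insert_loop T T' v u w \<in> carr (Lp_time p X)"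
  and "nrm (Lp_time p X) (insert_loop T T' v u w) <= nrm (Lp_time p X) v
    + (2 * (LINT t|lebesgue. indicator {T<..T'} t * nrm X (zext {0<..} u t) powr p)) powr (1 / p)"
proof -
 let ?z = "zext {0<..}"
 let ?h = "insert_loop T T' (?z v) (?z u) (?z w)"
 have ae: "AE t in lebesgue. ?z (insert_loop T T' v u w) t = ?h t"
  using AE_not_in[OF null_lebesgue_singleton[of "2 * T' - T"]]
  by (rule AE_mp) (use T in \<open>auto simp: zext_def insert_loop_def intro!: AE_I2\<close>)
 have sm: "strongly_meas X UNIV (?z v)" "strongly_meas X UNIV (?z u)" "strongly_meas X UNIV (?z w)"
  using v u w by (auto simp: Lp_iff)
 have heq: "?h = (%t. if t \<in> {..T} then ?z v t else if t \<in> {..T'} then ?z u t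
   else if t \<in> {..2 * T' - T} then ?z w (2 * T' + (-1) * t) else ?z v (2 * (T - T') + 1 * t))"
  by (auto simp: fun_eq_iff insert_loop_def)
 have smh: "strongly_meas X UNIV ?h" unfolding heq
  by (rule strongly_meas_If[OF _ sm(1) strongly_meas_If[OF _ sm(2)
    strongly_meas_If[OF _ strongly_meas_affine[OF sm(3)] strongly_meas_affine[OF sm(1)]]]]) auto
 have smg: "strongly_meas X UNIV (?z (insert_loop T T' v u w))"
  by (rule strongly_meas_UNIV_AE_cong[OF smh]) (use ae in \<open>auto elim: eventually_mono\<close>)
 have iv: "integrable lebesgue (%t. nrm X (?z v t) powr p)" using v by (simp add: Lp_iff)
 have "integrable lebesgue (%t. nrm X (?z u t) powr p)" using u by (simp add: Lp_iff)
 from integrable_mult_indicator[OF _ this, of "{T<..T'}"]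
 have iu: "integrable lebesgue (%t. indicator {T<..T'} t * nrm X (?z u t) powr p)" by simp
 have wu': "AE t in lebesgue. indicator {T<..T'} t * nrm X (?z w t) powr p = indicator {T<..T'} t * nrm X (?z u t) powr p"
  using wu by eventually_elim (simp add: zext_def)
 note G = insert_loop_integral[OF T(2) iv iu wu']
 have eq: "insert_loop T T' (%t. nrm X (?z v t) powr p) (%t. nrm X (?z u t) powr p) (%t. nrm X (?z w t) powr p) t = nrm X (?h t) powr p" for t
  by (simp add: insert_loop_def)
 have ae2: "AE t in lebesgue. nrm X (?h t) powr p = nrm X (?z (insert_loop T T' v u w) t) powr p"
  using ae by eventually_elim simp
 note H = lebesgue_AE_cong[OF G(1)[unfolded eq[abs_def], simplified eq] ae2]
 show "insert_loop T T' v u w \<in> carr (Lp_time p X)" using smg H(1) by (simp add: Lp_iff)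
 have "nrm (Lp_time p X) (insert_loop T T' v u w) = ((LINT t|lebesgue. nrm X (?z v t) powr p) + 2 * (LINT t|lebesgue. indicator {T<..T'} t * nrm X (?z u t) powr p)) powr (1 / p)"
  unfolding Lp_nrm H(2) using G(2) by (simp add: eq)
 also have "... <= nrm (Lp_time p X) v + (2 * (LINT t|lebesgue. indicator {T<..T'} t * nrm X (?z u t) powr p)) powr (1 / p)"
  unfolding Lp_nrm by (rule powr_sum_ge[OF p]) (auto intro!: integral_nonneg_AE mult_nonneg_nonneg)
 finally show "nrm (Lp_time p X) (insert_loop T T' v u w) <= nrm (Lp_time p X) v
    + (2 * (LINT t|lebesgue. indicator {T<..T'} t * nrm X (zext {0<..} u t) powr p)) powr (1 / p)" .
qed

lemma Lp_shift:
 assumes a: "a >= 0" and f: "f \<in> carr (Lp_time p X)" shows "(%t. f (a + 1 * t)) \<in> carr (Lp_time p X)"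
proof -
 let ?z = "zext {0<..}"
 have eq: "?z (%t. f (a + 1 * t)) = (%t. if t \<in> {0<..} then ?z f (a + 1 * t) else 0)" using a by (auto simp: zext_def fun_eq_iff)
 have sm: "strongly_meas X UNIV (?z f)" and i: "integrable lebesgue (%t. nrm X (?z f t) powr p)" using f by (auto simp: Lp_iff)
 have "strongly_meas X UNIV (?z (%t. f (a + 1 * t)))"
  unfolding eq by (rule strongly_meas_If[OF _ strongly_meas_affine[OF sm] strongly_meas_0]) auto
 moreover have "integrable lebesgue (%t. nrm X (?z (%t. f (a + 1 * t)) t) powr p)"
 proof -
  have "integrable lebesgue (%t. indicator {0<..} t *\<^sub>R (nrm X (?z f (a + 1 * t)) powr p))"
   by (intro integrable_mult_indicator lebesgue_integrable_real_affine[OF i]) auto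
  moreover have "indicator {0<..} t *\<^sub>R (nrm X (?z f (a + 1 * t)) powr p) = nrm X (?z (%t. f (a + 1 * t)) t) powr p" for t
   unfolding eq by (auto simp: nrm_0)
  ultimately show ?thesis by (simp only:)
 qed
 ultimately show ?thesis by (simp add: Lp_iff)
qed

end

context nsp begin

lemma Lp_xint:
 assumes p: "p >= 1" and f: "f \<in> carr (Lp_time p X)" and S: "S \<in> sets lebesgue" "S \<subseteq> {0..R}"
 shows "xint UNIV (%t. if t \<in> S then zext {0<..} f t else 0)"
proof -
 let ?f = "zext {0<..} f"
 have sm: "strongly_meas X UNIV ?f" and i: "integrable lebesgue (%t. nrm X (?f t) powr p)" using f by (auto simp: Lp_iff)
 have "strongly_meas X UNIV (%t. if t \<in> S then ?f t else 0)" by (rule strongly_meas_If[OF S(1) sm strongly_meas_0])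
 moreover have "integrable lebesgue (%t. nrm X (if t \<in> S then ?f t else 0))"
 proof (rule bochner_bound)
  have "integrable lebesgue (indicator {0..R} :: real => real)" using lmeasurable_cbox[of 0 R] by (simp add: lmeasurable_iff_integrable)
  then show "integrable lebesgue (%t. indicator {0..R} t + nrm X (?f t) powr p)" using i by auto
  show "(%t. nrm X (if t \<in> S then ?f t else 0)) \<in> borel_measurable lebesgue"
   using strongly_meas_nrm[OF _ calculation] by (simp add: lebesgue_on_UNIV_eq)
  show "AE t in lebesgue. norm (nrm X (if t \<in> S then ?f t else 0)) <= norm (indicator {0..R} t + nrm X (?f t) powr p)"
  proof (rule AE_I2)
   fix t
   have "nrm X (?f t) <= 1 + nrm X (?f t) powr p"
   proof (cases "nrm X (?f t) <= 1")
    case False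
    then have "nrm X (?f t) powr 1 <= nrm X (?f t) powr p" using p by (intro powr_mono) auto
    then show ?thesis using False by simp
   qed (simp add: add_increasing2)
   then show "norm (nrm X (if t \<in> S then ?f t else 0)) <= norm (indicator {0..R} t + nrm X (?f t) powr p)"
    using nonneg S by (auto simp: nrm_0 split: split_indicator)
  qed
 qed
 ultimately show ?thesis by (simp add: xint_def lebesgue_on_UNIV_eq)
qed

lemma Lp_dual_int:
 assumes p: "p >= 1" and f: "f \<in> carr (Lp_time p X)" and l: "l \<in> dual X"
 shows "integrable lebesgue (%t. indicator {0..R} t * l (zext {0<..} f t))"
proof -
 have U: "UNIV \<in> sets (lebesgue :: real measure)" by simp
 have "integrable lebesgue (%t. l (if t \<in> {0..R} then zext {0<..} f t else 0))"
  using xint_dual[OF U Lp_xint[OF p f, of "{0..R}" R] l] by (simp add: lebesgue_on_UNIV_eq)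
 moreover have "l (if t \<in> {0..R} then zext {0<..} f t else 0) = indicator {0..R} t * l (zext {0<..} f t)" for t
  by (simp add: dual_0[OF l])
 ultimately show ?thesis by (simp only:)
qed

lemma Lp_dual_int':
 assumes p: "p >= 1" and f: "f \<in> carr (Lp_time p X)" and l: "l \<in> dual X" and s: "0 <= s"
 shows "integrable lebesgue (%t. indicator {s<..r} t * l (zext {0<..} f t))"
proof -
 have "integrable lebesgue (%t. indicator {s<..r} t *\<^sub>R (indicator {0..r} t * l (zext {0<..} f t)))"
  by (intro integrable_mult_indicator Lp_dual_int[OF p f l]) auto
 moreover have "indicator {s<..r} t *\<^sub>R (indicator {0..r} t * l (zext {0<..} f t)) = indicator {s<..r} t * l (zext {0<..} f t)" for t
  using s by (auto split: split_indicator)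
 ultimately show ?thesis by (simp only:)
qed

text \<open>\<open>f\<close> is a path defined at every time, including 0, and \<open>g\<close> is
  its derivative modulo null sets; the fundamental theorem of calculus is imposed on each
  \<open>l (f t)\<close>. In this weak form translation, reflection and gluing of paths are
  manipulations of real integrals.\<close>

definition AC :: "real => (real => 'v) => (real => 'v) => bool" where
 "AC p f g \<longleftrightarrow> (\<forall>t\<ge>0. f t \<in> carr X) \<and> g \<in> carr (Lp_time p X)
   \<and> (\<forall>l\<in>dual X. \<forall>s t. 0 <= s --> s <= t -->
     (LINT r|lebesgue. indicator {s<..t} r * l (zext {0<..} g r)) = l (f t) - l (f s))"

lemma AC_D:
 assumes "AC p f g"
 shows "t >= 0 ==> f t \<in> carr X" and "g \<in> carr (Lp_time p X)"
  and "l \<in> dual X ==> 0 <= s ==> s <= t ==> (LINT r|lebesgue. indicator {s<..t} r * l (zext {0<..} g r)) = l (f t) - l (f s)"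
 using assms by (auto simp: AC_def)

lemma AC_shift:
 assumes a: "a >= 0" and f: "AC p f g" shows "AC p (%t. f (a + 1 * t)) (%t. g (a + 1 * t))"
 unfolding AC_def
proof (intro conjI allI impI ballI)
 show "f (a + 1 * t) \<in> carr X" if "t >= 0" for t using AC_D(1)[OF f] a that by simp
 show "(%t. g (a + 1 * t)) \<in> carr (Lp_time p X)" by (rule Lp_shift[OF a AC_D(2)[OF f]])
 fix l s t assume l: "l \<in> dual X" and st: "0 <= s" "s <= (t::real)"
 have "(LINT r|lebesgue. indicator {s<..t} r * l (zext {0<..} (%t. g (a + 1 * t)) r))
   = (LINT r|lebesgue. indicator {a + s<..a + t} (a + 1 * r) * l (zext {0<..} g (a + 1 * r)))"
  using st a by (intro bochner_cong) (auto simp: zext_def split: split_indicator)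
 also have "... = (LINT r|lebesgue. indicator {a + s<..a + t} r * l (zext {0<..} g r))"
  using lebesgue_integral_real_affine[of 1 "%r. indicator {a + s<..a + t} r * l (zext {0<..} g r)" a] by simp
 also have "... = l (f (a + t)) - l (f (a + s))" using AC_D(3)[OF f l, of "a + s" "a + t"] st a by simp
 finally show "(LINT r|lebesgue. indicator {s<..t} r * l (zext {0<..} (%t. g (a + 1 * t)) r)) = l (f (a + 1 * t)) - l (f (a + 1 * s))" by simp
qed

end

lemma AC_join:
 fixes F c :: "real => real"
 assumes i: "!!s t. a <= s ==> integrable lebesgue (%r. indicator {s<..t} r * c r)" and b: "a <= b"
  and 1: "!!s t. a <= s ==> s <= t ==> t <= b ==> (LINT r|lebesgue. indicator {s<..t} r * c r) = F t - F s"
  and 2: "!!s t. b <= s ==> s <= t ==> t <= d ==> (LINT r|lebesgue. indicator {s<..t} r * c r) = F t - F s"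
  and st: "a <= s" "s <= t" "t <= d"
 shows "(LINT r|lebesgue. indicator {s<..t} r * c r) = F t - F s"
proof -
 consider "t <= b" | "b <= s" | "s < b" "b < t" by linarith
 then show ?thesis
 proof cases
  case 3
  have "(LINT r|lebesgue. indicator {s<..t} r * c r) = (LINT r|lebesgue. indicator {s<..b} r * c r + indicator {b<..t} r * c r)"
   using 3 by (intro bochner_cong) (auto split: split_indicator)
  also have "... = (F b - F s) + (F t - F b)"
   using i[of s b] i[of b t] 1[of s b] 2[of b t] 3 st b by simp
  finally show ?thesis by simp
 qed (use 1 2 st in auto)
qed

context nsp begin

text \<open>The four stretches are verified one by one and glued by \<open>AC_join\<close>. The
  condition \<open>u T = v T\<close> closes the loop, so that \<open>v\<close> can be resumed where
  it was left.\<close>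

lemma AC_insert_loop:
 assumes p: "p >= 1" and T: "0 <= T" "T <= T'" and v: "AC p v gv" and u: "AC p u gu" and uv: "u T = v T"
 shows "AC p (insert_loop T T' v u u) (insert_loop T T' gv gu (%t. - gu t))"
  and "nrm (Lp_time p X) (insert_loop T T' gv gu (%t. - gu t)) <= nrm (Lp_time p X) gv
    + (2 * (LINT t|lebesgue. indicator {T<..T'} t * nrm X (zext {0<..} gu t) powr p)) powr (1 / p)"
proof -
 let ?z = "zext {0<..}"
 let ?h = "insert_loop T T' v u u" and ?k = "insert_loop T T' gv gu (%t. - gu t)"
 note gv = AC_D(2)[OF v] and gu = AC_D(2)[OF u]
 have car: "AE t in lebesgue. t > 0 --> gu t \<in> carr X"
  using strongly_meas_carr[of UNIV "?z gu"] gu unfolding Lp_iff lebesgue_on_UNIV_eq by (auto simp: zext_def elim!: eventually_mono)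
 have mgu: "(%t. - gu t) \<in> carr (Lp_time p X)"
 proof -
  have z: "?z (%t. - gu t) = (%t. (-1) *\<^sub>R ?z gu t)" by (auto simp: zext_def fun_eq_iff)
  have "strongly_meas X UNIV (?z gu)" using gu by (simp add: Lp_iff)
  then have s: "strongly_meas X UNIV (?z (%t. - gu t))" unfolding z by (rule strongly_meas_scaleR) simp
  have "integrable lebesgue (%t. nrm X (?z gu t) powr p)" using gu by (simp add: Lp_iff)
  then have "integrable lebesgue (%t. nrm X (?z (%t. - gu t) t) powr p)"
   by (rule lebesgue_AE_cong) (use car in \<open>eventually_elim, auto simp: zext_def nrm_minus\<close>)
  with s show ?thesis by (simp add: Lp_iff)
 qed
 have nn: "AE t in lebesgue. t > 0 --> nrm X (- gu t) = nrm X (gu t)" using car by eventually_elim (simp add: nrm_minus)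
 note L = Lp_insert_loop[OF p T gv gu mgu nn]
 show "nrm (Lp_time p X) ?k <= nrm (Lp_time p X) gv
    + (2 * (LINT t|lebesgue. indicator {T<..T'} t * nrm X (zext {0<..} gu t) powr p)) powr (1 / p)" by (rule L(2))
 show "AC p ?h ?k" unfolding AC_def
 proof (intro conjI L(1) ballI allI impI)
  show "?h t \<in> carr X" if "t >= 0" for t using that T AC_D(1)[OF v] AC_D(1)[OF u] by (auto simp: insert_loop_def)
  fix l s t assume l: "l \<in> dual X" and st: "0 <= s" "s <= (t::real)"
  let ?c = "%r. l (?z ?k r)" and ?F = "%t. l (?h t)"
  have i: "integrable lebesgue (%r. indicator {s<..t} r * ?c r)" if "0 <= s" for s t
   by (rule Lp_dual_int'[OF p L(1) l that])
  have A1: "(LINT r|lebesgue. indicator {s<..t} r * ?c r) = ?F t - ?F s" if st: "0 <= s" "s <= t" "t <= T" for s t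
  proof -
   have "(LINT r|lebesgue. indicator {s<..t} r * ?c r) = (LINT r|lebesgue. indicator {s<..t} r * l (?z gv r))"
    using st by (intro bochner_cong) (auto simp: zext_def insert_loop_def split: split_indicator)
   then show ?thesis using AC_D(3)[OF v l st(1,2)] st by (simp add: insert_loop_def)
  qed
  have hu: "?h t = u t" if "T <= t" "t <= T'" for t using that uv by (auto simp: insert_loop_def)
  have A2: "(LINT r|lebesgue. indicator {s<..t} r * ?c r) = ?F t - ?F s" if st: "T <= s" "s <= t" "t <= T'" for s t
  proof -
   have "(LINT r|lebesgue. indicator {s<..t} r * ?c r) = (LINT r|lebesgue. indicator {s<..t} r * l (?z gu r))"
    using st by (intro bochner_cong) (auto simp: zext_def insert_loop_def split: split_indicator)
   then show ?thesis using AC_D(3)[OF u l, of s t] st T hu[of s] hu[of t] by simp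
  qed
  have hr: "?h t = u (2 * T' + (-1) * t)" if "T' <= t" "t <= 2 * T' - T" for t
  proof -
   show ?thesis
   proof (cases "t = T'")
    case True then show ?thesis using hu[of T'] T by simp
   next
    case False then show ?thesis using that T by (simp add: insert_loop_def)
   qed
  qed
  have hs: "?h t = v (2 * (T - T') + 1 * t)" if "2 * T' - T <= t" for t
  proof (cases "t = 2 * T' - T")
   case True
   then have "2 * T' + (-1) * t = T" "2 * (T - T') + 1 * t = T" by auto
   then show ?thesis using hr[of t] True T uv by simp
  next
   case False
   then show ?thesis using that T by (auto simp: insert_loop_def)
  qed
  have A3: "(LINT r|lebesgue. indicator {s<..t} r * ?c r) = ?F t - ?F s" if st: "T' <= s" "s <= t" "t <= 2 * T' - T" for s t
  proof -
   have st': "0 <= 2 * T' - t" "2 * T' - t <= 2 * T' - s" using st T by auto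
   have ig: "integrable lebesgue (%r. indicator {2 * T' - t<..2 * T' - s} r * l (?z gu r))" by (rule Lp_dual_int'[OF p gu l st'(1)])
   let ?e = "%r. indicator {2 * T' - t<..2 * T' - s} r * l (?z gu r)"
   have "(LINT r|lebesgue. - ?e (2 * T' + (-1) * r)) = - (LINT r|lebesgue. ?e r)"
    using lebesgue_integral_real_affine[of "-1" ?e "2 * T'"] by simp
   also have "... = l (u (2 * T' - t)) - l (u (2 * T' - s))" using AC_D(3)[OF u l st'] by simp
   also have "... = ?F t - ?F s" using hr[of t] hr[of s] st by simp
   finally have R: "(LINT r|lebesgue. - ?e (2 * T' + (-1) * r)) = ?F t - ?F s" .
   have ie: "integrable lebesgue (%r. - ?e (2 * T' + (-1) * r))"
    using lebesgue_integrable_real_affine[OF ig, of "-1" "2 * T'"] by simp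
   have c1: "(-1::real) ~= 0" by simp
   have nn: "AE r in lebesgue. r \<notin> {s, t, 2 * T' - T, T'}" by (rule AE_not_in[OF finite_null_lebesgue]) simp
   \<comment> \<open>A functional commutes with negation on the carrier, and the derivative lies
     there only for almost every time; the reflection maps the exceptional null set to a null
     set.\<close>
   have "AE r in lebesgue. - ?e (2 * T' + (-1) * r) = indicator {s<..t} r * ?c r"
    using AE_lebesgue_affine[OF car c1, of "2 * T'"] nn
   proof eventually_elim
    case (elim r)
    show ?case
    proof (cases "s < r \<and> r < t")
     case True
     then have r: "T' < r" "r < 2 * T' - T" "r > 0" "2 * T' + (-1) * r > 0" using st T by auto
     then have "?z ?k r = - gu (2 * T' + (-1) * r)" using T by (simp add: zext_def insert_loop_def)
     moreover have "gu (2 * T' + (-1) * r) \<in> carr X" using elim(1) r(4) by blast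
     ultimately show ?thesis using True r by (simp add: dual_minus[OF l] zext_def split: split_indicator)
    next
     case False
     then have "\<not> (s < r \<and> r <= t)" using elim(2) by auto
     moreover have "\<not> (2 * T' - t < 2 * T' + (-1) * r \<and> 2 * T' + (-1) * r <= 2 * T' - s)" using False elim(2) by auto
     ultimately show ?thesis by (simp split: split_indicator)
    qed
   qed
   from lebesgue_AE_cong(2)[OF ie this] R show ?thesis by simp
  qed
  have A4: "(LINT r|lebesgue. indicator {s<..t} r * ?c r) = ?F t - ?F s" if st: "2 * T' - T <= s" "s <= t" for s t
  proof -
   let ?d = "2 * (T - T')"
   have "(LINT r|lebesgue. indicator {s<..t} r * ?c r) = (LINT r|lebesgue. indicator {?d + s<..?d + t} (?d + 1 * r) * l (?z gv (?d + 1 * r)))"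
    using st T by (intro bochner_cong) (auto simp: zext_def insert_loop_def split: split_indicator)
   also have "... = (LINT r|lebesgue. indicator {?d + s<..?d + t} r * l (?z gv r))"
    using lebesgue_integral_real_affine[of 1 "%r. indicator {?d + s<..?d + t} r * l (?z gv r)" ?d] by simp
   also have "... = l (v (?d + t)) - l (v (?d + s))" using AC_D(3)[OF v l, of "?d + s" "?d + t"] st T by simp
   finally show ?thesis using hs[of s] hs[of t] st by simp
  qed
  have B1: "(LINT r|lebesgue. indicator {s<..t} r * ?c r) = ?F t - ?F s" if "0 <= s" "s <= t" "t <= T'" for s t
   using AC_join[of 0 ?c T ?F T' s t] i A1 A2 T that by blast
  have B2: "(LINT r|lebesgue. indicator {s<..t} r * ?c r) = ?F t - ?F s" if "0 <= s" "s <= t" "t <= 2 * T' - T" for s t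
   using AC_join[of 0 ?c T' ?F "2 * T' - T" s t] i B1 A3 T that by force
  have "0 <= 2 * T' - T" using T by simp
  from AC_join[of 0 ?c "2 * T' - T" ?F t s t, OF i this] B2 A4 st
  show "(LINT r|lebesgue. indicator {s<..t} r * ?c r) = ?F t - ?F s" by blast
 qed
qed

end

section \<open>Weak time derivatives and absolutely continuous representatives\<close>

lemma AE_lebesgue_ex:
 fixes a b :: real
 assumes ae: "AE t in lebesgue. P t" and ab: "a < b" shows "\<exists>t\<in>{a<..<b}. P t"
proof (rule ccontr)
 assume "\<not> (\<exists>t\<in>{a<..<b}. P t)"
 then have "AE t in lebesgue. t \<notin> {a<..<b}" using ae by (auto elim!: eventually_mono)
 then have "{a<..<b} \<in> null_sets lebesgue" by (subst (asm) AE_iff_null_sets[symmetric]) auto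
 then have "emeasure lebesgue {a<..<b} = 0" by auto
 then show False using ab by simp
qed

context nsp begin

lemma Lp_carr_AE: "f \<in> carr (Lp_time p X) ==> AE t in lebesgue. zext {0<..} f t \<in> carr X"
 using strongly_meas_carr[of UNIV "zext {0<..} f"] unfolding Lp_iff lebesgue_on_UNIV_eq by blast

lemma Lp_test_xint:
 assumes p: "p >= 1" and f: "f \<in> carr (Lp_time p X)" and \<phi>: "continuous_on UNIV \<phi>"
  and K: "0 < a" "!!t. t \<notin> {a..b} ==> \<phi> t = 0"
 shows "xint UNIV (%t. \<phi> t *\<^sub>R zext {0<..} f t)"
proof -
 let ?f = "zext {0<..} f"
 have sm: "strongly_meas X UNIV ?f" using f by (auto simp: Lp_iff)
 have m: "\<phi> \<in> borel_measurable lebesgue" by (rule continuous_imp_measurable_lebesgue[OF \<phi>])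
 have "strongly_meas X UNIV (%t. \<phi> t *\<^sub>R ?f t)"
  by (rule strongly_meas_scaleR[OF sm]) (simp add: lebesgue_on_UNIV_eq m)
 moreover have "integrable lebesgue (%t. nrm X (\<phi> t *\<^sub>R ?f t))"
 proof -
  have ab: "{a..b} \<subseteq> {0..b}" using K(1) by auto
  have "integrable lebesgue (%t. nrm X (if t \<in> {a..b} then ?f t else 0))"
   using Lp_xint[OF p f _ ab] by (simp add: xint_def lebesgue_on_UNIV_eq)
  moreover have "nrm X (if t \<in> {a..b} then ?f t else 0) = indicator {a..b} t * nrm X (?f t)" for t
   by (simp add: nrm_0)
  ultimately have i: "integrable lebesgue (%t. indicator {a..b} t * nrm X (?f t))" by (simp only:)
  have c: "continuous_on UNIV (%t. \<bar>\<phi> t\<bar>)" by (intro continuous_intros \<phi>)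
  have z: "\<bar>\<phi> t\<bar> = 0" if "t \<notin> {a..b}" for t using K(2)[OF that] by simp
  have "integrable lebesgue (%t. nrm X (?f t) * \<bar>\<phi> t\<bar>)"
   by (rule test_fun_integrable_mult[OF c compact_Icc z i])
  moreover have "AE t in lebesgue. nrm X (?f t) * \<bar>\<phi> t\<bar> = nrm X (\<phi> t *\<^sub>R ?f t)"
   using Lp_carr_AE[OF f] by eventually_elim (simp add: nrm_scale)
  ultimately show ?thesis by (rule lebesgue_AE_cong(1))
 qed
 ultimately show ?thesis by (simp add: xint_def lebesgue_on_UNIV_eq)
qed

lemma Lp_test_dual:
 assumes p: "p >= 1" and f: "f \<in> carr (Lp_time p X)" and \<phi>: "continuous_on UNIV \<phi>"
  and K: "0 < a" "!!t. t \<notin> {a..b} ==> \<phi> t = 0" and l: "l \<in> dual X"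
 shows "(LINT t|lebesgue. l (\<phi> t *\<^sub>R zext {0<..} f t)) = (LINT t|lebesgue. \<phi> t * l (zext {0<..} f t))"
proof -
 have U: "UNIV \<in> sets (lebesgue :: real measure)" by simp
 have i: "integrable lebesgue (%t. l (\<phi> t *\<^sub>R zext {0<..} f t))"
  using xint_dual[OF U Lp_test_xint[OF p f \<phi> K] l] by (simp add: lebesgue_on_UNIV_eq)
 have ae: "AE t in lebesgue. l (\<phi> t *\<^sub>R zext {0<..} f t) = \<phi> t * l (zext {0<..} f t)"
  using Lp_carr_AE[OF f] by eventually_elim (simp add: dual_scale[OF l])
 show ?thesis by (rule lebesgue_AE_cong(2)[OF i ae, symmetric])
qed

end

lemma zext_scaleR: "zext S (%t. \<phi> t *\<^sub>R (f t :: 'v::real_vector)) = (%t. \<phi> t *\<^sub>R zext S f t)"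
 by (auto simp: zext_def fun_eq_iff)

context bsp begin

text \<open>The integral containing \<open>deriv \<phi>\<close> exists by
  \<open>has_bint_ex\<close>; the scalar identities then identify its negative as the other
  integral, so that the vector equation can be tested by functionals.\<close>

lemma weak_time_deriv_iff:
 assumes p: "p >= 1" and f: "f \<in> carr (Lp_time p X)" and g: "g \<in> carr (Lp_time p X)"
 shows "weak_time_deriv X f g \<longleftrightarrow> (\<forall>\<phi>. test_fun {0<..} \<phi> --> (\<forall>l\<in>dual X.
  (LINT t|lebesgue. deriv \<phi> t * l (zext {0<..} f t)) = - (LINT t|lebesgue. \<phi> t * l (zext {0<..} g t))))"
proof -
 have U: "UNIV \<in> sets (lebesgue :: real measure)" and P: "{0<..} \<in> sets (lebesgue :: real measure)" by auto
 have "(\<exists>I. has_bint X {0<..} (%t. deriv \<phi> t *\<^sub>R f t) I \<and> has_bint X {0<..} (%t. \<phi> t *\<^sub>R g t) (- I))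
  \<longleftrightarrow> (\<forall>l\<in>dual X. (LINT t|lebesgue. deriv \<phi> t * l (zext {0<..} f t)) = - (LINT t|lebesgue. \<phi> t * l (zext {0<..} g t)))"
  if \<phi>: "test_fun {0<..} \<phi>" for \<phi> :: "real => real"
 proof -
  obtain a b where a: "0 < a" and z: "!!t. t \<notin> {a..b} ==> \<phi> t = 0" and z': "!!t. t \<notin> {a..b} ==> deriv \<phi> t = 0"
   by (rule test_fun_real_support[OF \<phi>]) blast
  have c: "continuous_on UNIV \<phi>" by (rule continuous_test_fun[OF \<phi>])
  have c': "continuous_on UNIV (deriv \<phi>)" by (rule test_fun_real_DERIV(2)[OF \<phi>])
  note xf = Lp_test_xint[OF p f c' a z'] and xg = Lp_test_xint[OF p g c a z]
  note lf = Lp_test_dual[OF p f c' a z'] and lg = Lp_test_dual[OF p g c a z]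
  have hf: "has_bint X {0<..} (%t. deriv \<phi> t *\<^sub>R f t) I \<longleftrightarrow> I \<in> carr X \<and> (\<forall>l\<in>dual X. (LINT t|lebesgue. deriv \<phi> t * l (zext {0<..} f t)) = l I)" for I
   unfolding has_bint_zext[OF P] zext_scaleR has_bint_iff[OF U] lebesgue_on_UNIV_eq using xf lf by auto
  have hg: "has_bint X {0<..} (%t. \<phi> t *\<^sub>R g t) I \<longleftrightarrow> I \<in> carr X \<and> (\<forall>l\<in>dual X. (LINT t|lebesgue. \<phi> t * l (zext {0<..} g t)) = l I)" for I
   unfolding has_bint_zext[OF P] zext_scaleR has_bint_iff[OF U] lebesgue_on_UNIV_eq using xg lg by auto
  show ?thesis
  proof
   assume "\<exists>I. has_bint X {0<..} (%t. deriv \<phi> t *\<^sub>R f t) I \<and> has_bint X {0<..} (%t. \<phi> t *\<^sub>R g t) (- I)"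
   then show "\<forall>l\<in>dual X. (LINT t|lebesgue. deriv \<phi> t * l (zext {0<..} f t)) = - (LINT t|lebesgue. \<phi> t * l (zext {0<..} g t))"
    unfolding hf hg by (auto simp: dual_minus)
  next
   assume eq: "\<forall>l\<in>dual X. (LINT t|lebesgue. deriv \<phi> t * l (zext {0<..} f t)) = - (LINT t|lebesgue. \<phi> t * l (zext {0<..} g t))"
   obtain I where "has_bint X {0<..} (%t. deriv \<phi> t *\<^sub>R f t) I"
    using has_bint_ex[OF U xf] unfolding has_bint_zext[OF P] zext_scaleR by blast
   then have I: "I \<in> carr X" "!!l. l \<in> dual X ==> (LINT t|lebesgue. deriv \<phi> t * l (zext {0<..} f t)) = l I" unfolding hf by auto
   have "has_bint X {0<..} (%t. \<phi> t *\<^sub>R g t) (- I)"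
    unfolding hg
   proof (intro conjI ballI)
    show "- I \<in> carr X" by (rule uminus[OF I(1)])
    show "(LINT t|lebesgue. \<phi> t * l (zext {0<..} g t)) = l (- I)" if l: "l \<in> dual X" for l
     using I(2)[OF l] eq l by (simp add: dual_minus[OF l I(1)])
   qed
   then show "\<exists>I. has_bint X {0<..} (%t. deriv \<phi> t *\<^sub>R f t) I \<and> has_bint X {0<..} (%t. \<phi> t *\<^sub>R g t) (- I)"
    using I hf by blast
  qed
 qed
 then show ?thesis unfolding weak_time_deriv_def by blast
qed

lemma AC_imp_weak:
 assumes p: "p >= 1" and f: "f \<in> carr (Lp_time p X)" and ac: "AC p f g"
 shows "weak_time_deriv X f g"
 unfolding weak_time_deriv_iff[OF p f AC_D(2)[OF ac]]
proof (intro allI impI ballI)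
 fix \<phi> :: "real => real" and l assume \<phi>: "test_fun {0<..} \<phi>" and l: "l \<in> dual X"
 have "l (f t) = l (f 0) + (LINT s|lebesgue. indicator {0..t} s * l (zext {0<..} g s))" if "t >= 0" for t
 proof -
  have "(LINT s|lebesgue. indicator {0..t} s * l (zext {0<..} g s)) = (LINT s|lebesgue. indicator {0<..t} s * l (zext {0<..} g s))"
   by (rule bochner_cong) (auto simp: zext_def dual_0[OF l] split: split_indicator)
  then show ?thesis using AC_D(3)[OF ac l _ that] by simp
 qed
 then have eq: "(LINT t|lebesgue. deriv \<phi> t * l (f t)) = - (LINT t|lebesgue. \<phi> t * l (zext {0<..} g t))"
  by (rule integral_AC_by_parts(1)[OF Lp_dual_int[OF p AC_D(2)[OF ac] l] _ \<phi>])
 obtain a b where a: "0 < a" and z: "!!t. t \<notin> {a..b} ==> deriv \<phi> t = 0"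
  by (rule test_fun_real_support[OF \<phi>]) blast
 have "deriv \<phi> t * l (zext {0<..} f t) = deriv \<phi> t * l (f t)" for t
  using a z[of t] by (cases "t \<in> {a..b}") (auto simp: zext_def)
 with eq show "(LINT t|lebesgue. deriv \<phi> t * l (zext {0<..} f t)) = - (LINT t|lebesgue. \<phi> t * l (zext {0<..} g t))" by (simp only:)
qed

lemma AE_eq_of_dual:
 assumes f: "AE t in M. f t \<in> carr X" and g: "AE t in M. g t \<in> carr X"
  and eq: "!!l. l \<in> dual X ==> AE t in M. l (f t) = l (g t)"
 shows "AE t in M. f t = g t"
proof -
 obtain L where L: "countable L" "L \<subseteq> dual X" "!!x. x \<in> carr X ==> (\<forall>l\<in>L. l x = 0) ==> x = 0" using separating by blast
 have "AE t in M. \<forall>l\<in>L. l (f t) = l (g t)" using eq L(2) by (subst AE_ball_countable[OF L(1)]) blast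
 then show ?thesis using f g
 proof eventually_elim
  case (elim t)
  have "l (f t - g t) = 0" if "l \<in> L" for l using elim that dual_diff[of l "f t" "g t"] L(2) by auto
  then have "f t - g t = 0" using L(3)[OF diff] elim by blast
  then show ?case by simp
 qed
qed

lemma weak_time_deriv_unique:
 assumes p: "p >= 1" and f: "f \<in> carr (Lp_time p X)" and g: "g \<in> carr (Lp_time p X)" and h: "h \<in> carr (Lp_time p X)"
  and w: "weak_time_deriv X f g" "weak_time_deriv X f h"
 shows "AE t in lebesgue. t > 0 --> g t = h t"
proof -
 have "AE t in lebesgue. zext {0<..} g t = zext {0<..} h t"
 proof (rule AE_eq_of_dual[OF Lp_carr_AE[OF g] Lp_carr_AE[OF h]])
  fix l assume l: "l \<in> dual X"
  let ?v = "%t. l (zext {0<..} g t) - l (zext {0<..} h t)"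
  have "AE t in lebesgue. t \<in> {0<..} --> ?v t = 0"
  proof (rule du_Bois_Reymond)
   fix K :: "real set" assume K: "compact K" "K \<subseteq> {0<..}"
   then obtain R where R: "K \<subseteq> {..R}" by (meson compact_imp_bounded bounded_has_Sup(1) atMost_iff subsetI bounded_imp_bdd_above bdd_above.E)
   have m: "K \<in> sets lebesgue" using borel_compact[OF K(1)] by simp
   have "integrable lebesgue (%t. indicator K t *\<^sub>R (indicator {0..R} t * l (zext {0<..} g t) - indicator {0..R} t * l (zext {0<..} h t)))"
    by (rule integrable_mult_indicator[OF m Bochner_Integration.integrable_diff[OF Lp_dual_int[OF p g l] Lp_dual_int[OF p h l]]])
   moreover have "indicator K t *\<^sub>R (indicator {0..R} t * l (zext {0<..} g t) - indicator {0..R} t * l (zext {0<..} h t)) = indicator K t * ?v t" for t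
    using K R by (cases "t \<in> K") (force simp: subset_iff less_imp_le)+
   ultimately show "integrable lebesgue (%t. indicator K t * ?v t)" by (simp only:)
  next
   fix \<phi> :: "real => real" assume \<phi>: "test_fun {0<..} \<phi>"
   obtain a b where a: "0 < a" and z: "!!t. t \<notin> {a..b} ==> \<phi> t = 0"
    by (rule test_fun_real_support[OF \<phi>]) blast
   have c: "continuous_on UNIV \<phi>" by (rule continuous_test_fun[OF \<phi>])
   have z': "\<phi> t = 0" if "t \<notin> {0..b}" for t using z[of t] a that by auto
   have ii: "integrable lebesgue (%t. l (zext {0<..} k t) * \<phi> t)" if "k \<in> carr (Lp_time p X)" for k
    by (rule test_fun_integrable_mult[OF c compact_Icc z' Lp_dual_int[OF p that l]])
   have "(LINT t|lebesgue. \<phi> t * l (zext {0<..} g t)) = (LINT t|lebesgue. \<phi> t * l (zext {0<..} h t))"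
    using w(1)[unfolded weak_time_deriv_iff[OF p f g], rule_format, OF \<phi> l]
     w(2)[unfolded weak_time_deriv_iff[OF p f h], rule_format, OF \<phi> l] by linarith
   then show "(LINT t|lebesgue. ?v t * \<phi> t) = 0"
    using ii[OF g] ii[OF h] by (simp add: algebra_simps)
  qed simp
  then show "AE t in lebesgue. l (zext {0<..} g t) = l (zext {0<..} h t)"
   by (rule eventually_mono) (simp add: zext_def split: if_splits)
 qed
 then show ?thesis by (rule eventually_mono) (simp add: zext_def split: if_splits)
qed

text \<open>With \<open>F\<close> the Bochner primitive of \<open>g\<close>, each functional gives
  \<open>l (f t) = c l + l (F t)\<close> almost everywhere, with constants \<open>c l\<close> that
  are unrelated at first. Restriction to the countable separating set leaves one common null
  set.\<close>

lemma weak_imp_AC: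
 assumes p: "p >= 1" and f: "f \<in> carr (Lp_time p X)" and g: "g \<in> carr (Lp_time p X)" and w: "weak_time_deriv X f g"
 shows "\<exists>f'. AC p f' g \<and> (AE t in lebesgue. t > 0 --> f t = f' t)"
proof -
 let ?z = "zext {0<..}"
 have U: "UNIV \<in> sets (lebesgue :: real measure)" by simp
 have "\<exists>I. has_bint X UNIV (%s. if s \<in> {0..t} then ?z g s else 0) I" for t
  using has_bint_ex[OF U Lp_xint[OF p g, of "{0..t}" t]] by auto
 then obtain F where F: "!!t. has_bint X UNIV (%s. if s \<in> {0..t} then ?z g s else 0) (F t)" by metis
 have Fc: "F t \<in> carr X" for t using F[of t] unfolding has_bint_iff[OF U] by blast
 have Fl: "l (F t) = (LINT s|lebesgue. indicator {0..t} s * l (?z g s))" if l: "l \<in> dual X" for l t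
 proof -
  have "l (F t) = (LINT s|lebesgue. l (if s \<in> {0..t} then ?z g s else 0))"
   using F[of t] l unfolding has_bint_iff[OF U] lebesgue_on_UNIV_eq by auto
  also have "... = (LINT s|lebesgue. indicator {0..t} s * l (?z g s))"
   by (rule bochner_cong) (auto simp: dual_0[OF l])
  finally show ?thesis .
 qed
 have ex: "\<exists>c. AE t in lebesgue. t \<in> {0<..} --> l (?z f t) = c + l (F t)" if l: "l \<in> dual X" for l
  unfolding Fl[OF l]
 proof (rule weak_derivative_imp_AC)
  fix K :: "real set" assume K: "compact K" "K \<subseteq> {0<..}"
  then obtain R where R: "K \<subseteq> {..R}" by (meson compact_imp_bounded bounded_has_Sup(1) atMost_iff subsetI bounded_imp_bdd_above bdd_above.E)
  have m: "K \<in> sets lebesgue" using borel_compact[OF K(1)] by simp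
  have "integrable lebesgue (%t. indicator K t *\<^sub>R (indicator {0..R} t * l (?z f t)))"
   by (rule integrable_mult_indicator[OF m Lp_dual_int[OF p f l]])
  moreover have "indicator K t *\<^sub>R (indicator {0..R} t * l (?z f t)) = indicator K t * l (?z f t)" for t
   using K R by (cases "t \<in> K") (force simp: subset_iff less_imp_le)+
  ultimately show "integrable lebesgue (%t. indicator K t * l (?z f t))" by (simp only:)
 qed (use Lp_dual_int[OF p g l] w l in \<open>auto simp: weak_time_deriv_iff[OF p f g]\<close>)
 then obtain c where c: "!!l. l \<in> dual X ==> AE t in lebesgue. t \<in> {0<..} --> l (?z f t) = c l + l (F t)" by metis
 obtain L where L: "countable L" "L \<subseteq> dual X" "!!x. x \<in> carr X ==> (\<forall>l\<in>L. l x = 0) ==> x = 0" using separating by blast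
 have aeL: "AE t in lebesgue. \<forall>l\<in>L. t \<in> {0<..} --> l (?z f t) = c l + l (F t)"
  using c L(2) by (subst AE_ball_countable[OF L(1)]) blast
 have aeC: "AE t in lebesgue. ?z f t \<in> carr X \<and> (\<forall>l\<in>L. t \<in> {0<..} --> l (?z f t) = c l + l (F t))"
  using aeL Lp_carr_AE[OF f] by eventually_elim auto
 obtain t0 where t0: "t0 > 0" "?z f t0 \<in> carr X" "!!l. l \<in> L ==> l (?z f t0) = c l + l (F t0)"
  using AE_lebesgue_ex[OF aeC, of 0 1] by auto
 \<comment> \<open>A single good time \<open>t0\<close> realises all constants at once: for
   \<open>l\<close> in the separating set, \<open>c l\<close> is the value of \<open>l\<close> at
   this vector.\<close>
 define A where "A = ?z f t0 - F t0"
 have A: "A \<in> carr X" unfolding A_def by (rule diff[OF t0(2) Fc])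
 have Al: "l A = c l" if "l \<in> L" for l using dual_diff[OF _ t0(2) Fc] t0(3) that L(2) by (force simp: A_def)
 have "AE t in lebesgue. t > 0 --> f t = A + F t"
  using aeC
 proof (eventually_elim, intro impI)
  fix t :: real assume H: "?z f t \<in> carr X \<and> (\<forall>l\<in>L. t \<in> {0<..} --> l (?z f t) = c l + l (F t))" and t: "t > 0"
  then have ft: "f t \<in> carr X" "!!l. l \<in> L ==> l (f t) = c l + l (F t)" by (auto simp: zext_def)
  have AF: "A + F t \<in> carr X" by (rule add[OF A Fc])
  have "l (f t - (A + F t)) = 0" if l: "l \<in> L" for l
  proof -
   have l': "l \<in> dual X" using l L(2) by blast
   show ?thesis using ft(2)[OF l] Al[OF l] by (simp add: dual_diff[OF l' ft(1) AF] dual_add[OF l' A Fc])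
  qed
  then have "f t - (A + F t) = 0" using L(3)[OF diff[OF ft(1) AF]] by blast
  then show "f t = A + F t" by simp
 qed
 moreover have "AC p (%t. A + F t) g" unfolding AC_def
 proof (intro conjI allI impI ballI)
  fix l s t assume l: "l \<in> dual X" and st: "0 <= s" "s <= (t::real)"
  have "(LINT r|lebesgue. indicator {0..t} r * l (?z g r)) = (LINT r|lebesgue. indicator {0..s} r * l (?z g r) + indicator {s<..t} r * l (?z g r))"
   using st by (intro bochner_cong) (auto split: split_indicator)
  also have "... = (LINT r|lebesgue. indicator {0..s} r * l (?z g r)) + (LINT r|lebesgue. indicator {s<..t} r * l (?z g r))"
   by (rule Bochner_Integration.integral_add[OF Lp_dual_int[OF p g l] Lp_dual_int'[OF p g l st(1)]])
  finally show "(LINT r|lebesgue. indicator {s<..t} r * l (?z g r)) = l (A + F t) - l (A + F s)"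
   by (simp add: dual_add[OF l A Fc] Fl[OF l])
 qed (use add A Fc g in auto)
 ultimately show ?thesis by blast
qed

text \<open>The norm of \<open>W1p_time\<close> picks some weak derivative by \<open>SOME\<close>;
  since weak derivatives agree almost everywhere, any \<open>g\<close> computes it.\<close>

lemma W1p_AC:
 assumes p: "p >= 1" and f: "f \<in> carr (Lp_time p X)" and g: "g \<in> carr (Lp_time p X)" and w: "weak_time_deriv X f g"
 shows "f \<in> carr (W1p_time p X)" and "nrm (W1p_time p X) f = nrm (Lp_time p X) f + nrm (Lp_time p X) g"
proof -
 show "f \<in> carr (W1p_time p X)" using f g w by (auto simp: W1p_time_def)
 let ?h = "SOME g. g \<in> carr (Lp_time p X) \<and> weak_time_deriv X f g"
 have h: "?h \<in> carr (Lp_time p X) \<and> weak_time_deriv X f ?h" by (rule someI[of _ g]) (use g w in simp)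
 have "nrm (Lp_time p X) ?h = nrm (Lp_time p X) g"
  by (rule Lp_AE_cong(2)[OF g weak_time_deriv_unique[OF p f g _ w]]) (use h in auto)
 then show "nrm (W1p_time p X) f = nrm (Lp_time p X) f + nrm (Lp_time p X) g" by (simp add: W1p_time_def)
qed

text \<open>Functionals identify the increment as the Bochner integral of \<open>g\<close> over the
  interval, so the norm inequality for that integral applies.\<close>

lemma AC_nrm_le:
 assumes p: "p >= 1" and ac: "AC p f g" and st: "0 <= s" "s <= t"
 shows "nrm X (f t - f s) <= (LINT r|lebesgue. indicator {s<..t} r * nrm X (zext {0<..} g r))"
  and "integrable lebesgue (%r. indicator {s<..t} r * nrm X (zext {0<..} g r))"
proof -
 have U: "UNIV \<in> sets (lebesgue :: real measure)" by simp
 have sub: "{s<..t} \<subseteq> {0..t}" using st by auto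
 let ?h = "%r. if r \<in> {s<..t} then zext {0<..} g r else 0"
 have x: "xint UNIV ?h" by (rule Lp_xint[OF p AC_D(2)[OF ac] _ sub]) simp
 obtain I where I: "has_bint X UNIV ?h I" "nrm X I <= (LINT r|lebesgue. nrm X (?h r))"
  using has_bint_ex[OF U x] by (auto simp: lebesgue_on_UNIV_eq)
 have eq: "nrm X (?h r) = indicator {s<..t} r * nrm X (zext {0<..} g r)" for r by (simp add: nrm_0)
 have fs: "f t \<in> carr X" "f s \<in> carr X" using AC_D(1)[OF ac] st by auto
 have "I = f t - f s"
 proof (rule dual_eqI[OF _ diff[OF fs]])
  show "I \<in> carr X" using has_bintD(2)[OF U I(1)] .
  fix l assume l: "l \<in> dual X"
  have "l I = (LINT r|lebesgue. l (?h r))" using has_bintD(3)[OF U I(1) l] by (simp add: lebesgue_on_UNIV_eq)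
  also have "... = (LINT r|lebesgue. indicator {s<..t} r * l (zext {0<..} g r))"
   by (rule bochner_cong) (auto simp: dual_0[OF l])
  also have "... = l (f t - f s)" by (simp add: AC_D(3)[OF ac l st] dual_diff[OF l fs])
  finally show "l I = l (f t - f s)" .
 qed
 then show "nrm X (f t - f s) <= (LINT r|lebesgue. indicator {s<..t} r * nrm X (zext {0<..} g r))"
  using I(2) unfolding eq by simp
 show "integrable lebesgue (%r. indicator {s<..t} r * nrm X (zext {0<..} g r))"
  using x unfolding xint_def lebesgue_on_UNIV_eq eq by blast
qed

end

section \<open>The trace inequality\<close>

text \<open>If \<open>c\<close> exceeded its mean at every good time, its integral would be too
  large. The point is found inside the set where \<open>P\<close> holds, because the trace argument
  needs a time at which \<open>u\<close> lies in the regular space.\<close>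

lemma ex_le_average:
 fixes c :: "real => real"
 assumes s: "s > 0" and i: "integrable lebesgue (%t. indicator {0<..<s} t * c t)" and ae: "AE t in lebesgue. t > 0 --> P t"
 shows "\<exists>t. 0 < t \<and> t < s \<and> P t \<and> s * c t <= (LINT t|lebesgue. indicator {0<..<s} t * c t)"
proof (rule ccontr)
 assume no: "\<not> ?thesis"
 define m where "m = (LINT t|lebesgue. indicator {0<..<s} t * c t)"
 have i1: "integrable lebesgue (%t. indicator {0<..<s} t * (m / s))"
  using lmeasurable_box[of 0 s] by (intro integrable_mult_left) (simp add: lmeasurable_iff_integrable box_real)
 have I1: "(LINT t|lebesgue. indicator {0<..<s} t * (m / s)) = m"
  using s by simp
 have nn: "AE t in lebesgue. 0 <= indicator {0<..<s} t * c t - indicator {0<..<s} t * (m / s)"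
  using ae
 proof eventually_elim
  case (elim t)
  show ?case
  proof (cases "0 < t \<and> t < s")
   case True
   then have "\<not> s * c t <= m" using no elim unfolding m_def by blast
   then have "m / s <= c t" using s by (simp add: field_simps)
   then show ?thesis using True by simp
  qed (auto split: split_indicator)
 qed
 have "AE t in lebesgue. indicator {0<..<s} t * c t - indicator {0<..<s} t * (m / s) = 0"
  by (subst integral_nonneg_eq_0_iff_AE[symmetric, OF _ nn]) (use i i1 I1 in \<open>simp_all add: m_def[symmetric]\<close>)
 then have ae2: "AE t in lebesgue. indicator {0<..<s} t * c t - indicator {0<..<s} t * (m / s) = 0 \<and> (t > 0 --> P t)"
  using ae by eventually_elim auto
 obtain t where t: "0 < t" "t < s" "P t" "c t = m / s"
  using AE_lebesgue_ex[OF ae2 s] by auto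
 then have "s * c t <= m" using s by simp
 then show False using no t unfolding m_def by blast
qed

lemma borel_measurable_indicator_times:
 fixes h :: "'a => real"
 assumes "S \<in> sets M" "h \<in> borel_measurable M" shows "(%t. indicator S t * h t) \<in> borel_measurable M"
 by (rule borel_measurable_times[OF borel_measurable_indicator]) (use assms in auto)

text \<open>Hoelder's inequality against the constant 1; the interval has length 1, so no constant
  appears.\<close>

lemma Jensen_unit_interval:
 fixes f :: "real => real"
 assumes p: "p > 1" and f: "f \<in> borel_measurable lebesgue" and f0: "!!t. f t >= 0"
  and i: "integrable lebesgue (%t. f t powr p)"
 shows "integrable lebesgue (%t. indicator {0<..<1} t * f t)"
  and "(LINT t|lebesgue. indicator {0<..<1} t * f t) <= (LINT t|lebesgue. indicator {0<..<1} t * f t powr p) powr (1 / p)"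
proof -
 define r where "r = p / (p - 1)"
 have r: "1 / p + 1 / r = 1" "r > 0" using p by (auto simp: r_def field_simps)
 let ?g = "%t. indicator {0<..<1} t * f t" and ?o = "%t::real. indicator {0<..<1} t :: real"
 have o: "integrable lebesgue ?o" using lmeasurable_box[of 0 "1::real"] by (simp add: lmeasurable_iff_integrable box_real)
 have gp: "norm (?g t) powr p = indicator {0<..<1} t * f t powr p" for t using f0[of t] by (simp split: split_indicator)
 have op: "norm (?o t) powr r = ?o t" for t using r by (simp split: split_indicator)
 have ig: "integrable lebesgue (%t. norm (?g t) powr p)" unfolding gp
  using integrable_mult_indicator[OF _ i, of "{0<..<1}"] by simp
 have io: "integrable lebesgue (%t. norm (?o t) powr r)" unfolding op by (rule o)
 have m: "?g \<in> borel_measurable lebesgue" "?o \<in> borel_measurable lebesgue"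
  using borel_measurable_indicator_times[OF _ f, of "{0<..<1}"] borel_measurable_integrable[OF o] by auto
 note H = Hoelder[OF p r(1) m ig io]
 have e: "?g t * ?o t = ?g t" for t by (simp split: split_indicator)
 have e2: "norm (?g t) = ?g t" for t using f0[of t] by (simp split: split_indicator)
 show "integrable lebesgue ?g" using H(1) unfolding e .
 show "(LINT t|lebesgue. ?g t) <= (LINT t|lebesgue. indicator {0<..<1} t * f t powr p) powr (1 / p)"
  using H(2) unfolding gp op unfolding e e2 by simp
qed

lemma K_fun_le:
 assumes "!!x. nrm X x >= 0" "!!x. nrm Y x >= 0" "s >= 0" "a \<in> carr X" "b \<in> carr Y"
 shows "K_fun X Y s (a + b) <= nrm X a + s * nrm Y b"
 unfolding K_fun_def by (rule cInf_lower) (use assms in \<open>auto intro!: bdd_belowI[of _ 0]\<close>)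

lemma K_fun_nonneg:
 assumes "!!x. nrm X x >= 0" "!!x. nrm Y x >= 0" "s >= 0" "a \<in> carr X" "b \<in> carr Y"
 shows "K_fun X Y s (a + b) >= 0"
 unfolding K_fun_def by (rule cInf_greatest) (use assms in auto)

text \<open>Monotonicity in \<open>s\<close> serves to make the K-functional Borel measurable, as
  Hardy's inequality requires.\<close>

lemma K_fun_mono:
 assumes "!!x. nrm X x >= 0" "!!x. nrm Y x >= 0" "0 <= s" "s <= s'" "a \<in> carr X" "b \<in> carr Y"
 shows "K_fun X Y s (a + b) <= K_fun X Y s' (a + b)"
 unfolding K_fun_def[of X Y s']
proof (rule cInf_greatest)
 fix r assume "r \<in> {nrm X a' + s' * nrm Y b' |a' b'. a' \<in> carr X \<and> b' \<in> carr Y \<and> a + b = a' + b'}"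
 then obtain a' b' where r: "r = nrm X a' + s' * nrm Y b'" "a' \<in> carr X" "b' \<in> carr Y" "a + b = a' + b'" by blast
 have "K_fun X Y s (a + b) <= nrm X a' + s * nrm Y b'" using K_fun_le[of X Y s a' b'] assms r by simp
 also have "... <= r" using assms r by (simp add: mult_right_mono)
 finally show "K_fun X Y s (a + b) <= r" .
qed (use assms in auto)

lemma interp_nrm: "nrm (interp_sp \<theta> p X Y) x
  = (LINT t:{0<..}|lborel. (t powr - \<theta> * K_fun X Y t x) powr p / t) powr (1 / p)"
 by (simp add: interp_sp_def)

text \<open>At the exponent \<open>1 - 1 / p\<close> the total weight of the K-functional in the
  interpolation norm is \<open>t powr (- p)\<close>, so this norm is precisely the root of the
  left-hand side of Hardy's inequality.\<close>

lemma interp_Hardy: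
 assumes p: "p > 1" and nn: "!!x. nrm X x >= 0" "!!x. nrm Y x >= 0" and x: "a \<in> carr X" "b \<in> carr Y"
  and \<phi>: "\<phi> \<in> borel_measurable lebesgue" "!!t. \<phi> t >= 0" "integrable lebesgue (%t. indicator {0<..} t * \<phi> t powr p)"
  and le: "!!s. s > 0 ==> integrable lebesgue (%t. indicator {0<..<s} t * \<phi> t) ==> K_fun X Y s (a + b) <= (LINT t|lebesgue. indicator {0<..<s} t * \<phi> t)"
 shows "a + b \<in> carr (interp_sp (1 - 1 / p) p X Y)"
  and "nrm (interp_sp (1 - 1 / p) p X Y) (a + b)
   <= (((p - 1) / p) powr (- p) * (LINT t|lebesgue. indicator {0<..} t * \<phi> t powr p)) powr (1 / p)"
proof -
 \<comment> \<open>The cut-off at 0 makes the function monotone and nonnegative on the whole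
   line.\<close>
 define K where "K s = K_fun X Y (max s 0) (a + b)" for s
 have K0: "K s >= 0" for s unfolding K_def by (rule K_fun_nonneg[OF nn _ x]) simp
 have "mono K" unfolding K_def by (rule monoI, rule K_fun_mono[OF nn _ _ x]) auto
 then have Km: "K \<in> borel_measurable borel" by (rule borel_measurable_mono)
 have Kle: "K s <= (LINT t|lebesgue. indicator {0<..<s} t * \<phi> t)"
  if "s > 0" "integrable lebesgue (%t. indicator {0<..<s} t * \<phi> t)" for s using le[OF that] that(1) by (simp add: K_def)
 note H = Hardy[OF p \<phi> Km K0 Kle]
 have eq: "indicator {0<..} t *\<^sub>R ((t powr - (1 - 1 / p) * K_fun X Y t (a + b)) powr p / t) = indicator {0<..} t * (K t / t) powr p" for t
 proof (cases "t > 0")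
  case True
  have "(t powr - (1 - 1 / p) * K t) powr p / t = t powr (- (1 - 1 / p) * p) * K t powr p / t powr 1"
   using True K0[of t] by (simp add: powr_mult powr_powr)
  also have "... = (t powr (- (1 - 1 / p) * p) / t powr 1) * K t powr p" by simp
  also have "t powr (- (1 - 1 / p) * p) / t powr 1 = t powr (- p)"
   using p by (subst powr_diff[symmetric]) (simp add: field_simps)
  also have "t powr (- p) * K t powr p = (K t / t) powr p"
   using True K0[of t] by (simp add: powr_divide powr_minus_divide)
  finally show ?thesis using True by (simp add: K_def)
 qed simp
 show "a + b \<in> carr (interp_sp (1 - 1 / p) p X Y)"
 proof -
  have "set_integrable lborel {0<..} (%t. (t powr - (1 - 1 / p) * K_fun X Y t (a + b)) powr p / t)"
   unfolding set_integrable_def eq by (rule H(1))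
  then show ?thesis using x by (simp add: interp_sp_def) blast
 qed
 have "nrm (interp_sp (1 - 1 / p) p X Y) (a + b) = (LINT s|lborel. indicator {0<..} s * (K s / s) powr p) powr (1 / p)"
  unfolding interp_nrm set_lebesgue_integral_def eq ..
 also have "... <= (((p - 1) / p) powr (- p) * (LINT t|lebesgue. indicator {0<..} t * \<phi> t powr p)) powr (1 / p)"
  by (rule powr_mono2[OF _ _ H(2)]) (use p in \<open>auto intro!: integral_nonneg_AE\<close>)
 finally show "nrm (interp_sp (1 - 1 / p) p X Y) (a + b)
   <= (((p - 1) / p) powr (- p) * (LINT t|lebesgue. indicator {0<..} t * \<phi> t powr p)) powr (1 / p)" .
qed

context bsp begin

text \<open>The trace at time \<open>0\<close> lies in the interpolation space: splitting \<open>u 0 = (u 0 - u \<sigma>) + u \<sigma>\<close> with a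
 suitable \<open>\<sigma> < s\<close> bounds the K-functional at \<open>s\<close> by the integral of the integrand over \<open>(0, s)\<close>, and
 Hardy's inequality applies.\<close>

lemma trace_0:
 assumes p: "p > 1" and u: "u \<in> carr (Lp_time p X)" and ac: "AC p u g"
  and X': "!!x. nrm X' x >= 0" "carr X \<subseteq> carr X'" "!!x. x \<in> carr X ==> nrm X' x = nrm X x"
  and Z: "!!x. nrm Z x >= 0" "0 \<in> carr Z" "nrm Z 0 = 0"
  and c: "c \<in> borel_measurable lebesgue" "!!t. c t >= 0" "integrable lebesgue (%t. c t powr p)"
  and uZ: "AE t in lebesgue. t > 0 --> u t \<in> carr Z \<and> nrm Z (u t) <= c t"
 defines "I \<equiv> LINT t|lebesgue. indicator {0<..<1} t * (nrm X (zext {0<..} u t) + nrm X (zext {0<..} g t) + c t) powr p"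
 shows "u 0 \<in> carr (interp_sp (1 - 1 / p) p X' Z)"
  and "nrm (interp_sp (1 - 1 / p) p X' Z) (u 0) <= (((p - 1) / p) powr (- p) * I) powr (1 / p)"
  and "nrm X (u 0) <= I powr (1 / p)"
proof -
 define a b where "a t = nrm X (zext {0<..} u t)" and "b t = nrm X (zext {0<..} g t)" for t
 define \<Phi> where "\<Phi> t = a t + b t + c t" for t
 have p1: "p >= 1" using p by simp
 note g = AC_D(2)[OF ac]
 have ab: "a \<in> borel_measurable lebesgue" "b \<in> borel_measurable lebesgue" "integrable lebesgue (%t. a t powr p)" "integrable lebesgue (%t. b t powr p)"
  using Lp_nrm_measurable[OF u] Lp_nrm_measurable[OF g] p u g unfolding Lp_iff by (simp_all add: a_def[abs_def] b_def[abs_def])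
 have nn: "a t >= 0" "b t >= 0" "\<Phi> t >= 0" for t using nonneg c(2)[of t] by (auto simp: a_def b_def \<Phi>_def)
 have m\<Phi>: "\<Phi> \<in> borel_measurable lebesgue" unfolding \<Phi>_def using ab c by measurable
 have i1: "integrable lebesgue (%t. norm (a t + b t) powr p)"
  by (rule integrable_powr_add[OF p1 ab(1,2)]) (use ab nn in simp_all)
 have i\<Phi>: "integrable lebesgue (%t. \<Phi> t powr p)"
  using integrable_powr_add[OF p1 _ c(1), of "%t. a t + b t"] i1 ab c nn unfolding \<Phi>_def by simp
 note J = Jensen_unit_interval[OF p m\<Phi> nn(3) i\<Phi>]
 have ih: "integrable lebesgue (%t. indicator {0<..<s} t * h t)"
  if h: "h \<in> borel_measurable lebesgue" "!!t. 0 <= h t" "!!t. h t <= \<Phi> t" and s: "s <= 1" for h s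
 proof (rule bochner_bound[OF J(1)])
  show "(%t. indicator {0<..<s} t * h t) \<in> borel_measurable lebesgue"
   by (rule borel_measurable_indicator_times[OF _ h(1)]) simp
  show "AE t in lebesgue. norm (indicator {0<..<s} t * h t) <= norm (indicator {0<..<1} t * \<Phi> t)"
   using h s nn(3) by (auto split: split_indicator)
 qed
 have le\<Phi>: "a t <= \<Phi> t" "b t <= \<Phi> t" "c t <= \<Phi> t" for t using nn[of t] c(2)[of t] by (auto simp: \<Phi>_def)
 have ia: "integrable lebesgue (%t. indicator {0<..<s} t * a t)" if "s <= 1" for s by (rule ih[OF ab(1) nn(1) le\<Phi>(1) that])
 have ib: "integrable lebesgue (%t. indicator {0<..<s} t * b t)" if "s <= 1" for s by (rule ih[OF ab(2) nn(2) le\<Phi>(2) that])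
 have ic: "integrable lebesgue (%t. indicator {0<..<s} t * c t)" if "s <= 1" for s by (rule ih[OF c(1,2) le\<Phi>(3) that])
 have split: "(LINT t|lebesgue. indicator {0<..<s} t * \<Phi> t) = (LINT t|lebesgue. indicator {0<..<s} t * a t)
   + (LINT t|lebesgue. indicator {0<..<s} t * b t) + (LINT t|lebesgue. indicator {0<..<s} t * c t)" if s: "s <= 1" for s
  using ia[OF s] ib[OF s] ic[OF s] by (simp add: \<Phi>_def distrib_left)
 have pos: "0 <= (LINT t|lebesgue. indicator {0<..<s} t * h t)" if "!!t. 0 <= h t" for h :: "real => real" and s
  using that by (intro integral_nonneg_AE) (auto split: split_indicator)
 have inc: "nrm X (u \<sigma> - u 0) <= (LINT t|lebesgue. indicator {0<..<s} t * b t)" if "0 < \<sigma>" "\<sigma> < s" "s <= 1" for \<sigma> s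
 proof -
  have 0: "0 <= \<sigma>" using that by simp
  have "nrm X (u \<sigma> - u 0) <= (LINT t|lebesgue. indicator {0<..\<sigma>} t * b t)" using AC_nrm_le(1)[OF p1 ac order_refl 0] by (simp add: b_def)
  also have "... <= (LINT t|lebesgue. indicator {0<..<s} t * b t)"
   using AC_nrm_le(2)[OF p1 ac order_refl 0] that ib[of s] nn by (intro integral_mono) (auto simp: b_def[symmetric] split: split_indicator)
  finally show ?thesis .
 qed
 have u0: "u t \<in> carr X" if "t >= 0" for t by (rule AC_D(1)[OF ac that])
 have n0: "nrm X (u 0) <= (LINT t|lebesgue. indicator {0<..<1} t * \<Phi> t)"
 proof -
  obtain \<sigma> where \<sigma>: "0 < \<sigma>" "\<sigma> < 1" "1 * a \<sigma> <= (LINT t|lebesgue. indicator {0<..<1} t * a t)"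
   using ex_le_average[OF zero_less_one ia[OF order_refl], of "%_. True"] by auto
  have "nrm X (u 0) <= nrm X (u \<sigma>) + nrm X (u 0 - u \<sigma>)"
   using triangle[of "u \<sigma>" "u 0 - u \<sigma>"] diff u0 \<sigma>(1) by simp
  moreover have "nrm X (u 0 - u \<sigma>) = nrm X (u \<sigma> - u 0)" using u0 \<sigma>(1) by (intro nrm_minus_commute) auto
  moreover have "nrm X (u \<sigma>) = a \<sigma>" using \<sigma>(1) by (simp add: a_def zext_def)
  ultimately show ?thesis using \<sigma> inc[of \<sigma> 1] split[of 1] pos[of c 1, OF c(2)] by simp
 qed
 then show "nrm X (u 0) <= I powr (1 / p)" using J(2) by (simp add: I_def \<Phi>_def a_def b_def)
 \<comment> \<open>The integrand is cut off at time 1. For larger \<open>s\<close> the trivial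
   splitting \<open>u 0 + 0\<close> costs \<open>nrm X (u 0)\<close>, which does not grow with
   \<open>s\<close>; this confines the energy to a unit interval.\<close>
 define \<phi> where "\<phi> t = indicator {0<..<1} t * \<Phi> t" for t
 have \<phi>: "\<phi> \<in> borel_measurable lebesgue" "!!t. \<phi> t >= 0" using m\<Phi> nn unfolding \<phi>_def
  using borel_measurable_indicator_times[OF _ m\<Phi>, of "{0<..<1}"] by auto
 have \<phi>p: "indicator {0<..} t * \<phi> t powr p = indicator {0<..<1} t * \<Phi> t powr p" for t by (auto simp: \<phi>_def split: split_indicator)
 have i\<phi>: "integrable lebesgue (%t. indicator {0<..} t * \<phi> t powr p)" unfolding \<phi>p
  using integrable_mult_indicator[OF _ i\<Phi>, of "{0<..<1}"] by simp
 have "K_fun X' Z s (u 0 + 0) <= (LINT t|lebesgue. indicator {0<..<s} t * \<phi> t)" if s: "s > 0" for s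
 proof (cases "s <= 1")
  case True
  obtain \<sigma> where \<sigma>: "0 < \<sigma>" "\<sigma> < s" "u \<sigma> \<in> carr Z" "nrm Z (u \<sigma>) <= c \<sigma>" "s * c \<sigma> <= (LINT t|lebesgue. indicator {0<..<s} t * c t)"
   using ex_le_average[OF s ic[OF True] uZ] by auto
  have d: "u 0 - u \<sigma> \<in> carr X" using diff u0 \<sigma>(1) by auto
  have "K_fun X' Z s ((u 0 - u \<sigma>) + u \<sigma>) <= nrm X' (u 0 - u \<sigma>) + s * nrm Z (u \<sigma>)"
   by (rule K_fun_le) (use X' Z s d \<sigma> in auto)
  also have "nrm X' (u 0 - u \<sigma>) = nrm X (u \<sigma> - u 0)" using X'(3)[OF d] nrm_minus_commute[of "u 0" "u \<sigma>"] u0 \<sigma>(1) by simp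
  also have "s * nrm Z (u \<sigma>) <= s * c \<sigma>" using \<sigma> s by simp
  finally have "K_fun X' Z s (u 0 + 0) <= (LINT t|lebesgue. indicator {0<..<s} t * \<Phi> t)"
   using inc[OF \<sigma>(1,2) True] \<sigma>(5) split[OF True] pos[of a s, OF nn(1)] by simp
  also have "... = (LINT t|lebesgue. indicator {0<..<s} t * \<phi> t)"
   using True by (intro bochner_cong) (auto simp: \<phi>_def split: split_indicator)
  finally show ?thesis .
 next
  case False
  have "K_fun X' Z s (u 0 + 0) <= nrm X' (u 0) + s * nrm Z 0"
   by (rule K_fun_le) (use X' Z s u0[of 0] in auto)
  also have "... = nrm X (u 0)" using Z X'(3)[OF u0[of 0]] by simp
  also have "... <= (LINT t|lebesgue. indicator {0<..<1} t * \<Phi> t)" by (rule n0)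
  also have "... = (LINT t|lebesgue. indicator {0<..<s} t * \<phi> t)"
   using False by (intro bochner_cong) (auto simp: \<phi>_def split: split_indicator)
  finally show ?thesis .
 qed
 note H = interp_Hardy[OF p X'(1) Z(1) _ Z(2) \<phi> i\<phi> this]
 have u0': "u 0 \<in> carr X'" using u0[of 0] X'(2) by auto
 show "u 0 \<in> carr (interp_sp (1 - 1 / p) p X' Z)" using H(1)[OF u0'] by simp
 show "nrm (interp_sp (1 - 1 / p) p X' Z) (u 0) <= (((p - 1) / p) powr (- p) * I) powr (1 / p)"
  using H(2)[OF u0'] unfolding \<phi>p by (simp add: I_def \<Phi>_def a_def b_def)
qed

text \<open>A translation of \<open>trace_0\<close>. The space \<open>X'\<close> may be larger than
  \<open>X\<close>, with the same norm on \<open>X\<close>, because \<open>Btilde\<close>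
  interpolates between unrestricted vector fields while the path takes solenoidal values.\<close>

lemma trace:
 assumes p: "p > 1" and u: "u \<in> carr (Lp_time p X)" and ac: "AC p u g"
  and X': "!!x. nrm X' x >= 0" "carr X \<subseteq> carr X'" "!!x. x \<in> carr X ==> nrm X' x = nrm X x"
  and Z: "!!x. nrm Z x >= 0" "0 \<in> carr Z" "nrm Z 0 = 0"
  and c: "c \<in> borel_measurable lebesgue" "!!t. c t >= 0" "integrable lebesgue (%t. c t powr p)"
  and uZ: "AE t in lebesgue. t > 0 --> u t \<in> carr Z \<and> nrm Z (u t) <= c t" and r: "r >= 0"
 defines "I \<equiv> LINT t|lebesgue. indicator {r<..<r+1} t * (nrm X (zext {0<..} u t) + nrm X (zext {0<..} g t) + c t) powr p"
 shows "u r \<in> carr (interp_sp (1 - 1 / p) p X' Z)"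
  and "nrm (interp_sp (1 - 1 / p) p X' Z) (u r) <= (((p - 1) / p) powr (- p) * I) powr (1 / p)"
  and "nrm X (u r) <= I powr (1 / p)"
proof -
 let ?c = "%t. c (r + 1 * t)"
 have mc: "?c \<in> borel_measurable lebesgue"
  by (rule measurable_compose[OF affine_measurable_lebesgue c(1)]) simp
 have ic: "integrable lebesgue (%t. ?c t powr p)" using lebesgue_integrable_real_affine[OF c(3), of 1 r] by simp
 have uZ': "AE t in lebesgue. t > 0 --> u (r + 1 * t) \<in> carr Z \<and> nrm Z (u (r + 1 * t)) <= ?c t"
  using AE_lebesgue_affine[OF uZ one_neq_zero, of r] by eventually_elim (use r in auto)
 note T = trace_0[OF p Lp_shift[OF r u] AC_shift[OF r ac] X' Z mc c(2) ic uZ']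
 have "I = (LINT t|lebesgue. indicator {r<..<r+1} (r + 1 * t) * (nrm X (zext {0<..} u (r + 1 * t)) + nrm X (zext {0<..} g (r + 1 * t)) + c (r + 1 * t)) powr p)"
  unfolding I_def
  using lebesgue_integral_real_affine[of 1 "%t. indicator {r<..<r+1} t * (nrm X (zext {0<..} u t) + nrm X (zext {0<..} g t) + c t) powr p" r] by simp
 also have "... = (LINT t|lebesgue. indicator {0<..<1} t * (nrm X (zext {0<..} (%t. u (r + 1 * t)) t) + nrm X (zext {0<..} (%t. g (r + 1 * t)) t) + ?c t) powr p)"
  using r by (intro bochner_cong) (auto simp: zext_def split: split_indicator)
 finally have I: "I = (LINT t|lebesgue. indicator {0<..<1} t * (nrm X (zext {0<..} (%t. u (r + 1 * t)) t) + nrm X (zext {0<..} (%t. g (r + 1 * t)) t) + ?c t) powr p)" .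
 show "u r \<in> carr (interp_sp (1 - 1 / p) p X' Z)"
  "nrm (interp_sp (1 - 1 / p) p X' Z) (u r) <= (((p - 1) / p) powr (- p) * I) powr (1 / p)"
  "nrm X (u r) <= I powr (1 / p)"
  using T unfolding I[symmetric] by simp_all
qed

end

section \<open>Maximal regularity\<close>

lemma integral_Ioc_eq:
 fixes h :: "real => real"
 assumes h: "integrable lebesgue h" and T: "0 <= T" "T <= T'"
 shows "(LINT t|lebesgue. indicator {T<..T'} t * h t) = (LINT t|lebesgue. indicator {0..T'} t * h t) - (LINT t|lebesgue. indicator {0..T} t * h t)"
proof -
 have i: "integrable lebesgue (%t. indicator S t * h t)" if "S \<in> sets lebesgue" for S
  using integrable_mult_indicator[OF that h] by simp
 have "(LINT t|lebesgue. indicator {0..T'} t * h t) = (LINT t|lebesgue. indicator {0..T} t * h t + indicator {T<..T'} t * h t)"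
  using T by (intro bochner_cong) (auto split: split_indicator)
 then show ?thesis using i[of "{0..T}"] i[of "{T<..T'}"] by simp
qed

text \<open>The primitive \<open>H\<close> is continuous at \<open>T0\<close>. Each end of the
  window contributes a deviation below a quarter of \<open>e powr p\<close>, which leaves room for
  the factor 2 that counts the two passages of a loop.\<close>

lemma small_integral:
 fixes h :: "real => real"
 assumes h: "integrable lebesgue h" "!!t. h t >= 0" and T0: "T0 >= 0" and e: "e > 0" and p: "p >= 1"
 shows "\<exists>d>0. \<forall>T T'. 0 <= T --> T <= T' --> \<bar>T - T0\<bar> < d --> \<bar>T' - T0\<bar> < d -->
  (2 * (LINT t|lebesgue. indicator {T<..T'} t * h t)) powr (1 / p) < e"
proof -
 define H where "H t = (LINT s|lebesgue. indicator {0..t} s * h s)" for t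
 have i: "integrable lebesgue (%t. indicator {0..R} t * h t)" for R
  using integrable_mult_indicator[OF _ h(1), of "{0..R}"] by simp
 have "continuous_on {0..T0+1} H" unfolding H_def by (rule continuous_on_indefinite_integral[OF i])
 moreover have "T0 \<in> {0..T0+1}" using T0 by simp
 moreover have e': "e powr p / 4 > 0" using e by simp
 ultimately obtain d where d: "d > 0" "!!t. t \<in> {0..T0+1} ==> dist t T0 < d ==> dist (H t) (H T0) < e powr p / 4"
  unfolding continuous_on_iff by metis
 show ?thesis
 proof (intro exI[of _ "min d 1"] conjI allI impI)
  fix T T' assume T: "0 <= T" "T <= T'" "\<bar>T - T0\<bar> < min d 1" "\<bar>T' - T0\<bar> < min d 1"
  have "\<bar>H T - H T0\<bar> < e powr p / 4" "\<bar>H T' - H T0\<bar> < e powr p / 4"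
   using d(2)[of T] d(2)[of T'] T by (auto simp: dist_real_def)
  then have "H T' - H T < e powr p / 2" by linarith
  then have 2: "2 * (LINT t|lebesgue. indicator {T<..T'} t * h t) < e powr p"
   unfolding integral_Ioc_eq[OF h(1) T(1,2)] H_def by simp
  have 0: "0 <= (LINT t|lebesgue. indicator {T<..T'} t * h t)" using h(2) by (intro integral_nonneg_AE) auto
  have "(2 * (LINT t|lebesgue. indicator {T<..T'} t * h t)) powr (1 / p) < (e powr p) powr (1 / p)"
   using 2 0 p by (intro powr_less_mono2) auto
  also have "... = e" using e p by (simp add: powr_powr)
  finally show "(2 * (LINT t|lebesgue. indicator {T<..T'} t * h t)) powr (1 / p) < e" .
 qed (use d in auto)
qed

context zsp begin

definition loop_cost :: "real => (real => 'v) => real => real => real" where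
 "loop_cost p u T T' = (2 * (LINT t|lebesgue. indicator {T<..T'} t * nrm X (zext {0<..} u t) powr p)) powr (1 / p)"

lemma loop_cost_small:
 assumes "p >= 1" "u \<in> carr (Lp_time p X)" "T0 >= 0" "e > 0"
 shows "\<exists>d>0. \<forall>T T'. 0 <= T --> T <= T' --> \<bar>T - T0\<bar> < d --> \<bar>T' - T0\<bar> < d --> loop_cost p u T T' < e"
 unfolding loop_cost_def by (rule small_integral) (use assms in \<open>auto simp: Lp_iff\<close>)

end

locale mrsp = X: bsp X + Y: zsp Y for X Y :: "'v::real_vector nspace"
begin

text \<open>Here \<open>f\<close> itself is the absolutely continuous path with derivative
  \<open>g\<close>, whereas membership in \<open>max_reg_sp\<close> determines a function only up to
  null sets.\<close>

definition mr :: "real => (real => 'v) => (real => 'v) => bool" where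
 "mr p f g \<longleftrightarrow> f \<in> carr (Lp_time p Y) \<and> f \<in> carr (Lp_time p X) \<and> X.AC p f g"

lemma mr_max_reg:
 assumes p: "p >= 1" and f: "mr p f g"
 shows "f \<in> carr (max_reg_sp p Y X)"
  and "nrm (max_reg_sp p Y X) f = nrm (Lp_time p Y) f + nrm (Lp_time p X) f + nrm (Lp_time p X) g"
proof -
 have fY: "f \<in> carr (Lp_time p Y)" and fX: "f \<in> carr (Lp_time p X)" and ac: "X.AC p f g" using f by (auto simp: mr_def)
 note W = X.W1p_AC[OF p fX X.AC_D(2)[OF ac] X.AC_imp_weak[OF p fX ac]]
 show "f \<in> carr (max_reg_sp p Y X)"
  and "nrm (max_reg_sp p Y X) f = nrm (Lp_time p Y) f + nrm (Lp_time p X) f + nrm (Lp_time p X) g"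
  using fY W by (simp_all add: max_reg_sp_def)
qed

text \<open>The last conjunct is conditional, since \<open>f\<close> need not agree everywhere with
  its representative. For mild functions the agreement is established in
  \<open>mild_reg\<close>.\<close>

lemma max_reg_AC:
 assumes p: "p >= 1" and f: "f \<in> carr (max_reg_sp p Y X)"
 shows "\<exists>f' g. X.AC p f' g \<and> (AE t in lebesgue. t > 0 --> f t = f' t) \<and> ((\<forall>t\<ge>0. f t = f' t) --> mr p f g)"
proof -
 have fY: "f \<in> carr (Lp_time p Y)" and fX: "f \<in> carr (Lp_time p X)" and "\<exists>g\<in>carr (Lp_time p X). weak_time_deriv X f g"
  using f by (auto simp: max_reg_sp_def W1p_time_def)
 then obtain g where g: "g \<in> carr (Lp_time p X)" "weak_time_deriv X f g" by blast
 obtain f' where f': "X.AC p f' g" "AE t in lebesgue. t > 0 --> f t = f' t" using X.weak_imp_AC[OF p fX g] by blast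
 have "X.AC p f g" if "\<forall>t\<ge>0. f t = f' t"
  using f'(1) that unfolding X.AC_def by auto
 then show ?thesis using f' fX fY by (auto simp: mr_def)
qed

lemma max_reg_nonneg: "nrm (max_reg_sp p Y X) f >= 0"
 unfolding max_reg_sp_def W1p_time_def by (simp add: X.Lp_nrm_nonneg Y.Lp_nrm_nonneg)

lemma mr_shift: "a >= 0 ==> mr p f g ==> mr p (%t. f (a + 1 * t)) (%t. g (a + 1 * t))"
 unfolding mr_def using X.Lp_shift Y.Lp_shift X.AC_shift by blast

lemma mr_insert_loop:
 assumes p: "p >= 1" and T: "0 <= T" "T <= T'" and v: "mr p v gv" and u: "mr p u gu" and uv: "u T = v T"
 shows "mr p (insert_loop T T' v u u) (insert_loop T T' gv gu (%t. - gu t))"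
  and "nrm (max_reg_sp p Y X) (insert_loop T T' v u u) <= nrm (max_reg_sp p Y X) v
   + (Y.loop_cost p u T T' + X.loop_cost p u T T' + X.loop_cost p gu T T')"
proof -
 have v': "v \<in> carr (Lp_time p Y)" "v \<in> carr (Lp_time p X)" "X.AC p v gv" using v by (auto simp: mr_def)
 have u': "u \<in> carr (Lp_time p Y)" "u \<in> carr (Lp_time p X)" "X.AC p u gu" using u by (auto simp: mr_def)
 have t: "AE t in lebesgue. t > 0 --> r (u t) = r (u t)" for r :: "'v => real" by simp
 note LY = Y.Lp_insert_loop[OF p T v'(1) u'(1) u'(1) t] and LX = X.Lp_insert_loop[OF p T v'(2) u'(2) u'(2) t]
  and LA = X.AC_insert_loop[OF p T v'(3) u'(3) uv]
 show m: "mr p (insert_loop T T' v u u) (insert_loop T T' gv gu (%t. - gu t))"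
  unfolding mr_def using LY(1) LX(1) LA(1) by blast
 show "nrm (max_reg_sp p Y X) (insert_loop T T' v u u) <= nrm (max_reg_sp p Y X) v
   + (Y.loop_cost p u T T' + X.loop_cost p u T T' + X.loop_cost p gu T T')"
  unfolding mr_max_reg(2)[OF p m] mr_max_reg(2)[OF p v] Y.loop_cost_def X.loop_cost_def
  using LY(2) LX(2) LA(2) by linarith
qed

end

section \<open>Mild solutions of linear equations\<close>

text \<open>An inequality valid for almost all small \<open>h\<close> may be passed to the limit,
  because every right neighbourhood of 0 contains good values of \<open>h\<close>.\<close>

lemma AE_le_limit_0:
 fixes F :: "real => real"
 assumes F: "(F \<longlongrightarrow> 0) (at_right 0)" and a: "a > 0" and ae: "AE h in lebesgue. 0 < h --> h < a --> c <= F h"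
 shows "c <= 0"
proof (rule ccontr)
 assume "\<not> c <= 0"
 then have "\<forall>\<^sub>F h in at_right 0. F h < c" using order_tendstoD(2)[OF F, of c] by simp
 then obtain d where d: "d > 0" "!!h. 0 < h ==> h < d ==> F h < c" unfolding eventually_at_right_field by auto
 obtain h where "0 < h" "h < min d a" "0 < h --> h < a --> c <= F h"
  using AE_lebesgue_ex[OF ae, of 0 "min d a"] d a by auto
 then show False using d(2)[of h] by auto
qed

lemma continuous_Icc_at_right_0:
 fixes P :: "real => real"
 assumes "continuous_on {0..t} P" "t > 0"
 shows "((%s. P s - P 0) \<longlongrightarrow> 0) (at_right 0)" and "((%h. P t - P (t - h)) \<longlongrightarrow> 0) (at_right 0)"
proof -
 have "(P \<longlongrightarrow> P 0) (at 0 within {0..t})" using assms by (auto simp: continuous_on_def)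
 moreover have "at 0 within {0..t} = at_right 0" using assms by (intro at_within_Icc_at_right)
 ultimately show "((%s. P s - P 0) \<longlongrightarrow> 0) (at_right 0)" by (simp add: LIM_zero_iff)
 have l: "(P \<longlongrightarrow> P t) (at t within {0..t})" using assms by (auto simp: continuous_on_def)
 have "filterlim (%h. t - h) (at t within {0..t}) (at_right 0)"
  unfolding filterlim_at
 proof
  show "\<forall>\<^sub>F h in at_right 0. t - h \<in> {0..t} \<and> t - h ~= t"
   unfolding eventually_at_right_field using assms(2) by (intro exI[of _ t]) auto
  show "((%h. t - h) \<longlongrightarrow> t) (at_right 0)" by (auto intro!: tendsto_eq_intros)
 qed
 from filterlim_compose[OF l this] have "((%h. P (t - h)) \<longlongrightarrow> P t) (at_right 0)" .
 from tendsto_diff[OF tendsto_const[of "P t"] this] show "((%h. P t - P (t - h)) \<longlongrightarrow> 0) (at_right 0)" by simp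
qed

text \<open>The bound \<open>B0\<close> is uniform in time; in the application it comes from the
  exponential stability of the linear closed loop.\<close>

locale c0 = bsp X for X :: "'v::complex_vector nspace" +
 fixes S :: "real => 'v => 'v" and B0 :: real
 assumes C0: "C0_semigroup X S" and B0: "B0 >= 0" and S_bound: "t >= 0 ==> x \<in> carr X ==> nrm X (S t x) <= B0 * nrm X x"
begin

lemma S_carr: "t >= 0 ==> x \<in> carr X ==> S t x \<in> carr X"
 using C0 unfolding C0_semigroup_def bounded_op_def by blast

lemma S_add: "t >= 0 ==> x \<in> carr X ==> y \<in> carr X ==> S t (x + y) = S t x + S t y"
 using C0 by (auto simp: C0_semigroup_def bounded_op_def)

lemma S_scaleR: "t >= 0 ==> x \<in> carr X ==> S t (r *\<^sub>R x) = r *\<^sub>R S t x"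
 using C0 by (auto simp: C0_semigroup_def bounded_op_def scaleR_scaleC)

lemma S_diff: "t >= 0 ==> x \<in> carr X ==> y \<in> carr X ==> S t (x - y) = S t x - S t y"
 using S_add[of t x "- y"] S_scaleR[of t y "-1"] uminus[of y] by simp

lemma S_0: "x \<in> carr X ==> S 0 x = x"
 using C0 by (auto simp: C0_semigroup_def)

lemma S_S: "s >= 0 ==> t >= 0 ==> x \<in> carr X ==> S s (S t x) = S (s + t) x"
 using C0 by (auto simp: C0_semigroup_def)

lemma S_tends: "x \<in> carr X ==> ((%t. nrm X (S t x - x)) \<longlongrightarrow> 0) (at_right 0)"
 using C0 by (auto simp: C0_semigroup_def tends_in_def)

lemma S_dual:
 assumes l: "l \<in> dual X" and t: "t >= 0" shows "(%x. l (S t x)) \<in> dual X"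
proof -
 obtain B where B: "B > 0" "!!x. x \<in> carr X ==> \<bar>l x\<bar> <= B * nrm X x" using dual_bound[OF l] by blast
 have "\<bar>l (S t x)\<bar> <= (B * B0) * nrm X x" if x: "x \<in> carr X" for x
 proof -
  have "\<bar>l (S t x)\<bar> <= B * nrm X (S t x)" by (rule B(2)[OF S_carr[OF t x]])
  also have "... <= B * (B0 * nrm X x)" using S_bound[OF t x] B(1) by simp
  finally show ?thesis by (simp add: mult.assoc)
 qed
 then have "\<exists>B. \<forall>x\<in>carr X. \<bar>l (S t x)\<bar> <= B * nrm X x" by blast
 then show ?thesis
  using l t unfolding dual_def
  by (auto simp: S_add S_scaleR dual_add[OF l] dual_scale[OF l] S_carr)
qed

lemma duhamel_carr: "duhamel X S H J ==> t >= 0 ==> J t \<in> carr X"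
 unfolding duhamel_def using has_bintD(2)[of "{0..t}"] by auto

lemma duhamel_0: "duhamel X S H J ==> J 0 = 0"
 unfolding duhamel_def using has_bint_0[OF null_lebesgue_singleton[of 0], of _ "J 0"] by force

text \<open>The operator \<open>S (t - s)\<close> is moved under the integral by means of the
  functionals that map \<open>x\<close> to \<open>l (S (t - s) x)\<close>, which are again bounded.
  The semigroup law is applied where \<open>H \<tau>\<close> lies in the carrier, that is for almost
  every time.\<close>

lemma duhamel_initial:
 assumes J: "duhamel X S H J" and H: "AE \<tau> in lebesgue. \<tau> > 0 --> H \<tau> \<in> carr X" and s: "0 <= s" "s <= t"
 shows "has_bint X {0..s} (%\<tau>. S (t - \<tau>) (H \<tau>)) (S (t - s) (J s))"
proof -
 have m: "{0..r} \<in> sets (lebesgue :: real measure)" for r :: real by simp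
 let ?k = "%\<tau>. S (t - \<tau>) (H \<tau>)" and ?kk = "%\<tau>. S (s - \<tau>) (H \<tau>)"
 have b: "has_bint X {0..t} ?k (J t)" "has_bint X {0..s} ?kk (J s)"
  using J[unfolded duhamel_def, rule_format, of t] J[unfolded duhamel_def, rule_format, of s] s by simp_all
 have x: "xint {0..s} ?k" by (rule xint_subset[OF m m _ has_bintD(1)[OF m b(1)]]) (use s in auto)
 have nn: "AE \<tau> in lebesgue. \<tau> ~= (0::real)" using AE_not_in[OF null_lebesgue_singleton[of 0]] by simp
 have ae: "AE \<tau> in lebesgue_on {0..s}. S (t - s) (?kk \<tau>) = ?k \<tau>"
 proof (subst AE_restrict_space_iff)
  show "AE \<tau> in lebesgue. \<tau> \<in> {0..s} --> S (t - s) (?kk \<tau>) = ?k \<tau>"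
   using H nn
  proof eventually_elim
   case (elim \<tau>)
   show ?case
   proof
    assume "\<tau> \<in> {0..s}"
    then have "H \<tau> \<in> carr X" "s - \<tau> >= 0" "t - s >= 0" using elim s by auto
    then show "S (t - s) (?kk \<tau>) = ?k \<tau>" by (simp add: S_S)
   qed
  qed
 qed simp
 have ts: "t - s >= 0" using s by simp
 show ?thesis unfolding has_bint_iff[OF m]
 proof (intro conjI ballI)
  show "xint {0..s} ?k" by (rule x)
  show "S (t - s) (J s) \<in> carr X" by (rule S_carr[OF ts duhamel_carr[OF J s(1)]])
  fix l assume l: "l \<in> dual X"
  note l' = S_dual[OF l ts]
  have "(LINT \<tau>|lebesgue_on {0..s}. l (?k \<tau>)) = (LINT \<tau>|lebesgue_on {0..s}. l (S (t - s) (?kk \<tau>)))"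
   by (rule integral_cong_AE)
    (use ae xint_dual[OF m x l] xint_dual[OF m has_bintD(1)[OF m b(2)] l'] in \<open>auto elim: eventually_mono\<close>)
  also have "... = l (S (t - s) (J s))" using has_bintD(3)[OF m b(2) l'] .
  finally show "(LINT \<tau>|lebesgue_on {0..s}. l (?k \<tau>)) = l (S (t - s) (J s))" .
 qed
qed

lemma duhamel_final:
 assumes J: "duhamel X S H J" and H: "AE \<tau> in lebesgue. \<tau> > 0 --> H \<tau> \<in> carr X" and s: "0 <= s" "s <= t"
 shows "has_bint X {s..t} (%\<tau>. S (t - \<tau>) (H \<tau>)) (J t - S (t - s) (J s))"
proof -
 have m: "{r..r'} \<in> sets (lebesgue :: real measure)" for r r' :: real by simp
 let ?k = "%\<tau>. S (t - \<tau>) (H \<tau>)"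
 have b: "has_bint X {0..t} ?k (J t)" using J s by (auto simp: duhamel_def)
 note b0 = duhamel_initial[OF J H s]
 have x: "xint {s..t} ?k" by (rule xint_subset[OF m m _ has_bintD(1)[OF m b]]) (use s in auto)
 have Jc: "J t \<in> carr X" "S (t - s) (J s) \<in> carr X" using has_bintD(2)[OF m b] has_bintD(2)[OF m b0] by auto
 show ?thesis unfolding has_bint_iff[OF m]
 proof (intro conjI ballI)
  show "xint {s..t} ?k" by (rule x)
  show "J t - S (t - s) (J s) \<in> carr X" by (rule diff[OF Jc])
  fix l assume l: "l \<in> dual X"
  have i: "integrable lebesgue (%\<tau>. indicator {r..r'} \<tau> * l (?k \<tau>))" if "xint {r..r'} ?k" for r r'
   using xint_dual[OF m that l] by (simp add: integrable_restrict_space)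
  have I: "(LINT \<tau>|lebesgue_on {r..r'}. l (?k \<tau>)) = (LINT \<tau>|lebesgue. indicator {r..r'} \<tau> * l (?k \<tau>))" for r r' :: real
   by (simp add: integral_restrict_space)
  note i1 = i[OF x] and i2 = i[OF has_bintD(1)[OF m b0]] and i3 = i[OF has_bintD(1)[OF m b]]
  have nn: "AE \<tau> in lebesgue. \<tau> ~= s" using AE_not_in[OF null_lebesgue_singleton[of s]] by simp
  have "AE \<tau> in lebesgue. indicator {0..t} \<tau> * l (?k \<tau>) = indicator {0..s} \<tau> * l (?k \<tau>) + indicator {s..t} \<tau> * l (?k \<tau>)"
   using nn by eventually_elim (use s in \<open>auto split: split_indicator\<close>)
  from lebesgue_AE_cong(2)[OF i3 this]
  have "(LINT \<tau>|lebesgue. indicator {0..t} \<tau> * l (?k \<tau>)) = (LINT \<tau>|lebesgue. indicator {0..s} \<tau> * l (?k \<tau>)) + (LINT \<tau>|lebesgue. indicator {s..t} \<tau> * l (?k \<tau>))"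
   using i1 i2 by simp
  then show "(LINT \<tau>|lebesgue_on {s..t}. l (?k \<tau>)) = l (J t - S (t - s) (J s))"
   using has_bintD(3)[OF m b l] has_bintD(3)[OF m b0 l] unfolding I by (simp add: dual_diff[OF l Jc])
 qed
qed

text \<open>This permits restarting a solution at time \<open>r\<close>: after subtraction of the
  propagated past \<open>S t (J r)\<close>, what remains is the Duhamel integral of the shifted
  forcing.\<close>

lemma duhamel_shift:
 assumes J: "duhamel X S H J" and H: "AE \<tau> in lebesgue. \<tau> > 0 --> H \<tau> \<in> carr X" and r: "0 <= r"
 shows "duhamel X S (%\<tau>. H (r + 1 * \<tau>)) (%t. J (r + 1 * t) - S t (J r))"
 unfolding duhamel_def
proof (intro allI impI)
 fix t :: real assume t: "t >= 0"
 have m: "{a..b} \<in> sets (lebesgue :: real measure)" for a b :: real by simp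
 have U: "UNIV \<in> sets (lebesgue :: real measure)" by simp
 let ?k = "%\<tau>. S (r + t - \<tau>) (H \<tau>)" and ?h = "%\<tau>. S (t - \<tau>) (H (r + 1 * \<tau>))" and ?I = "J (r + t) - S t (J r)"
 have rt: "r <= r + t" using t by simp
 have "has_bint X {r..r+t} ?k ?I" using duhamel_final[OF J H r rt] by simp
 then have "has_bint X UNIV (zext {r..r+t} ?k) ?I" unfolding has_bint_zext[OF m] .
 then have k: "xint UNIV (zext {r..r+t} ?k)" "?I \<in> carr X" "!!l. l \<in> dual X ==> (LINT \<tau>|lebesgue. l (zext {r..r+t} ?k \<tau>)) = l ?I"
  unfolding has_bint_iff[OF U] lebesgue_on_UNIV_eq by auto
 have eq: "zext {0..t} ?h = (%\<tau>. zext {r..r+t} ?k (r + 1 * \<tau>))" by (auto simp: zext_def fun_eq_iff)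
 have "has_bint X UNIV (zext {0..t} ?h) ?I"
  unfolding has_bint_iff[OF U] lebesgue_on_UNIV_eq eq
 proof (intro conjI ballI)
  show "xint UNIV (%\<tau>. zext {r..r+t} ?k (r + 1 * \<tau>))" by (rule xint_affine[OF k(1)]) simp
  show "(LINT \<tau>|lebesgue. l (zext {r..r+t} ?k (r + 1 * \<tau>))) = l ?I" if "l \<in> dual X" for l
   using lebesgue_integral_real_affine[of 1 "%\<tau>. l (zext {r..r+t} ?k \<tau>)" r] k(3)[OF that] by simp
 qed (rule k)
 then show "has_bint X {0..t} ?h (J (r + 1 * t) - S t (J r))" unfolding has_bint_zext[OF m] by simp
qed

text \<open>The integrand depends on the final time \<open>t\<close>, hence so does
  \<open>Q\<close>. For fixed \<open>t\<close>, both parts of the integral split at \<open>s\<close>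
  are bounded by increments of this one continuous function.\<close>

lemma duhamel_modulus:
 assumes J: "duhamel X S H J" and H: "AE \<tau> in lebesgue. \<tau> > 0 --> H \<tau> \<in> carr X" and t: "t >= 0"
 shows "\<exists>Q. continuous_on {0..t} Q \<and> Q 0 = 0 \<and> (\<forall>s\<in>{0..t}. nrm X (J t - S (t - s) (J s)) <= Q t - Q s \<and> nrm X (S (t - s) (J s)) <= Q s)"
proof -
 have m: "{a..b} \<in> sets (lebesgue :: real measure)" for a b :: real by simp
 let ?k = "%\<tau>. S (t - \<tau>) (H \<tau>)"
 define h where "h \<tau> = indicator {0..t} \<tau> * nrm X (?k \<tau>)" for \<tau>
 have "has_bint X {0..t} ?k (J t)" using J t by (auto simp: duhamel_def)
 from has_bintD(1)[OF m this] have "integrable (lebesgue_on {0..t}) (%\<tau>. nrm X (?k \<tau>))" by (simp add: xint_def)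
 then have h: "integrable lebesgue h" unfolding h_def by (simp add: integrable_restrict_space)
 have ih: "integrable lebesgue (%\<tau>. indicator {0..R} \<tau> * h \<tau>)" for R
  using integrable_mult_indicator[OF m h, of 0 R] by simp
 define Q where "Q s = (LINT \<tau>|lebesgue. indicator {0..s} \<tau> * h \<tau>)" for s
 have "continuous_on {0..t} Q" unfolding Q_def by (rule continuous_on_indefinite_integral[OF ih])
 moreover have "Q 0 = 0"
 proof -
  have nn: "AE \<tau> in lebesgue. \<tau> ~= (0::real)" using AE_not_in[OF null_lebesgue_singleton[of 0]] by simp
  show ?thesis unfolding Q_def by (rule integral_eq_zero_AE) (use nn in \<open>eventually_elim, auto split: split_indicator\<close>)
 qed
 moreover have "nrm X (J t - S (t - s) (J s)) <= Q t - Q s \<and> nrm X (S (t - s) (J s)) <= Q s" if "s \<in> {0..t}" for s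
 proof
  have s: "0 <= s" "s <= t" using that by auto
  have nn: "AE \<tau> in lebesgue. \<tau> ~= s" using AE_not_in[OF null_lebesgue_singleton[of s]] by simp
  have "nrm X (S (t - s) (J s)) <= (LINT \<tau>|lebesgue_on {0..s}. nrm X (?k \<tau>))"
   by (rule has_bint_nrm_le[OF m duhamel_initial[OF J H s]])
  also have "... = (LINT \<tau>|lebesgue. indicator {0..s} \<tau> * nrm X (?k \<tau>))" by (simp add: integral_restrict_space)
  also have "... = Q s" unfolding Q_def
   by (rule bochner_cong) (use s in \<open>auto simp: h_def split: split_indicator\<close>)
  finally show "nrm X (S (t - s) (J s)) <= Q s" .
  have "nrm X (J t - S (t - s) (J s)) <= (LINT \<tau>|lebesgue_on {s..t}. nrm X (?k \<tau>))"
   by (rule has_bint_nrm_le[OF m duhamel_final[OF J H s]])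
  also have "... = (LINT \<tau>|lebesgue. indicator {s..t} \<tau> * nrm X (?k \<tau>))" by (simp add: integral_restrict_space)
  also have "... = (LINT \<tau>|lebesgue. indicator {s<..t} \<tau> * h \<tau>)"
  proof (rule lebesgue_AE_cong(2)[symmetric])
   show "integrable lebesgue (%\<tau>. indicator {s..t} \<tau> * nrm X (?k \<tau>))"
   proof -
    have "integrable lebesgue (%\<tau>. indicator {s..t} \<tau> * h \<tau>)" using integrable_mult_indicator[OF m h, of s t] by simp
    moreover have "indicator {s..t} \<tau> * h \<tau> = indicator {s..t} \<tau> * nrm X (?k \<tau>)" for \<tau>
     using s by (auto simp: h_def split: split_indicator)
    ultimately show ?thesis by (simp only:)
   qed
   show "AE \<tau> in lebesgue. indicator {s..t} \<tau> * nrm X (?k \<tau>) = indicator {s<..t} \<tau> * h \<tau>"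
    using nn by eventually_elim (use s in \<open>auto simp: h_def split: split_indicator\<close>)
  qed
  also have "... = Q t - Q s" unfolding Q_def by (rule integral_Ioc_eq[OF h s])
  finally show "nrm X (J t - S (t - s) (J s)) <= Q t - Q s" .
 qed
 ultimately show ?thesis by blast
qed

text \<open>No continuity of \<open>J\<close> is known a priori; the comparison with \<open>y\<close> at time \<open>t\<close> is made through times
 \<open>s < t\<close> at which the two sides agree.\<close>

lemma mild_eq_continuous:
 assumes J: "duhamel X S H J" and H: "AE \<tau> in lebesgue. \<tau> > 0 --> H \<tau> \<in> carr X" and b: "b \<in> carr X"
  and y: "!!t. t >= 0 ==> y t \<in> carr X" and P: "!!t. continuous_on {0..t} P"
  and yP: "!!s t. 0 <= s ==> s <= t ==> nrm X (y t - y s) <= P t - P s"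
  and ae: "AE t in lebesgue. t > 0 --> S t b - J t = y t" and t: "t >= 0"
 shows "S t b - J t = y t"
proof (cases "t = 0")
 case False
 then have t: "t > 0" using t by simp
 have t0: "t >= 0" using t by simp
 obtain Q where Q: "continuous_on {0..t} Q" "!!s. s \<in> {0..t} ==> nrm X (J t - S (t - s) (J s)) <= Q t - Q s"
  using duhamel_modulus[OF J H t0] by blast
 have Jc: "J s \<in> carr X" if "s >= 0" for s by (rule duhamel_carr[OF J that])
 \<comment> \<open>Three errors that vanish with \<open>h\<close>: the increment of \<open>y\<close>
   transported by the semigroup, the failure of \<open>S h\<close> to fix \<open>y t\<close>, and
   the last portion of the Duhamel integral.\<close>
 define F where "F h = B0 * (P t - P (t - h)) + nrm X (S h (y t) - y t) + (Q t - Q (t - h))" for h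
 have "(F \<longlongrightarrow> B0 * 0 + 0 + 0) (at_right 0)" unfolding F_def
  by (intro tendsto_intros continuous_Icc_at_right_0(2) P Q t S_tends y t0)
 then have F: "(F \<longlongrightarrow> 0) (at_right 0)" by simp
 have car: "S t b - J t - y t \<in> carr X" using diff S_carr b Jc y t0 by simp
 have "AE h in lebesgue. t + (-1) * h > 0 --> S (t + (-1) * h) b - J (t + (-1) * h) = y (t + (-1) * h)"
  by (rule AE_lebesgue_affine[OF ae]) simp
 then have "AE h in lebesgue. 0 < h --> h < t --> nrm X (S t b - J t - y t) <= F h"
 proof (eventually_elim, intro impI)
  fix h assume hh: "t + (-1) * h > 0 --> S (t + (-1) * h) b - J (t + (-1) * h) = y (t + (-1) * h)" and h: "0 < h" "h < t"
  define s where "s = t - h"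
  have s: "0 <= s" "s <= t" "t - s = h" "0 <= h" using h by (auto simp: s_def)
  have ys: "S s b = y s + J s" using hh h by (simp add: s_def algebra_simps)
  note c = y[OF s(1)] Jc[OF s(1)] y[OF t0] Jc[OF t0]
  have "S t b = S h (S s b)" using S_S[OF s(4,1) b] by (simp add: s_def)
  also have "... = S h (y s) + S h (J s)" unfolding ys by (rule S_add[OF s(4) c(1,2)])
  finally have "S t b - J t - y t = (S h (y s - y t) + (S h (y t) - y t)) - (J t - S h (J s))"
   by (simp add: S_diff[OF s(4) c(1,3)] algebra_simps)
  moreover have c': "S h (y s - y t) \<in> carr X" "S h (y t) - y t \<in> carr X" "J t - S h (J s) \<in> carr X"
   using c s(4) by (simp_all add: diff S_carr)
  ultimately have "nrm X (S t b - J t - y t) <= nrm X (S h (y s - y t)) + nrm X (S h (y t) - y t) + nrm X (J t - S h (J s))"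
   using order_trans[OF triangle_diff[OF add[OF c'(1,2)] c'(3)] add_right_mono[OF triangle[OF c'(1,2)]]] by (simp only:)
  moreover have "nrm X (S h (y s - y t)) <= B0 * nrm X (y t - y s)"
   using S_bound[OF s(4) diff[OF c(1,3)]] nrm_minus_commute[OF c(1,3)] by simp
  moreover have "B0 * nrm X (y t - y s) <= B0 * (P t - P s)" using yP[OF s(1,2)] B0 by (rule mult_left_mono)
  moreover have "nrm X (J t - S h (J s)) <= Q t - Q s" using Q(2)[of s] s by simp
  ultimately show "nrm X (S t b - J t - y t) <= F h" by (simp add: F_def s_def)
 qed
 from AE_le_limit_0[OF F t this] have "nrm X (S t b - J t - y t) = 0" using nonneg[of "S t b - J t - y t"] by simp
 then show ?thesis using nrm_eq_0[OF car] by simp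
next
 case True
 \<comment> \<open>At time 0 there are no earlier times. Instead \<open>S t b\<close> and
   \<open>S t (y 0)\<close> are shown to coincide for every positive \<open>t\<close>, and strong
   continuity as \<open>t\<close> tends to 0 gives \<open>b = y 0\<close>.\<close>
 have eq: "S t b = S t (y 0)" if t: "t > 0" for t
 proof -
  have t0: "t >= 0" using t by simp
  obtain Q where Q: "continuous_on {0..t} Q" "Q 0 = 0" "!!s. s \<in> {0..t} ==> nrm X (S (t - s) (J s)) <= Q s"
   using duhamel_modulus[OF J H t0] by blast
  have Jc: "J s \<in> carr X" if "s >= 0" for s by (rule duhamel_carr[OF J that])
  define F where "F s = B0 * (P s - P 0) + (Q s - Q 0) + B0 * nrm X (S s (y 0) - y 0)" for s
  have "(F \<longlongrightarrow> B0 * 0 + 0 + B0 * 0) (at_right 0)" unfolding F_def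
   by (intro tendsto_intros continuous_Icc_at_right_0(1)[OF P t] continuous_Icc_at_right_0(1)[OF Q(1) t] S_tends y order_refl)
  then have F: "(F \<longlongrightarrow> 0) (at_right 0)" by simp
  have y0: "y 0 \<in> carr X" using y by simp
  have car: "S t b - S t (y 0) \<in> carr X" using diff S_carr b y0 t0 by simp
  have "AE s in lebesgue. 0 < s --> s < t --> nrm X (S t b - S t (y 0)) <= F s"
   using ae
  proof (eventually_elim, intro impI)
   fix s assume hh: "s > 0 --> S s b - J s = y s" and s: "0 < s" "s < t"
   have s0: "0 <= s" "0 <= t - s" using s by auto
   have ys: "S s b = y s + J s" using hh s by (simp add: algebra_simps)
   note c = y[OF s0(1)] Jc[OF s0(1)] y0
   let ?T = "S (t - s)"
   have Ss: "S s (y 0) \<in> carr X" by (rule S_carr[OF s0(1) y0])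
   have "S t b = ?T (S s b)" "S t (y 0) = ?T (S s (y 0))" using S_S[OF s0(2,1)] b y0 by simp_all
   then have "S t b - S t (y 0) = ?T (y s - y 0) + ?T (J s) - ?T (S s (y 0) - y 0)"
    unfolding ys by (simp add: S_add[OF s0(2) c(1,2)] S_diff[OF s0(2) c(1,3)] S_diff[OF s0(2) Ss c(3)])
   moreover have c': "?T (y s - y 0) \<in> carr X" "?T (J s) \<in> carr X" "?T (S s (y 0) - y 0) \<in> carr X"
    using c Ss s0(2) by (simp_all add: diff S_carr)
   ultimately have "nrm X (S t b - S t (y 0)) <= nrm X (?T (y s - y 0)) + nrm X (?T (J s)) + nrm X (?T (S s (y 0) - y 0))"
    using triangle_diff[OF add[OF c'(1,2)] c'(3)] triangle[OF c'(1,2)] by simp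
   moreover have "nrm X (?T (y s - y 0)) <= B0 * nrm X (y s - y 0)" by (rule S_bound[OF s0(2) diff[OF c(1,3)]])
   moreover have "B0 * nrm X (y s - y 0) <= B0 * (P s - P 0)" using yP[OF order_refl s0(1)] B0 by (rule mult_left_mono)
   moreover have "nrm X (?T (S s (y 0) - y 0)) <= B0 * nrm X (S s (y 0) - y 0)" by (rule S_bound[OF s0(2) diff[OF Ss c(3)]])
   moreover have "nrm X (?T (J s)) <= Q s" using Q(3)[of s] s by simp
   ultimately show "nrm X (S t b - S t (y 0)) <= F s" using Q(2) by (simp add: F_def)
  qed
  from AE_le_limit_0[OF F t this] have "nrm X (S t b - S t (y 0)) = 0" using nonneg[of "S t b - S t (y 0)"] by simp
  then show ?thesis using nrm_eq_0[OF car] by simp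
 qed
 have y0: "y 0 \<in> carr X" using y by simp
 have "((%t. nrm X (S t b - b) + nrm X (S t (y 0) - y 0)) \<longlongrightarrow> 0 + 0) (at_right 0)"
  by (intro tendsto_intros S_tends b y0)
 then have F: "((%t. nrm X (S t b - b) + nrm X (S t (y 0) - y 0)) \<longlongrightarrow> 0) (at_right 0)" by simp
 have "nrm X (b - y 0) <= nrm X (S t b - b) + nrm X (S t (y 0) - y 0)" if t: "t > 0" for t
 proof -
  have t0: "t >= 0" using t by simp
  have "b - y 0 = (S t (y 0) - y 0) - (S t b - b)" using eq[OF t] by simp
  then show ?thesis using triangle_diff[of "S t (y 0) - y 0" "S t b - b"] S_carr[OF t0] b y0 by (simp add: diff)
 qed
 then have "AE t in lebesgue. 0 < t --> t < 1 --> nrm X (b - y 0) <= nrm X (S t b - b) + nrm X (S t (y 0) - y 0)" by simp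
 from AE_le_limit_0[OF F zero_less_one this] have "nrm X (b - y 0) = 0" using nonneg[of "b - y 0"] by simp
 then have "b = y 0" using nrm_eq_0[OF diff[OF b y0]] by simp
 then show ?thesis using True S_0[OF b] duhamel_0[OF J] by simp
qed

end

section \<open>The closed loop\<close>

lemma (in zsp) Lp_0: "(%_. 0) \<in> carr (Lp_time p X)" "nrm (Lp_time p X) (%_. 0) = 0"
proof -
 have "zext {0<..} (%_. 0::'v) = (%_. 0)" by (auto simp: zext_def)
 then show "(%_. 0) \<in> carr (Lp_time p X)" "nrm (Lp_time p X) (%_. 0) = 0"
  using strongly_meas_0 nrm_0 by (simp_all add: Lp_iff Lp_nrm)
qed

lemma (in zsp) Lp_carr_AE':
 assumes "f \<in> carr (Lp_time p X)" shows "AE t in lebesgue. t > 0 --> f t \<in> carr X"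
proof -
 have "AE t in lebesgue_on {0<..}. f t \<in> carr X"
  using assms by (auto simp: Lp_time_def strongly_meas_def)
 then show ?thesis by (subst (asm) AE_restrict_space_iff) auto
qed

lemma (in bsp) AC_modulus:
 assumes p: "p >= 1" and ac: "AC p f g"
 shows "\<exists>P. (\<forall>t. continuous_on {0..t} P) \<and> (\<forall>s t. 0 <= s --> s <= t --> nrm X (f t - f s) <= P t - P s)"
proof -
 let ?h = "%r. nrm X (zext {0<..} g r)"
 have i: "integrable lebesgue (%r. indicator {0..R} r * ?h r)" for R
 proof -
  have "integrable lebesgue (%t. nrm X (if t \<in> {0..R} then zext {0<..} g t else 0))"
   using Lp_xint[OF p AC_D(2)[OF ac], of "{0..R}" R] by (simp add: xint_def lebesgue_on_UNIV_eq)
  moreover have "nrm X (if t \<in> {0..R} then zext {0<..} g t else 0) = indicator {0..R} t * ?h t" for t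
   by (simp add: nrm_0)
  ultimately show ?thesis by (simp only:)
 qed
 define P where "P t = (LINT r|lebesgue. indicator {0..t} r * ?h r)" for t
 have "continuous_on {0..t} P" for t unfolding P_def by (rule continuous_on_indefinite_integral[OF i])
 moreover have "nrm X (f t - f s) <= P t - P s" if st: "0 <= s" "s <= t" for s t
 proof -
  have "P t = (LINT r|lebesgue. indicator {0..s} r * ?h r + indicator {s<..t} r * ?h r)"
   unfolding P_def using st by (intro bochner_cong) (auto split: split_indicator)
  also have "... = P s + (LINT r|lebesgue. indicator {s<..t} r * ?h r)"
   unfolding P_def by (rule Bochner_Integration.integral_add[OF i AC_nrm_le(2)[OF p ac st]])
  finally show ?thesis using AC_nrm_le(1)[OF p ac st] by simp
 qed
 ultimately show ?thesis by blast
qed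

context mrsp begin

text \<open>The weight \<open>\<kappa>\<close> accounts for the comparison between the norm of
  \<open>Y\<close> and the norm of the second interpolation space. The window has length 1 because
  the trace inequality was cut off there.\<close>

definition energy :: "real => real => (real => 'v) => (real => 'v) => real => real" where
 "energy p \<kappa> f g r = (LINT t|lebesgue. indicator {r<..<r+1} t
   * (nrm X (zext {0<..} f t) + nrm X (zext {0<..} g t) + \<kappa> * nrm Y (zext {0<..} f t)) powr p)"

lemma energy_nonneg: "energy p \<kappa> f g r >= 0"
 unfolding energy_def by (intro integral_nonneg_AE) auto

text \<open>Windows starting at different integers are disjoint, so their energies add up to at most
  the integral over the half-line, which Minkowski's inequality bounds by the maximal-regularity
  norm.\<close>

lemma energy_bounds:
 assumes p: "p > 1" and k: "\<kappa> >= 1" and f: "mr p f g"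
 shows "(\<Sum>k=1..N. energy p \<kappa> f g (real k)) <= (\<kappa> * nrm (max_reg_sp p Y X) f) powr p"
  and "energy p \<kappa> f g r <= (\<kappa> * nrm (max_reg_sp p Y X) f) powr p"
proof -
 define a b c where "a t = nrm X (zext {0<..} f t)" and "b t = nrm X (zext {0<..} g t)" and "c t = \<kappa> * nrm Y (zext {0<..} f t)" for t
 define \<Phi> where "\<Phi> t = a t + b t + c t" for t
 have p1: "p >= 1" "p > 0" using p by auto
 have f': "f \<in> carr (Lp_time p Y)" "f \<in> carr (Lp_time p X)" "g \<in> carr (Lp_time p X)"
  using f X.AC_D(2) by (auto simp: mr_def)
 have m: "a \<in> borel_measurable lebesgue" "b \<in> borel_measurable lebesgue" "c \<in> borel_measurable lebesgue"
  unfolding a_def b_def c_def using X.Lp_nrm_measurable[OF f'(2) p1(2)] X.Lp_nrm_measurable[OF f'(3) p1(2)]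
   Y.Lp_nrm_measurable[OF f'(1) p1(2)] by auto
 have nn: "a t >= 0" "b t >= 0" "c t >= 0" "\<Phi> t >= 0" for t using X.nonneg Y.nonneg k by (auto simp: a_def b_def c_def \<Phi>_def)
 have cp: "norm (c t) powr p = \<kappa> powr p * nrm Y (zext {0<..} f t) powr p" for t
  using k Y.nonneg by (simp add: c_def abs_mult powr_mult)
 have i: "integrable lebesgue (%t. norm (a t) powr p)" "integrable lebesgue (%t. norm (b t) powr p)" "integrable lebesgue (%t. norm (c t) powr p)"
  unfolding cp using f' X.nonneg by (auto simp: X.Lp_iff Y.Lp_iff a_def b_def)
 note i1 = integrable_powr_add[OF p1(1) m(1,2) i(1,2)] and M1 = Minkowski[OF p1(1) m(1,2) i(1,2)]
 have m1: "(%t. a t + b t) \<in> borel_measurable lebesgue" using m by auto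
 note i2 = integrable_powr_add[OF p1(1) m1 m(3) i1 i(3)] and M2 = Minkowski[OF p1(1) m1 m(3) i1 i(3)]
 have i\<Phi>: "integrable lebesgue (%t. \<Phi> t powr p)" using i2 nn unfolding \<Phi>_def by simp
 define I where "I = (LINT t|lebesgue. \<Phi> t powr p)"
 have "I powr (1 / p) <= nrm (Lp_time p X) f + nrm (Lp_time p X) g + \<kappa> * nrm (Lp_time p Y) f"
 proof -
  have "(LINT t|lebesgue. norm (c t) powr p) powr (1 / p) = \<kappa> * nrm (Lp_time p Y) f"
   unfolding cp Y.Lp_nrm using k p1 by (simp add: powr_mult powr_powr)
  then show ?thesis using M1 M2 nn X.nonneg by (simp add: I_def \<Phi>_def a_def b_def X.Lp_nrm)
 qed
 also have "... <= \<kappa> * (nrm (Lp_time p X) f + nrm (Lp_time p X) g) + \<kappa> * nrm (Lp_time p Y) f"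
  using mult_right_mono[OF k, of "nrm (Lp_time p X) f + nrm (Lp_time p X) g"] X.Lp_nrm_nonneg[of p f] X.Lp_nrm_nonneg[of p g] by simp
 also have "... = \<kappa> * nrm (max_reg_sp p Y X) f" unfolding mr_max_reg(2)[OF p1(1) f] by (simp add: algebra_simps)
 finally have "(I powr (1 / p)) powr p <= (\<kappa> * nrm (max_reg_sp p Y X) f) powr p" using p1 by (intro powr_mono2) auto
 moreover have I0: "I >= 0" unfolding I_def by simp
 ultimately have I: "I <= (\<kappa> * nrm (max_reg_sp p Y X) f) powr p" using p1 by (simp add: powr_powr)
 have E: "energy p \<kappa> f g r = (LINT t|lebesgue. indicator {r<..<r+1} t * \<Phi> t powr p)" for r
  by (simp add: energy_def \<Phi>_def a_def b_def c_def)
 have iE: "integrable lebesgue (%t. indicator {r<..<r+1} t * \<Phi> t powr p)" for r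
  using integrable_mult_indicator[OF _ i\<Phi>, of "{r<..<r+1}"] by simp
 have "energy p \<kappa> f g r <= I" unfolding E I_def
  by (rule integral_mono[OF iE i\<Phi>]) (simp split: split_indicator)
 then show "energy p \<kappa> f g r <= (\<kappa> * nrm (max_reg_sp p Y X) f) powr p" using I by simp
 \<comment> \<open>Bounding by the indicator of a half-line instead of by 1 makes the induction
   work: the next window starts where this half-line ends.\<close>
 have ind: "(\<Sum>k=1..n. indicator {real k<..<real k+1} t) <= (indicator {..<real n + 1} t :: real)" for n t
  by (induction n) (auto split: split_indicator split_indicator_asm)
 have "(\<Sum>k=1..N. energy p \<kappa> f g (real k)) = (LINT t|lebesgue. (\<Sum>k=1..N. indicator {real k<..<real k+1} t * \<Phi> t powr p))"
  unfolding E by (rule Bochner_Integration.integral_sum[symmetric]) (rule iE)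
 also have "... <= I" unfolding I_def
 proof (rule integral_mono[OF Bochner_Integration.integrable_sum[OF iE] i\<Phi>])
  fix t
  have "(\<Sum>k=1..N. indicator {real k<..<real k+1} t) <= (1::real)" using ind[of t N] by (rule order_trans) (simp split: split_indicator)
  from mult_right_mono[OF this, of "\<Phi> t powr p"]
  show "(\<Sum>k=1..N. indicator {real k<..<real k+1} t * \<Phi> t powr p) <= \<Phi> t powr p" by (simp add: sum_distrib_right)
 qed
 finally show "(\<Sum>k=1..N. energy p \<kappa> f g (real k)) <= (\<kappa> * nrm (max_reg_sp p Y X) f) powr p" using I by simp
qed

end

text \<open>The state space is described by \<open>trace_V\<close>, \<open>V_carr\<close> and
  \<open>V_nonneg\<close>, which lets both admissible choices of its second factor be treated at
  once. The nonlinearity enters through \<open>G\<close>, which maps regular values into the basic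
  space, and through \<open>estimate\<close>, which provides an image under the fixed point map
  together with its Duhamel part.\<close>

locale closed_loop =
 A: mrsp X1 Y1 + B: mrsp X2 Y2 + c0 "prod_sp X1 X2" S B0
 for X1 Y1 :: "'v::complex_vector nspace" and X2 Y2 :: "'w::complex_vector nspace" and S B0 +
 fixes p \<kappa> cT C :: real and G :: "'v \<times> 'w => 'v \<times> 'w" and V :: "('v \<times> 'w) nspace"
 assumes p: "p > 1" and \<kappa>: "\<kappa> >= 1" and cT: "cT > 0" and C: "C > 0"
  and G: "z \<in> carr Y1 ==> h \<in> carr Y2 ==> G (z, h) \<in> carr (prod_sp X1 X2)"
  and V_carr: "b \<in> carr V ==> b \<in> carr (prod_sp X1 X2)" and V_nonneg: "nrm V b >= 0"
  and trace_V: "A.mr p (fst \<circ> f) g1 ==> B.mr p (snd \<circ> f) g2 ==> r >= 0 ==> f r \<in> carr V \<and>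
   nrm V (f r) <= cT * (A.energy p \<kappa> (fst \<circ> f) g1 r powr (1 / p) + B.energy p \<kappa> (snd \<circ> f) g2 r powr (1 / p))"
  and estimate: "b \<in> carr V ==> fst \<circ> f \<in> carr (max_reg_sp p Y1 X1) ==> snd \<circ> f \<in> carr (max_reg_sp p Y2 X2) ==>
   \<exists>y J. duhamel (prod_sp X1 X2) S (%\<tau>. G (f \<tau>)) J \<and> (\<forall>t\<ge>0. y t = S t b - J t)
    \<and> fst \<circ> y \<in> carr (max_reg_sp p Y1 X1) \<and> snd \<circ> y \<in> carr (max_reg_sp p Y2 X2)
    \<and> nrm (max_reg_sp p Y1 X1) (fst \<circ> y) + nrm (max_reg_sp p Y2 X2) (snd \<circ> y)
     <= C * (nrm V b + nrm (max_reg_sp p Y1 X1) (fst \<circ> f)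
       * (nrm (max_reg_sp p Y1 X1) (fst \<circ> f) + nrm (max_reg_sp p Y2 X2) (snd \<circ> f)))"
begin

abbreviation W where "W \<equiv> prod_sp X1 X2"

lemma W_carr: "w \<in> carr W \<longleftrightarrow> fst w \<in> carr X1 \<and> snd w \<in> carr X2"
 by (auto simp: prod_sp_def mem_Times_iff)

lemma W_nrm: "nrm W w = nrm X1 (fst w) + nrm X2 (snd w)"
 by (simp add: prod_sp_def split: prod.splits)

definition inX :: "(real => 'v \<times> 'w) => bool" where
 "inX f \<longleftrightarrow> fst \<circ> f \<in> carr (max_reg_sp p Y1 X1) \<and> snd \<circ> f \<in> carr (max_reg_sp p Y2 X2)"

definition Xn :: "(real => 'v \<times> 'w) => real" where
 "Xn f = nrm (max_reg_sp p Y1 X1) (fst \<circ> f) + nrm (max_reg_sp p Y2 X2) (snd \<circ> f)"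

definition mild :: "'v \<times> 'w => (real => 'v \<times> 'w) => (real => 'v \<times> 'w) => bool" where
 "mild b f y \<longleftrightarrow> (\<exists>J. duhamel W S (%\<tau>. G (f \<tau>)) J \<and> (\<forall>t\<ge>0. y t = S t b - J t))"

definition sol :: "'v \<times> 'w => (real => 'v \<times> 'w) => bool" where
 "sol b x \<longleftrightarrow> inX x \<and> mild b x x"

text \<open>Insertion of a loop at \<open>T\<close> compares values at a single instant. The
  competitors for \<open>rho\<close> are therefore absolutely continuous themselves; membership in
  \<open>inX\<close> would fix them only up to null sets.\<close>

definition reg :: "(real => 'v \<times> 'w) => bool" where
 "reg f \<longleftrightarrow> (\<exists>g1. A.mr p (fst \<circ> f) g1) \<and> (\<exists>g2. B.mr p (snd \<circ> f) g2)"

lemma p_ge_1: "p >= 1" using p by simp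

lemma reg_inX: "reg f ==> inX f"
 unfolding reg_def inX_def using A.mr_max_reg(1)[OF p_ge_1] B.mr_max_reg(1)[OF p_ge_1] by blast

lemma Xn_nonneg: "Xn f >= 0"
 unfolding Xn_def using A.max_reg_nonneg[of p "fst \<circ> f"] B.max_reg_nonneg[of p "snd \<circ> f"] by simp

lemma G_carr:
 assumes "inX f" shows "AE \<tau> in lebesgue. \<tau> > 0 --> G (f \<tau>) \<in> carr W"
proof -
 have "fst \<circ> f \<in> carr (Lp_time p Y1)" "snd \<circ> f \<in> carr (Lp_time p Y2)"
  using assms by (auto simp: inX_def max_reg_sp_def)
 from A.Y.Lp_carr_AE'[OF this(1)] B.Y.Lp_carr_AE'[OF this(2)]
 show ?thesis
 proof eventually_elim
  case (elim \<tau>)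
  then show ?case using G[of "fst (f \<tau>)" "snd (f \<tau>)"] by simp
 qed
qed

text \<open>The first factor of the product is enlarged to the full norm, which produces a quadratic
  inequality in the single quantity \<open>Xn f\<close>.\<close>

lemma estimate':
 assumes "b \<in> carr V" "inX f"
 shows "\<exists>y. mild b f y \<and> inX y \<and> Xn y <= C * (nrm V b + (Xn f)\<^sup>2)"
proof -
 let ?n1 = "nrm (max_reg_sp p Y1 X1) (fst \<circ> f)"
 obtain y where y: "mild b f y" "inX y" "Xn y <= C * (nrm V b + ?n1 * Xn f)"
  using estimate[OF assms(1), of f] assms(2) unfolding inX_def mild_def Xn_def by blast
 have "?n1 <= Xn f" unfolding Xn_def using B.max_reg_nonneg by simp
 from mult_right_mono[OF this Xn_nonneg[of f]] have "C * (nrm V b + ?n1 * Xn f) <= C * (nrm V b + (Xn f)\<^sup>2)"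
  using C by (simp add: power2_eq_square)
 then show ?thesis using y by (intro exI[of _ y]) auto
qed

text \<open>The components have absolutely continuous representatives that agree with
  \<open>y\<close> almost everywhere; the mild formula upgrades this to every \<open>t >= 0\<close>
  through \<open>mild_eq_continuous\<close>.\<close>

lemma mild_reg:
 assumes b: "b \<in> carr W" and f: "inX f" and y: "inX y" and m: "mild b f y" shows "reg y"
proof -
 obtain J where J: "duhamel W S (%\<tau>. G (f \<tau>)) J" "!!t. t >= 0 ==> y t = S t b - J t" using m by (auto simp: mild_def)
 obtain f1 g1 where 1: "A.X.AC p f1 g1" "AE t in lebesgue. t > 0 --> fst (y t) = f1 t" "(\<forall>t\<ge>0. (fst \<circ> y) t = f1 t) ==> A.mr p (fst \<circ> y) g1"
  using A.max_reg_AC[OF p_ge_1, of "fst \<circ> y"] y by (auto simp: inX_def)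
 obtain f2 g2 where 2: "B.X.AC p f2 g2" "AE t in lebesgue. t > 0 --> snd (y t) = f2 t" "(\<forall>t\<ge>0. (snd \<circ> y) t = f2 t) ==> B.mr p (snd \<circ> y) g2"
  using B.max_reg_AC[OF p_ge_1, of "snd \<circ> y"] y by (auto simp: inX_def)
 obtain P1 where P1: "!!t. continuous_on {0..t} P1" "!!s t. 0 <= s ==> s <= t ==> nrm X1 (f1 t - f1 s) <= P1 t - P1 s"
  using A.X.AC_modulus[OF p_ge_1 1(1)] by blast
 obtain P2 where P2: "!!t. continuous_on {0..t} P2" "!!s t. 0 <= s ==> s <= t ==> nrm X2 (f2 t - f2 s) <= P2 t - P2 s"
  using B.X.AC_modulus[OF p_ge_1 2(1)] by blast
 have "S t b - J t = (f1 t, f2 t)" if t: "t >= 0" for t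
 proof (rule mild_eq_continuous[OF J(1) G_carr[OF f] b, where P = "%t. P1 t + P2 t"])
  show "(f1 t, f2 t) \<in> carr W" if "t >= 0" for t
   using A.X.AC_D(1)[OF 1(1) that] B.X.AC_D(1)[OF 2(1) that] by (simp add: W_carr)
  show "continuous_on {0..t} (%t. P1 t + P2 t)" for t by (intro continuous_intros P1 P2)
  show "nrm W ((f1 t, f2 t) - (f1 s, f2 s)) <= (P1 t + P2 t) - (P1 s + P2 s)" if "0 <= s" "s <= t" for s t
   using P1(2)[OF that] P2(2)[OF that] by (simp add: W_nrm)
  show "AE t in lebesgue. t > 0 --> S t b - J t = (f1 t, f2 t)"
   using 1(2) 2(2)
  proof eventually_elim
   case (elim t)
   show ?case
   proof
    assume t: "t > 0"
    then have "y t = S t b - J t" using J(2) by simp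
    moreover have "y t = (f1 t, f2 t)" using elim t by (simp add: prod_eq_iff)
    ultimately show "S t b - J t = (f1 t, f2 t)" by simp
   qed
  qed
 qed (use t in auto)
 then have "y t = (f1 t, f2 t)" if "t >= 0" for t using J(2)[OF that] that by simp
 then show ?thesis using 1(3) 2(3) unfolding reg_def by auto
qed

lemma sol_reg: "b \<in> carr V ==> sol b x ==> reg x"
 unfolding sol_def using mild_reg V_carr by blast

lemma sol_shift:
 assumes b: "b \<in> carr V" and x: "sol b x" and r: "r >= 0"
 shows "sol (x r) (%t. x (r + 1 * t))"
proof -
 obtain J where J: "duhamel W S (%\<tau>. G (x \<tau>)) J" "!!t. t >= 0 ==> x t = S t b - J t" and X: "inX x"
  using x by (auto simp: mild_def sol_def)
 obtain g1 g2 where g: "A.mr p (fst \<circ> x) g1" "B.mr p (snd \<circ> x) g2" using sol_reg[OF b x] by (auto simp: reg_def)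
 have "reg (%t. x (r + 1 * t))"
  using A.mr_shift[OF r g(1)] B.mr_shift[OF r g(2)] unfolding reg_def o_def by blast
 moreover have "mild (x r) (%t. x (r + 1 * t)) (%t. x (r + 1 * t))" unfolding mild_def
 proof (intro exI conjI allI impI)
  show "duhamel W S (%\<tau>. G (x (r + 1 * \<tau>))) (%t. J (r + 1 * t) - S t (J r))"
   by (rule duhamel_shift[OF J(1) G_carr[OF X] r])
  fix t :: real assume t: "t >= 0"
  have c: "S r b \<in> carr W" "J r \<in> carr W" using S_carr[OF r V_carr[OF b]] duhamel_carr[OF J(1) r] by auto
  have "x (r + t) = S t (S r b) - J (r + t)" using J(2)[of "r + t"] r t S_S[OF t r V_carr[OF b]] by (simp add: add.commute)
  moreover have "S t (x r) = S t (S r b) - S t (J r)" using J(2)[OF r] S_diff[OF t c] by simp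
  ultimately show "x (r + 1 * t) = S t (x r) - (J (r + 1 * t) - S t (J r))" by simp
 qed
 ultimately show ?thesis using reg_inX by (auto simp: sol_def)
qed

section \<open>The quotient norm of an initial segment\<close>

definition Ad :: "(real => 'v \<times> 'w) => real => (real => 'v \<times> 'w) set" where
 "Ad x T = {f. reg f \<and> (\<forall>t\<in>{0..T}. f t = x t)}"

text \<open>The quotient norm of the restriction of \<open>x\<close> to \<open>[0, T]\<close>.\<close>

definition rho :: "(real => 'v \<times> 'w) => real => real" where
 "rho x T = Inf (Xn ` Ad x T)"

lemma rho_le: "f \<in> Ad x T ==> rho x T <= Xn f"
 unfolding rho_def by (rule cInf_lower) (auto intro!: bdd_belowI[of _ 0] Xn_nonneg)

lemma rho_approx:
 assumes x: "reg x" and e: "e > 0" shows "\<exists>f\<in>Ad x T. Xn f < rho x T + e"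
proof -
 have "Xn ` Ad x T ~= {}" using x by (auto simp: Ad_def)
 from cInf_lessD[OF this, of "rho x T + e"] show ?thesis using e by (auto simp: rho_def)
qed

lemma rho_mono: "reg x ==> T <= T' ==> rho x T <= rho x T'"
 unfolding rho_def[of x T'] by (rule cInf_greatest) (auto simp: Ad_def intro!: rho_le)

lemma rho_nonneg: "reg x ==> rho x T >= 0"
 unfolding rho_def by (rule cInf_greatest) (auto simp: Ad_def intro!: Xn_nonneg)

text \<open>The cost \<open>U\<close> of prolonging the agreement from \<open>T\<close> to
  \<open>T'\<close> is computed from \<open>x\<close> alone, not from the competitor
  \<open>f\<close>. It therefore survives the infimum over \<open>f\<close> and is small near every
  \<open>T0\<close> by absolute continuity of the integral.\<close>

lemma rho_step:
 assumes x: "reg x" shows "\<exists>U. (\<forall>T T'. 0 <= T --> T <= T' --> rho x T' <= rho x T + U T T')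
  \<and> (\<forall>T0\<ge>0. \<forall>e>0. \<exists>d>0. \<forall>T T'. 0 <= T --> T <= T' --> \<bar>T - T0\<bar> < d --> \<bar>T' - T0\<bar> < d --> U T T' < e)"
proof -
 obtain g1 g2 where g: "A.mr p (fst \<circ> x) g1" "B.mr p (snd \<circ> x) g2" using x by (auto simp: reg_def)
 define U where "U T T' = (A.Y.loop_cost p (fst \<circ> x) T T' + A.X.loop_cost p (fst \<circ> x) T T' + A.X.loop_cost p g1 T T')
  + (B.Y.loop_cost p (snd \<circ> x) T T' + B.X.loop_cost p (snd \<circ> x) T T' + B.X.loop_cost p g2 T T')" for T T'
 have "rho x T' - U T T' <= rho x T" if T: "0 <= T" "T <= T'" for T T'
  unfolding rho_def[of x T]
 proof (rule cInf_greatest)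
  show "Xn ` Ad x T ~= {}" using x by (auto simp: Ad_def)
  fix r assume "r \<in> Xn ` Ad x T"
  then obtain f where f: "f \<in> Ad x T" "r = Xn f" by blast
  obtain k1 k2 where k: "A.mr p (fst \<circ> f) k1" "B.mr p (snd \<circ> f) k2" using f by (auto simp: reg_def Ad_def)
  have fx: "(fst \<circ> x) T = (fst \<circ> f) T" "(snd \<circ> x) T = (snd \<circ> f) T" using f T by (auto simp: Ad_def)
  \<comment> \<open>The new path follows \<open>x\<close> up to \<open>T'\<close>, so it is
    admissible there. It then has to travel back to the point \<open>f T\<close>, where the
    remainder of \<open>f\<close> can be attached: \<open>f\<close> and \<open>x\<close> need not
    meet at \<open>T'\<close>.\<close>
  let ?h = "insert_loop T T' f x x"
  have c: "fst \<circ> ?h = insert_loop T T' (fst \<circ> f) (fst \<circ> x) (fst \<circ> x)" "snd \<circ> ?h = insert_loop T T' (snd \<circ> f) (snd \<circ> x) (snd \<circ> x)"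
   by (auto simp: fun_eq_iff insert_loop_def)
  note h1 = A.mr_insert_loop[OF p_ge_1 T k(1) g(1) fx(1)] and h2 = B.mr_insert_loop[OF p_ge_1 T k(2) g(2) fx(2)]
  have "reg ?h" unfolding reg_def c using h1(1) h2(1) by blast
  then have "?h \<in> Ad x T'" using f T by (auto simp: Ad_def insert_loop_def)
  then have "rho x T' <= Xn ?h" by (rule rho_le)
  also have "... <= Xn f + U T T'" using h1(2) h2(2) unfolding Xn_def c U_def by linarith
  finally show "rho x T' - U T T' <= r" using f by simp
 qed
 then have "rho x T' <= rho x T + U T T'" if "0 <= T" "T <= T'" for T T' using that by (simp add: diff_le_eq)
 moreover have "\<exists>d>0. \<forall>T T'. 0 <= T --> T <= T' --> \<bar>T - T0\<bar> < d --> \<bar>T' - T0\<bar> < d --> U T T' < e" if T0: "T0 >= 0" and e: "e > 0" for T0 e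
 proof -
  have L: "fst \<circ> x \<in> carr (Lp_time p Y1)" "fst \<circ> x \<in> carr (Lp_time p X1)" "g1 \<in> carr (Lp_time p X1)"
   "snd \<circ> x \<in> carr (Lp_time p Y2)" "snd \<circ> x \<in> carr (Lp_time p X2)" "g2 \<in> carr (Lp_time p X2)"
   using g A.X.AC_D(2) B.X.AC_D(2) by (auto simp: A.mr_def B.mr_def)
  have e6: "e / 6 > 0" using e by simp
  note Ls = A.Y.loop_cost_small[OF p_ge_1 L(1) T0 e6] A.X.loop_cost_small[OF p_ge_1 L(2) T0 e6] A.X.loop_cost_small[OF p_ge_1 L(3) T0 e6]
   B.Y.loop_cost_small[OF p_ge_1 L(4) T0 e6] B.X.loop_cost_small[OF p_ge_1 L(5) T0 e6] B.X.loop_cost_small[OF p_ge_1 L(6) T0 e6]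
  obtain d1 where d1: "d1 > 0" "!!T T'. 0 <= T ==> T <= T' ==> \<bar>T - T0\<bar> < d1 ==> \<bar>T' - T0\<bar> < d1 ==> A.Y.loop_cost p (fst \<circ> x) T T' < e / 6" using Ls(1) by blast
  obtain d2 where d2: "d2 > 0" "!!T T'. 0 <= T ==> T <= T' ==> \<bar>T - T0\<bar> < d2 ==> \<bar>T' - T0\<bar> < d2 ==> A.X.loop_cost p (fst \<circ> x) T T' < e / 6" using Ls(2) by blast
  obtain d3 where d3: "d3 > 0" "!!T T'. 0 <= T ==> T <= T' ==> \<bar>T - T0\<bar> < d3 ==> \<bar>T' - T0\<bar> < d3 ==> A.X.loop_cost p g1 T T' < e / 6" using Ls(3) by blast
  obtain d4 where d4: "d4 > 0" "!!T T'. 0 <= T ==> T <= T' ==> \<bar>T - T0\<bar> < d4 ==> \<bar>T' - T0\<bar> < d4 ==> B.Y.loop_cost p (snd \<circ> x) T T' < e / 6" using Ls(4) by blast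
  obtain d5 where d5: "d5 > 0" "!!T T'. 0 <= T ==> T <= T' ==> \<bar>T - T0\<bar> < d5 ==> \<bar>T' - T0\<bar> < d5 ==> B.X.loop_cost p (snd \<circ> x) T T' < e / 6" using Ls(5) by blast
  obtain d6 where d6: "d6 > 0" "!!T T'. 0 <= T ==> T <= T' ==> \<bar>T - T0\<bar> < d6 ==> \<bar>T' - T0\<bar> < d6 ==> B.X.loop_cost p g2 T T' < e / 6" using Ls(6) by blast
  let ?d = "min d1 (min d2 (min d3 (min d4 (min d5 d6))))"
  show ?thesis
  proof (intro exI[of _ ?d] conjI allI impI)
   fix T T' assume T: "0 <= T" "T <= T'" "\<bar>T - T0\<bar> < ?d" "\<bar>T' - T0\<bar> < ?d"
   have a: "\<bar>T - T0\<bar> < d1" "\<bar>T - T0\<bar> < d2" "\<bar>T - T0\<bar> < d3" "\<bar>T - T0\<bar> < d4" "\<bar>T - T0\<bar> < d5" "\<bar>T - T0\<bar> < d6"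
    "\<bar>T' - T0\<bar> < d1" "\<bar>T' - T0\<bar> < d2" "\<bar>T' - T0\<bar> < d3" "\<bar>T' - T0\<bar> < d4" "\<bar>T' - T0\<bar> < d5" "\<bar>T' - T0\<bar> < d6"
    using T(3,4) by (simp_all only: min_less_iff_conj)
   show "U T T' < e"
    using d1(2)[OF T(1,2) a(1,7)] d2(2)[OF T(1,2) a(2,8)] d3(2)[OF T(1,2) a(3,9)] d4(2)[OF T(1,2) a(4,10)]
     d5(2)[OF T(1,2) a(5,11)] d6(2)[OF T(1,2) a(6,12)]
    unfolding U_def by linarith
  qed (use d1 d2 d3 d4 d5 d6 in simp)
 qed
 ultimately show ?thesis by (intro exI[of _ U]) blast
qed

lemma rho_continuous: assumes x: "reg x" shows "continuous_on {0..} (rho x)"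
proof -
 obtain U where U': "(\<forall>T T'. 0 <= T --> T <= T' --> rho x T' <= rho x T + U T T')
  \<and> (\<forall>T0\<ge>0. \<forall>e>0. \<exists>d>0. \<forall>T T'. 0 <= T --> T <= T' --> \<bar>T - T0\<bar> < d --> \<bar>T' - T0\<bar> < d --> U T T' < e)"
  using rho_step[OF x] ..
 note U = U'[THEN conjunct1, rule_format] U'[THEN conjunct2, rule_format]
 show ?thesis unfolding continuous_on_iff
 proof (intro ballI allI impI)
  fix T0 e :: real assume T0: "T0 \<in> {0..}" and e: "e > 0"
  then obtain d where d: "d > 0" "!!T T'. 0 <= T ==> T <= T' ==> \<bar>T - T0\<bar> < d ==> \<bar>T' - T0\<bar> < d ==> U T T' < e"
   using U(2)[of T0 e] by (metis atLeast_iff)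
  have "dist (rho x T) (rho x T0) < e" if T: "T \<in> {0..}" "dist T T0 < d" for T
  proof (cases "T <= T0")
   case True
   then show ?thesis using U(1)[of T T0] d(2)[of T T0] d(1) rho_mono[OF x True] T by (simp add: dist_real_def)
  next
   case False
   then have le: "T0 <= T" by simp
   then show ?thesis using U(1)[of T0 T] d(2)[of T0 T] d(1) rho_mono[OF x le] T T0 by (simp add: dist_real_def)
  qed
  then show "\<exists>d>0. \<forall>T\<in>{0..}. dist T T0 < d --> dist (rho x T) (rho x T0) < e" using d(1) by blast
 qed
qed

text \<open>Causality: if \<open>f\<close> agrees with \<open>x\<close> on \<open>[0, T]\<close>,
  the Duhamel integrals of \<open>f\<close> and \<open>x\<close> coincide up to \<open>T\<close>.
  The image \<open>y\<close> of \<open>f\<close> then agrees with \<open>x\<close> there as well and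
  competes in the infimum.\<close>

lemma rho_estimate:
 assumes b: "b \<in> carr V" and x: "sol b x" and T: "T >= 0"
 shows "rho x T <= C * (nrm V b + (rho x T)\<^sup>2)"
proof -
 note rx = sol_reg[OF b x]
 obtain J where J: "duhamel W S (%\<tau>. G (x \<tau>)) J" "!!t. t >= 0 ==> x t = S t b - J t"
  using x by (auto simp: mild_def sol_def)
 have step: "rho x T <= C * (nrm V b + (Xn f)\<^sup>2)" if f: "f \<in> Ad x T" for f
 proof -
  have rf: "reg f" using f by (simp add: Ad_def)
  obtain y where y: "mild b f y" "inX y" "Xn y <= C * (nrm V b + (Xn f)\<^sup>2)" using estimate'[OF b reg_inX[OF rf]] by blast
  obtain J' where J': "duhamel W S (%\<tau>. G (f \<tau>)) J'" "!!t. t >= 0 ==> y t = S t b - J' t"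
   using y(1) by (auto simp: mild_def)
  have "J' t = J t" if t: "t \<in> {0..T}" for t
  proof -
   have m: "{0..t} \<in> sets (lebesgue :: real measure)" by simp
   have "has_bint W {0..t} (%\<tau>. S (t - \<tau>) (G (f \<tau>))) (J' t)" using J'(1) t by (simp add: duhamel_def)
   then have "has_bint W {0..t} (%\<tau>. S (t - \<tau>) (G (x \<tau>))) (J' t)"
    by (rule has_bint_AE_cong[OF m]) (use f t in \<open>auto simp: Ad_def AE_restrict_space_iff\<close>)
   moreover have "has_bint W {0..t} (%\<tau>. S (t - \<tau>) (G (x \<tau>))) (J t)" using J(1) t by (simp add: duhamel_def)
   ultimately show ?thesis by (rule has_bint_unique[OF m])
  qed
  then have "y \<in> Ad x T" using mild_reg[OF V_carr[OF b] reg_inX[OF rf] y(2,1)] J(2) J'(2) by (simp add: Ad_def)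
  then show ?thesis using rho_le[of y x T] y(3) by simp
 qed
 \<comment> \<open>The infimum need not be attained, so an excess \<open>e\<close> is carried along
   and sent to 0 at the end.\<close>
 have ev: "rho x T <= C * (nrm V b + (rho x T + e)\<^sup>2)" if e: "e > 0" for e
 proof -
  obtain f where f: "f \<in> Ad x T" "Xn f < rho x T + e" using rho_approx[OF rx e] by blast
  have "(Xn f)\<^sup>2 <= (rho x T + e)\<^sup>2" using f(2) Xn_nonneg[of f] by (intro power_mono) auto
  then show ?thesis using step[OF f(1)] C by (smt (verit) mult_left_mono)
 qed
 have "((%e. C * (nrm V b + (rho x T + e)\<^sup>2)) \<longlongrightarrow> C * (nrm V b + (rho x T + 0)\<^sup>2)) (at_right 0)"
  by (intro tendsto_intros)
 then have lim: "((%e. C * (nrm V b + (rho x T + e)\<^sup>2)) \<longlongrightarrow> C * (nrm V b + (rho x T)\<^sup>2)) (at_right 0)" by simp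
 show ?thesis
  by (rule tendsto_lowerbound[OF lim]) (use ev in \<open>auto simp: eventually_at_right_field intro: exI[of _ 1]\<close>)
qed

text \<open>At \<open>T = 0\<close> agreement with \<open>x\<close> concerns the value
  \<open>b\<close> only. The image of the zero function has this value, and its estimate contains no
  quadratic term.\<close>

lemma rho_0:
 assumes b: "b \<in> carr V" and x: "sol b x" shows "rho x 0 <= C * nrm V b"
proof -
 let ?z = "%_::real. (0, 0) :: 'v \<times> 'w"
 have c: "fst \<circ> ?z = (%_. 0)" "snd \<circ> ?z = (%_. 0)" by auto
 have "A.mr p (%_. 0) (%_. 0)" "B.mr p (%_. 0) (%_. 0)"
  using A.X.Lp_0[of p] A.Y.Lp_0[of p] B.X.Lp_0[of p] B.Y.Lp_0[of p]
  by (auto simp: A.mr_def B.mr_def A.X.AC_def B.X.AC_def A.X.zero B.X.zero zext_def A.X.dual_0 B.X.dual_0)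
 note m = this
 have rz: "reg ?z" using m unfolding reg_def c by blast
 have nz: "Xn ?z = 0" unfolding Xn_def c A.mr_max_reg(2)[OF p_ge_1 m(1)] B.mr_max_reg(2)[OF p_ge_1 m(2)]
  using A.X.Lp_0[of p] A.Y.Lp_0[of p] B.X.Lp_0[of p] B.Y.Lp_0[of p] by simp
 obtain y where y: "mild b ?z y" "inX y" "Xn y <= C * (nrm V b + (Xn ?z)\<^sup>2)" using estimate'[OF b reg_inX[OF rz]] by blast
 have "x 0 = b" "y 0 = b"
  using x y(1) S_0[OF V_carr[OF b]] duhamel_0 unfolding sol_def mild_def by fastforce+
 then have "y \<in> Ad x 0" using mild_reg[OF V_carr[OF b] reg_inX[OF rz] y(2,1)] by (simp add: Ad_def)
 then show ?thesis using rho_le[of y x 0] y(3) nz by simp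
qed

text \<open>The quadratic inequality of \<open>rho_estimate\<close> excludes the value \<open>1 / (2 C)\<close>, so by continuity \<open>rho\<close>
 stays on its lower branch.\<close>

lemma rho_bound:
 assumes b: "b \<in> carr V" and x: "sol b x" and small: "4 * C\<^sup>2 * nrm V b < 1" and T: "T >= 0"
 shows "rho x T <= 2 * C * nrm V b"
proof -
 note rx = sol_reg[OF b x]
 define \<beta> where "\<beta> = nrm V b"
 have \<beta>: "\<beta> >= 0" "4 * C * (C * \<beta>) < 1" using V_nonneg small by (auto simp: \<beta>_def power2_eq_square mult.assoc)
 have C\<beta>: "C * \<beta> < 1 / (4 * C)" using \<beta> C by (simp add: field_simps)
 \<comment> \<open>The two roots of \<open>\<rho> = C * (\<beta> + \<rho>^2)\<close> meet at
   \<open>1 / (2 * C)\<close> when \<open>\<beta>\<close> reaches \<open>1 / (4 * C^2)\<close>; this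
   is the origin of the threshold for the data. Below it the inequality at this value would say
   \<open>1 / (2 * C) <= C * \<beta> + 1 / (4 * C)\<close>, which is false.\<close>
 have half: "rho x T' ~= 1 / (2 * C)" if "T' >= 0" for T'
 proof
  assume eq: "rho x T' = 1 / (2 * C)"
  have "1 / (2 * C) <= C * (\<beta> + (1 / (2 * C))\<^sup>2)" using rho_estimate[OF b x that] unfolding eq \<beta>_def .
  also have "... = C * \<beta> + 1 / (4 * C)" using C by (simp add: field_simps power2_eq_square)
  finally show False using C\<beta> C by (simp add: field_simps)
 qed
 have lt: "rho x T < 1 / (2 * C)"
 proof (rule ccontr)
  assume "\<not> rho x T < 1 / (2 * C)"
  moreover have "rho x 0 <= 1 / (2 * C)"
  proof -
   have "rho x 0 <= 1 / (4 * C)" using rho_0[OF b x] C\<beta> by (simp add: \<beta>_def)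
   also have "... <= 1 / (2 * C)" using C by (intro divide_left_mono) auto
   finally show ?thesis .
  qed
  moreover have "continuous_on {0..T} (rho x)" using rho_continuous[OF rx] by (rule continuous_on_subset) auto
  ultimately obtain T' where "0 <= T'" "rho x T' = 1 / (2 * C)" using IVT'[of "rho x" 0 "1 / (2 * C)" T] T by auto
  then show False using half by blast
 qed
 \<comment> \<open>On the lower branch half of \<open>rho\<close> absorbs the quadratic term; hence
   the factor 2 in the conclusion.\<close>
 have "C * (rho x T)\<^sup>2 <= rho x T / 2"
 proof -
  have "C * rho x T <= 1 / 2" using lt C by (simp add: field_simps)
  from mult_right_mono[OF this rho_nonneg[OF rx]] show ?thesis by (simp add: power2_eq_square mult.assoc)
 qed
 moreover have "rho x T <= C * \<beta> + C * (rho x T)\<^sup>2" using rho_estimate[OF b x T] by (simp add: \<beta>_def algebra_simps)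
 ultimately show ?thesis by (simp add: \<beta>_def)
qed

end

section \<open>From the quotient norm to exponential decay\<close>

lemma le_mult_of_le_mult_add_epsilon:
 fixes a c d :: real
 assumes le: "!!e. e > 0 ==> a <= c * (d + e)" and c: "c >= 0" shows "a <= c * d"
proof (rule field_le_epsilon)
 fix e :: real assume e: "e > 0"
 then have "a <= c * (d + e / (c + 1))" using le[of "e / (c + 1)"] c by simp
 also have "... = c * d + e * (c / (c + 1))" using c by (simp add: field_simps)
 also have "... <= c * d + e * 1" using c e by (intro add_left_mono mult_left_mono) auto
 finally show "a <= c * d + e" by simp
qed

context closed_loop begin

text \<open>The energies of the \<open>N\<close> windows add up to at most \<open>2 * Z\<close>, so
  one of them is at most \<open>2 * Z / real N\<close>. The values of \<open>x\<close> are estimated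
  through the extension \<open>f\<close>: a trace at a time close to \<open>T\<close> uses energy
  from beyond \<open>T\<close>, which is available since \<open>f\<close> lives on the
  half-line.\<close>

lemma window_bounds:
 assumes f: "f \<in> Ad x T" and N: "N >= 1" "real N <= T"
 shows "!!t. t \<in> {0..T} ==> x t \<in> carr V \<and> nrm V (x t) <= cT * \<kappa> * Xn f"
  and "\<exists>k\<in>{1..N}. nrm V (x (real k)) <= cT * (2 * (2 / real N) powr (1 / p) * \<kappa>) * Xn f"
proof -
 obtain g1 g2 where g: "A.mr p (fst \<circ> f) g1" "B.mr p (snd \<circ> f) g2" using f by (auto simp: Ad_def reg_def)
 define n1 n2 where "n1 = nrm (max_reg_sp p Y1 X1) (fst \<circ> f)" and "n2 = nrm (max_reg_sp p Y2 X2) (snd \<circ> f)"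
 define E1 E2 where "E1 r = A.energy p \<kappa> (fst \<circ> f) g1 r" and "E2 r = B.energy p \<kappa> (snd \<circ> f) g2 r" for r
 have n: "n1 >= 0" "n2 >= 0" "Xn f = n1 + n2" using A.max_reg_nonneg B.max_reg_nonneg by (auto simp: n1_def n2_def Xn_def)
 have E0: "E1 r >= 0" "E2 r >= 0" for r using A.energy_nonneg B.energy_nonneg by (auto simp: E1_def E2_def)
 have T: "x r \<in> carr V" "nrm V (x r) <= cT * (E1 r powr (1 / p) + E2 r powr (1 / p))" if "r \<in> {0..T}" for r
  using trace_V[OF g, of r] f that by (auto simp: Ad_def E1_def E2_def)
 have root: "y powr (1 / p) <= z" if "0 <= y" "y <= z powr p" "0 <= z" for y z
 proof -
  have "y powr (1 / p) <= (z powr p) powr (1 / p)" using that p by (intro powr_mono2) auto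
  then show ?thesis using that p by (simp add: powr_powr)
 qed
 show "x t \<in> carr V \<and> nrm V (x t) <= cT * \<kappa> * Xn f" if t: "t \<in> {0..T}" for t
 proof
  have "E1 t powr (1 / p) <= \<kappa> * n1" "E2 t powr (1 / p) <= \<kappa> * n2"
   using root[OF E0(1) A.energy_bounds(2)[OF p \<kappa> g(1), of t, folded E1_def n1_def]]
    root[OF E0(2) B.energy_bounds(2)[OF p \<kappa> g(2), of t, folded E2_def n2_def]] n \<kappa> by auto
  then have "cT * (E1 t powr (1 / p) + E2 t powr (1 / p)) <= cT * (\<kappa> * n1 + \<kappa> * n2)"
   using cT by (intro mult_left_mono add_mono) auto
  then show "nrm V (x t) <= cT * \<kappa> * Xn f" using T(2)[OF t] by (simp add: n(3) algebra_simps)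
 qed (rule T(1)[OF t])
 define Z where "Z = (\<kappa> * Xn f) powr p"
 have "(\<Sum>k=1..N. E1 (real k) + E2 (real k)) <= (\<kappa> * n1) powr p + (\<kappa> * n2) powr p"
  using A.energy_bounds(1)[OF p \<kappa> g(1), of N] B.energy_bounds(1)[OF p \<kappa> g(2), of N]
  by (simp add: sum.distrib E1_def E2_def n1_def n2_def)
 also have "... <= Z + Z" unfolding Z_def using n \<kappa> p by (intro add_mono powr_mono2 mult_left_mono) auto
 finally have sum: "(\<Sum>k=1..N. E1 (real k) + E2 (real k)) <= 2 * Z" by simp
 have "\<exists>k\<in>{1..N}. E1 (real k) + E2 (real k) <= 2 * Z / real N"
 proof (rule ccontr)
  assume "\<not> ?thesis"
  then have "(\<Sum>k=1..N. 2 * Z / real N) < (\<Sum>k=1..N. E1 (real k) + E2 (real k))"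
   using N by (intro sum_strict_mono) (auto simp: not_le)
  then show False using sum N by simp
 qed
 then obtain k where k: "k \<in> {1..N}" "E1 (real k) + E2 (real k) <= 2 * Z / real N" by blast
 \<comment> \<open>Chosen such that \<open>\<delta> powr p\<close> equals
   \<open>2 * Z / real N\<close>. The additional factor 2 in the claim comes from adding the two
   components.\<close>
 define \<delta> where "\<delta> = (2 / real N) powr (1 / p) * \<kappa> * Xn f"
 have Xk: "\<kappa> * Xn f >= 0" using \<kappa> Xn_nonneg[of f] by simp
 have "\<delta> powr p = 2 / real N * Z" unfolding \<delta>_def Z_def using p N Xk
  by (simp add: mult.assoc powr_mult powr_powr)
 then have E: "E1 (real k) <= \<delta> powr p" "E2 (real k) <= \<delta> powr p" using k(2) E0(1)[of "real k"] E0(2)[of "real k"] by auto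
 have \<delta>: "\<delta> >= 0" unfolding \<delta>_def using \<kappa> Xn_nonneg[of f] by (intro mult_nonneg_nonneg) auto
 have "E1 (real k) powr (1 / p) + E2 (real k) powr (1 / p) <= \<delta> + \<delta>"
  using root[OF E0(1) E(1) \<delta>] root[OF E0(2) E(2) \<delta>] by (rule add_mono)
 from mult_left_mono[OF this, of cT] have "cT * (E1 (real k) powr (1 / p) + E2 (real k) powr (1 / p)) <= cT * (\<delta> + \<delta>)"
  using cT by simp
 moreover have "real k \<in> {0..T}" using k(1) N by auto
 ultimately have "nrm V (x (real k)) <= cT * (\<delta> + \<delta>)" using T(2) order_trans by blast
 then show "\<exists>k\<in>{1..N}. nrm V (x (real k)) <= cT * (2 * (2 / real N) powr (1 / p) * \<kappa>) * Xn f"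
  using k(1) by (intro bexI[of _ k]) (auto simp: \<delta>_def algebra_simps)
qed

lemma sol_window:
 shows "\<exists>N M. N >= 1 \<and> M >= 0 \<and> (\<forall>b x. b \<in> carr V --> 4 * C\<^sup>2 * nrm V b < 1 --> sol b x -->
  (\<forall>t\<in>{0..real N}. x t \<in> carr V \<and> nrm V (x t) <= M * nrm V b) \<and> (\<exists>k\<in>{1..N}. nrm V (x (real k)) <= nrm V b / 2))"
proof -
 \<comment> \<open>Chosen to make \<open>4 * cT * \<kappa> * C * \<delta>\<close> equal to
   \<open>1 / 2\<close>; the 4 collects the factor 2 of \<open>window_bounds\<close> and the factor
   2 of \<open>rho_bound\<close>.\<close>
 define \<delta> where "\<delta> = 1 / (8 * cT * \<kappa> * C)"
 have \<delta>: "\<delta> > 0" using cT \<kappa> C by (simp add: \<delta>_def)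
 obtain N0 :: nat where N0: "2 / \<delta> powr p <= real N0" using real_arch_simple by blast
 define N where "N = max 1 N0"
 have N: "N >= 1" "2 / \<delta> powr p <= real N" using N0 by (auto simp: N_def)
 have "2 / real N <= \<delta> powr p" using N \<delta> by (simp add: field_simps)
 then have "(2 / real N) powr (1 / p) <= (\<delta> powr p) powr (1 / p)" using p by (intro powr_mono2) auto
 then have Nd: "(2 / real N) powr (1 / p) <= \<delta>" using \<delta> p by (simp add: powr_powr)
 let ?c = "cT * (2 * (2 / real N) powr (1 / p) * \<kappa>)"
 have c0: "?c >= 0" using cT \<kappa> by simp
 have c: "?c * (2 * C) <= 1 / 2"
 proof -
  have "?c * (2 * C) = (4 * cT * \<kappa> * C) * (2 / real N) powr (1 / p)" by simp
  also have "... <= (4 * cT * \<kappa> * C) * \<delta>" using Nd cT \<kappa> C by (intro mult_left_mono) auto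
  also have "... = 1 / 2" using cT \<kappa> C by (simp add: \<delta>_def)
  finally show ?thesis .
 qed
 have "(\<forall>t\<in>{0..real N}. x t \<in> carr V \<and> nrm V (x t) <= cT * \<kappa> * (2 * C) * nrm V b) \<and> (\<exists>k\<in>{1..N}. nrm V (x (real k)) <= nrm V b / 2)"
  if b: "b \<in> carr V" and small: "4 * C\<^sup>2 * nrm V b < 1" and x: "sol b x" for b x
 proof -
  note rx = sol_reg[OF b x]
  have rho: "rho x (real N) <= 2 * C * nrm V b" by (rule rho_bound[OF b x small]) simp
  have ex: "\<exists>f\<in>Ad x (real N). Xn f <= 2 * C * nrm V b + e" if "e > 0" for e
   using rho_approx[OF rx that, of "real N"] rho by force
  have 1: "x t \<in> carr V \<and> nrm V (x t) <= cT * \<kappa> * (2 * C * nrm V b)" if t: "t \<in> {0..real N}" for t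
  proof
   show "x t \<in> carr V" using ex[of 1] window_bounds(1)[OF _ N(1) order_refl t] by auto
   show "nrm V (x t) <= cT * \<kappa> * (2 * C * nrm V b)"
   proof (rule le_mult_of_le_mult_add_epsilon)
    fix e :: real assume "e > 0"
    then obtain f where f: "f \<in> Ad x (real N)" "Xn f <= 2 * C * nrm V b + e" using ex by blast
    have "nrm V (x t) <= cT * \<kappa> * Xn f" using window_bounds(1)[OF f(1) N(1) order_refl t] by blast
    also have "... <= cT * \<kappa> * (2 * C * nrm V b + e)" using f(2) cT \<kappa> by (intro mult_left_mono) auto
    finally show "nrm V (x t) <= cT * \<kappa> * (2 * C * nrm V b + e)" .
   qed (use cT \<kappa> in simp)
  qed
  \<comment> \<open>The index delivered by \<open>window_bounds\<close> depends on the extension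
    \<open>f\<close> and so on \<open>e\<close>; the minimum over the finitely many candidates does
    not, which permits \<open>e\<close> to tend to 0.\<close>
  define m where "m = Min ((%k. nrm V (x (real k))) ` {1..N})"
  have ne: "(%k. nrm V (x (real k))) ` {1..N} ~= {}" using N by auto
  have "m <= ?c * (2 * C * nrm V b)"
  proof (rule le_mult_of_le_mult_add_epsilon[OF _ c0])
   fix e :: real assume "e > 0"
   then obtain f where f: "f \<in> Ad x (real N)" "Xn f <= 2 * C * nrm V b + e" using ex by blast
   obtain k where k: "k \<in> {1..N}" "nrm V (x (real k)) <= ?c * Xn f" using window_bounds(2)[OF f(1) N(1) order_refl] by blast
   have "m <= nrm V (x (real k))" unfolding m_def using k(1) by (intro Min_le) auto
   also note k(2)
   also have "?c * Xn f <= ?c * (2 * C * nrm V b + e)" by (rule mult_left_mono[OF f(2) c0])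
   finally show "m <= ?c * (2 * C * nrm V b + e)" .
  qed
  also have "... = ?c * (2 * C) * nrm V b" by simp
  also have "... <= 1 / 2 * nrm V b" by (rule mult_right_mono[OF c V_nonneg])
  finally have "m <= nrm V b / 2" by simp
  moreover have "m \<in> (%k. nrm V (x (real k))) ` {1..N}" unfolding m_def by (rule Min_in[OF _ ne]) simp
  ultimately show ?thesis using 1 by (auto simp: mult.assoc)
 qed
 then show ?thesis using N cT \<kappa> C by (intro exI[of _ N] exI[of _ "cT * \<kappa> * (2 * C)"]) auto
qed

lemma sol_decay:
 assumes r: "r <= 1 / (4 * C\<^sup>2)"
 shows "\<exists>\<gamma>>0. \<exists>M>0. \<forall>b\<in>carr V. nrm V b < r --> (\<forall>x. sol b x -->
  (\<forall>t\<ge>0. x t \<in> carr V \<and> nrm V (x t) <= M * exp (- \<gamma> * t) * nrm V b))"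
proof -
 obtain N M where N: "N >= 1" and M: "M >= 0" and NM: "!!b x. b \<in> carr V ==> 4 * C\<^sup>2 * nrm V b < 1 ==> sol b x ==>
  (\<forall>t\<in>{0..real N}. x t \<in> carr V \<and> nrm V (x t) <= M * nrm V b) \<and> (\<exists>k\<in>{1..N}. nrm V (x (real k)) <= nrm V b / 2)"
  using sol_window by metis
 \<comment> \<open>At most \<open>N\<close> units of time pass between two halvings, and this
   determines the rate.\<close>
 define \<gamma> where "\<gamma> = ln 2 / real N"
 have \<gamma>: "\<gamma> > 0" "\<gamma> * real N = ln 2" using N by (auto simp: \<gamma>_def)
 have small: "4 * C\<^sup>2 * nrm V b < 1" if "nrm V b < r" for b
 proof -
  have "nrm V b < 1 / (4 * C\<^sup>2)" using that r by simp
  then show ?thesis using C by (simp add: field_simps)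
 qed
 \<comment> \<open>Induction on an integer above \<open>t\<close>: the restart time \<open>k\<close>
   is at least 1, so the remaining time falls below the preceding integer, and the halved value
   stays below \<open>r\<close>, so the smallness condition is inherited. The factor 2 pays for the
   last, incomplete window.\<close>
 have main: "x t \<in> carr V \<and> nrm V (x t) <= 2 * M * exp (- \<gamma> * t) * nrm V b"
  if "b \<in> carr V" "nrm V b < r" "sol b x" "0 <= t" "t <= real n" for b x t n
  using that
 proof (induction n arbitrary: b x t)
  case (Suc n)
  note W = NM[OF Suc.prems(1) small[OF Suc.prems(2)] Suc.prems(3)]
  show ?case
  proof (cases "t <= real N")
   case True
   then have t: "x t \<in> carr V" "nrm V (x t) <= M * nrm V b" using W Suc.prems(4) by auto
   have "\<gamma> * t <= ln 2" using True \<gamma> mult_left_mono[of t "real N" \<gamma>] by simp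
   then have "exp (\<gamma> * t) <= 2" using exp_le_cancel_iff[of "\<gamma> * t" "ln 2"] by simp
   then have "1 <= 2 * exp (- \<gamma> * t)" by (simp add: exp_minus field_simps)
   from mult_left_mono[OF this, of "M * nrm V b"] have "M * nrm V b <= 2 * M * exp (- \<gamma> * t) * nrm V b"
    using M V_nonneg by (simp add: mult_ac)
   then show ?thesis using t by simp
  next
   case False
   obtain k where k: "k \<in> {1..N}" "nrm V (x (real k)) <= nrm V b / 2" using W by blast
   have xk: "x (real k) \<in> carr V" using W k(1) by auto
   have small': "nrm V (x (real k)) < r" using k(2) Suc.prems(2) V_nonneg[of b] by simp
   have t: "0 <= t - real k" "t - real k <= real n" using k(1) False Suc.prems(5) by auto
   have s: "sol (x (real k)) (%t. x (real k + 1 * t))" by (rule sol_shift[OF Suc.prems(1,3)]) simp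
   have IH: "x t \<in> carr V" "nrm V (x t) <= 2 * M * exp (- \<gamma> * (t - real k)) * nrm V (x (real k))"
    using Suc.IH[OF xk small' s t] by auto
   have "\<gamma> * real k <= ln 2" using k(1) \<gamma> mult_left_mono[of "real k" "real N" \<gamma>] by simp
   then have e: "exp (\<gamma> * real k) <= 2" using exp_le_cancel_iff[of "\<gamma> * real k" "ln 2"] by simp
   have "exp (- \<gamma> * (t - real k)) = exp (- \<gamma> * t) * exp (\<gamma> * real k)" by (simp add: exp_add[symmetric] algebra_simps)
   also have "... <= exp (- \<gamma> * t) * 2" using e by simp
   finally have "2 * M * exp (- \<gamma> * (t - real k)) * nrm V (x (real k)) <= 2 * M * (exp (- \<gamma> * t) * 2) * (nrm V b / 2)"
    using k(2) M V_nonneg by (intro mult_mono mult_left_mono) auto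
   also have "... = 2 * M * exp (- \<gamma> * t) * nrm V b" by simp
   finally show ?thesis using IH order_trans by blast
  qed
 next
  case 0
  then have "x t \<in> carr V \<and> nrm V (x t) <= M * nrm V b" using NM[OF 0(1) small[OF 0(2)] 0(3)] by auto
  moreover have "t = 0" using 0 by simp
  moreover have "0 <= M * nrm V b" using M V_nonneg[of b] by simp
  ultimately show ?case by simp
 qed
 \<comment> \<open>\<open>M\<close> may be 0, so \<open>2 * M + 1\<close> provides a positive
   constant.\<close>
 show ?thesis
 proof (rule exI[of _ \<gamma>], intro exI[of _ "2 * M + 1"] conjI ballI impI allI)
  fix b x t assume H: "b \<in> carr V" "nrm V b < r" "sol b x" "0 <= (t::real)"
  obtain n where n: "t <= real n" using real_arch_simple by blast
  note m = main[OF H n]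
  then show "x t \<in> carr V" by blast
  have "2 * M * exp (- \<gamma> * t) * nrm V b <= (2 * M + 1) * exp (- \<gamma> * t) * nrm V b"
   using V_nonneg by (intro mult_right_mono) auto
  then show "nrm V (x t) <= (2 * M + 1) * exp (- \<gamma> * t) * nrm V b" by (rule order_trans[OF m[THEN conjunct2]])
 qed (use \<gamma> M in auto)
qed

end

section \<open>The Boussinesq system\<close>

text \<open>The majorant \<open>c\<close> of \<open>trace\<close> is taken to be a multiple of the
  norm of \<open>Y\<close>, which turns the integral there into the energy.\<close>

lemma (in mrsp) trace_energy:
 assumes p: "p > 1" and \<kappa>: "\<kappa> >= 1" and f: "mr p f g" and r: "r >= 0"
  and X': "!!x. nrm X' x >= 0" "carr X \<subseteq> carr X'" "!!x. x \<in> carr X ==> nrm X' x = nrm X x"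
  and Z: "!!x. nrm Z x >= 0" "0 \<in> carr Z" "nrm Z 0 = 0"
  and YZ: "!!x. x \<in> carr Y ==> x \<in> carr Z \<and> nrm Z x <= \<kappa> * nrm Y x"
 shows "f r \<in> carr (interp_sp (1 - 1 / p) p X' Z)"
  and "nrm (interp_sp (1 - 1 / p) p X' Z) (f r) <= (((p - 1) / p) powr (- p)) powr (1 / p) * energy p \<kappa> f g r powr (1 / p)"
  and "nrm X (f r) <= energy p \<kappa> f g r powr (1 / p)"
proof -
 have f': "f \<in> carr (Lp_time p Y)" "f \<in> carr (Lp_time p X)" "X.AC p f g" using f by (auto simp: mr_def)
 define c where "c t = \<kappa> * nrm Y (zext {0<..} f t)" for t
 have c: "c \<in> borel_measurable lebesgue" "c t >= 0" for t
  using Y.Lp_nrm_measurable[OF f'(1)] p \<kappa> Y.nonneg by (auto simp: c_def[abs_def])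
 have "integrable lebesgue (%t. \<kappa> powr p * nrm Y (zext {0<..} f t) powr p)" using f'(1) by (simp add: Y.Lp_iff)
 then have ic: "integrable lebesgue (%t. c t powr p)" using \<kappa> Y.nonneg by (simp add: c_def powr_mult)
 have ae: "AE t in lebesgue. t > 0 --> f t \<in> carr Z \<and> nrm Z (f t) <= c t"
  using Y.Lp_carr_AE'[OF f'(1)] by eventually_elim (auto simp: c_def zext_def YZ)
 note T = X.trace[OF p f'(2,3) X' Z c ic ae r]
 show "f r \<in> carr (interp_sp (1 - 1 / p) p X' Z)" by (rule T(1))
 show "nrm (interp_sp (1 - 1 / p) p X' Z) (f r) <= (((p - 1) / p) powr (- p)) powr (1 / p) * energy p \<kappa> f g r powr (1 / p)"
  using T(2) energy_nonneg[of p \<kappa> f g r] by (simp add: powr_mult energy_def c_def)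
 show "nrm X (f r) <= energy p \<kappa> f g r powr (1 / p)" using T(3) by (simp add: energy_def c_def)
qed

lemma restrict_sp_simps: "carr (restrict_sp X A) = carr X \<inter> A" "nrm (restrict_sp X A) = nrm X"
 by (simp_all add: restrict_sp_def)

lemma interp_nonneg: "nrm (interp_sp \<theta> p X Y) x >= 0"
 by (simp add: interp_sp_def)

context
 fixes U :: "(real ^ 'd::finite) set" and q p \<kappa> :: real and ye :: "'d field"
 assumes U: "open U" "bounded U" and q: "q > real CARD('d)" and p: "p > 1"
  and ye: "ye \<in> carr (vec_sp (W20_sp U q))"
begin

lemma q_gt_1: "q > 1" using q card_ge_1[where 'd='d] by linarith

interpretation L: bsp "Lq U q" by (rule bsp_Lq[OF q_gt_1 U(2)])
interpretation Lv: bsp "Lqv U q" by (rule bsp_vec) unfold_locales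
interpretation Ls: bsp "Lq_sigma U q" by (rule bsp_Lq_sigma[OF U q_gt_1])

lemma zsp_W20: "zsp (W20_sp U q)"
proof
 have 1: "q >= 1" using q_gt_1 by simp
 show "0 \<in> carr (W20_sp U q)" "nrm (W20_sp U q) 0 = 0"
  using Wkq_zero[OF 1 U(1), of 2] W1q0_zero[OF 1 U(1)] by (auto simp: W20_sp_def restrict_sp_simps)
 show "nrm (W20_sp U q) x >= 0" for x by (simp add: W20_sp_def restrict_sp_simps Wkq_nonneg)
qed

interpretation W20: zsp "W20_sp U q" by (rule zsp_W20)

lemma zsp_W20_sigma: "zsp (W20_sigma_sp U q)"
proof
 show "0 \<in> carr (W20_sigma_sp U q)" using W20.zero Ls.zero
  by (simp add: W20_sigma_sp_def restrict_sp_simps vec_sp_carr)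
 show "nrm (W20_sigma_sp U q) 0 = 0" by (simp add: W20_sigma_sp_def restrict_sp_simps vec_sp_nrm W20.nrm_0)
 show "nrm (W20_sigma_sp U q) x >= 0" for x
  by (simp add: W20_sigma_sp_def restrict_sp_simps vec_sp_nrm W20.nonneg sum_nonneg)
qed

interpretation W20s: zsp "W20_sigma_sp U q" by (rule zsp_W20_sigma)
interpretation A: mrsp "Lq_sigma U q" "W20_sigma_sp U q" by unfold_locales
interpretation B: mrsp "Lq U q" "W20_sp U q" by unfold_locales

lemma Lq_sigma_carr: "carr (Lq_sigma U q) = carr (Lqv U q) \<inter> {g. is_weak_div U g 0 \<and> normal_trace_zero U q g}"
 by (simp add: Lq_sigma_def restrict_sp_simps)

text \<open>The interpolation is between unrestricted vector fields; the side conditions in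
  \<open>Btilde\<close> hold because the values of the path lie in \<open>Lq_sigma\<close> at every
  time.\<close>

lemma Btilde_trace:
 assumes f: "A.mr p f g" and r: "r >= 0" and k: "k >= 1"
 shows "f r \<in> carr (Btilde U q p)"
  and "nrm (Btilde U q p) (f r) <= (((p - 1) / p) powr (- p)) powr (1 / p) * A.energy p k f g r powr (1 / p)"
proof -
 have 1: "q >= 1" using q_gt_1 by simp
 have YZ: "x \<in> carr (vec_sp (Wkq U 2 q)) \<and> nrm (vec_sp (Wkq U 2 q)) x <= k * nrm (W20_sigma_sp U q) x"
  if "x \<in> carr (W20_sigma_sp U q)" for x
 proof
  show "x \<in> carr (vec_sp (Wkq U 2 q))" using that
   by (auto simp: W20_sigma_sp_def W20_sp_def restrict_sp_simps vec_sp_carr)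
  have "nrm (vec_sp (Wkq U 2 q)) x = 1 * nrm (W20_sigma_sp U q) x"
   by (simp add: W20_sigma_sp_def W20_sp_def restrict_sp_simps vec_sp_nrm)
  also have "... <= k * nrm (W20_sigma_sp U q) x" by (rule mult_right_mono[OF k W20s.nonneg])
  finally show "nrm (vec_sp (Wkq U 2 q)) x <= k * nrm (W20_sigma_sp U q) x" .
 qed
 have Z: "nrm (vec_sp (Wkq U 2 q)) x >= 0" "0 \<in> carr (vec_sp (Wkq U 2 q))" "nrm (vec_sp (Wkq U 2 q)) 0 = 0" for x :: "'d field"
  using Wkq_zero[OF 1 U(1), of 2] by (auto simp: vec_sp_carr vec_sp_nrm Wkq_nonneg sum_nonneg)
 have X: "carr (Lq_sigma U q) \<subseteq> carr (Lqv U q)" "nrm (Lqv U q) x = nrm (Lq_sigma U q) x" for x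
  by (auto simp: Lq_sigma_carr) (simp add: Lq_sigma_def restrict_sp_simps)
 note T = A.trace_energy[OF p k f r Lv.nonneg X Z YZ]
 have "f r \<in> carr (Lq_sigma U q)" using Ls.AC_D(1)[of p f g] f r by (simp add: A.mr_def)
 then show "f r \<in> carr (Btilde U q p)" using T(1) by (simp add: Btilde_def restrict_sp_simps Lq_sigma_carr)
 show "nrm (Btilde U q p) (f r) <= (((p - 1) / p) powr (- p)) powr (1 / p) * A.energy p k f g r powr (1 / p)"
  using T(2) by (simp add: Btilde_def restrict_sp_simps)
qed

lemma Btilde_subset: "carr (Btilde U q p) \<subseteq> carr (Lq_sigma U q)"
proof
 fix b assume b: "b \<in> carr (Btilde U q p)"
 then obtain x y where xy: "x \<in> carr (Lqv U q)" "y \<in> carr (vec_sp (Wkq U 2 q))" "b = x + y"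
  by (auto simp: Btilde_def restrict_sp_simps interp_sp_def)
 have "y \<in> carr (Lqv U q)" using xy(2) by (auto simp: vec_sp_carr numeral_2_eq_2)
 then show "b \<in> carr (Lq_sigma U q)" using b xy Lv.add by (auto simp: Btilde_def restrict_sp_simps Lq_sigma_carr)
qed

text \<open>One constant covers both choices of the second factor: its summand 1 serves
  \<open>Lq\<close>, the Hardy constant serves the interpolation space. The weight
  \<open>k = 1 + c\<close> bounds the graph norm of \<open>heat_op\<close> by the norm of
  \<open>W20_sp\<close>.\<close>

lemma second_trace:
 assumes V2: "V2 = Lq U q \<or> V2 = interp_sp (1 - 1 / p) p (Lq U q) (graph_sp (Lq U q) (carr (W20_sp U q)) (heat_op U \<kappa> ye))"
 shows "\<exists>k\<ge>1. \<forall>f g r. B.mr p f g --> r >= 0 --> f r \<in> carr V2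
  \<and> nrm V2 (f r) <= ((((p - 1) / p) powr (- p)) powr (1 / p) + 1) * B.energy p k f g r powr (1 / p)"
  and "carr V2 \<subseteq> carr (Lq U q)" and "nrm V2 h >= 0"
proof -
 let ?Z = "graph_sp (Lq U q) (carr (W20_sp U q)) (heat_op U \<kappa> ye)"
 let ?H = "(((p - 1) / p) powr (- p)) powr (1 / p)"
 obtain c where c: "c >= 0" "!!h. h \<in> carr (W20_sp U q) ==> heat_op U \<kappa> ye h \<in> carr (Lq U q) \<and> Lq_norm q (heat_op U \<kappa> ye h) <= c * nrm (W20_sp U q) h"
  using heat_op_bounded[OF U(1) q ye] by blast
 define k where "k = 1 + c"
 have k: "k >= 1" using c by (simp add: k_def)
 have YZ: "h \<in> carr ?Z \<and> nrm ?Z h <= k * nrm (W20_sp U q) h" if h: "h \<in> carr (W20_sp U q)" for h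
 proof -
  have "Lq_norm q h <= Lq_norm q h + (\<Sum>i\<in>UNIV. Lq_norm q (pdi U i h)) + (\<Sum>i\<in>UNIV. Lq_norm q (pdi U i (pdi U i h)))"
   by (simp add: Lq_norm_nonneg sum_nonneg)
  also have "... <= nrm (W20_sp U q) h" by (rule W20_facts(5)[OF h])
  finally show ?thesis using c(2)[OF h] h by (simp add: graph_sp_def Lq_nrm k_def algebra_simps)
 qed
 have "heat_op U \<kappa> ye 0 \<in> carr (Lq U q)" "Lq_norm q (heat_op U \<kappa> ye 0) = 0"
  using c(2)[OF W20.zero] Lq_norm_nonneg[of q "heat_op U \<kappa> ye 0"] by (auto simp: W20.nrm_0)
 then have Z: "nrm ?Z h >= 0" "0 \<in> carr ?Z" "nrm ?Z 0 = 0" for h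
  using W20.zero L.nonneg L.nrm_0 by (auto simp: graph_sp_def Lq_nrm)
 have tr: "f r \<in> carr V2 \<and> nrm V2 (f r) <= (?H + 1) * B.energy p k f g r powr (1 / p)"
  if f: "B.mr p f g" and r: "r >= 0" for f g r
 proof -
  note T = B.trace_energy[OF p k f r L.nonneg order_refl refl Z YZ]
  let ?E = "B.energy p k f g r powr (1 / p)"
  have le: "?H * ?E <= (?H + 1) * ?E" "?E <= (?H + 1) * ?E" by (auto simp: algebra_simps)
  have fr: "f r \<in> carr (Lq U q)" using L.AC_D(1)[of p f g] f r by (simp add: B.mr_def)
  show ?thesis using V2 T fr order_trans[OF T(2) le(1)] order_trans[OF T(3) le(2)] by auto
 qed
 then show "\<exists>k\<ge>1. \<forall>f g r. B.mr p f g --> r >= 0 --> f r \<in> carr V2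
  \<and> nrm V2 (f r) <= (?H + 1) * B.energy p k f g r powr (1 / p)" using k by blast
 have "carr (interp_sp (1 - 1 / p) p (Lq U q) ?Z) \<subseteq> carr (Lq U q)"
 proof
  fix h assume "h \<in> carr (interp_sp (1 - 1 / p) p (Lq U q) ?Z)"
  then obtain a b where "a \<in> carr (Lq U q)" "b \<in> carr ?Z" "h = a + b" unfolding interp_sp_def by auto
  moreover from this(2) have "b \<in> carr (Lq U q)" by (intro W20_facts(1)) (simp add: graph_sp_def)
  ultimately show "h \<in> carr (Lq U q)" using L.add by blast
 qed
 then show "carr V2 \<subseteq> carr (Lq U q)" using V2 by auto
 show "nrm V2 h >= 0" using V2 interp_nonneg L.nonneg by auto
qed

lemma mild_solution_decay:
 fixes S :: "real => 'd state => 'd state" and V2 :: "'d scalar nspace"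
 assumes H: "helmholtz U q"
  and V2: "V2 = Lq U q \<or> V2 = interp_sp (1 - 1 / p) p (Lq U q) (graph_sp (Lq U q) (carr (W20_sp U q)) (heat_op U \<kappa> ye))"
  and S: "C0_semigroup (W_state U q) S"
  and S_bound: "B0 >= 0" "!!t w. t >= 0 ==> w \<in> carr (W_state U q) ==> nrm (W_state U q) (S t w) <= B0 * nrm (W_state U q) w"
  and C: "C > 0" and est: "fixed_point_estimate U q p (prod_sp (Btilde U q p) V2) S C"
  and r: "r <= 1 / (4 * C\<^sup>2)"
 shows "\<exists>\<gamma>>0. \<exists>M>0. \<forall>b\<in>carr (prod_sp (Btilde U q p) V2). nrm (prod_sp (Btilde U q p) V2) b < r -->
  (\<forall>x. mild_solution U q p S b x --> (\<forall>t\<ge>0. x t \<in> carr (prod_sp (Btilde U q p) V2) \<and>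
   nrm (prod_sp (Btilde U q p) V2) (x t) <= M * exp (- \<gamma> * t) * nrm (prod_sp (Btilde U q p) V2) b))"
proof -
 let ?V = "prod_sp (Btilde U q p) V2" and ?H = "(((p - 1) / p) powr (- p)) powr (1 / p)"
 obtain k where k: "k >= 1" "!!f g r. B.mr p f g ==> r >= 0 ==> f r \<in> carr V2 \<and> nrm V2 (f r) <= (?H + 1) * B.energy p k f g r powr (1 / p)"
  using second_trace(1)[OF V2] by blast
 have Vc: "b \<in> carr ?V \<longleftrightarrow> fst b \<in> carr (Btilde U q p) \<and> snd b \<in> carr V2" for b
  by (auto simp: prod_sp_def mem_Times_iff)
 have Vn: "nrm ?V b = nrm (Btilde U q p) (fst b) + nrm V2 (snd b)" for b
  by (simp add: prod_sp_def split: prod.splits)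
 have Xst: "f \<in> carr (Xinf_state U q p) \<longleftrightarrow> fst \<circ> f \<in> carr (max_reg_sp p (W20_sigma_sp U q) (Lq_sigma U q))
   \<and> snd \<circ> f \<in> carr (max_reg_sp p (W20_sp U q) (Lq U q))" for f
  by (simp add: Xinf_state_def Xinf_sigma_def Xinf_def)
 interpret P: bsp "prod_sp (Lq_sigma U q) (Lq U q)" by (rule bsp_prod) unfold_locales
 interpret closed_loop "Lq_sigma U q" "W20_sigma_sp U q" "Lq U q" "W20_sp U q" S B0 p k "?H + 1" C "bouss_nonlin U q" ?V
 proof (unfold_locales)
  show "1 < p" "1 <= k" "0 < C" "0 <= B0" by (fact p k(1) C S_bound(1))+
  show "0 < ?H + 1" using powr_ge_zero[of "((p - 1) / p) powr (- p)" "1 / p"] by linarith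
  show "C0_semigroup (prod_sp (Lq_sigma U q) (Lq U q)) S" using S by (simp add: W_state_def)
  show "nrm (prod_sp (Lq_sigma U q) (Lq U q)) (S t x) <= B0 * nrm (prod_sp (Lq_sigma U q) (Lq U q)) x"
   if "0 <= t" "x \<in> carr (prod_sp (Lq_sigma U q) (Lq U q))" for t x using S_bound(2)[OF that(1), of x] that(2) by (simp add: W_state_def)
  show "bouss_nonlin U q (z, h) \<in> carr (prod_sp (Lq_sigma U q) (Lq U q))"
   if "z \<in> carr (W20_sigma_sp U q)" "h \<in> carr (W20_sp U q)" for z h
   using bouss_nonlin_in_W that q q_gt_1 H U by (simp add: W_state_def)
  show "b \<in> carr (prod_sp (Lq_sigma U q) (Lq U q))" if "b \<in> carr ?V" for b
   using that Btilde_subset second_trace(2)[OF V2] by (auto simp: prod_sp_def)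
  show "0 <= nrm ?V b" for b
   unfolding Vn by (rule add_nonneg_nonneg[OF _ second_trace(3)[OF V2]])
    (simp add: Btilde_def restrict_sp_simps interp_nonneg)
  show "f r \<in> carr ?V \<and> nrm ?V (f r) <= (?H + 1) * (A.energy p k (fst \<circ> f) g1 r powr (1 / p) + B.energy p k (snd \<circ> f) g2 r powr (1 / p))"
   if m: "A.mr p (fst \<circ> f) g1" "B.mr p (snd \<circ> f) g2" "r >= 0" for f g1 g2 r
  proof -
   let ?E = "A.energy p k (fst \<circ> f) g1 r powr (1 / p)"
   have "?H * ?E <= (?H + 1) * ?E" by (simp add: algebra_simps)
   then show ?thesis using Btilde_trace[OF m(1,3) k(1)] k(2)[OF m(2,3)] unfolding Vc Vn by (simp add: distrib_left)
  qed
  show "\<exists>y J. duhamel (prod_sp (Lq_sigma U q) (Lq U q)) S (%\<tau>. bouss_nonlin U q (f \<tau>)) J \<and> (\<forall>t\<ge>0. y t = S t b - J t)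
    \<and> fst \<circ> y \<in> carr (max_reg_sp p (W20_sigma_sp U q) (Lq_sigma U q)) \<and> snd \<circ> y \<in> carr (max_reg_sp p (W20_sp U q) (Lq U q))
    \<and> nrm (max_reg_sp p (W20_sigma_sp U q) (Lq_sigma U q)) (fst \<circ> y) + nrm (max_reg_sp p (W20_sp U q) (Lq U q)) (snd \<circ> y)
     <= C * (nrm ?V b + nrm (max_reg_sp p (W20_sigma_sp U q) (Lq_sigma U q)) (fst \<circ> f)
       * (nrm (max_reg_sp p (W20_sigma_sp U q) (Lq_sigma U q)) (fst \<circ> f) + nrm (max_reg_sp p (W20_sp U q) (Lq U q)) (snd \<circ> f)))"
   if b: "b \<in> carr ?V" and f: "fst \<circ> f \<in> carr (max_reg_sp p (W20_sigma_sp U q) (Lq_sigma U q))"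
    "snd \<circ> f \<in> carr (max_reg_sp p (W20_sp U q) (Lq U q))" for b f
  proof -
   have "f \<in> carr (Xinf_state U q p)" using f Xst by blast
   from est[unfolded fixed_point_estimate_def, rule_format, OF b this]
   show ?thesis unfolding mild_map_def W_state_def Xst by (simp add: Xinf_state_def Xinf_sigma_def Xinf_def) blast
  qed
 qed
 have "sol b x \<longleftrightarrow> mild_solution U q p S b x" for b x
  unfolding sol_def inX_def mild_def mild_solution_def mild_map_def W_state_def Xst by blast
 then show ?thesis using sol_decay[OF r] by simp
qed

end

theorem theorem2p3:
  fixes \<Omega> \<omega> :: "(real ^ 'd::{finite,linorder}) set"
    and q p \<nu> \<kappa> gbar \<theta>bar \<gamma> :: real
    and f ye :: "'d field" and g \<theta>e \<pi>e :: "'d scalar"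
    and A AF PN :: "'d state \<Rightarrow> 'd state" and D :: "'d state set"
    and \<mu>next :: complex and K :: nat
    and u pk :: "nat \<Rightarrow> 'd state"
    and S :: "real \<Rightarrow> 'd state \<Rightarrow> 'd state"
    and V :: "'d state nspace"
    and C r1 :: real
  assumes dim: "CARD('d) = 2 \<or> CARD('d) = 3"
    and q: "q > real CARD('d)"
    and p: "1 < p" "p < 2 * q / (2 * q - 1)"
    and Omega: "open \<Omega>" "connected \<Omega>" "bounded \<Omega>" "\<Omega> \<noteq> {}" "Ck_boundary 2 \<Omega>"
    and omega: "open \<omega>" "connected \<omega>" "\<omega> \<noteq> {}" "\<omega> \<subseteq> \<Omega>" "Ck_boundary 2 \<omega>"
    and helmholtz: "helmholtz \<Omega> q"
    and constants: "\<nu> > 0" "\<kappa> > 0" "\<theta>bar \<noteq> 0" "\<gamma> = gbar / \<theta>bar"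
    and equilibrium: "equilibrium \<Omega> q \<nu> \<kappa> \<gamma> \<theta>bar f g ye \<theta>e \<pi>e"
    and A: "A = bouss_op \<Omega> q \<nu> \<kappa> \<gamma> ye \<theta>e" and D: "D = bouss_dom \<Omega> q"
    and unstable: "finite (unstable_eigs D A)" "unstable_eigs D A \<noteq> {}"
    and \<mu>next: "\<mu>next \<in> eigenvalues D A" "Re \<mu>next < 0"
      "\<forall>\<mu>\<in>eigenvalues D A - unstable_eigs D A. Re \<mu> \<le> Re \<mu>next"
    and K: "K = Max (geom_mult D A ` unstable_eigs D A)"
    and PN: "PN = riesz_proj (W_state \<Omega> q) D A (unstable_eigs D A)"
    and u: "\<forall>k\<in>{1..K}. u k \<in> hat_range \<Omega> q PN"
    and pk: "\<forall>k\<in>{1..K}. pk k \<in> adjoint_range \<Omega> q PN"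
    and AF: "AF = (\<lambda>w. A w + feedback \<Omega> \<omega> q PN K u pk w)"
    and V: "V = V_state \<Omega> q p \<or> V = Vb_state \<Omega> q p \<kappa> ye"
    and stab_W: "stabilized_on p (Re \<mu>next) (W_state \<Omega> q) D AF S"
    and stab_V: "stabilized_on p (Re \<mu>next) V D AF S"
    and C: "C > 1 / 4" "fixed_point_estimate \<Omega> q p V S C"
    and r1: "r1 > 0" "r1 \<le> 1 / (4 * C\<^sup>2)" "well_posed_below \<Omega> q p V S r1"
  shows "\<exists>\<gamma>t>0. \<exists>M>0. \<forall>b\<in>carr V. nrm V b < r1 \<longrightarrow>
           (\<forall>x. mild_solution \<Omega> q p S b x \<longrightarrow>
              (\<forall>t\<ge>0. x t \<in> carr V \<and> nrm V (x t) \<le> M * exp (- \<gamma>t * t) * nrm V b))"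
proof -
 obtain V2 where V2: "V = prod_sp (Btilde \<Omega> q p) V2"
  "V2 = Lq \<Omega> q \<or> V2 = interp_sp (1 - 1 / p) p (Lq \<Omega> q) (graph_sp (Lq \<Omega> q) (carr (W20_sp \<Omega> q)) (heat_op \<Omega> \<kappa> ye))"
  using V unfolding V_state_def Vb_state_def by blast
 have ye: "ye \<in> carr (vec_sp (W20_sp \<Omega> q))" using equilibrium by (simp add: equilibrium_def)
 have S: "C0_semigroup (W_state \<Omega> q) S" using stab_W by (simp add: stabilized_on_def generates_def)
 have q_gt_1: "q > 1" using q card_ge_1[where 'd='d] by linarith
 interpret W: bsp "W_state \<Omega> q" by (rule bsp_W_state[OF Omega(1,3) q_gt_1])
 \<comment> \<open>Half the distance of the remaining spectrum from the imaginary axis is an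
   admissible rate; the estimate is used to extract a bound on \<open>S\<close> in the basic space
   that is uniform in time.\<close>
 define \<gamma>0 where "\<gamma>0 = - Re \<mu>next / 2"
 have \<gamma>0: "\<gamma>0 > 0" "Re \<mu>next < - \<gamma>0" using \<mu>next by (auto simp: \<gamma>0_def)
 obtain B where B: "!!t w. t >= 0 ==> w \<in> carr (W_state \<Omega> q) ==> nrm (W_state \<Omega> q) (S t w) <= B * exp (- \<gamma>0 * t) * nrm (W_state \<Omega> q) w"
  using stab_W \<gamma>0 unfolding stabilized_on_def by blast
 have S_bound: "nrm (W_state \<Omega> q) (S t w) <= \<bar>B\<bar> * nrm (W_state \<Omega> q) w" if "t >= 0" "w \<in> carr (W_state \<Omega> q)" for t w
 proof -
  have "B * exp (- \<gamma>0 * t) <= \<bar>B\<bar> * 1" using that(1) \<gamma>0(1) by (intro mult_mono) auto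
  from mult_right_mono[OF this W.nonneg[of w]] show ?thesis using B[OF that] by simp
 qed
 have C0: "C > 0" using C(1) by simp
 show ?thesis
  unfolding V2(1)
  by (rule mild_solution_decay[OF Omega(1,3) q p(1) ye helmholtz V2(2) S abs_ge_zero S_bound C0 C(2)[unfolded V2(1)] r1(2)])
qed

end
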